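(* Let $\Bbbk$ be an algebraically closed field and let $A$ be a basic finite-dimensional $\Bbbk$-algebra which is quasi-hereditary with respect to the natural order on $\{1,2,\dots,n\}$, with standard modules $\Delta(i)$ and costandard modules $\nabla(i)$. (1) Let $i,j\in\{1,\dots,n\}$ with $j<i$. Then there exists a bilinear pairing $$\langle\cdot\,,\cdot\rangle:\operatorname{Hom}_A(\Delta(j),\Delta(i))\times\operatorname{Ext}^1_A(\nabla(i),\nabla(j))\to\Bbbk ,$$ namely the map $(f,[\xi])\mapsto\langle f,\xi\rangle$ described in the context is well defined and bilinear. (2) If $j=i-1$, then this pairing $\langle\cdot\,,\cdot\rangle$ is non-degenerate.
   Context: Modules are finitely generated left modules. $P(i)$, $\Delta(i)$, $\nabla(i)$, $L(i)$ denote the projective, standard, costandard and simple $A$-modules corresponding to $i\in\{1,\dots,n\}$; $\Delta(i)$ is the maximal quotient of $P(i)$ all of whose composition factors are $L(s)$ with $s\le i$, and $\nabla(i)$ is defined dually inside the injective hull of $L(i)$. Definition of the pairing. For each $i$ fix a non-zero homomorphism $\alpha_i:\Delta(i)\to\nabla(i)$ (unique up to a scalar; it maps the top $L(i)$ of $\Delta(i)$ onto the socle of $\nabla(i)$). Let $j<i$, let $f\in\operatorname{Hom}_A(\Delta(j),\Delta(i))$, and let $\xi:\ 0\to\nabla(j)\xrightarrow{\beta}X\xrightarrow{\gamma}\nabla(i)\to0$ be a short exact sequence. Since $\operatorname{Hom}_A(\Delta(i),\nabla(j))=0=\operatorname{Ext}^1_A(\Delta(i),\nabla(j))$, there is a unique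 $\varphi:\Delta(i)\to X$ with $\gamma\circ\varphi=\alpha_i$. The map $\varphi\circ f:\Delta(j)\to X$ is a scalar multiple of the non-zero map $\beta\circ\alpha_j:\Delta(j)\to X$, and $\langle f,\xi\rangle\in\Bbbk$ denotes the unique scalar with $\varphi\circ f=\langle f,\xi\rangle\,(\beta\circ\alpha_j)$. The pairing depends on $\xi$ only through its class in $\operatorname{Ext}^1_A(\nabla(i),\nabla(j))$. *)

theory Defs
  imports "HOL-Algebra.Algebraic_Closure" "HOL-Algebra.Module" "HOL-Algebra.QuotRing"
begin
text \<open>
  The record type \<^typ>\<open>('a, 'm) module\<close> serves both for a \<open>K\<close>-algebra \<open>A\<close> (ring structure and
  scalar multiplication by \<open>K\<close>) and for left \<open>A\<close>-modules; in the latter case the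
  fields \<^const>\<open>monoid.mult\<close> and \<^const>\<open>one\<close> carry no meaning. The library locales \<^locale>\<open>module\<close> and
  \<^locale>\<open>algebra\<close> need a commutative ring (respectively algebra), so the noncommutative versions
  are given here.
\<close>

locale fd_algebra = module K A + ring A for K (structure) and A (structure) +
  assumes smult_mult_left:
      "\<lbrakk>c \<in> carrier K; x \<in> carrier A; y \<in> carrier A\<rbrakk> \<Longrightarrow>
        (c \<odot>\<^bsub>A\<^esub> x) \<otimes>\<^bsub>A\<^esub> y = c \<odot>\<^bsub>A\<^esub> (x \<otimes>\<^bsub>A\<^esub> y)"
    and smult_mult_right:
      "\<lbrakk>c \<in> carrier K; x \<in> carrier A; y \<in> carrier A\<rbrakk> \<Longrightarrow>
        x \<otimes>\<^bsub>A\<^esub> (c \<odot>\<^bsub>A\<^esub> y) = c \<odot>\<^bsub>A\<^esub> (x \<otimes>\<^bsub>A\<^esub> y)"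
    and finite_dim:
      "\<exists>B. finite B \<and> B \<subseteq> carrier A \<and>
        (\<forall>x\<in>carrier A. \<exists>c\<in>B \<rightarrow> carrier K. x = (\<Oplus>\<^bsub>A\<^esub>b\<in>B. c b \<odot>\<^bsub>A\<^esub> b))"

locale left_module = A?: ring A + M?: abelian_group M
  for A :: "('a, 'r) ring_scheme" (structure) and M :: "('a, 'm) module" (structure) +
  assumes smult_closed [simp, intro]:
      "\<lbrakk>a \<in> carrier A; x \<in> carrier M\<rbrakk> \<Longrightarrow> a \<odot>\<^bsub>M\<^esub> x \<in> carrier M"
    and smult_l_distr:
      "\<lbrakk>a \<in> carrier A; b \<in> carrier A; x \<in> carrier M\<rbrakk> \<Longrightarrow>
        (a \<oplus>\<^bsub>A\<^esub> b) \<odot>\<^bsub>M\<^esub> x = a \<odot>\<^bsub>M\<^esub> x \<oplus>\<^bsub>M\<^esub> b \<odot>\<^bsub>M\<^esub> x"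
    and smult_r_distr:
      "\<lbrakk>a \<in> carrier A; x \<in> carrier M; y \<in> carrier M\<rbrakk> \<Longrightarrow>
        a \<odot>\<^bsub>M\<^esub> (x \<oplus>\<^bsub>M\<^esub> y) = a \<odot>\<^bsub>M\<^esub> x \<oplus>\<^bsub>M\<^esub> a \<odot>\<^bsub>M\<^esub> y"
    and smult_assoc1:
      "\<lbrakk>a \<in> carrier A; b \<in> carrier A; x \<in> carrier M\<rbrakk> \<Longrightarrow>
        (a \<otimes>\<^bsub>A\<^esub> b) \<odot>\<^bsub>M\<^esub> x = a \<odot>\<^bsub>M\<^esub> (b \<odot>\<^bsub>M\<^esub> x)"
    and smult_one [simp]: "x \<in> carrier M \<Longrightarrow> \<one>\<^bsub>A\<^esub> \<odot>\<^bsub>M\<^esub> x = x"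

definition fg_module :: "('a, 'r) ring_scheme \<Rightarrow> ('a, 'm) module \<Rightarrow> bool" where
  "fg_module A M \<longleftrightarrow> left_module A M \<and>
    (\<exists>S. finite S \<and> S \<subseteq> carrier M \<and> (\<forall>N. submodule N A M \<and> S \<subseteq> N \<longrightarrow> N = carrier M))"

text \<open>Homomorphisms are extensional functions, so that equality of functions is equality of
  homomorphisms; composites are formed with \<^const>\<open>compose\<close>.\<close>

definition mod_hom ::
    "('a, 'r) ring_scheme \<Rightarrow> ('a, 'm) module \<Rightarrow> ('a, 'l) module \<Rightarrow> ('m \<Rightarrow> 'l) set" where
  "mod_hom A M N = {f \<in> carrier M \<rightarrow>\<^sub>E carrier N.
     (\<forall>x\<in>carrier M. \<forall>y\<in>carrier M. f (x \<oplus>\<^bsub>M\<^esub> y) = f x \<oplus>\<^bsub>N\<^esub> f y) \<and>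
     (\<forall>a\<in>carrier A. \<forall>x\<in>carrier M. f (a \<odot>\<^bsub>M\<^esub> x) = a \<odot>\<^bsub>N\<^esub> f x)}"

definition zero_hom :: "('a, 'm) module \<Rightarrow> ('a, 'l) module \<Rightarrow> 'm \<Rightarrow> 'l" where
  "zero_hom M N = (\<lambda>x\<in>carrier M. \<zero>\<^bsub>N\<^esub>)"

definition mod_iso :: "('a, 'r) ring_scheme \<Rightarrow> ('a, 'm) module \<Rightarrow> ('a, 'l) module \<Rightarrow> bool" where
  "mod_iso A M N \<longleftrightarrow> (\<exists>f\<in>mod_hom A M N. bij_betw f (carrier M) (carrier N))"

definition mod_quot :: "('a, 'm) module \<Rightarrow> 'm set \<Rightarrow> ('a, 'm set) module" where
  "mod_quot M N = \<lparr>carrier = a_rcosets\<^bsub>M\<^esub> N, monoid.mult = undefined, one = undefined,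
     zero = N, add = set_add M, smult = (\<lambda>a C. \<Union>x\<in>C. N +>\<^bsub>M\<^esub> (a \<odot>\<^bsub>M\<^esub> x))\<rparr>"

definition mod_prod :: "('a, 'm) module \<Rightarrow> ('a, 'l) module \<Rightarrow> ('a, 'm \<times> 'l) module" where
  "mod_prod M N = \<lparr>carrier = carrier M \<times> carrier N, monoid.mult = undefined, one = undefined,
     zero = (\<zero>\<^bsub>M\<^esub>, \<zero>\<^bsub>N\<^esub>),
     add = (\<lambda>(x, y) (x', y'). (x \<oplus>\<^bsub>M\<^esub> x', y \<oplus>\<^bsub>N\<^esub> y')),
     smult = (\<lambda>a (x, y). (a \<odot>\<^bsub>M\<^esub> x, a \<odot>\<^bsub>N\<^esub> y))\<rparr>"

definition left_regular :: "('a, 'r) ring_scheme \<Rightarrow> ('a, 'a) module" where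
  "left_regular A = \<lparr>carrier = carrier A, monoid.mult = monoid.mult A, one = \<one>\<^bsub>A\<^esub>, zero = \<zero>\<^bsub>A\<^esub>,
     add = add A, smult = monoid.mult A\<rparr>"

definition primitive_idempotent :: "('a, 'r) ring_scheme \<Rightarrow> 'a \<Rightarrow> bool" where
  "primitive_idempotent A e \<longleftrightarrow> e \<in> carrier A \<and> e \<otimes>\<^bsub>A\<^esub> e = e \<and> e \<noteq> \<zero>\<^bsub>A\<^esub> \<and>
    \<not> (\<exists>f\<in>carrier A. \<exists>g\<in>carrier A. f \<otimes>\<^bsub>A\<^esub> f = f \<and> g \<otimes>\<^bsub>A\<^esub> g = g \<and>
        f \<otimes>\<^bsub>A\<^esub> g = \<zero>\<^bsub>A\<^esub> \<and> g \<otimes>\<^bsub>A\<^esub> f = \<zero>\<^bsub>A\<^esub> \<and>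
        f \<noteq> \<zero>\<^bsub>A\<^esub> \<and> g \<noteq> \<zero>\<^bsub>A\<^esub> \<and> e = f \<oplus>\<^bsub>A\<^esub> g)"

text \<open>Equivalently, the regular module is a direct sum of pairwise non-isomorphic indecomposable
  modules \<open>A e\<close>.\<close>

definition basic_algebra :: "('a, 'r) ring_scheme \<Rightarrow> bool" where
  "basic_algebra A \<longleftrightarrow> (\<exists>(m::nat) e.
     (\<forall>s<m. primitive_idempotent A (e s)) \<and>
     (\<forall>s<m. \<forall>t<m. s \<noteq> t \<longrightarrow> e s \<otimes>\<^bsub>A\<^esub> e t = \<zero>\<^bsub>A\<^esub>) \<and>
     (\<Oplus>\<^bsub>A\<^esub>s\<in>{..<m}. e s) = \<one>\<^bsub>A\<^esub> \<and>
     (\<forall>s<m. \<forall>t<m. s \<noteq> t \<longrightarrow>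
        \<not> mod_iso A ((left_regular A)\<lparr>carrier := {a \<otimes>\<^bsub>A\<^esub> e s | a. a \<in> carrier A}\<rparr>)
                     ((left_regular A)\<lparr>carrier := {a \<otimes>\<^bsub>A\<^esub> e t | a. a \<in> carrier A}\<rparr>)))"

definition simple_module :: "('a, 'r) ring_scheme \<Rightarrow> ('a, 'm) module \<Rightarrow> bool" where
  "simple_module A M \<longleftrightarrow> left_module A M \<and> carrier M \<noteq> {\<zero>\<^bsub>M\<^esub>} \<and>
    (\<forall>N. submodule N A M \<longrightarrow> N = {\<zero>\<^bsub>M\<^esub>} \<or> N = carrier M)"

definition mod_filtration ::
    "('a, 'r) ring_scheme \<Rightarrow> ('a, 'm) module \<Rightarrow> 'm set list \<Rightarrow> bool" where
  "mod_filtration A M Ns \<longleftrightarrow> Ns \<noteq> [] \<and> hd Ns = {\<zero>\<^bsub>M\<^esub>} \<and> last Ns = carrier M \<and>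
    (\<forall>N\<in>set Ns. submodule N A M) \<and> (\<forall>t. Suc t < length Ns \<longrightarrow> Ns ! t \<subseteq> Ns ! Suc t)"

definition filtration_factor :: "('a, 'm) module \<Rightarrow> 'm set list \<Rightarrow> nat \<Rightarrow> ('a, 'm set) module" where
  "filtration_factor M Ns t = mod_quot (M\<lparr>carrier := Ns ! Suc t\<rparr>) (Ns ! t)"

definition composition_series ::
    "('a, 'r) ring_scheme \<Rightarrow> ('a, 'm) module \<Rightarrow> 'm set list \<Rightarrow> bool" where
  "composition_series A M Ns \<longleftrightarrow> mod_filtration A M Ns \<and>
    (\<forall>t. Suc t < length Ns \<longrightarrow> simple_module A (filtration_factor M Ns t))"

definition comp_factors_in ::
    "('a, 'r) ring_scheme \<Rightarrow> ('a, 'm) module \<Rightarrow> ('a, 'l) module set \<Rightarrow> bool" where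
  "comp_factors_in A M \<S> \<longleftrightarrow> (\<forall>Ns. composition_series A M Ns \<longrightarrow>
     (\<forall>t. Suc t < length Ns \<longrightarrow> (\<exists>S\<in>\<S>. mod_iso A (filtration_factor M Ns t) S)))"

definition filtered_by ::
    "('a, 'r) ring_scheme \<Rightarrow> ('a, 'm) module \<Rightarrow> ('a, 'l) module set \<Rightarrow> bool" where
  "filtered_by A M \<X> \<longleftrightarrow> (\<exists>Ns. mod_filtration A M Ns \<and>
     (\<forall>t. Suc t < length Ns \<longrightarrow> (\<exists>E\<in>\<X>. mod_iso A (filtration_factor M Ns t) E)))"

text \<open>
  Quantification over all finitely generated modules (in the definitions of projective and
  injective modules and of \<open>Ext\<close>) requires a fixed carrier type. The lemma
  \<open>fg_module_in_universe\<close> below shows that every finitely generated left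
  module, whatever its carrier type, has an isomorphic copy of the following type.
\<close>

type_synonym 'a umod = "('a, nat \<Rightarrow> 'a) module"

lemma (in left_module) smult_zero_l:
  assumes "x \<in> carrier M" shows "\<zero>\<^bsub>A\<^esub> \<odot>\<^bsub>M\<^esub> x = \<zero>\<^bsub>M\<^esub>"
proof -
  have c: "\<zero>\<^bsub>A\<^esub> \<odot>\<^bsub>M\<^esub> x \<in> carrier M" using assms by simp
  have "\<zero>\<^bsub>A\<^esub> \<odot>\<^bsub>M\<^esub> x \<oplus>\<^bsub>M\<^esub> \<zero>\<^bsub>A\<^esub> \<odot>\<^bsub>M\<^esub> x = \<zero>\<^bsub>A\<^esub> \<odot>\<^bsub>M\<^esub> x \<oplus>\<^bsub>M\<^esub> \<zero>\<^bsub>M\<^esub>"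
    using smult_l_distr[of "\<zero>\<^bsub>A\<^esub>" "\<zero>\<^bsub>A\<^esub>" x] assms c by simp
  then show ?thesis using c by (metis M.add.l_cancel M.zero_closed)
qed

lemma (in left_module) smult_zero_r:
  assumes "a \<in> carrier A" shows "a \<odot>\<^bsub>M\<^esub> \<zero>\<^bsub>M\<^esub> = \<zero>\<^bsub>M\<^esub>"
  using smult_assoc1[of a "\<zero>\<^bsub>A\<^esub>" "\<zero>\<^bsub>M\<^esub>"] assms by (simp add: smult_zero_l)

lemma (in left_module) smult_minus_one:
  assumes "x \<in> carrier M" shows "(\<ominus>\<^bsub>A\<^esub> \<one>\<^bsub>A\<^esub>) \<odot>\<^bsub>M\<^esub> x = \<ominus>\<^bsub>M\<^esub> x"
proof -
  have "(\<ominus>\<^bsub>A\<^esub> \<one>\<^bsub>A\<^esub>) \<odot>\<^bsub>M\<^esub> x \<oplus>\<^bsub>M\<^esub> x = \<zero>\<^bsub>M\<^esub>"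
    using smult_l_distr[of "\<ominus>\<^bsub>A\<^esub> \<one>\<^bsub>A\<^esub>" "\<one>\<^bsub>A\<^esub>" x] assms
    by (simp add: smult_zero_l A.l_neg)
  then show ?thesis using assms by (metis M.minus_equality smult_closed A.a_inv_closed A.one_closed)
qed

lemma (in left_module) submodule_intro:
  assumes "H \<subseteq> carrier M" and "\<zero>\<^bsub>M\<^esub> \<in> H"
    and "\<And>x y. \<lbrakk>x \<in> H; y \<in> H\<rbrakk> \<Longrightarrow> x \<oplus>\<^bsub>M\<^esub> y \<in> H"
    and "\<And>a x. \<lbrakk>a \<in> carrier A; x \<in> H\<rbrakk> \<Longrightarrow> a \<odot>\<^bsub>M\<^esub> x \<in> H"
  shows "submodule H A M"
proof (intro submodule.intro subgroup.intro submodule_axioms.intro)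
  fix x assume x: "x \<in> H"
  then have "\<ominus>\<^bsub>M\<^esub> x = (\<ominus>\<^bsub>A\<^esub> \<one>\<^bsub>A\<^esub>) \<odot>\<^bsub>M\<^esub> x" using assms(1) smult_minus_one by auto
  then have "\<ominus>\<^bsub>M\<^esub> x \<in> H" using assms(4)[OF _ x] by simp
  then show "inv\<^bsub>add_monoid M\<^esub> x \<in> H" by (simp add: a_inv_def)
qed (use assms in auto)

lemma fg_module_injection:
  fixes A :: "('a, 'r) ring_scheme" and M :: "('a, 'm) module"
  assumes "fg_module A M"
  shows "\<exists>h :: 'm \<Rightarrow> nat \<Rightarrow> 'a. inj_on h (carrier M)"
proof -
  interpret left_module A M using assms by (simp add: fg_module_def)
  obtain S where S: "finite S" "S \<subseteq> carrier M"
    and gen: "\<And>N. submodule N A M \<Longrightarrow> S \<subseteq> N \<Longrightarrow> N = carrier M"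
    using assms unfolding fg_module_def by blast
  define lc where "lc c = (\<Oplus>\<^bsub>M\<^esub>s\<in>S. c s \<odot>\<^bsub>M\<^esub> s)" for c
  have cl: "c \<in> S \<rightarrow> carrier A \<Longrightarrow> (\<lambda>s. c s \<odot>\<^bsub>M\<^esub> s) \<in> S \<rightarrow> carrier M" for c
    using S(2) by auto
  have lc_smult: "a \<odot>\<^bsub>M\<^esub> lc c = lc (\<lambda>s. a \<otimes>\<^bsub>A\<^esub> c s)"
    if "a \<in> carrier A" "c \<in> S \<rightarrow> carrier A" for a c
  proof -
    have "T \<subseteq> S \<Longrightarrow> a \<odot>\<^bsub>M\<^esub> (\<Oplus>\<^bsub>M\<^esub>s\<in>T. c s \<odot>\<^bsub>M\<^esub> s) = (\<Oplus>\<^bsub>M\<^esub>s\<in>T. (a \<otimes>\<^bsub>A\<^esub> c s) \<odot>\<^bsub>M\<^esub> s)" if "finite T" for T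
      using that
    proof (induction T rule: finite_induct)
      case empty
      show ?case using that(1) \<open>a \<in> carrier A\<close> by (simp add: smult_zero_r)
    next
      case (insert t T)
      have "t \<in> carrier M" "c t \<in> carrier A" using insert.prems S(2) \<open>c \<in> S \<rightarrow> carrier A\<close> by auto
      moreover have "(\<lambda>s. c s \<odot>\<^bsub>M\<^esub> s) \<in> T \<rightarrow> carrier M"
        "(\<lambda>s. (a \<otimes>\<^bsub>A\<^esub> c s) \<odot>\<^bsub>M\<^esub> s) \<in> T \<rightarrow> carrier M"
        using insert.prems S(2) \<open>c \<in> S \<rightarrow> carrier A\<close> \<open>a \<in> carrier A\<close> by (auto intro!: smult_closed A.m_closed)
      ultimately show ?case using insert \<open>a \<in> carrier A\<close>
        by (simp add: smult_r_distr smult_assoc1)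
    qed
    then show ?thesis using S(1) by (simp add: lc_def)
  qed
  have lc_add: "lc c \<oplus>\<^bsub>M\<^esub> lc d = lc (\<lambda>s. c s \<oplus>\<^bsub>A\<^esub> d s)"
    if "c \<in> S \<rightarrow> carrier A" "d \<in> S \<rightarrow> carrier A" for c d
  proof -
    have "lc (\<lambda>s. c s \<oplus>\<^bsub>A\<^esub> d s) = (\<Oplus>\<^bsub>M\<^esub>s\<in>S. c s \<odot>\<^bsub>M\<^esub> s \<oplus>\<^bsub>M\<^esub> d s \<odot>\<^bsub>M\<^esub> s)"
      unfolding lc_def using that S(2)
      by (intro M.finsum_cong') (auto simp: smult_l_distr Pi_iff subset_iff)
    then show ?thesis using M.finsum_addf[OF cl[OF that(1)] cl[OF that(2)]] by (simp add: lc_def)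
  qed
  let ?C = "lc ` (S \<rightarrow> carrier A)"
  have "submodule ?C A M"
  proof (rule submodule_intro)
    show "?C \<subseteq> carrier M" using cl by (auto simp: lc_def intro!: M.finsum_closed)
    have "lc (\<lambda>_. \<zero>\<^bsub>A\<^esub>) = (\<Oplus>\<^bsub>M\<^esub>s\<in>S. \<zero>\<^bsub>M\<^esub>)"
      unfolding lc_def using S(2) by (intro M.finsum_cong') (auto simp: smult_zero_l)
    then show "\<zero>\<^bsub>M\<^esub> \<in> ?C" by (auto intro!: image_eqI[where x = "\<lambda>_. \<zero>\<^bsub>A\<^esub>"])
  next
    fix x y assume "x \<in> ?C" "y \<in> ?C"
    then obtain c d where *: "c \<in> S \<rightarrow> carrier A" "d \<in> S \<rightarrow> carrier A" "x = lc c" "y = lc d" by blast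
    then have "x \<oplus>\<^bsub>M\<^esub> y = lc (\<lambda>s. c s \<oplus>\<^bsub>A\<^esub> d s)" using lc_add by simp
    moreover have "(\<lambda>s. c s \<oplus>\<^bsub>A\<^esub> d s) \<in> S \<rightarrow> carrier A" using * by auto
    ultimately show "x \<oplus>\<^bsub>M\<^esub> y \<in> ?C" by blast
  next
    fix a x assume "a \<in> carrier A" "x \<in> ?C"
    then obtain c where *: "c \<in> S \<rightarrow> carrier A" "x = lc c" by blast
    then have "a \<odot>\<^bsub>M\<^esub> x = lc (\<lambda>s. a \<otimes>\<^bsub>A\<^esub> c s)" using lc_smult \<open>a \<in> carrier A\<close> by simp
    moreover have "(\<lambda>s. a \<otimes>\<^bsub>A\<^esub> c s) \<in> S \<rightarrow> carrier A" using * \<open>a \<in> carrier A\<close> by auto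
    ultimately show "a \<odot>\<^bsub>M\<^esub> x \<in> ?C" by blast
  qed
  moreover have "S \<subseteq> ?C"
  proof
    fix t assume t: "t \<in> S"
    define d where "d = (\<lambda>s. if s = t then \<one>\<^bsub>A\<^esub> else \<zero>\<^bsub>A\<^esub>)"
    have "lc d = (\<Oplus>\<^bsub>M\<^esub>s\<in>S. if t = s then s else \<zero>\<^bsub>M\<^esub>)"
      unfolding lc_def d_def using S(2) by (intro M.finsum_cong') (auto simp: smult_zero_l)
    also have "\<dots> = t" using t S M.finsum_singleton[of t S "\<lambda>s. s"] by auto
    finally show "t \<in> ?C" by (auto simp: d_def intro!: image_eqI[where x = d])
  qed
  ultimately have C: "?C = carrier M" by (rule gen)
  define co where "co = inv_into (S \<rightarrow> carrier A) lc"
  have co: "lc (co x) = x" if "x \<in> carrier M" for x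
    using that C by (simp add: co_def f_inv_into_f)
  have lc_cong: "lc c = lc d" if "d \<in> S \<rightarrow> carrier A" "\<forall>s\<in>S. c s = d s" for c d
    unfolding lc_def using that(2) cl[OF that(1)] by (intro M.finsum_cong') auto
  have co_in: "co x \<in> S \<rightarrow> carrier A" if "x \<in> carrier M" for x
    using that C unfolding co_def by (metis inv_into_into)
  obtain idx :: "'m \<Rightarrow> nat" where idx: "inj_on idx S"
    using finite_imp_inj_to_nat_seg[OF S(1)] by blast
  define h where "h x = (\<lambda>k. co x (inv_into S idx k))" for x
  have "inj_on h (carrier M)"
  proof (rule inj_onI)
    fix x y assume xy: "x \<in> carrier M" "y \<in> carrier M" "h x = h y"
    have "\<forall>s\<in>S. co x s = co y s"
      using fun_cong[OF xy(3)] inv_into_f_f[OF idx] unfolding h_def by metis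
    then show "x = y" using lc_cong[OF co_in[OF xy(2)]] co xy by metis
  qed
  then show ?thesis by blast
qed

lemma fg_module_in_universe:
  fixes A :: "('a, 'r) ring_scheme" and M :: "('a, 'm) module"
  assumes "fg_module A M"
  shows "\<exists>N :: 'a umod. fg_module A N \<and> mod_iso A M N"
proof -
  interpret left_module A M using assms by (simp add: fg_module_def)
  obtain h :: "'m \<Rightarrow> nat \<Rightarrow> 'a" where h: "inj_on h (carrier M)"
    using fg_module_injection[OF assms] by blast
  define g where "g = inv_into (carrier M) h"
  have gh: "g (h x) = x" if "x \<in> carrier M" for x using h that by (simp add: g_def)
  define N :: "'a umod" where "N = \<lparr>carrier = h ` carrier M, monoid.mult = undefined, one = undefined,
     zero = h \<zero>\<^bsub>M\<^esub>, add = (\<lambda>u v. h (g u \<oplus>\<^bsub>M\<^esub> g v)), smult = (\<lambda>a u. h (a \<odot>\<^bsub>M\<^esub> g u))\<rparr>"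
  have N: "carrier N = h ` carrier M" "\<zero>\<^bsub>N\<^esub> = h \<zero>\<^bsub>M\<^esub>"
    "\<And>x y. x \<in> carrier M \<Longrightarrow> y \<in> carrier M \<Longrightarrow> h x \<oplus>\<^bsub>N\<^esub> h y = h (x \<oplus>\<^bsub>M\<^esub> y)"
    "\<And>a x. x \<in> carrier M \<Longrightarrow> a \<odot>\<^bsub>N\<^esub> h x = h (a \<odot>\<^bsub>M\<^esub> x)"
    by (auto simp: N_def gh)
  have "abelian_group N"
  proof (rule abelian_groupI)
    fix u assume "u \<in> carrier N"
    then obtain x where x: "x \<in> carrier M" "u = h x" using N(1) by auto
    then have "h (\<ominus>\<^bsub>M\<^esub> x) \<oplus>\<^bsub>N\<^esub> u = \<zero>\<^bsub>N\<^esub>" by (simp add: N M.l_neg)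
    then show "\<exists>v\<in>carrier N. v \<oplus>\<^bsub>N\<^esub> u = \<zero>\<^bsub>N\<^esub>" using x N(1) by blast
  qed (auto simp: N M.a_ac)
  then have lN: "left_module A N"
    by (intro left_module.intro left_module_axioms.intro A.ring_axioms)
       (auto simp: N smult_l_distr smult_r_distr smult_assoc1)
  then interpret N: left_module A N .
  obtain S where S: "finite S" "S \<subseteq> carrier M"
    and gen: "\<And>N. submodule N A M \<Longrightarrow> S \<subseteq> N \<Longrightarrow> N = carrier M"
    using assms unfolding fg_module_def by blast
  have "N' = carrier N" if N': "submodule N' A N" "h ` S \<subseteq> N'" for N'
  proof -
    interpret N': submodule N' A N by (fact N'(1))
    have sub: "N' \<subseteq> carrier N" and z: "h \<zero>\<^bsub>M\<^esub> \<in> N'"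
      and add: "\<And>u v. u \<in> N' \<Longrightarrow> v \<in> N' \<Longrightarrow> u \<oplus>\<^bsub>N\<^esub> v \<in> N'"
      using N'.subset N'.one_closed N'.m_closed by (auto simp: N)
    have "submodule {x \<in> carrier M. h x \<in> N'} A M"
    proof (rule submodule_intro)
      fix x y assume "x \<in> {x \<in> carrier M. h x \<in> N'}" "y \<in> {x \<in> carrier M. h x \<in> N'}"
      then show "x \<oplus>\<^bsub>M\<^esub> y \<in> {x \<in> carrier M. h x \<in> N'}" using add[of "h x" "h y"] by (simp add: N)
    next
      fix a x assume "a \<in> carrier A" "x \<in> {x \<in> carrier M. h x \<in> N'}"
      then show "a \<odot>\<^bsub>M\<^esub> x \<in> {x \<in> carrier M. h x \<in> N'}"
        using N'.smult_closed[of a "h x"] by (simp add: N)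
    qed (use z in auto)
    then have "{x \<in> carrier M. h x \<in> N'} = carrier M"
      by (rule gen) (use S(2) N'(2) in auto)
    then show ?thesis using sub by (auto simp: N)
  qed
  then have "fg_module A N"
    unfolding fg_module_def using lN S by (intro conjI exI[of _ "h ` S"]) (auto simp: N)
  moreover have "mod_iso A M N"
    unfolding mod_iso_def mod_hom_def using h
    by (intro bexI[of _ "restrict h (carrier M)"]) (auto simp: N bij_betw_def)
  ultimately show ?thesis by blast
qed

definition projective_module :: "('a, 'r) ring_scheme \<Rightarrow> 'a umod \<Rightarrow> bool" where
  "projective_module A P \<longleftrightarrow> fg_module A P \<and>
    (\<forall>(M :: 'a umod) (N :: 'a umod) g h. fg_module A M \<and> fg_module A N \<and>
       g \<in> mod_hom A M N \<and> g ` carrier M = carrier N \<and> h \<in> mod_hom A P N \<longrightarrow>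
       (\<exists>h'\<in>mod_hom A P M. compose (carrier P) g h' = h))"

definition injective_module :: "('a, 'r) ring_scheme \<Rightarrow> 'a umod \<Rightarrow> bool" where
  "injective_module A I \<longleftrightarrow> fg_module A I \<and>
    (\<forall>(M :: 'a umod) (N :: 'a umod) g h. fg_module A M \<and> fg_module A N \<and>
       g \<in> mod_hom A M N \<and> inj_on g (carrier M) \<and> h \<in> mod_hom A M I \<longrightarrow>
       (\<exists>h'\<in>mod_hom A N I. compose (carrier M) h' g = h))"

definition projective_cover :: "('a, 'r) ring_scheme \<Rightarrow> 'a umod \<Rightarrow> 'a umod \<Rightarrow> bool" where
  "projective_cover A P M \<longleftrightarrow> projective_module A P \<and>
    (\<exists>p\<in>mod_hom A P M. p ` carrier P = carrier M \<and>
      (\<forall>U. submodule U A P \<and> U <+>\<^bsub>P\<^esub> a_kernel P M p = carrier P \<longrightarrow> U = carrier P))"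

definition injective_hull :: "('a, 'r) ring_scheme \<Rightarrow> 'a umod \<Rightarrow> 'a umod \<Rightarrow> bool" where
  "injective_hull A I M \<longleftrightarrow> injective_module A I \<and>
    (\<exists>q\<in>mod_hom A M I. inj_on q (carrier M) \<and>
      (\<forall>U. submodule U A I \<and> U \<inter> q ` carrier M = {\<zero>\<^bsub>I\<^esub>} \<longrightarrow> U = {\<zero>\<^bsub>I\<^esub>}))"

definition simple_representatives ::
    "('a, 'r) ring_scheme \<Rightarrow> nat \<Rightarrow> (nat \<Rightarrow> 'a umod) \<Rightarrow> bool" where
  "simple_representatives A n L \<longleftrightarrow>
    (\<forall>i\<in>{1..n}. simple_module A (L i)) \<and>
    (\<forall>i\<in>{1..n}. \<forall>j\<in>{1..n}. i \<noteq> j \<longrightarrow> \<not> mod_iso A (L i) (L j)) \<and>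
    (\<forall>S :: 'a umod. simple_module A S \<longrightarrow> (\<exists>i\<in>{1..n}. mod_iso A S (L i)))"

text \<open>The maximal quotient of \<open>P\<close> with the required composition factors is the quotient by the
  least submodule \<open>N\<close> such that \<open>P / N\<close> has these composition factors.\<close>

definition std_kernel ::
    "('a, 'r) ring_scheme \<Rightarrow> (nat \<Rightarrow> 'a umod) \<Rightarrow> nat \<Rightarrow> 'a umod \<Rightarrow> (nat \<Rightarrow> 'a) set \<Rightarrow> bool" where
  "std_kernel A L i P N \<longleftrightarrow>
    submodule N A P \<and> comp_factors_in A (mod_quot P N) (L ` {1..i}) \<and>
    (\<forall>N'. submodule N' A P \<and> comp_factors_in A (mod_quot P N') (L ` {1..i}) \<longrightarrow> N \<subseteq> N')"

definition standard_module ::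
    "('a, 'r) ring_scheme \<Rightarrow> (nat \<Rightarrow> 'a umod) \<Rightarrow> nat \<Rightarrow> 'a umod \<Rightarrow> 'a umod \<Rightarrow> bool" where
  "standard_module A L i P D \<longleftrightarrow>
    fg_module A D \<and> (\<exists>N. std_kernel A L i P N \<and> mod_iso A (mod_quot P N) D)"

definition costandard_module ::
    "('a, 'r) ring_scheme \<Rightarrow> (nat \<Rightarrow> 'a umod) \<Rightarrow> nat \<Rightarrow> 'a umod \<Rightarrow> 'a umod \<Rightarrow> bool" where
  "costandard_module A L i I D \<longleftrightarrow>
    fg_module A D \<and> (\<exists>N. submodule N A I \<and> comp_factors_in A (I\<lparr>carrier := N\<rparr>) (L ` {1..i}) \<and>
      (\<forall>N'. submodule N' A I \<and> comp_factors_in A (I\<lparr>carrier := N'\<rparr>) (L ` {1..i}) \<longrightarrow> N' \<subseteq> N) \<and>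
      mod_iso A (I\<lparr>carrier := N\<rparr>) D)"

definition quasi_hereditary ::
    "('a, 'r) ring_scheme \<Rightarrow> nat \<Rightarrow> (nat \<Rightarrow> 'a umod) \<Rightarrow> (nat \<Rightarrow> 'a umod) \<Rightarrow> (nat \<Rightarrow> 'a umod) \<Rightarrow> bool"
  where
  "quasi_hereditary A n L P \<Delta> \<longleftrightarrow> (\<forall>i\<in>{1..n}.
     (\<exists>N. std_kernel A L i (P i) N \<and> filtered_by A ((P i)\<lparr>carrier := N\<rparr>) (\<Delta> ` {i<..n})) \<and>
     (\<exists>r\<in>mod_hom A (\<Delta> i) (L i). r ` carrier (\<Delta> i) = carrier (L i) \<and>
        filtered_by A ((\<Delta> i)\<lparr>carrier := a_kernel (\<Delta> i) (L i) r\<rparr>) (L ` {1..<i})))"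

definition hom_scale ::
    "('k, 'a) module \<Rightarrow> ('a, 'm) module \<Rightarrow> ('a, 'l) module \<Rightarrow> 'k \<Rightarrow> ('m \<Rightarrow> 'l) \<Rightarrow> 'm \<Rightarrow> 'l" where
  "hom_scale A M N c f = (\<lambda>x\<in>carrier M. (c \<odot>\<^bsub>A\<^esub> \<one>\<^bsub>A\<^esub>) \<odot>\<^bsub>N\<^esub> f x)"

definition Hom_space ::
    "('k, 'a) module \<Rightarrow> ('a, 'm) module \<Rightarrow> ('a, 'l) module \<Rightarrow> ('k, 'm \<Rightarrow> 'l) module" where
  "Hom_space A M N = \<lparr>carrier = mod_hom A M N, monoid.mult = undefined, one = undefined,
     zero = zero_hom M N, add = (\<lambda>f g. \<lambda>x\<in>carrier M. f x \<oplus>\<^bsub>N\<^esub> g x),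
     smult = hom_scale A M N\<rparr>"

text \<open>A triple \<open>(E, \<beta>, \<gamma>)\<close> stands for \<open>0 \<rightarrow> N \<rightarrow> E \<rightarrow> M \<rightarrow> 0\<close> with maps \<open>\<beta>\<close> and \<open>\<gamma>\<close>.\<close>

type_synonym ('a, 'm, 'l, 'x) extension = "('a, 'x) module \<times> ('l \<Rightarrow> 'x) \<times> ('x \<Rightarrow> 'm)"
type_synonym 'a uext = "('a, nat \<Rightarrow> 'a, nat \<Rightarrow> 'a, nat \<Rightarrow> 'a) extension"

definition extensions :: "('a, 'r) ring_scheme \<Rightarrow> 'a umod \<Rightarrow> 'a umod \<Rightarrow> 'a uext set" where
  "extensions A M N = {(E, \<beta>, \<gamma>). fg_module A E \<and>
     \<beta> \<in> mod_hom A N E \<and> \<gamma> \<in> mod_hom A E M \<and>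
     inj_on \<beta> (carrier N) \<and> \<gamma> ` carrier E = carrier M \<and> \<beta> ` carrier N = a_kernel E M \<gamma>}"

fun ext_equivalent :: "('a, 'r) ring_scheme \<Rightarrow> ('a, 'l) module \<Rightarrow>
    ('a, 'm, 'l, 'x) extension \<Rightarrow> ('a, 'm, 'l, 'y) extension \<Rightarrow> bool" where
  "ext_equivalent A N (E, \<beta>, \<gamma>) (E', \<beta>', \<gamma>') \<longleftrightarrow>
    (\<exists>\<theta>\<in>mod_hom A E E'. bij_betw \<theta> (carrier E) (carrier E') \<and>
       compose (carrier N) \<theta> \<beta> = \<beta>' \<and> compose (carrier E) \<gamma>' \<theta> = \<gamma>)"

definition ext_rel :: "('a, 'r) ring_scheme \<Rightarrow> 'a umod \<Rightarrow> 'a umod \<Rightarrow> 'a uext rel" where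
  "ext_rel A M N = {(\<xi>, \<xi>'). \<xi> \<in> extensions A M N \<and> \<xi>' \<in> extensions A M N \<and> ext_equivalent A N \<xi> \<xi>'}"

definition split_ext :: "('a, 'm) module \<Rightarrow> ('a, 'l) module \<Rightarrow> ('a, 'm, 'l, 'l \<times> 'm) extension" where
  "split_ext M N =
    (mod_prod N M, (\<lambda>y\<in>carrier N. (y, \<zero>\<^bsub>M\<^esub>)), (\<lambda>p\<in>carrier (mod_prod N M). snd p))"

text \<open>The Baer sum is the pullback \<open>Y\<close> of the two epimorphisms modulo the antidiagonal copy
  of \<open>N\<close>; the scalar multiple by \<open>c\<close> is the pullback along multiplication by \<open>c\<close> on \<open>M\<close>.\<close>

fun baer_sum :: "('a, 'l) module \<Rightarrow> ('a, 'm, 'l, 'x) extension \<Rightarrow> ('a, 'm, 'l, 'y) extension \<Rightarrow>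
    ('a, 'm, 'l, ('x \<times> 'y) set) extension" where
  "baer_sum N (E, \<beta>, \<gamma>) (E', \<beta>', \<gamma>') =
    (let Y = (mod_prod E E')\<lparr>carrier := {(x, x') \<in> carrier E \<times> carrier E'. \<gamma> x = \<gamma>' x'}\<rparr>;
         D = {(\<beta> y, \<ominus>\<^bsub>E'\<^esub> \<beta>' y) | y. y \<in> carrier N};
         Q = mod_quot Y D
     in (Q, (\<lambda>y\<in>carrier N. D +>\<^bsub>Y\<^esub> (\<beta> y, \<zero>\<^bsub>E'\<^esub>)),
         (\<lambda>C\<in>carrier Q. the_elem ((\<lambda>p. \<gamma> (fst p)) ` C))))"

fun ext_scale :: "('k, 'a) module \<Rightarrow> ('a, 'm) module \<Rightarrow> ('a, 'l) module \<Rightarrow> 'k \<Rightarrow>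
    ('a, 'm, 'l, 'x) extension \<Rightarrow> ('a, 'm, 'l, 'x \<times> 'm) extension" where
  "ext_scale A M N c (E, \<beta>, \<gamma>) =
    (let Y = (mod_prod E M)\<lparr>carrier :=
           {(x, z) \<in> carrier E \<times> carrier M. \<gamma> x = (c \<odot>\<^bsub>A\<^esub> \<one>\<^bsub>A\<^esub>) \<odot>\<^bsub>M\<^esub> z}\<rparr>
     in (Y, (\<lambda>y\<in>carrier N. (\<beta> y, \<zero>\<^bsub>M\<^esub>)), (\<lambda>p\<in>carrier Y. snd p)))"

definition Ext1_space ::
    "('k, 'a) module \<Rightarrow> 'a umod \<Rightarrow> 'a umod \<Rightarrow> ('k, 'a uext set) module" where
  "Ext1_space A M N = \<lparr>carrier = extensions A M N // ext_rel A M N,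
     monoid.mult = undefined, one = undefined,
     zero = {\<zeta> \<in> extensions A M N. ext_equivalent A N (split_ext M N) \<zeta>},
     add = (\<lambda>c c'. {\<zeta> \<in> extensions A M N.
       \<exists>\<xi>\<in>c. \<exists>\<xi>'\<in>c'. ext_equivalent A N (baer_sum N \<xi> \<xi>') \<zeta>}),
     smult = (\<lambda>s c. {\<zeta> \<in> extensions A M N.
       \<exists>\<xi>\<in>c. ext_equivalent A N (ext_scale A M N s \<xi>) \<zeta>})\<rparr>"

definition bilinear_form ::
    "('k, 'r) ring_scheme \<Rightarrow> ('k, 'v) module \<Rightarrow> ('k, 'w) module \<Rightarrow> ('v \<Rightarrow> 'w \<Rightarrow> 'k) \<Rightarrow> bool" where
  "bilinear_form K V W b \<longleftrightarrow>
    (\<forall>v\<in>carrier V. \<forall>w\<in>carrier W. b v w \<in> carrier K) \<and>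
    (\<forall>v\<in>carrier V. \<forall>v'\<in>carrier V. \<forall>w\<in>carrier W. b (v \<oplus>\<^bsub>V\<^esub> v') w = b v w \<oplus>\<^bsub>K\<^esub> b v' w) \<and>
    (\<forall>v\<in>carrier V. \<forall>w\<in>carrier W. \<forall>w'\<in>carrier W. b v (w \<oplus>\<^bsub>W\<^esub> w') = b v w \<oplus>\<^bsub>K\<^esub> b v w') \<and>
    (\<forall>s\<in>carrier K. \<forall>v\<in>carrier V. \<forall>w\<in>carrier W. b (s \<odot>\<^bsub>V\<^esub> v) w = s \<otimes>\<^bsub>K\<^esub> b v w) \<and>
    (\<forall>s\<in>carrier K. \<forall>v\<in>carrier V. \<forall>w\<in>carrier W. b v (s \<odot>\<^bsub>W\<^esub> w) = s \<otimes>\<^bsub>K\<^esub> b v w)"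

definition nondegenerate_form ::
    "('k, 'r) ring_scheme \<Rightarrow> ('k, 'v) module \<Rightarrow> ('k, 'w) module \<Rightarrow> ('v \<Rightarrow> 'w \<Rightarrow> 'k) \<Rightarrow> bool" where
  "nondegenerate_form K V W b \<longleftrightarrow>
    (\<forall>v\<in>carrier V. (\<forall>w\<in>carrier W. b v w = \<zero>\<^bsub>K\<^esub>) \<longrightarrow> v = \<zero>\<^bsub>V\<^esub>) \<and>
    (\<forall>w\<in>carrier W. (\<forall>v\<in>carrier V. b v w = \<zero>\<^bsub>K\<^esub>) \<longrightarrow> w = \<zero>\<^bsub>W\<^esub>)"

text \<open>In \<open>is_lift\<close> and \<open>is_value\<close> the parameters are \<open>Di = \<Delta> i\<close>, \<open>a = \<alpha>\<^sub>i\<close>, and \<open>Dj = \<Delta> j\<close>, \<open>b = \<alpha>\<^sub>j\<close>.\<close>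

definition is_lift :: "('a, 'r) ring_scheme \<Rightarrow> ('a, 'd) module \<Rightarrow> ('d \<Rightarrow> 'm) \<Rightarrow>
    ('a, 'm, 'l, 'x) extension \<Rightarrow> ('d \<Rightarrow> 'x) \<Rightarrow> bool" where
  "is_lift A Di a \<xi> \<phi> \<longleftrightarrow>
    (case \<xi> of (E, \<beta>, \<gamma>) \<Rightarrow> \<phi> \<in> mod_hom A Di E \<and> compose (carrier Di) \<gamma> \<phi> = a)"

definition is_value :: "('k, 'r) ring_scheme \<Rightarrow> ('k, 'a) module \<Rightarrow> ('a, 'd) module \<Rightarrow>
    ('e \<Rightarrow> 'x) \<Rightarrow> ('d \<Rightarrow> 'l) \<Rightarrow> ('d \<Rightarrow> 'e) \<Rightarrow> ('a, 'm, 'l, 'x) extension \<Rightarrow> 'k \<Rightarrow> bool" where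
  "is_value K A Dj \<phi> b f \<xi> s \<longleftrightarrow> (case \<xi> of (E, \<beta>, \<gamma>) \<Rightarrow> s \<in> carrier K \<and>
     compose (carrier Dj) \<phi> f = hom_scale A Dj E s (compose (carrier Dj) \<beta> b))"

definition pairing_value :: "('k, 'r) ring_scheme \<Rightarrow> ('k, 'a) module \<Rightarrow>
    ('a, 'e) module \<Rightarrow> ('a, 'd) module \<Rightarrow> ('e \<Rightarrow> 'm) \<Rightarrow> ('d \<Rightarrow> 'l) \<Rightarrow>
    ('d \<Rightarrow> 'e) \<Rightarrow> ('a, 'm, 'l, 'x) extension \<Rightarrow> 'k" where
  "pairing_value K A Di Dj a b f \<xi> =
    (THE s. is_value K A Dj (THE \<phi>. is_lift A Di a \<xi> \<phi>) b f \<xi> s)"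

definition pairing :: "('k, 'r) ring_scheme \<Rightarrow> ('k, 'a) module \<Rightarrow>
    ('a, 'e) module \<Rightarrow> ('a, 'd) module \<Rightarrow> ('e \<Rightarrow> 'm) \<Rightarrow> ('d \<Rightarrow> 'l) \<Rightarrow>
    ('d \<Rightarrow> 'e) \<Rightarrow> ('a, 'm, 'l, 'x) extension set \<Rightarrow> 'k" where
  "pairing K A Di Dj a b f c = the_elem (pairing_value K A Di Dj a b f ` c)"

end

theory Submission
  imports Defs
begin

text \<open>
  Write \<open>\<B>\<^sub>m\<close> for the modules all of whose composition factors are \<open>L l\<close> with \<open>l \<le> m\<close>. In \<open>\<B>\<^sub>m\<close> the module
  \<open>\<Delta> m\<close> is projective and \<open>Nabla m\<close> is injective, which gives the unique lifts; the values exist since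
  \<open>Hom(\<Delta> j, Nabla i) = 0\<close> and, by Schur's lemma, \<open>Hom(\<Delta> j, Nabla j)\<close> is one-dimensional.

  Let \<open>j = i - 1\<close>; then the radical \<open>R\<close> of \<open>\<Delta> i\<close> lies in \<open>\<B>\<^sub>j\<close>. If an extension \<open>X\<close> of \<open>Nabla i\<close> by \<open>Nabla j\<close>
  pairs to zero with every homomorphism, then the lift \<open>\<phi>\<close> kills \<open>R\<close>: otherwise its image meets the socle
  of \<open>Nabla j\<close>, and \<open>\<Delta> j\<close>, being projective in \<open>\<B>\<^sub>j\<close>, has a map to \<open>R\<close> that \<open>\<phi>\<close> does not kill. Hence \<open>Nabla j\<close> embeds
  into the quotient of \<open>X\<close> by the image of \<open>\<phi>\<close>, which lies in \<open>\<B>\<^sub>j\<close>, and \<open>X\<close> splits.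

  Conversely, for \<open>f \<noteq> 0\<close> the map \<open>\<alpha> j\<close> factors through \<open>f\<close> and extends to \<open>R \<rightarrow> Nabla j\<close>, then to
  \<open>H : \<Delta> i \<rightarrow> I j\<close>. With \<open>C = I j / Nabla j\<close>, the induced map \<open>soc (Nabla i) \<rightarrow> C\<close> extends to \<open>Nabla i\<close> because
  \<open>Ext\<^sup>1(M, C) = Ext\<^sup>2(M, Nabla j) = 0\<close> for \<open>M\<close> in \<open>\<B>\<^sub>j\<close>; this is where the \<open>\<Delta>\<close>-filtrations of the
  projective modules enter. The pullback of \<open>I j \<rightarrow> C\<close> along this extension pairs to \<open>1\<close> with \<open>f\<close>.
\<close>

text \<open>Quasi-heredity is a condition on \<open>\<Delta>\<close> only, so facts about costandard
  modules, such as the multiplicity one of \<open>L i\<close> in \<open>Nabla i\<close>, are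
  obtained by mapping standard modules into them. The detour through \<open>C\<close> rests on the
  description of Ext^1(Nabla i, Nabla j) as Hom(Nabla i, C) modulo the maps that lift to
  \<open>I j\<close>. An extension with a prescribed value is thus a map from \<open>Nabla i\<close>
  to \<open>C\<close> with prescribed restriction to the socle, and the obstruction lies in Ext^1 of
  the quotient by the socle with values in \<open>C\<close>. No derived functor is formed: each
  vanishing statement appears as a lifting property of the projection from \<open>I j\<close> to
  \<open>C\<close>, or as an extension property of \<open>C\<close>. Two formal obstacles shape the
  rest. Composition factors are defined through all composition series; they are traded for
  subquotients, which pass to submodules, images and extensions directly. Projectivity, injectivity
  and Ext are tested on one carrier type, whereas quotients and products live on others, so
  isomorphic copies are interposed.\<close>

abbreviation res_mod :: "('a, 'm) module \<Rightarrow> 'm set \<Rightarrow> ('a, 'm) module" (infixl "\<restriction>" 95)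
  where "M \<restriction> U \<equiv> M\<lparr>carrier := U\<rparr>"

section \<open>Submodules and homomorphisms\<close>

lemma submoduleD:
  assumes "submodule U A M"
  shows "U \<subseteq> carrier M" "\<zero>\<^bsub>M\<^esub> \<in> U"
    "\<lbrakk>x \<in> U; y \<in> U\<rbrakk> \<Longrightarrow> x \<oplus>\<^bsub>M\<^esub> y \<in> U"
      "\<lbrakk>a \<in> carrier A; x \<in> U\<rbrakk> \<Longrightarrow> a \<odot>\<^bsub>M\<^esub> x \<in> U"
    "x \<in> U \<Longrightarrow> \<ominus>\<^bsub>M\<^esub> x \<in> U"
proof -
  interpret submodule U A M by fact
  show "U \<subseteq> carrier M" "\<zero>\<^bsub>M\<^esub> \<in> U"
    "\<lbrakk>x \<in> U; y \<in> U\<rbrakk> \<Longrightarrow> x \<oplus>\<^bsub>M\<^esub> y \<in> U"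
    "\<lbrakk>a \<in> carrier A; x \<in> U\<rbrakk> \<Longrightarrow> a \<odot>\<^bsub>M\<^esub> x \<in> U"
      "x \<in> U \<Longrightarrow> \<ominus>\<^bsub>M\<^esub> x \<in> U"
    using subset one_closed m_closed m_inv_closed by (auto simp: a_inv_def)
qed

lemma submodule_memD: "submodule U A M \<Longrightarrow> x \<in> U \<Longrightarrow> x \<in> carrier M"
  using submoduleD(1) by blast

lemma res_left_module:
  assumes "left_module A M" "submodule U A M"
  shows "left_module A (M \<restriction> U)"
proof -
  interpret M: left_module A M by fact
  note U = submoduleD[OF assms(2)]
  have "abelian_group (M \<restriction> U)"
  proof (rule abelian_groupI)
    fix x assume "x \<in> carrier (M \<restriction> U)"
    then show "\<exists>y\<in>carrier (M \<restriction> U). y \<oplus>\<^bsub>M \<restriction> U\<^esub> x = \<zero>\<^bsub>M \<restriction> U\<^esub>"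
      using U(1,5) by (intro bexI[of _ "\<ominus>\<^bsub>M\<^esub> x"]) (auto simp: M.M.l_neg)
  qed (use U in \<open>auto simp: M.M.a_ac subset_iff\<close>)
  then show ?thesis
    using U by (intro left_module.intro left_module_axioms.intro M.A.ring_axioms)
      (auto simp: M.smult_l_distr M.smult_r_distr M.smult_assoc1 subset_iff)
qed

lemma submodule_carrier: "left_module A M \<Longrightarrow> submodule (carrier M) A M"
proof -
  assume "left_module A M"
  then interpret M: left_module A M .
  show ?thesis by (rule M.submodule_intro) auto
qed

lemma submodule_zero: "left_module A M \<Longrightarrow> submodule {\<zero>\<^bsub>M\<^esub>} A M"
proof -
  assume "left_module A M"
  then interpret M: left_module A M .
  show ?thesis by (rule M.submodule_intro) (auto simp: M.smult_zero_r)
qed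

lemma submodule_res_iff:
  assumes "left_module A M" "submodule U A M"
  shows "submodule V A (M \<restriction> U) \<longleftrightarrow> submodule V A M \<and> V \<subseteq> U"
proof -
  interpret M: left_module A M by fact
  interpret U: left_module A "M \<restriction> U" by (rule res_left_module[OF assms])
  show ?thesis
  proof
    assume "submodule V A (M \<restriction> U)"
    note V = submoduleD[OF this]
    have "submodule V A M"
      by (rule M.submodule_intro) (use V submoduleD[OF assms(2)] in auto)
    then show "submodule V A M \<and> V \<subseteq> U" using V by auto
  next
    assume "submodule V A M \<and> V \<subseteq> U"
    then show "submodule V A (M \<restriction> U)"
      by (intro U.submodule_intro) (use submoduleD[of V A M] in auto)
  qed
qed

lemma submodule_Int:
  assumes "left_module A M" "submodule U A M" "submodule V A M"
  shows "submodule (U \<inter> V) A M"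
proof -
  interpret M: left_module A M by fact
  show ?thesis
    by (rule M.submodule_intro) (use submoduleD[OF assms(2)] submoduleD[OF assms(3)] in auto)
qed

lemma submodule_Inter:
  assumes "left_module A M" "\<And>U. U \<in> \<U> \<Longrightarrow> submodule U A M" "\<U> \<noteq> {}"
  shows "submodule (\<Inter>\<U>) A M"
proof -
  interpret M: left_module A M by fact
  note * = submoduleD[OF assms(2)]
  obtain U where "U \<in> \<U>" using assms(3) by blast
  show ?thesis
  proof (rule M.submodule_intro)
    show "\<Inter>\<U> \<subseteq> carrier M" using *(1)[OF \<open>U \<in> \<U>\<close>] \<open>U \<in> \<U>\<close> by blast
  qed (simp_all add: *(2-4))
qed

section \<open>Homomorphisms, their kernels and their images\<close>

lemma mod_homI:
  assumes "\<And>x. x \<in> carrier M \<Longrightarrow> f x \<in> carrier N"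
    and "\<And>x y. \<lbrakk>x \<in> carrier M; y \<in> carrier M\<rbrakk> \<Longrightarrow> f (x \<oplus>\<^bsub>M\<^esub> y) = f x \<oplus>\<^bsub>N\<^esub> f y"
    and "\<And>a x. \<lbrakk>a \<in> carrier A; x \<in> carrier M\<rbrakk> \<Longrightarrow> f (a \<odot>\<^bsub>M\<^esub> x) = a \<odot>\<^bsub>N\<^esub> f x"
    and "left_module A M"
  shows "restrict f (carrier M) \<in> mod_hom A M N"
proof -
  interpret M: left_module A M by fact
  show ?thesis using assms(1-3) by (auto simp: mod_hom_def)
qed

lemma mod_homD:
  assumes "f \<in> mod_hom A M N"
  shows "x \<in> carrier M \<Longrightarrow> f x \<in> carrier N"
    "\<lbrakk>x \<in> carrier M; y \<in> carrier M\<rbrakk> \<Longrightarrow> f (x \<oplus>\<^bsub>M\<^esub> y) = f x \<oplus>\<^bsub>N\<^esub> f y"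
    "\<lbrakk>a \<in> carrier A; x \<in> carrier M\<rbrakk> \<Longrightarrow> f (a \<odot>\<^bsub>M\<^esub> x) = a \<odot>\<^bsub>N\<^esub> f x"
    "f \<in> extensional (carrier M)"
  using assms unfolding mod_hom_def PiE_def by auto

lemma mod_hom_eqI:
  assumes "f \<in> mod_hom A M N" "g \<in> mod_hom A M N'" "\<And>x. x \<in> carrier M \<Longrightarrow> f x = g x"
  shows "f = g"
  using assms by (intro extensionalityI[of _ "carrier M"]) (auto dest: mod_homD(4))

lemma mod_hom_zero:
  assumes "left_module A M" "left_module A N" "f \<in> mod_hom A M N"
  shows "f \<zero>\<^bsub>M\<^esub> = \<zero>\<^bsub>N\<^esub>"
proof -
  interpret M: left_module A M by fact
  interpret N: left_module A N by fact
  have "f \<zero>\<^bsub>M\<^esub> = f (\<zero>\<^bsub>A\<^esub> \<odot>\<^bsub>M\<^esub> \<zero>\<^bsub>M\<^esub>)"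
    by (simp add: M.smult_zero_l)
  also have "\<dots> = \<zero>\<^bsub>N\<^esub>" using mod_homD[OF assms(3)] by (simp add: N.smult_zero_l)
  finally show ?thesis .
qed

lemma mod_hom_minus:
  assumes "left_module A M" "left_module A N" "f \<in> mod_hom A M N" "x \<in> carrier M"
  shows "f (\<ominus>\<^bsub>M\<^esub> x) = \<ominus>\<^bsub>N\<^esub> f x"
proof -
  interpret M: left_module A M by fact
  interpret N: left_module A N by fact
  show ?thesis using mod_homD[OF assms(3)] assms(4)
    by (simp flip: M.smult_minus_one N.smult_minus_one)
qed

lemma mod_hom_comp:
  assumes "f \<in> mod_hom A M N" "g \<in> mod_hom A N Q" "left_module A M"
  shows "compose (carrier M) g f \<in> mod_hom A M Q"
  unfolding compose_def
  by (rule mod_homI) (use mod_homD[OF assms(1)] mod_homD[OF assms(2)] assms(3) in auto)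

lemma mod_hom_res:
  assumes "f \<in> mod_hom A M N" "submodule U A M" "left_module A M"
  shows "restrict f U \<in> mod_hom A (M \<restriction> U) N"
  using mod_homI[of "M \<restriction> U" f N A] mod_homD[OF assms(1)] res_left_module[OF assms(3,2)]
    submodule_memD[OF assms(2)] by auto

text \<open>A homomorphism is extensional on its domain only, so shrinking the codomain to a set
  that contains the image leaves the function itself unchanged.\<close>

lemma mod_hom_corestrict:
  assumes "f \<in> mod_hom A M N" "f ` carrier M \<subseteq> V"
  shows "f \<in> mod_hom A M (N \<restriction> V)"
  using assms unfolding mod_hom_def by (auto simp: PiE_def)

lemma mod_hom_expand:
  assumes "f \<in> mod_hom A M (N \<restriction> V)" "V \<subseteq> carrier N"
  shows "f \<in> mod_hom A M N"
  using assms unfolding mod_hom_def by (auto simp: PiE_def Pi_iff)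

lemma mod_hom_id: "left_module A M \<Longrightarrow> (\<lambda>x\<in>carrier M. x) \<in> mod_hom A M M"
  by (rule mod_homI) auto

lemma mod_hom_incl:
  assumes "submodule U A M" "left_module A M"
  shows "(\<lambda>x\<in>U. x) \<in> mod_hom A (M \<restriction> U) M"
proof -
  have "restrict (\<lambda>x\<in>carrier M. x) U = (\<lambda>x\<in>U. x)"
    using submodule_memD[OF assms(1)] by (auto simp: restrict_def)
  then show ?thesis using mod_hom_res[OF mod_hom_id[OF assms(2)] assms] by simp
qed

lemma mod_hom_add:
  assumes "f \<in> mod_hom A M N" "g \<in> mod_hom A M N" "left_module A M" "left_module A N"
  shows "(\<lambda>x\<in>carrier M. f x \<oplus>\<^bsub>N\<^esub> g x) \<in> mod_hom A M N"
proof -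
  interpret N: left_module A N by fact
  show ?thesis
    by (rule mod_homI)
      (use mod_homD[OF assms(1)] mod_homD[OF assms(2)] assms(3) in \<open>auto simp: N.M.a_ac N.smult_r_distr\<close>)
qed

lemma (in left_module) smult_minus_right:
  "a \<in> carrier A \<Longrightarrow> x \<in> carrier M \<Longrightarrow> a \<odot>\<^bsub>M\<^esub> \<ominus>\<^bsub>M\<^esub> x = \<ominus>\<^bsub>M\<^esub> (a \<odot>\<^bsub>M\<^esub> x)"
  by (metis M.add.inv_closed M.minus_equality M.l_neg smult_closed smult_r_distr smult_zero_r)

lemma mod_hom_diff:
  assumes "f \<in> mod_hom A M N" "g \<in> mod_hom A M N" "left_module A M" "left_module A N"
  shows "(\<lambda>x\<in>carrier M. f x \<ominus>\<^bsub>N\<^esub> g x) \<in> mod_hom A M N"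
proof -
  interpret N: left_module A N by fact
  show ?thesis
    by (rule mod_homI)
      (use mod_homD[OF assms(1)] mod_homD[OF assms(2)] assms(3) in
        \<open>auto simp: N.M.a_ac N.smult_r_distr a_minus_def N.M.minus_add N.smult_minus_right\<close>)
qed

lemma zero_hom_in: "left_module A M \<Longrightarrow> left_module A N \<Longrightarrow> zero_hom M N \<in> mod_hom A M N"
proof -
  assume *: "left_module A M" "left_module A N"
  interpret N: left_module A N by fact
  show ?thesis unfolding zero_hom_def by (rule mod_homI) (use * in \<open>auto simp: N.smult_zero_r\<close>)
qed

lemma a_kernel_eq: "a_kernel M N f = {x \<in> carrier M. f x = \<zero>\<^bsub>N\<^esub>}"
  by (simp add: a_kernel_def kernel_def)

lemma submodule_vimage:
  assumes "left_module A M" "left_module A N" "f \<in> mod_hom A M N" "submodule V A N"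
  shows "submodule {x \<in> carrier M. f x \<in> V} A M"
proof -
  interpret M: left_module A M by fact
  show ?thesis
    by (rule M.submodule_intro)
      (use submoduleD[OF assms(4)] mod_homD[OF assms(3)] mod_hom_zero[OF assms(1-3)] in auto)
qed

lemma submodule_kernel:
  assumes "left_module A M" "left_module A N" "f \<in> mod_hom A M N"
  shows "submodule (a_kernel M N f) A M"
  using submodule_vimage[OF assms submodule_zero[OF assms(2)]] by (simp add: a_kernel_eq)

lemma submodule_image:
  assumes "left_module A M" "left_module A N" "f \<in> mod_hom A M N" "submodule U A M"
  shows "submodule (f ` U) A N"
proof -
  interpret N: left_module A N by fact
  note U = submoduleD[OF assms(4)] and f = mod_homD[OF assms(3)]
  show ?thesis
  proof (rule N.submodule_intro)
    show "\<zero>\<^bsub>N\<^esub> \<in> f ` U" using mod_hom_zero[OF assms(1-3)] U(2) by force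
  next
    fix x y assume "x \<in> f ` U" "y \<in> f ` U"
    then obtain u v where uv: "u \<in> U" "v \<in> U" "x = f u" "y = f v" by blast
    then have "x \<oplus>\<^bsub>N\<^esub> y = f (u \<oplus>\<^bsub>M\<^esub> v)" using subsetD[OF U(1)] f(2) by auto
    then show "x \<oplus>\<^bsub>N\<^esub> y \<in> f ` U" using U(3) uv by blast
  next
    fix a x assume "a \<in> carrier A" "x \<in> f ` U"
    then obtain u where u: "u \<in> U" "x = f u" by blast
    then have "a \<odot>\<^bsub>N\<^esub> x = f (a \<odot>\<^bsub>M\<^esub> u)"
      using subsetD[OF U(1)] f(3) \<open>a \<in> carrier A\<close> by auto
    then show "a \<odot>\<^bsub>N\<^esub> x \<in> f ` U" using U(4) u \<open>a \<in> carrier A\<close> by blast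
  qed (use U f in auto)
qed

lemma (in left_module) diff_eq_zero_iff:
  "x \<in> carrier M \<Longrightarrow> y \<in> carrier M \<Longrightarrow> x \<ominus>\<^bsub>M\<^esub> y = \<zero>\<^bsub>M\<^esub> \<longleftrightarrow> x = y"
  by (metis M.add.inv_closed M.add.inv_inv M.minus_equality M.r_neg a_minus_def)

lemma mod_hom_inj_onI:
  assumes "left_module A M" "left_module A N" "f \<in> mod_hom A M N"
    and "\<And>x. \<lbrakk>x \<in> carrier M; f x = \<zero>\<^bsub>N\<^esub>\<rbrakk> \<Longrightarrow> x = \<zero>\<^bsub>M\<^esub>"
  shows "inj_on f (carrier M)"
proof (rule inj_onI)
  interpret M: left_module A M by fact
  interpret N: left_module A N by fact
  note f = mod_homD[OF assms(3)]
  fix x y assume *: "x \<in> carrier M" "y \<in> carrier M" "f x = f y"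
  have "f (x \<oplus>\<^bsub>M\<^esub> \<ominus>\<^bsub>M\<^esub> y) = \<zero>\<^bsub>N\<^esub>"
    using * f by (simp add: mod_hom_minus[OF assms(1-3)] N.M.r_neg)
  then have "x \<oplus>\<^bsub>M\<^esub> \<ominus>\<^bsub>M\<^esub> y = \<zero>\<^bsub>M\<^esub>" using * assms(4) by simp
  then show "x = y" using * by (metis M.M.minus_equality M.M.add.inv_closed M.M.minus_minus)
qed

lemma mod_hom_eq_iff_diff:
  assumes "left_module A M" "left_module A N" "f \<in> mod_hom A M N" "x \<in> carrier M" "y \<in> carrier M"
  shows "f x = f y \<longleftrightarrow> x \<ominus>\<^bsub>M\<^esub> y \<in> a_kernel M N f"
proof -
  interpret M: left_module A M by fact
  interpret N: left_module A N by fact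
  note f = mod_homD[OF assms(3)]
  have "f (x \<ominus>\<^bsub>M\<^esub> y) = f x \<ominus>\<^bsub>N\<^esub> f y"
    using assms f by (simp add: a_minus_def mod_hom_minus[OF assms(1-3)])
  then show ?thesis using assms f by (simp add: a_kernel_eq N.diff_eq_zero_iff)
qed

text \<open>The surjection \<open>p : M \<rightarrow> Q\<close> plays the role of a quotient map, so that the carrier type of cosets is
  hardly ever needed.\<close>

lemma hom_factor:
  assumes "left_module A M" "left_module A Q" "left_module A N"
    and "p \<in> mod_hom A M Q" "p ` carrier M = carrier Q" "f \<in> mod_hom A M N"
    and "\<And>x. \<lbrakk>x \<in> carrier M; p x = \<zero>\<^bsub>Q\<^esub>\<rbrakk> \<Longrightarrow> f x = \<zero>\<^bsub>N\<^esub>"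
  shows "\<exists>g\<in>mod_hom A Q N. \<forall>x\<in>carrier M. g (p x) = f x"
proof -
  note p = mod_homD[OF assms(4)] and f = mod_homD[OF assms(6)]
  have ker: "a_kernel M Q p \<subseteq> a_kernel M N f" using assms(7) by (auto simp: a_kernel_eq)
  have wd: "f x = f y" if "x \<in> carrier M" "y \<in> carrier M" "p x = p y" for x y
    using that ker mod_hom_eq_iff_diff[OF assms(1,2,4)] mod_hom_eq_iff_diff[OF assms(1,3,6)] by blast
  interpret M: left_module A M by fact
  \<comment> \<open>\<open>s\<close> is a section of \<open>p\<close> on the level of sets only. The
    composite of \<open>f\<close> with it respects the operations because \<open>wd\<close> allows
    any preimage to be exchanged for any other.\<close>
  define s where "s = inv_into (carrier M) p"
  have s: "s y \<in> carrier M" "p (s y) = y" if "y \<in> carrier Q" for y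
    using that assms(5) unfolding s_def by (metis inv_into_into, metis f_inv_into_f)
  have g: "f (s (p x)) = f x" if "x \<in> carrier M" for x
    using that s[of "p x"] p by (intro wd) auto
  have "restrict (\<lambda>y. f (s y)) (carrier Q) \<in> mod_hom A Q N"
  proof (rule mod_homI)
    fix x y assume xy: "x \<in> carrier Q" "y \<in> carrier Q"
    have "f (s (x \<oplus>\<^bsub>Q\<^esub> y)) = f (s (p (s x \<oplus>\<^bsub>M\<^esub> s y)))" using s xy p by simp
    also have "\<dots> = f (s x) \<oplus>\<^bsub>N\<^esub> f (s y)" using g s xy f by simp
    finally show "f (s (x \<oplus>\<^bsub>Q\<^esub> y)) = f (s x) \<oplus>\<^bsub>N\<^esub> f (s y)" .
  next
    fix a x assume ax: "a \<in> carrier A" "x \<in> carrier Q"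
    have "f (s (a \<odot>\<^bsub>Q\<^esub> x)) = f (s (p (a \<odot>\<^bsub>M\<^esub> s x)))" using s ax p by simp
    also have "\<dots> = a \<odot>\<^bsub>N\<^esub> f (s x)" using g s ax f by simp
    finally show "f (s (a \<odot>\<^bsub>Q\<^esub> x)) = a \<odot>\<^bsub>N\<^esub> f (s x)" .
  qed (use s f assms(2) in auto)
  then show ?thesis using g p by (intro bexI[of _ "restrict (\<lambda>y. f (s y)) (carrier Q)"]) auto
qed

text \<open>Counterpart of \<open>hom_factor\<close> for a monomorphism \<open>i\<close>: the
  preimage of \<open>f x\<close> under \<open>i\<close> is unique, and uniqueness makes it additive
  and linear in \<open>x\<close>. A map that lands in the image of \<open>i\<close> thus becomes a
  map into \<open>N\<close> itself.\<close>

lemma hom_lift_inj: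
  assumes "left_module A M" "left_module A N" "left_module A Q"
    and "i \<in> mod_hom A N Q" "inj_on i (carrier N)" "f \<in> mod_hom A M Q" "f ` carrier M \<subseteq> i ` carrier N"
  shows "\<exists>g\<in>mod_hom A M N. \<forall>x\<in>carrier M. i (g x) = f x"
proof -
  interpret M: left_module A M by fact
  interpret N: left_module A N by fact
  note i = mod_homD[OF assms(4)] and f = mod_homD[OF assms(6)]
  define g where "g x = inv_into (carrier N) i (f x)" for x
  have g: "g x \<in> carrier N" "i (g x) = f x" if "x \<in> carrier M" for x
    using that assms(7) unfolding g_def by (auto intro!: inv_into_into f_inv_into_f)
  have "restrict g (carrier M) \<in> mod_hom A M N"
    by (rule mod_homI) (use g i f assms(1) in \<open>auto intro!: inj_onD[OF assms(5)]\<close>)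
  then show ?thesis using g by (intro bexI[of _ "restrict g (carrier M)"]) auto
qed

lemma mod_iso_iff_surj_inj:
  "mod_iso A M N \<longleftrightarrow> (\<exists>f\<in>mod_hom A M N. inj_on f (carrier M) \<and> f ` carrier M = carrier N)"
  unfolding mod_iso_def bij_betw_def by auto

text \<open>The inclusion of the first kernel in the second yields the map out of \<open>Q\<close>,
  the reverse inclusion its injectivity.\<close>

lemma mod_iso_from_common_cover:
  assumes "left_module A M" "left_module A Q" "left_module A N"
    and "p \<in> mod_hom A M Q" "p ` carrier M = carrier Q"
    and "f \<in> mod_hom A M N" "f ` carrier M = carrier N" "a_kernel M Q p = a_kernel M N f"
  shows "mod_iso A Q N"
proof -
  have ker: "p x = \<zero>\<^bsub>Q\<^esub> \<longleftrightarrow> f x = \<zero>\<^bsub>N\<^esub>" if "x \<in> carrier M" for x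
    using assms(8) that by (auto simp: a_kernel_eq set_eq_iff)
  obtain g where g: "g \<in> mod_hom A Q N" "\<forall>x\<in>carrier M. g (p x) = f x"
    using hom_factor[OF assms(1-6)] ker by blast
  have "inj_on g (carrier Q)"
    by (rule mod_hom_inj_onI[OF assms(2,3) g(1)]) (use g(2) ker assms(5) in force)
  moreover have "g ` carrier Q = carrier N"
    using g(2) unfolding assms(5)[symmetric] assms(7)[symmetric] image_image
    by (intro image_cong) auto
  ultimately show ?thesis using g(1) by (auto simp: mod_iso_iff_surj_inj)
qed

text \<open>\<open>M\<close> covers \<open>N\<close> by the isomorphism and itself by the identity.
  Both kernels are zero, and two covers with equal kernels give an isomorphism in either
  direction.\<close>

lemma mod_iso_sym:
  assumes "left_module A M" "left_module A N" "mod_iso A M N"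
  shows "mod_iso A N M"
proof -
  obtain f where f: "f \<in> mod_hom A M N" "inj_on f (carrier M)" "f ` carrier M = carrier N"
    using assms(3) by (auto simp: mod_iso_iff_surj_inj)
  interpret M: left_module A M by fact
  have "f x = \<zero>\<^bsub>N\<^esub> \<longleftrightarrow> x = \<zero>\<^bsub>M\<^esub>" if "x \<in> carrier M" for x
    using f(2) mod_hom_zero[OF assms(1,2) f(1)] that by (metis M.M.zero_closed inj_onD)
  then show ?thesis
    using mod_iso_from_common_cover[OF assms(1,2,1) f(1,3) mod_hom_id[OF assms(1)]]
    by (auto simp: a_kernel_eq cong: conj_cong)
qed

lemma mod_iso_trans:
  assumes "left_module A M" "mod_iso A M N" "mod_iso A N Q"
  shows "mod_iso A M Q"
proof -
  obtain f g where "f \<in> mod_hom A M N" "bij_betw f (carrier M) (carrier N)"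
    "g \<in> mod_hom A N Q" "bij_betw g (carrier N) (carrier Q)"
    using assms by (auto simp: mod_iso_def)
  then show ?thesis using mod_hom_comp[of f A M N g Q] assms(1) bij_betw_trans
    unfolding mod_iso_def by (intro bexI[of _ "compose (carrier M) g f"])
      (auto intro!: bij_betw_compose)
qed

lemma sum_submodule:
  assumes "left_module A M" "submodule U A M" "submodule V A M"
  shows "submodule (U <+>\<^bsub>M\<^esub> V) A M" "U \<subseteq> U <+>\<^bsub>M\<^esub> V" "V \<subseteq> U <+>\<^bsub>M\<^esub> V"
proof -
  interpret M: left_module A M by fact
  note U = submoduleD[OF assms(2)] and V = submoduleD[OF assms(3)]
  have mem: "z \<in> U <+>\<^bsub>M\<^esub> V \<longleftrightarrow> (\<exists>u\<in>U. \<exists>v\<in>V. z = u \<oplus>\<^bsub>M\<^esub> v)" for z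
    by (auto simp: set_add_def set_mult_def)
  have UV: "u \<in> carrier M" "v \<in> carrier M" if "u \<in> U" "v \<in> V" for u v using U V that by auto
  show "submodule (U <+>\<^bsub>M\<^esub> V) A M"
  proof (rule M.submodule_intro)
    fix x y assume "x \<in> U <+>\<^bsub>M\<^esub> V" "y \<in> U <+>\<^bsub>M\<^esub> V"
    then obtain u v u' v' where *: "u \<in> U" "v \<in> V" "x = u \<oplus>\<^bsub>M\<^esub> v" "u' \<in> U" "v' \<in> V"
      "y = u' \<oplus>\<^bsub>M\<^esub> v'"
      unfolding mem by blast
    then have "x \<oplus>\<^bsub>M\<^esub> y = (u \<oplus>\<^bsub>M\<^esub> u') \<oplus>\<^bsub>M\<^esub> (v \<oplus>\<^bsub>M\<^esub> v')" using UV by (simp add: M.M.a_ac)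
    then show "x \<oplus>\<^bsub>M\<^esub> y \<in> U <+>\<^bsub>M\<^esub> V" unfolding mem using U(3)[of u u'] V(3)[of v v'] * by blast
  next
    fix a x assume "a \<in> carrier A" "x \<in> U <+>\<^bsub>M\<^esub> V"
    then obtain u v where *: "u \<in> U" "v \<in> V" "x = u \<oplus>\<^bsub>M\<^esub> v" unfolding mem by blast
    then have "a \<odot>\<^bsub>M\<^esub> x = a \<odot>\<^bsub>M\<^esub> u \<oplus>\<^bsub>M\<^esub> a \<odot>\<^bsub>M\<^esub> v"
      using UV \<open>a \<in> carrier A\<close> by (simp add: M.smult_r_distr)
    then show "a \<odot>\<^bsub>M\<^esub> x \<in> U <+>\<^bsub>M\<^esub> V"
      unfolding mem using U(4)[of a u] V(4)[of a v] \<open>a \<in> carrier A\<close> * by blast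
  next
    show "U <+>\<^bsub>M\<^esub> V \<subseteq> carrier M" using mem UV by auto
    show "\<zero>\<^bsub>M\<^esub> \<in> U <+>\<^bsub>M\<^esub> V" unfolding mem using U(2) V(2) by force
  qed
  show "U \<subseteq> U <+>\<^bsub>M\<^esub> V" "V \<subseteq> U <+>\<^bsub>M\<^esub> V"
    unfolding subset_iff mem using U(1,2) V(1,2)
    by (metis M.M.r_zero subset_iff, metis M.M.l_zero subset_iff)
qed

section \<open>Quotients and products\<close>

lemma mod_quot_add: "x \<oplus>\<^bsub>mod_quot M N\<^esub> y = x <+>\<^bsub>M\<^esub> y"
  by (auto simp: mod_quot_def)

text \<open>Reduces the coset module to an epimorphism with prescribed kernel, the form in which
  \<open>hom_factor\<close> and its relatives take quotients.\<close>

lemma mod_quot_facts: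
  assumes "left_module A M" "submodule N A M"
  shows "left_module A (mod_quot M N)"
    and "(\<lambda>x\<in>carrier M. N +>\<^bsub>M\<^esub> x) \<in> mod_hom A M (mod_quot M N)"
    and "(\<lambda>x\<in>carrier M. N +>\<^bsub>M\<^esub> x) ` carrier M = carrier (mod_quot M N)"
    and "a_kernel M (mod_quot M N) (\<lambda>x\<in>carrier M. N +>\<^bsub>M\<^esub> x) = N"
    and "x \<in> carrier M \<Longrightarrow> (\<lambda>x\<in>carrier M. N +>\<^bsub>M\<^esub> x) x = \<zero>\<^bsub>mod_quot M N\<^esub> \<longleftrightarrow> x \<in> N"
proof -
  interpret M: left_module A M by fact
  note N = submoduleD[OF assms(2)]
  interpret sg: subgroup N "add_monoid M" using assms(2) by (simp add: submodule_def)
  interpret N: abelian_subgroup N M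
    by (rule abelian_subgroupI3) (auto simp: additive_subgroup_def sg.subgroup_axioms M.abelian_group_axioms)
  have eqi: "N +>\<^bsub>M\<^esub> x = N +>\<^bsub>M\<^esub> y \<longleftrightarrow> x \<ominus>\<^bsub>M\<^esub> y \<in> N" if "x \<in> carrier M" "y \<in> carrier M" for x y
    using that by (metis N.a_rcos_module N.a_rcos_self N.a_repr_independence' M.M.minus_eq)
  have car: "carrier (mod_quot M N) = (\<lambda>x. N +>\<^bsub>M\<^esub> x) ` carrier M"
    by (auto simp: mod_quot_def A_RCOSETS_def')
  have add: "(N +>\<^bsub>M\<^esub> x) \<oplus>\<^bsub>mod_quot M N\<^esub> (N +>\<^bsub>M\<^esub> y) = N +>\<^bsub>M\<^esub> (x \<oplus>\<^bsub>M\<^esub> y)"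
    if "x \<in> carrier M" "y \<in> carrier M" for x y
    unfolding mod_quot_add using N.a_rcos_sum[OF that] by assumption
  have zero: "\<zero>\<^bsub>mod_quot M N\<^esub> = N +>\<^bsub>M\<^esub> \<zero>\<^bsub>M\<^esub>"
    using N(1) by (simp add: mod_quot_def M.a_coset_add_zero)
  \<comment> \<open>The action on a coset is defined as a union over its representatives. It is a
    single coset because two representatives differ by an element of \<open>N\<close>, and so do
    their multiples.\<close>
  have smult: "a \<odot>\<^bsub>mod_quot M N\<^esub> (N +>\<^bsub>M\<^esub> x) = N +>\<^bsub>M\<^esub> (a \<odot>\<^bsub>M\<^esub> x)"
    if "a \<in> carrier A" "x \<in> carrier M" for a x
  proof -
    have "N +>\<^bsub>M\<^esub> (a \<odot>\<^bsub>M\<^esub> y) = N +>\<^bsub>M\<^esub> (a \<odot>\<^bsub>M\<^esub> x)" if "y \<in> N +>\<^bsub>M\<^esub> x" for y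
    proof -
      obtain z where z: "z \<in> N" "y = z \<oplus>\<^bsub>M\<^esub> x" using \<open>y \<in> _\<close> by (auto simp: a_r_coset_def')
      have "z \<in> carrier M" using z N by auto
      then have "a \<odot>\<^bsub>M\<^esub> y \<ominus>\<^bsub>M\<^esub> a \<odot>\<^bsub>M\<^esub> x = a \<odot>\<^bsub>M\<^esub> z"
        using z \<open>a \<in> _\<close> \<open>x \<in> _\<close> by (simp add: M.smult_r_distr a_minus_def M.M.a_assoc M.M.r_neg)
      then show ?thesis using z N \<open>z \<in> carrier M\<close> \<open>a \<in> _\<close> \<open>x \<in> _\<close> by (subst eqi) auto
    qed
    moreover have "x \<in> N +>\<^bsub>M\<^esub> x" using that by (simp add: N.a_rcos_self)
    ultimately have "(\<Union>y\<in>N +>\<^bsub>M\<^esub> x. N +>\<^bsub>M\<^esub> (a \<odot>\<^bsub>M\<^esub> y)) = N +>\<^bsub>M\<^esub> (a \<odot>\<^bsub>M\<^esub> x)" by blast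
    then show ?thesis by (simp add: mod_quot_def)
  qed
  have "abelian_group (mod_quot M N)"
  proof (rule abelian_groupI)
    fix C assume "C \<in> carrier (mod_quot M N)"
    then obtain x where x: "x \<in> carrier M" "C = N +>\<^bsub>M\<^esub> x" using car by auto
    then have "(N +>\<^bsub>M\<^esub> (\<ominus>\<^bsub>M\<^esub> x)) \<oplus>\<^bsub>mod_quot M N\<^esub> C = \<zero>\<^bsub>mod_quot M N\<^esub>"
      by (simp add: add zero M.M.l_neg)
    then show "\<exists>D\<in>carrier (mod_quot M N). D \<oplus>\<^bsub>mod_quot M N\<^esub> C = \<zero>\<^bsub>mod_quot M N\<^esub>"
      using x car by blast
  qed (auto simp: car add zero M.M.a_ac)
  then show lm: "left_module A (mod_quot M N)"
    by (intro left_module.intro left_module_axioms.intro M.A.ring_axioms)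
      (auto simp: car add smult M.smult_l_distr M.smult_r_distr M.smult_assoc1)
  show "(\<lambda>x\<in>carrier M. N +>\<^bsub>M\<^esub> x) \<in> mod_hom A M (mod_quot M N)"
    by (rule mod_homI) (auto simp: car add smult assms(1))
  show "(\<lambda>x\<in>carrier M. N +>\<^bsub>M\<^esub> x) ` carrier M = carrier (mod_quot M N)"
    using car by auto
  show ker: "a_kernel M (mod_quot M N) (\<lambda>x\<in>carrier M. N +>\<^bsub>M\<^esub> x) = N"
  proof -
    have "\<ominus>\<^bsub>M\<^esub> \<zero>\<^bsub>M\<^esub> = \<zero>\<^bsub>M\<^esub>"
      by (metis M.M.minus_equality M.M.l_zero M.M.zero_closed)
    then have "x \<ominus>\<^bsub>M\<^esub> \<zero>\<^bsub>M\<^esub> = x" if "x \<in> carrier M" for x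
      unfolding a_minus_def using that by simp
    then have "N +>\<^bsub>M\<^esub> x = N +>\<^bsub>M\<^esub> \<zero>\<^bsub>M\<^esub> \<longleftrightarrow> x \<in> N" if "x \<in> carrier M" for x
      using eqi[of x "\<zero>\<^bsub>M\<^esub>"] that by simp
    then show ?thesis unfolding a_kernel_eq zero using N(1) by (auto simp del: M.M.a_coset_add_zero)
  qed
  have "x \<in> N \<longleftrightarrow> x \<in> a_kernel M (mod_quot M N) (\<lambda>x\<in>carrier M. N +>\<^bsub>M\<^esub> x)"
    unfolding ker ..
  then show "x \<in> carrier M \<Longrightarrow> (\<lambda>x\<in>carrier M. N +>\<^bsub>M\<^esub> x) x = \<zero>\<^bsub>mod_quot M N\<^esub> \<longleftrightarrow> x \<in> N"
    unfolding a_kernel_eq by blast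
qed

lemma mod_quot_cong_iso:
  assumes "left_module A M" "left_module A Q" "p \<in> mod_hom A M Q" "p ` carrier M = carrier Q"
    "a_kernel M Q p = N"
  shows "mod_iso A (mod_quot M N) Q"
proof -
  have N: "submodule N A M" using submodule_kernel[OF assms(1-3)] assms(5) by simp
  note q = mod_quot_facts[OF assms(1) N]
  show ?thesis
    by (rule mod_iso_from_common_cover[OF assms(1) q(1) assms(2) q(2,3) assms(3,4)])
      (simp add: q(4) assms(5))
qed

text \<open>Converts a quotient given up to isomorphism, as in the definitions of standard modules
  and of filtrations, into an epimorphism from \<open>M\<close> with kernel exactly
  \<open>N\<close>.\<close>

lemma mod_iso_quot_hom:
  assumes "left_module A M" "submodule N A M" "mod_iso A (mod_quot M N) Q" "left_module A Q"
  shows "\<exists>p\<in>mod_hom A M Q. p ` carrier M = carrier Q \<and> a_kernel M Q p = N"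
proof -
  note q = mod_quot_facts[OF assms(1,2)]
  let ?q = "\<lambda>x\<in>carrier M. N +>\<^bsub>M\<^esub> x"
  obtain f where f: "f \<in> mod_hom A (mod_quot M N) Q" "inj_on f (carrier (mod_quot M N))"
    "f ` carrier (mod_quot M N) = carrier Q"
    using assms(3) by (auto simp: mod_iso_iff_surj_inj)
  have "f y = \<zero>\<^bsub>Q\<^esub> \<longleftrightarrow> y = \<zero>\<^bsub>mod_quot M N\<^esub>" if "y \<in> carrier (mod_quot M N)" for y
    using f(2) mod_hom_zero[OF q(1) assms(4) f(1)] that
    by (metis abelian_monoid.zero_closed abelian_group_def inj_onD left_module.axioms(2) q(1))
  then have "f (?q x) = \<zero>\<^bsub>Q\<^esub> \<longleftrightarrow> ?q x = \<zero>\<^bsub>mod_quot M N\<^esub>" if "x \<in> carrier M" for x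
    using mod_homD(1)[OF q(2) that] by blast
  then have "a_kernel M Q (compose (carrier M) f ?q) = a_kernel M (mod_quot M N) ?q"
    unfolding a_kernel_eq compose_def by (intro Collect_cong) auto
  then have "a_kernel M Q (compose (carrier M) f ?q) = N" by (simp only: q(4))
  moreover have "compose (carrier M) f ?q ` carrier M = carrier Q"
    using f(3) q(3) by (metis (no_types, lifting) image_cong image_image compose_eq)
  ultimately show ?thesis using mod_hom_comp[OF q(2) f(1) assms(1)] by blast
qed

lemma mod_prod_left_module:
  assumes "left_module A M" "left_module A N"
  shows "left_module A (mod_prod M N)"
proof -
  interpret M: left_module A M by fact
  interpret N: left_module A N by fact
  have "abelian_group (mod_prod M N)"
  proof (rule abelian_groupI)
    fix p assume "p \<in> carrier (mod_prod M N)"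
    then show "\<exists>q\<in>carrier (mod_prod M N). q \<oplus>\<^bsub>mod_prod M N\<^esub> p = \<zero>\<^bsub>mod_prod M N\<^esub>"
      by (intro bexI[of _ "(\<ominus>\<^bsub>M\<^esub> fst p, \<ominus>\<^bsub>N\<^esub> snd p)"]) (auto simp: mod_prod_def M.M.l_neg N.M.l_neg)
  qed (auto simp: mod_prod_def M.M.a_ac N.M.a_ac)
  then show ?thesis
    by (intro left_module.intro left_module_axioms.intro M.A.ring_axioms)
      (auto simp: mod_prod_def M.smult_l_distr M.smult_r_distr M.smult_assoc1
         N.smult_l_distr N.smult_r_distr N.smult_assoc1)
qed

lemma mod_prod_simps:
  "carrier (mod_prod M N) = carrier M \<times> carrier N"
  "\<zero>\<^bsub>mod_prod M N\<^esub> = (\<zero>\<^bsub>M\<^esub>, \<zero>\<^bsub>N\<^esub>)"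
  "p \<oplus>\<^bsub>mod_prod M N\<^esub> q = (fst p \<oplus>\<^bsub>M\<^esub> fst q, snd p \<oplus>\<^bsub>N\<^esub> snd q)"
  "a \<odot>\<^bsub>mod_prod M N\<^esub> p = (a \<odot>\<^bsub>M\<^esub> fst p, a \<odot>\<^bsub>N\<^esub> snd p)"
  by (auto simp: mod_prod_def split: prod.splits)

section \<open>Finitely generated modules\<close>

lemma fg_moduleD: "fg_module A M \<Longrightarrow> left_module A M"
  by (simp add: fg_module_def)

lemma fg_moduleE:
  assumes "fg_module A M"
  obtains S where "finite S" "S \<subseteq> carrier M" "\<And>U. submodule U A M \<Longrightarrow> S \<subseteq> U \<Longrightarrow> U = carrier M"
  using assms unfolding fg_module_def by meson

lemma fg_module_surj_image:
  assumes "fg_module A M" "left_module A N" "p \<in> mod_hom A M N" "p ` carrier M = carrier N"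
  shows "fg_module A N"
proof -
  have M: "left_module A M" using assms(1) by (rule fg_moduleD)
  obtain S where S: "finite S" "S \<subseteq> carrier M"
    and gen: "\<And>U. submodule U A M \<Longrightarrow> S \<subseteq> U \<Longrightarrow> U = carrier M"
    using assms(1) by (rule fg_moduleE) blast
  have "V = carrier N" if "submodule V A N" "p ` S \<subseteq> V" for V
  proof -
    have "{x \<in> carrier M. p x \<in> V} = carrier M"
      by (rule gen[OF submodule_vimage[OF M assms(2,3) that(1)]]) (use S(2) that(2) in auto)
    then have "carrier N \<subseteq> V" unfolding assms(4)[symmetric] by blast
    then show ?thesis using submoduleD(1)[OF that(1)] by blast
  qed
  then show ?thesis
    unfolding fg_module_def using assms(2-4) S mod_homD(1)[OF assms(3)]
    by (intro conjI exI[of _ "p ` S"]) auto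
qed

text \<open>Generators of the kernel together with lifts of generators of \<open>Q\<close> generate
  \<open>M\<close>: a submodule containing both contains the kernel and maps onto \<open>Q\<close>,
  so it contains every element after correction by the kernel.\<close>

lemma fg_module_extension:
  assumes "left_module A M" "left_module A Q" "p \<in> mod_hom A M Q" "p ` carrier M = carrier Q"
    "fg_module A Q" "fg_module A (M \<restriction> a_kernel M Q p)"
  shows "fg_module A M"
proof -
  let ?N = "a_kernel M Q p"
  interpret M: left_module A M by fact
  have N: "submodule ?N A M" by (rule submodule_kernel[OF assms(1-3)])
  obtain S where S: "finite S" "S \<subseteq> ?N"
    and genS: "\<And>U. submodule U A (M \<restriction> ?N) \<Longrightarrow> S \<subseteq> U \<Longrightarrow> U = ?N"
    using fg_moduleE[OF assms(6)] by auto
  obtain T where T: "finite T" "T \<subseteq> carrier Q"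
    and genT: "\<And>U. submodule U A Q \<Longrightarrow> T \<subseteq> U \<Longrightarrow> U = carrier Q"
    using assms(5) by (rule fg_moduleE) blast
  obtain T' where T': "finite T'" "T' \<subseteq> carrier M" "p ` T' = T"
    using T assms(4) by (metis finite_subset_image)
  have "U = carrier M" if U: "submodule U A M" "S \<union> T' \<subseteq> U" for U
  proof -
    have "U \<inter> ?N = ?N"
      by (rule genS) (use submodule_Int[OF assms(1) U(1) N] submodule_res_iff[OF assms(1) N] U S in auto)
    then have NU: "?N \<subseteq> U" by blast
    have pU: "p ` U = carrier Q"
      by (rule genT[OF submodule_image[OF assms(1-3) U(1)]]) (use T' U in auto)
    show ?thesis
    proof
      show "U \<subseteq> carrier M" using submoduleD(1)[OF U(1)] .
      show "carrier M \<subseteq> U"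
      proof
        fix x assume x: "x \<in> carrier M"
        then obtain u where u: "u \<in> U" "p x = p u" using pU assms(4) by (metis imageE imageI)
        have uM: "u \<in> carrier M" using u submoduleD(1)[OF U(1)] by auto
        then have "x \<ominus>\<^bsub>M\<^esub> u \<in> U" using mod_hom_eq_iff_diff[OF assms(1-3) x uM] u NU by auto
        then have "(x \<ominus>\<^bsub>M\<^esub> u) \<oplus>\<^bsub>M\<^esub> u \<in> U" using submoduleD(3)[OF U(1)] u by blast
        then show "x \<in> U" using x uM by (simp add: a_minus_def M.M.a_assoc M.M.l_neg)
      qed
    qed
  qed
  then show ?thesis
    unfolding fg_module_def using assms(1) S T' submoduleD(1)[OF N]
    by (intro conjI exI[of _ "S \<union> T'"]) auto
qed

lemma fg_module_prod:
  assumes "fg_module A M" "fg_module A N"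
  shows "fg_module A (mod_prod M N)"
proof -
  note M = fg_moduleD[OF assms(1)] and N = fg_moduleD[OF assms(2)]
  note MN = mod_prod_left_module[OF M N]
  interpret M: left_module A M by (rule M)
  interpret N: left_module A N by (rule N)
  let ?p = "\<lambda>q\<in>carrier (mod_prod M N). fst q"
  have p: "?p \<in> mod_hom A (mod_prod M N) M"
    by (rule mod_homI[OF _ _ _ MN]) (auto simp: mod_prod_simps)
  have s: "?p ` carrier (mod_prod M N) = carrier M"
    by (auto simp: mod_prod_simps intro!: image_eqI[of _ _ "(_, \<zero>\<^bsub>N\<^esub>)"])
  let ?K = "mod_prod M N \<restriction> a_kernel (mod_prod M N) M ?p"
  have K: "left_module A ?K"
    by (rule res_left_module[OF MN submodule_kernel[OF MN M p]])
  have i: "(\<lambda>y\<in>carrier N. (\<zero>\<^bsub>M\<^esub>, y)) \<in> mod_hom A N ?K"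
    by (rule mod_homI[OF _ _ _ N]) (auto simp: mod_prod_simps a_kernel_eq M.smult_zero_r)
  have "fg_module A ?K"
    by (rule fg_module_surj_image[OF assms(2) K i]) (auto simp: mod_prod_simps a_kernel_eq)
  then show ?thesis using fg_module_extension[OF MN M p s assms(1)] by simp
qed

section \<open>Finite length\<close>

text \<open>Modules carry an action of \<open>A\<close> alone, so a scalar acts on them through this
  element of \<open>A\<close>; its centrality is what makes scalar multiplication a
  homomorphism.\<close>

definition scal :: "('k, 'a) module \<Rightarrow> 'k \<Rightarrow> 'a" where
  "scal A c = c \<odot>\<^bsub>A\<^esub> \<one>\<^bsub>A\<^esub>"

locale fd_algebra_field = fd_algebra K A + field K for K :: "'k ring" (structure) and A :: "('k, 'a) module" (structure)
begin

lemma scal_closed [simp, intro]: "c \<in> carrier K \<Longrightarrow> scal A c \<in> carrier A"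
  by (simp add: scal_def)

lemma scal_simps:
  "scal A \<one>\<^bsub>K\<^esub> = \<one>\<^bsub>A\<^esub>" "scal A \<zero>\<^bsub>K\<^esub> = \<zero>\<^bsub>A\<^esub>"
  "\<lbrakk>c \<in> carrier K; d \<in> carrier K\<rbrakk> \<Longrightarrow> scal A (c \<oplus>\<^bsub>K\<^esub> d) = scal A c \<oplus>\<^bsub>A\<^esub> scal A d"
  "\<lbrakk>c \<in> carrier K; d \<in> carrier K\<rbrakk> \<Longrightarrow> scal A (c \<otimes>\<^bsub>K\<^esub> d) = scal A c \<otimes>\<^bsub>A\<^esub> scal A d"
  "c \<in> carrier K \<Longrightarrow> scal A (\<ominus>\<^bsub>K\<^esub> c) = \<ominus>\<^bsub>A\<^esub> scal A c"
  using smult_l_distr[of c d "\<one>\<^bsub>A\<^esub>"] smult_assoc1[of c d "\<one>\<^bsub>A\<^esub>"]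
    smult_mult_left[of c "\<one>\<^bsub>A\<^esub>" "d \<odot>\<^bsub>A\<^esub> \<one>\<^bsub>A\<^esub>"] smult_l_minus[of c "\<one>\<^bsub>A\<^esub>"]
  by (auto simp: scal_def)

lemma scal_mult: "c \<in> carrier K \<Longrightarrow> a \<in> carrier A \<Longrightarrow> scal A c \<otimes>\<^bsub>A\<^esub> a = c \<odot>\<^bsub>A\<^esub> a"
  by (simp add: scal_def smult_mult_left)

lemma scal_central: "c \<in> carrier K \<Longrightarrow> a \<in> carrier A \<Longrightarrow> scal A c \<otimes>\<^bsub>A\<^esub> a = a \<otimes>\<^bsub>A\<^esub> scal A c"
  by (simp add: scal_def smult_mult_left smult_mult_right)

lemma scal_commute:
  assumes "left_module A M" "x \<in> carrier M" "c \<in> carrier K" "a \<in> carrier A"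
  shows "scal A c \<odot>\<^bsub>M\<^esub> (a \<odot>\<^bsub>M\<^esub> x) = a \<odot>\<^bsub>M\<^esub> (scal A c \<odot>\<^bsub>M\<^esub> x)"
proof -
  interpret N: left_module A M by fact
  show ?thesis using assms by (simp add: scal_central flip: N.smult_assoc1)
qed

lemma scal_hom:
  assumes "left_module A M" "c \<in> carrier K"
  shows "(\<lambda>x\<in>carrier M. scal A c \<odot>\<^bsub>M\<^esub> x) \<in> mod_hom A M M"
proof -
  interpret N: left_module A M by fact
  show ?thesis
    by (rule mod_homI) (use assms in \<open>auto simp: N.smult_r_distr scal_commute[OF assms(1)]\<close>)
qed

lemma scal_mod:
  assumes "left_module A M" "x \<in> carrier M" "c \<in> carrier K" "d \<in> carrier K"
  shows "scal A (c \<oplus>\<^bsub>K\<^esub> d) \<odot>\<^bsub>M\<^esub> x = scal A c \<odot>\<^bsub>M\<^esub> x \<oplus>\<^bsub>M\<^esub> scal A d \<odot>\<^bsub>M\<^esub> x"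
    "scal A (c \<otimes>\<^bsub>K\<^esub> d) \<odot>\<^bsub>M\<^esub> x = scal A c \<odot>\<^bsub>M\<^esub> (scal A d \<odot>\<^bsub>M\<^esub> x)"
    "scal A (\<ominus>\<^bsub>K\<^esub> c) \<odot>\<^bsub>M\<^esub> x = \<ominus>\<^bsub>M\<^esub> (scal A c \<odot>\<^bsub>M\<^esub> x)"
    "scal A \<one>\<^bsub>K\<^esub> \<odot>\<^bsub>M\<^esub> x = x"
      "scal A \<zero>\<^bsub>K\<^esub> \<odot>\<^bsub>M\<^esub> x = \<zero>\<^bsub>M\<^esub>"
proof -
  interpret M: left_module A M by fact
  show 0: "scal A \<one>\<^bsub>K\<^esub> \<odot>\<^bsub>M\<^esub> x = x"
    "scal A \<zero>\<^bsub>K\<^esub> \<odot>\<^bsub>M\<^esub> x = \<zero>\<^bsub>M\<^esub>"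
    using assms by (auto simp: scal_simps M.smult_zero_l)
  show "scal A (c \<oplus>\<^bsub>K\<^esub> d) \<odot>\<^bsub>M\<^esub> x = scal A c \<odot>\<^bsub>M\<^esub> x \<oplus>\<^bsub>M\<^esub> scal A d \<odot>\<^bsub>M\<^esub> x"
    using assms by (simp add: scal_simps M.smult_l_distr)
  show "scal A (c \<otimes>\<^bsub>K\<^esub> d) \<odot>\<^bsub>M\<^esub> x = scal A c \<odot>\<^bsub>M\<^esub> (scal A d \<odot>\<^bsub>M\<^esub> x)"
    using assms by (simp add: scal_simps M.smult_assoc1)
  have "scal A (\<ominus>\<^bsub>K\<^esub> c) \<odot>\<^bsub>M\<^esub> x \<oplus>\<^bsub>M\<^esub> scal A c \<odot>\<^bsub>M\<^esub> x = scal A (\<ominus>\<^bsub>K\<^esub> c \<oplus>\<^bsub>K\<^esub> c) \<odot>\<^bsub>M\<^esub> x"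
    using assms by (simp add: scal_simps M.smult_l_distr)
  also have "\<dots> = \<zero>\<^bsub>M\<^esub>" using assms 0 by (simp add: R.l_neg)
  finally show "scal A (\<ominus>\<^bsub>K\<^esub> c) \<odot>\<^bsub>M\<^esub> x = \<ominus>\<^bsub>M\<^esub> (scal A c \<odot>\<^bsub>M\<^esub> x)"
    using assms by (metis M.M.minus_equality M.smult_closed R.a_inv_closed scal_closed)
qed

section \<open>Subspaces over \<open>K\<close>, spans and rank\<close>

definition ksubspace :: "('a, 'm) module \<Rightarrow> 'm set \<Rightarrow> bool" where
  "ksubspace M V \<longleftrightarrow> V \<subseteq> carrier M \<and> \<zero>\<^bsub>M\<^esub> \<in> V \<and> (\<forall>x\<in>V. \<forall>y\<in>V. x \<oplus>\<^bsub>M\<^esub> y \<in> V) \<and>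
    (\<forall>c\<in>carrier K. \<forall>x\<in>V. scal A c \<odot>\<^bsub>M\<^esub> x \<in> V)"

lemma ksubspaceD:
  assumes "ksubspace M V"
  shows "x \<in> V \<Longrightarrow> x \<in> carrier M" "\<zero>\<^bsub>M\<^esub> \<in> V"
    "\<lbrakk>x \<in> V; y \<in> V\<rbrakk> \<Longrightarrow> x \<oplus>\<^bsub>M\<^esub> y \<in> V"
    "\<lbrakk>c \<in> carrier K; x \<in> V\<rbrakk> \<Longrightarrow> scal A c \<odot>\<^bsub>M\<^esub> x \<in> V"
  using assms by (auto simp: ksubspace_def)

lemma submodule_ksubspace: "submodule V A M \<Longrightarrow> ksubspace M V"
  using submoduleD[of V A M] by (auto simp: ksubspace_def)

text \<open>Recursion on a list, in place of linear combinations over a set, because the spans of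
  the final segments form a flag. The rank \<open>klead\<close> is read off from this flag, and
  \<open>kspan_pev\<close> reads off polynomials when the list consists of powers.\<close>

fun kspan :: "('a, 'm) module \<Rightarrow> 'm list \<Rightarrow> 'm set" where
  "kspan M [] = {\<zero>\<^bsub>M\<^esub>}"
| "kspan M (b # bs) = {v \<oplus>\<^bsub>M\<^esub> scal A c \<odot>\<^bsub>M\<^esub> b | v c. v \<in> kspan M bs \<and> c \<in> carrier K}"

lemma kspan_ksubspace:
  assumes "left_module A M" "set bs \<subseteq> carrier M"
  shows "ksubspace M (kspan M bs)"
  using assms(2)
proof (induction bs)
  interpret M: left_module A M by fact
  case Nil
  then show ?case by (simp add: ksubspace_def M.smult_zero_r)
next
  interpret M: left_module A M by fact
  case (Cons b bs)
  then have b: "b \<in> carrier M" and IH: "ksubspace M (kspan M bs)" by auto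
  note V = ksubspaceD[OF IH]
  show ?case unfolding ksubspace_def
  proof (intro conjI ballI)
    show "kspan M (b # bs) \<subseteq> carrier M" using V(1) b by auto
    have "\<zero>\<^bsub>M\<^esub> = \<zero>\<^bsub>M\<^esub> \<oplus>\<^bsub>M\<^esub> scal A \<zero>\<^bsub>K\<^esub> \<odot>\<^bsub>M\<^esub> b" using b by (simp add: scal_simps M.smult_zero_l)
    then show "\<zero>\<^bsub>M\<^esub> \<in> kspan M (b # bs)" using V(2) by auto
  next
    fix x y assume "x \<in> kspan M (b # bs)" "y \<in> kspan M (b # bs)"
    then obtain v c w d where *: "v \<in> kspan M bs" "c \<in> carrier K"
      "x = v \<oplus>\<^bsub>M\<^esub> scal A c \<odot>\<^bsub>M\<^esub> b"
      "w \<in> kspan M bs" "d \<in> carrier K" "y = w \<oplus>\<^bsub>M\<^esub> scal A d \<odot>\<^bsub>M\<^esub> b" by auto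
    then have "x \<oplus>\<^bsub>M\<^esub> y = (v \<oplus>\<^bsub>M\<^esub> w) \<oplus>\<^bsub>M\<^esub> scal A (c \<oplus>\<^bsub>K\<^esub> d) \<odot>\<^bsub>M\<^esub> b"
      using b V(1) by (simp add: scal_mod[OF assms(1)] M.M.a_ac)
    then show "x \<oplus>\<^bsub>M\<^esub> y \<in> kspan M (b # bs)" using V(3)[OF *(1,4)] *(2,5) by auto
  next
    fix c x assume c: "c \<in> carrier K" and "x \<in> kspan M (b # bs)"
    then obtain v d where *: "v \<in> kspan M bs" "d \<in> carrier K"
      "x = v \<oplus>\<^bsub>M\<^esub> scal A d \<odot>\<^bsub>M\<^esub> b" by auto
    then have "scal A c \<odot>\<^bsub>M\<^esub> x = scal A c \<odot>\<^bsub>M\<^esub> v \<oplus>\<^bsub>M\<^esub> scal A (c \<otimes>\<^bsub>K\<^esub> d) \<odot>\<^bsub>M\<^esub> b"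
      using b c V(1) by (simp add: scal_mod[OF assms(1)] M.smult_r_distr)
    then show "scal A c \<odot>\<^bsub>M\<^esub> x \<in> kspan M (b # bs)" using V(4)[OF c *(1)] c *(2) by auto
  qed
qed

lemma kspan_mono_Cons:
  assumes "left_module A M" "set (b # bs) \<subseteq> carrier M"
  shows "kspan M bs \<subseteq> kspan M (b # bs)"
proof
  interpret M: left_module A M by fact
  fix v assume v: "v \<in> kspan M bs"
  then have "v \<in> carrier M" using ksubspaceD(1)[OF kspan_ksubspace[OF assms(1)]] assms(2) by auto
  then have "v = v \<oplus>\<^bsub>M\<^esub> scal A \<zero>\<^bsub>K\<^esub> \<odot>\<^bsub>M\<^esub> b" using assms(2)
    by (simp add: scal_simps M.smult_zero_l)
  then show "v \<in> kspan M (b # bs)" using v by auto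
qed

lemma kspan_hd:
  assumes "left_module A M" "set (b # bs) \<subseteq> carrier M"
  shows "b \<in> kspan M (b # bs)"
proof -
  interpret M: left_module A M by fact
  have "\<zero>\<^bsub>M\<^esub> \<in> kspan M bs" using ksubspaceD(2)[OF kspan_ksubspace[OF assms(1)]] assms(2) by auto
  moreover have "b = \<zero>\<^bsub>M\<^esub> \<oplus>\<^bsub>M\<^esub> scal A \<one>\<^bsub>K\<^esub> \<odot>\<^bsub>M\<^esub> b"
    using assms(2) by (simp add: scal_simps)
  ultimately show ?thesis by auto
qed

lemma kspan_mem:
  assumes "left_module A M" "set bs \<subseteq> carrier M" "b \<in> set bs"
  shows "b \<in> kspan M bs"
  using assms(2,3)
proof (induction bs)
  case (Cons a bs)
  then show ?case
    using kspan_mono_Cons[OF assms(1) Cons.prems(1)] kspan_hd[OF assms(1) Cons.prems(1)] by auto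
qed simp

text \<open>The products of a spanning family of \<open>A\<close> with generators of
  \<open>M\<close> span \<open>M\<close> over \<open>K\<close>.\<close>

lemma fg_kspan:
  assumes "fg_module A M"
  shows "\<exists>bs. set bs \<subseteq> carrier M \<and> kspan M bs = carrier M"
proof -
  have lM: "left_module A M" using assms by (rule fg_moduleD)
  interpret M: left_module A M by (rule lM)
  obtain S where S: "finite S" "S \<subseteq> carrier M"
    and gen: "\<And>U. submodule U A M \<Longrightarrow> S \<subseteq> U \<Longrightarrow> U = carrier M"
    using assms by (rule fg_moduleE) blast
  obtain B where B: "finite B" "B \<subseteq> carrier A"
    and span: "\<And>x. x \<in> carrier A \<Longrightarrow> \<exists>c\<in>B \<rightarrow> carrier K. x = (\<Oplus>\<^bsub>A\<^esub>b\<in>B. c b \<odot>\<^bsub>A\<^esub> b)"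
    using finite_dim by blast
  obtain bs where bs: "set bs = (\<lambda>(b, s). b \<odot>\<^bsub>M\<^esub> s) ` (B \<times> S)"
    using finite_list[of "(\<lambda>(b, s). b \<odot>\<^bsub>M\<^esub> s) ` (B \<times> S)"] B S by auto
  have bsM: "set bs \<subseteq> carrier M" unfolding bs using B(2) S(2) by (auto intro!: M.smult_closed)
  let ?W = "kspan M bs"
  note W = ksubspaceD[OF kspan_ksubspace[OF lM bsM]]
  have aS: "a \<odot>\<^bsub>M\<^esub> s \<in> ?W" if as: "a \<in> carrier A" "s \<in> S" for a s
  proof -
    have s: "s \<in> carrier M" using as S(2) by auto
    obtain c where c: "c \<in> B \<rightarrow> carrier K" "a = (\<Oplus>\<^bsub>A\<^esub>b\<in>B. c b \<odot>\<^bsub>A\<^esub> b)"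
      using span[OF as(1)] by blast
    have "T \<subseteq> B \<Longrightarrow> (\<Oplus>\<^bsub>A\<^esub>b\<in>T. c b \<odot>\<^bsub>A\<^esub> b) \<odot>\<^bsub>M\<^esub> s \<in> ?W" if "finite T" for T using that
    proof (induction T rule: finite_induct)
      case empty
      then show ?case using s W(2) by (simp add: M.smult_zero_l)
    next
      case (insert t T)
      have t: "t \<in> carrier A" "c t \<in> carrier K" "t \<in> B" using insert.prems B(2) c(1) by auto
      have cT: "(\<lambda>b. c b \<odot>\<^bsub>A\<^esub> b) \<in> T \<rightarrow> carrier A" using insert.prems B(2) c(1)
        by (auto intro!: smult_closed)
      have "(\<Oplus>\<^bsub>A\<^esub>b\<in>insert t T. c b \<odot>\<^bsub>A\<^esub> b) = scal A (c t) \<otimes>\<^bsub>A\<^esub> t \<oplus>\<^bsub>A\<^esub> (\<Oplus>\<^bsub>A\<^esub>b\<in>T. c b \<odot>\<^bsub>A\<^esub> b)"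
        using insert.hyps t cT by (simp add: scal_mult)
      moreover have "t \<odot>\<^bsub>M\<^esub> s \<in> ?W"
        using kspan_mem[OF lM bsM] bs t(3) \<open>s \<in> S\<close> by auto
      moreover have "(\<Oplus>\<^bsub>A\<^esub>b\<in>T. c b \<odot>\<^bsub>A\<^esub> b) \<in> carrier A" using cT
        by (rule abelian_monoid.finsum_closed[OF abelian_group.axioms(1)[OF ring.is_abelian_group[OF left_module.axioms(1)[OF lM]]]])
      ultimately show ?case
        using s t insert W(3,4) by (simp add: M.smult_l_distr M.smult_assoc1)
    qed
    then show ?thesis using B(1) c(2) by auto
  qed
  \<comment> \<open>A priori \<open>?W\<close> is only a subspace. The elements all of whose
    \<open>A\<close>-multiples lie in it form a submodule containing \<open>S\<close>, hence
    everything, and the multiple by 1 puts each element itself into \<open>?W\<close>.\<close>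
  have "{x \<in> carrier M. \<forall>a\<in>carrier A. a \<odot>\<^bsub>M\<^esub> x \<in> ?W} = carrier M"
  proof (rule gen)
    show "submodule {x \<in> carrier M. \<forall>a\<in>carrier A. a \<odot>\<^bsub>M\<^esub> x \<in> ?W} A M"
      by (rule M.submodule_intro)
        (use W in \<open>auto simp: M.smult_zero_r M.smult_r_distr simp flip: M.smult_assoc1\<close>)
    show "S \<subseteq> {x \<in> carrier M. \<forall>a\<in>carrier A. a \<odot>\<^bsub>M\<^esub> x \<in> ?W}" using aS S(2) by auto
  qed
  then have "x \<in> ?W" if "x \<in> carrier M" for x
    using that M.smult_one[OF that] monoid.one_closed[OF ring.is_monoid[OF left_module.axioms(1)[OF lM]]]
    by (metis (mono_tags, lifting) mem_Collect_eq)
  then have "?W = carrier M" using W(1) by auto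
  then show ?thesis using bsM by auto
qed

text \<open>The number of leading positions of \<open>U\<close> relative to the flag of spans of final segments of the
  list, that is, the rank of an echelon form.\<close>

fun klead :: "('a, 'm) module \<Rightarrow> 'm list \<Rightarrow> 'm set \<Rightarrow> nat" where
  "klead M [] U = 0"
| "klead M (b # bs) U = klead M bs U + (if U \<inter> kspan M (b # bs) \<subseteq> kspan M bs then 0 else 1)"

lemma klead_le: "klead M bs U \<le> length bs"
  by (induction bs) auto

lemma klead_mono:
  assumes "left_module A M" "set bs \<subseteq> carrier M" "U \<subseteq> V"
  shows "klead M bs U \<le> klead M bs V"
  using assms(2)
proof (induction bs)
  case (Cons b bs)
  have "V \<inter> kspan M (b # bs) \<subseteq> kspan M bs \<Longrightarrow> U \<inter> kspan M (b # bs) \<subseteq> kspan M bs"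
    using assms(3) by blast
  then show ?case using Cons by (auto simp del: kspan.simps)
qed simp

text \<open>Echelon elimination. Every leading position of \<open>U\<close> is one of
  \<open>V\<close>, so equal ranks force the same leading positions. A vector of \<open>V\<close>
  can then be reduced by a vector of \<open>U\<close> with the same leading position, and the
  difference lies in a shorter span.\<close>

lemma klead_eq:
  assumes "left_module A M" "set bs \<subseteq> carrier M" "ksubspace M U" "ksubspace M V" "U \<subseteq> V"
    "klead M bs U = klead M bs V"
  shows "U \<inter> kspan M bs = V \<inter> kspan M bs"
  using assms(2,6)
proof (induction bs)
  case Nil
  then show ?case using assms(3,4) by (auto simp: ksubspace_def)
next
  interpret M: left_module A M by fact
  case (Cons b bs)
  have b: "b \<in> carrier M" "set bs \<subseteq> carrier M" using Cons.prems by auto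
  note U = ksubspaceD[OF assms(3)] and V = ksubspaceD[OF assms(4)]
    and W = ksubspaceD[OF kspan_ksubspace[OF assms(1) b(2)]]
    and W' = ksubspaceD[OF kspan_ksubspace[OF assms(1) Cons.prems(1)]]
  let ?P = "\<lambda>U. U \<inter> kspan M (b # bs) \<subseteq> kspan M bs"
  have imp: "?P V \<Longrightarrow> ?P U" using assms(5) by blast
  \<comment> \<open>Both summands of \<open>klead\<close> grow with the subspace, so equal totals
    force equality at the head and in the tail separately.\<close>
  have eq: "klead M bs U = klead M bs V" "?P U \<longleftrightarrow> ?P V"
    using Cons.prems(2) klead_mono[OF assms(1) b(2) assms(5)] imp
    by (auto simp del: kspan.simps split: if_splits)
  have IH: "U \<inter> kspan M bs = V \<inter> kspan M bs" using Cons.IH b(2) eq(1) by blast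
  have "w \<in> U" if w: "w \<in> V" "w \<in> kspan M (b # bs)" for w
  proof (cases "?P V")
    case True
    then show ?thesis using w IH by blast
  next
    case False
    then obtain u where u: "u \<in> U" "u \<in> kspan M (b # bs)" "u \<notin> kspan M bs" using eq(2) by blast
    obtain v d where v: "v \<in> kspan M bs" "d \<in> carrier K" "u = v \<oplus>\<^bsub>M\<^esub> scal A d \<odot>\<^bsub>M\<^esub> b"
      using u(2) by auto
    obtain v' e where v': "v' \<in> kspan M bs" "e \<in> carrier K"
      "w = v' \<oplus>\<^bsub>M\<^esub> scal A e \<odot>\<^bsub>M\<^esub> b" using w(2) by auto
    have "d \<noteq> \<zero>\<^bsub>K\<^esub>" using u(3) v b W(1) by (auto simp: scal_simps M.smult_zero_l)
    then have d: "d \<in> Units K" using v(2) field_Units by auto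
    \<comment> \<open>The multiple of \<open>u\<close> by \<open>c\<close> has the same coefficient
      \<open>e\<close> at \<open>b\<close> as \<open>w\<close>. The coefficient \<open>d\<close> of
      \<open>u\<close> is invertible since \<open>u\<close> lies outside the span of
      \<open>bs\<close>.\<close>
    define c where "c = e \<otimes>\<^bsub>K\<^esub> inv\<^bsub>K\<^esub> d"
    have c: "c \<in> carrier K" "c \<otimes>\<^bsub>K\<^esub> d = e" using d v'(2) v(2) by (auto simp: c_def R.m_assoc)
    have uw: "u \<in> carrier M" "w \<in> carrier M" "v \<in> carrier M" "v' \<in> carrier M"
      using u w U(1) V(1) W(1) v v' by auto
    define cu where "cu = scal A c \<odot>\<^bsub>M\<^esub> u"
    have cu: "cu = scal A c \<odot>\<^bsub>M\<^esub> v \<oplus>\<^bsub>M\<^esub> scal A e \<odot>\<^bsub>M\<^esub> b"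
      using v c uw b by (simp add: cu_def M.smult_r_distr flip: scal_mod(2)[OF assms(1)])
    have cuM: "cu \<in> carrier M" "cu \<in> U" using uw c U(4) u by (auto simp: cu_def)
    have "\<ominus>\<^bsub>M\<^esub> cu = scal A (\<ominus>\<^bsub>K\<^esub> \<one>\<^bsub>K\<^esub>) \<odot>\<^bsub>M\<^esub> cu"
      using cuM by (simp add: scal_mod[OF assms(1), of _ "\<one>\<^bsub>K\<^esub>" "\<one>\<^bsub>K\<^esub>"])
    then have mcu: "\<ominus>\<^bsub>M\<^esub> cu \<in> V" using V(4)[of "\<ominus>\<^bsub>K\<^esub> \<one>\<^bsub>K\<^esub>" cu] cuM assms(5) by auto
    have "w \<oplus>\<^bsub>M\<^esub> \<ominus>\<^bsub>M\<^esub> cu = v' \<oplus>\<^bsub>M\<^esub> (scal A (\<ominus>\<^bsub>K\<^esub> c) \<odot>\<^bsub>M\<^esub> v)"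
    proof -
      have "w = (v' \<oplus>\<^bsub>M\<^esub> (scal A (\<ominus>\<^bsub>K\<^esub> c) \<odot>\<^bsub>M\<^esub> v)) \<oplus>\<^bsub>M\<^esub> cu"
        unfolding cu v'(3) using uw c v'(2) b
        by (simp add: scal_mod(3)[OF assms(1) _ c(1) c(1)] M.M.a_assoc M.M.r_neg1)
      then show ?thesis using uw c cuM by (simp add: M.M.a_assoc M.M.r_neg)
    qed
    then have "w \<oplus>\<^bsub>M\<^esub> \<ominus>\<^bsub>M\<^esub> cu \<in> kspan M bs" using W(3,4) v(1) v'(1) c(1) by auto
    then have "w \<oplus>\<^bsub>M\<^esub> \<ominus>\<^bsub>M\<^esub> cu \<in> U" using IH V(3)[OF w(1) mcu] by blast
    then have "(w \<oplus>\<^bsub>M\<^esub> \<ominus>\<^bsub>M\<^esub> cu) \<oplus>\<^bsub>M\<^esub> cu \<in> U" using U(3) cuM by blast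
    then show "w \<in> U" using uw cuM by (simp add: M.M.a_assoc M.M.l_neg)
  qed
  then show ?case using assms(5) by blast
qed

text \<open>The statement keeps of dimension just a bounded rank that grows strictly along
  inclusions. It drives the existence of maximal and minimal submodules, of chains with simple
  factors, and of polynomial relations for endomorphisms.\<close>

lemma fg_length:
  assumes "fg_module A M"
  obtains l :: "'m set \<Rightarrow> nat" where "\<And>U V. \<lbrakk>ksubspace M U; ksubspace M V; U \<subset> V\<rbrakk> \<Longrightarrow> l U < l V"
    and "bdd_above (range l)"
proof -
  note M = fg_moduleD[OF assms]
  obtain bs where bs: "set bs \<subseteq> carrier M" "kspan M bs = carrier M" using fg_kspan[OF assms] by blast
  show thesis
  proof (rule that)
    show "bdd_above (range (klead M bs))" using klead_le by (auto simp: bdd_above_def)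
    fix U V assume *: "ksubspace M U" "ksubspace M V" "U \<subset> V"
    have "klead M bs U \<noteq> klead M bs V"
      using klead_eq[OF M bs(1) *(1,2)] * bs(2) ksubspaceD(1)[OF *(1)] ksubspaceD(1)[OF *(2)] by blast
    then show "klead M bs U < klead M bs V" using klead_mono[OF M bs(1), of U V] * by auto
  qed
qed

lemma fg_maximal:
  assumes "fg_module A M" "\<And>U. Q U \<Longrightarrow> submodule U A M" "Q U"
  obtains W where "Q W" "\<And>V. Q V \<Longrightarrow> W \<subseteq> V \<Longrightarrow> V = W"
proof -
  obtain l :: "'b set \<Rightarrow> nat" where l: "\<And>U V. \<lbrakk>ksubspace M U; ksubspace M V; U \<subset> V\<rbrakk> \<Longrightarrow> l U < l V"
    "bdd_above (range l)" using fg_length[OF assms(1)] by metis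
  obtain k where "\<And>U. l U \<le> k" using l(2) by (auto simp: bdd_above_def)
  then obtain W where W: "Q W" "\<And>V. Q V \<Longrightarrow> l V \<le> l W"
    using arg_max_nat_lemma[of Q U l "Suc k"] assms(3) by (metis le_imp_less_Suc)
  have "V = W" if "Q V" "W \<subseteq> V" for V
    using l(1)[of W V] submodule_ksubspace assms(2) W(1) W(2)[OF that(1)] that by (metis leD psubsetI)
  then show thesis using that W(1) by blast
qed

lemma fg_minimal:
  assumes "fg_module A M" "\<And>U. Q U \<Longrightarrow> submodule U A M" "Q U"
  obtains W where "Q W" "\<And>V. Q V \<Longrightarrow> V \<subseteq> W \<Longrightarrow> V = W"
proof -
  obtain l :: "'b set \<Rightarrow> nat" where l: "\<And>U V. \<lbrakk>ksubspace M U; ksubspace M V; U \<subset> V\<rbrakk> \<Longrightarrow> l U < l V"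
    using fg_length[OF assms(1)] by metis
  obtain W where W: "Q W" "\<And>V. Q V \<Longrightarrow> l W \<le> l V"
    using ex_has_least_nat[of Q U l] assms(3) by metis
  have "V = W" if "Q V" "V \<subseteq> W" for V
    using l(1)[of V W] submodule_ksubspace assms(2) W(1) W(2)[OF that(1)] that by (metis leD psubsetI)
  then show thesis using that W(1) by blast
qed

text \<open>Noetherian argument: among the submodules generated by finite subsets of
  \<open>U\<close> there is a maximal one, and adjoining a further element of \<open>U\<close>
  cannot enlarge it, so it is \<open>U\<close>.\<close>

lemma fg_module_res:
  assumes "fg_module A M" "submodule U A M"
  shows "fg_module A (M \<restriction> U)"
proof -
  have M: "left_module A M" by (rule fg_moduleD[OF assms(1)])
  note resU = submodule_res_iff[OF M assms(2)]
  define gen where "gen S = \<Inter>{N. submodule N A M \<and> S \<subseteq> N}" for S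
  have sub: "submodule (gen S) A M" if "S \<subseteq> U" for S
    unfolding gen_def using assms(2) that by (intro submodule_Inter[OF M]) auto
  define Q where "Q W \<longleftrightarrow> (\<exists>S. finite S \<and> S \<subseteq> U \<and> W = gen S)" for W
  have Q: "Q (gen {})" "\<And>W. Q W \<Longrightarrow> submodule W A M" unfolding Q_def using sub by auto
  obtain W where W: "Q W" "\<And>V. Q V \<Longrightarrow> W \<subseteq> V \<Longrightarrow> V = W"
    using fg_maximal[where Q = Q, OF assms(1) Q(2,1)] by blast
  then obtain S where S: "finite S" "S \<subseteq> U" "W = gen S" unfolding Q_def by blast
  have "U \<subseteq> gen S"
  proof
    fix x assume x: "x \<in> U"
    have "gen S \<subseteq> gen (insert x S)" by (auto simp: gen_def)
    moreover have "Q (gen (insert x S))" unfolding Q_def using S x by blast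
    ultimately have "gen (insert x S) = gen S" using W(2)[of "gen (insert x S)"] S(3) by simp
    moreover have "x \<in> gen (insert x S)" by (auto simp: gen_def)
    ultimately show "x \<in> gen S" by simp
  qed
  then have "N = U" if "submodule N A (M \<restriction> U)" "S \<subseteq> N" for N
    using that unfolding resU gen_def by auto
  then show ?thesis unfolding fg_module_def using res_left_module[OF M assms(2)] S
    by (intro conjI exI[of _ S]) auto
qed

end

section \<open>Subquotients\<close>

text \<open>For finitely generated \<open>M\<close> and simple \<open>S\<close> this says that
  \<open>S\<close> is a composition factor, but it involves no choice of a series, which makes the
  closure properties below direct.\<close>

definition subquot :: "('a, 'r) ring_scheme \<Rightarrow> ('a, 'm) module \<Rightarrow> ('a, 'l) module \<Rightarrow> bool" where
  "subquot A M S \<longleftrightarrow> (\<exists>U. submodule U A M \<and> (\<exists>p\<in>mod_hom A (M \<restriction> U) S. p ` U = carrier S))"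

lemma subquotI:
  "submodule U A M \<Longrightarrow> p \<in> mod_hom A (M \<restriction> U) S \<Longrightarrow> p ` U = carrier S \<Longrightarrow> subquot A M S"
  by (auto simp: subquot_def)

lemma subquot_res:
  assumes "left_module A M" "submodule N A M" "subquot A (M \<restriction> N) S"
  shows "subquot A M S"
  using assms(3) unfolding subquot_def by (auto simp: submodule_res_iff[OF assms(1,2)])

lemma subquot_surj:
  assumes "left_module A M" "left_module A Q" "q \<in> mod_hom A M Q" "q ` carrier M = carrier Q"
    "subquot A Q S"
  shows "subquot A M S"
proof -
  obtain U p where U: "submodule U A Q" "p \<in> mod_hom A (Q \<restriction> U) S" "p ` U = carrier S"
    using assms(5) by (auto simp: subquot_def)
  let ?V = "{x \<in> carrier M. q x \<in> U}"
  have V: "submodule ?V A M" by (rule submodule_vimage[OF assms(1-3) U(1)])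
  have qV: "q ` ?V = U" using submoduleD(1)[OF U(1)] unfolding assms(4)[symmetric] by auto
  have "restrict q ?V \<in> mod_hom A (M \<restriction> ?V) Q" by (rule mod_hom_res[OF assms(3) V assms(1)])
  then have "restrict q ?V \<in> mod_hom A (M \<restriction> ?V) (Q \<restriction> U)"
    by (rule mod_hom_corestrict) auto
  then have "compose ?V p (restrict q ?V) \<in> mod_hom A (M \<restriction> ?V) S"
    using mod_hom_comp[OF _ U(2) res_left_module[OF assms(1) V]] by simp
  moreover have "compose ?V p (restrict q ?V) ` ?V = carrier S"
    unfolding U(3)[symmetric] by (subst qV[symmetric]) (auto simp: compose_def image_image)
  ultimately show ?thesis using V by (auto simp: subquot_def)
qed

lemma subquot_image:
  assumes "left_module A M" "left_module A N" "f \<in> mod_hom A M N" "subquot A (N \<restriction> (f ` carrier M)) S"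
  shows "subquot A M S"
  using subquot_surj[OF assms(1) _ mod_hom_corestrict[OF assms(3)] _ assms(4)]
    res_left_module[OF assms(2) submodule_image[OF assms(1-3) submodule_carrier[OF assms(1)]]] by auto

lemma subquot_inj:
  assumes "left_module A M" "left_module A N" "i \<in> mod_hom A M N" "inj_on i (carrier M)"
    "subquot A M S"
  shows "subquot A N S"
proof -
  have im: "submodule (i ` carrier M) A N"
    by (rule submodule_image[OF assms(1-3) submodule_carrier[OF assms(1)]])
  have res: "left_module A (N \<restriction> (i ` carrier M))" by (rule res_left_module[OF assms(2) im])
  have "mod_iso A M (N \<restriction> (i ` carrier M))"
    unfolding mod_iso_iff_surj_inj using mod_hom_corestrict[OF assms(3)] assms(4) by auto
  then obtain g where g: "g \<in> mod_hom A (N \<restriction> (i ` carrier M)) M" "g ` (i ` carrier M) = carrier M"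
    using mod_iso_sym[OF assms(1) res] by (auto simp: mod_iso_iff_surj_inj)
  then have "subquot A (N \<restriction> (i ` carrier M)) S"
    using subquot_surj[OF res assms(1) g(1) _ assms(5)] by simp
  then show ?thesis by (rule subquot_res[OF assms(2) im])
qed

lemma subquot_iso:
  assumes "left_module A M" "left_module A N" "mod_iso A M N" "subquot A M S"
  shows "subquot A N S"
  using assms subquot_inj by (auto simp: mod_iso_iff_surj_inj)

lemma subquot_target_iso:
  assumes "left_module A M" "subquot A M S" "mod_iso A S T"
  shows "subquot A M T"
proof -
  obtain U p where U: "submodule U A M" "p \<in> mod_hom A (M \<restriction> U) S" "p ` U = carrier S"
    using assms(2) by (auto simp: subquot_def)
  obtain g where g: "g \<in> mod_hom A S T" "g ` carrier S = carrier T"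
    using assms(3) by (auto simp: mod_iso_iff_surj_inj)
  have "compose U g p \<in> mod_hom A (M \<restriction> U) T"
    using mod_hom_comp[OF U(2) g(1) res_left_module[OF assms(1) U(1)]] by simp
  moreover have "compose U g p ` U = carrier T"
    unfolding g(2)[symmetric] U(3)[symmetric] by (auto simp: compose_def image_image)
  ultimately show ?thesis using U(1) by (auto simp: subquot_def)
qed

lemma simple_moduleD:
  assumes "simple_module A S"
  shows "left_module A S" "carrier S \<noteq> {\<zero>\<^bsub>S\<^esub>}"
    "submodule N A S \<Longrightarrow> N = {\<zero>\<^bsub>S\<^esub>} \<or> N = carrier S"
  using assms by (auto simp: simple_module_def)

lemma simple_nonzeroE:
  assumes "simple_module A S"
  obtains x where "x \<in> carrier S" "x \<noteq> \<zero>\<^bsub>S\<^esub>"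
  using submoduleD(2)[OF submodule_carrier[OF simple_moduleD(1)[OF assms]]] simple_moduleD(2)[OF assms] by blast

lemma simple_hom_inj:
  assumes "simple_module A S" "left_module A M" "f \<in> mod_hom A S M"
    "x \<in> carrier S" "f x \<noteq> \<zero>\<^bsub>M\<^esub>"
  shows "inj_on f (carrier S)"
proof -
  note S = simple_moduleD[OF assms(1)]
  have "a_kernel S M f = {\<zero>\<^bsub>S\<^esub>}"
    using S(3)[OF submodule_kernel[OF S(1) assms(2,3)]] assms(4,5) by (auto simp: a_kernel_eq)
  then show ?thesis by (intro mod_hom_inj_onI[OF S(1) assms(2,3)]) (auto simp: a_kernel_eq)
qed

lemma simple_hom_surj:
  assumes "simple_module A S" "left_module A M" "f \<in> mod_hom A M S"
    "x \<in> carrier M" "f x \<noteq> \<zero>\<^bsub>S\<^esub>"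
  shows "f ` carrier M = carrier S"
proof -
  note S = simple_moduleD[OF assms(1)]
  show ?thesis
    using S(3)[OF submodule_image[OF assms(2) S(1) assms(3) submodule_carrier[OF assms(2)]]] assms(4,5)
    by auto
qed

lemma simple_iso:
  assumes "simple_module A S" "left_module A M" "mod_iso A S M"
  shows "simple_module A M"
proof -
  note S = simple_moduleD[OF assms(1)]
  obtain f where f: "f \<in> mod_hom A S M" "inj_on f (carrier S)" "f ` carrier S = carrier M"
    using assms(3) by (auto simp: mod_iso_iff_surj_inj)
  have "N = {\<zero>\<^bsub>M\<^esub>} \<or> N = carrier M" if N: "submodule N A M" for N
  proof -
    have "f ` {x \<in> carrier S. f x \<in> N} = N" using submoduleD(1)[OF N] unfolding f(3)[symmetric] by auto
    then show ?thesis
      using S(3)[OF submodule_vimage[OF S(1) assms(2) f(1) N]] f(3) mod_hom_zero[OF S(1) assms(2) f(1)]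
      by force
  qed
  moreover have "carrier M \<noteq> {\<zero>\<^bsub>M\<^esub>}"
  proof
    assume M: "carrier M = {\<zero>\<^bsub>M\<^esub>}"
    obtain x where x: "x \<in> carrier S" "x \<noteq> \<zero>\<^bsub>S\<^esub>" using assms(1) by (rule simple_nonzeroE)
    have "\<zero>\<^bsub>S\<^esub> \<in> carrier S" using submoduleD(2)[OF submodule_carrier[OF S(1)]] .
    then show False using x f(2,3) M by (metis imageI inj_onD singletonD)
  qed
  ultimately show ?thesis using assms(2) by (simp add: simple_module_def)
qed

text \<open>Simplicity decides. The image under \<open>p\<close> of the intersection of
  \<open>U\<close> with the kernel of \<open>q\<close> is either all of \<open>S\<close>, and
  \<open>S\<close> occurs in the kernel, or zero, and \<open>p\<close> factors through
  \<open>q\<close>.\<close>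

lemma subquot_ext:
  assumes "left_module A M" "left_module A Q" "q \<in> mod_hom A M Q" "simple_module A S"
    "subquot A M S"
  shows "subquot A (M \<restriction> a_kernel M Q q) S \<or> subquot A Q S"
proof -
  note S = simple_moduleD[OF assms(4)]
  obtain U p where U: "submodule U A M" "p \<in> mod_hom A (M \<restriction> U) S" "p ` U = carrier S"
    using assms(5) by (auto simp: subquot_def)
  have lU: "left_module A (M \<restriction> U)" by (rule res_left_module[OF assms(1) U(1)])
  let ?N = "a_kernel M Q q"
  have N: "submodule ?N A M" by (rule submodule_kernel[OF assms(1-3)])
  have UN: "submodule (U \<inter> ?N) A M" by (rule submodule_Int[OF assms(1) U(1) N])
  then have UN': "submodule (U \<inter> ?N) A (M \<restriction> U)" by (simp add: submodule_res_iff[OF assms(1) U(1)])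
  have lUN: "left_module A (M \<restriction> (U \<inter> ?N))" by (rule res_left_module[OF assms(1) UN])
  show ?thesis
  proof (cases "p ` (U \<inter> ?N) = {\<zero>\<^bsub>S\<^esub>}")
    case True
    have qU: "restrict q U \<in> mod_hom A (M \<restriction> U) Q" by (rule mod_hom_res[OF assms(3) U(1) assms(1)])
    have qUs: "submodule (q ` U) A Q" by (rule submodule_image[OF assms(1-3) U(1)])
    have qU': "restrict q U \<in> mod_hom A (M \<restriction> U) (Q \<restriction> (q ` U))"
      by (rule mod_hom_corestrict[OF qU]) auto
    have "\<exists>g\<in>mod_hom A (Q \<restriction> (q ` U)) S. \<forall>x\<in>carrier (M \<restriction> U). g (restrict q U x) = p x"
    proof (rule hom_factor[OF lU res_left_module[OF assms(2) qUs] S(1) qU' _ U(2)])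
      fix x assume "x \<in> carrier (M \<restriction> U)" "restrict q U x = \<zero>\<^bsub>Q \<restriction> (q ` U)\<^esub>"
      then have "x \<in> U \<inter> ?N" using submoduleD(1)[OF U(1)] by (auto simp: a_kernel_eq)
      then show "p x = \<zero>\<^bsub>S\<^esub>" using True by blast
    qed auto
    then obtain g where g: "g \<in> mod_hom A (Q \<restriction> (q ` U)) S" "\<forall>x\<in>U. g (q x) = p x" by auto
    then have "g ` (q ` U) = carrier S" unfolding U(3)[symmetric] image_image by (intro image_cong) auto
    then show ?thesis using g(1) qUs by (auto simp: subquot_def)
  next
    case False
    have "submodule (p ` (U \<inter> ?N)) A S" by (rule submodule_image[OF lU S(1) U(2) UN'])
    then have "p ` (U \<inter> ?N) = carrier S" using S(3) False by blast
    moreover have "restrict p (U \<inter> ?N) \<in> mod_hom A (M \<restriction> (U \<inter> ?N)) S"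
      using mod_hom_res[OF U(2) UN' lU] by simp
    ultimately have "subquot A (M \<restriction> ?N) S"
      using UN submodule_res_iff[OF assms(1) N, of "U \<inter> ?N"]
      by (intro subquotI[of "U \<inter> ?N" A _ "restrict p (U \<inter> ?N)"]) auto
    then show ?thesis ..
  qed
qed

lemma subquot_simple:
  assumes "simple_module A M" "simple_module A S" "subquot A M S"
  shows "mod_iso A M S"
proof -
  note M = simple_moduleD[OF assms(1)] and S = simple_moduleD[OF assms(2)]
  obtain U p where U: "submodule U A M" "p \<in> mod_hom A (M \<restriction> U) S" "p ` U = carrier S"
    using assms(3) by (auto simp: subquot_def)
  have "U \<noteq> {\<zero>\<^bsub>M\<^esub>}"
  proof
    assume "U = {\<zero>\<^bsub>M\<^esub>}"
    then have "p ` U = {\<zero>\<^bsub>S\<^esub>}" using mod_hom_zero[OF res_left_module[OF M(1) U(1)] S(1) U(2)] by simp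
    then show False using U(3) S(2) by simp
  qed
  then have [simp]: "U = carrier M" using M(3)[OF U(1)] by blast
  have p: "p \<in> mod_hom A M S" using U(2) by simp
  obtain y where y: "y \<in> carrier S" "y \<noteq> \<zero>\<^bsub>S\<^esub>" using assms(2) by (rule simple_nonzeroE)
  then obtain x where "x \<in> carrier M" "p x \<noteq> \<zero>\<^bsub>S\<^esub>" using U(3) by (metis \<open>U = carrier M\<close> imageE)
  then show ?thesis using simple_hom_inj[OF assms(1) S(1) p] p U(3) by (auto simp: mod_iso_iff_surj_inj)
qed

lemma simple_quotI:
  assumes "left_module A M" "left_module A Q" "p \<in> mod_hom A M Q" "p ` carrier M = carrier Q"
    "a_kernel M Q p \<noteq> carrier M"
    "\<And>U. \<lbrakk>submodule U A M; a_kernel M Q p \<subseteq> U; U \<noteq> carrier M\<rbrakk> \<Longrightarrow> U = a_kernel M Q p"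
  shows "simple_module A Q"
  unfolding simple_module_def
proof (intro conjI allI impI)
  show "left_module A Q" by fact
  show "carrier Q \<noteq> {\<zero>\<^bsub>Q\<^esub>}"
    using assms(4,5) by (auto simp: a_kernel_eq)
  fix N assume N: "submodule N A Q"
  let ?U = "{x \<in> carrier M. p x \<in> N}"
  have pU: "p ` ?U = N" using submoduleD(1)[OF N] unfolding assms(4)[symmetric] by auto
  have "a_kernel M Q p \<subseteq> ?U" using submoduleD(2)[OF N] by (auto simp: a_kernel_eq)
  then have "?U = carrier M \<or> ?U = a_kernel M Q p"
    using assms(6)[OF submodule_vimage[OF assms(1-3) N]] by blast
  then show "N = {\<zero>\<^bsub>Q\<^esub>} \<or> N = carrier Q"
  proof
    assume "?U = carrier M"
    then show ?thesis using pU assms(4) by simp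
  next
    assume U: "?U = a_kernel M Q p"
    have "N \<subseteq> {\<zero>\<^bsub>Q\<^esub>}" using pU unfolding U by (auto simp: a_kernel_eq)
    then show ?thesis using submoduleD(2)[OF N] by blast
  qed
qed

lemma simple_fg:
  assumes "simple_module A S"
  shows "fg_module A S"
proof -
  note S = simple_moduleD[OF assms]
  obtain x where x: "x \<in> carrier S" "x \<noteq> \<zero>\<^bsub>S\<^esub>" using assms by (rule simple_nonzeroE)
  then have "N = carrier S" if "submodule N A S" "{x} \<subseteq> N" for N using S(3)[OF that(1)] that(2) by auto
  then show ?thesis using x S(1) unfolding fg_module_def by (intro conjI exI[of _ "{x}"]) auto
qed

section \<open>Chains of submodules with simple factors\<close>

definition simple_chain :: "('a, 'r) ring_scheme \<Rightarrow> ('a, 'm) module \<Rightarrow> 'm set list \<Rightarrow> bool" where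
  "simple_chain A M Ns \<longleftrightarrow> (\<forall>N\<in>set Ns. submodule N A M) \<and>
    (\<forall>t. Suc t < length Ns \<longrightarrow> Ns ! t \<subseteq> Ns ! Suc t \<and> simple_module A (filtration_factor M Ns t))"

lemma composition_series_eq:
  "composition_series A M Ns \<longleftrightarrow> Ns \<noteq> [] \<and> hd Ns = {\<zero>\<^bsub>M\<^esub>} \<and> last Ns = carrier M \<and> simple_chain A M Ns"
  by (auto simp: composition_series_def mod_filtration_def simple_chain_def)

text \<open>This is why \<open>simple_chain\<close> leaves its end points free: pieces between
  arbitrary submodules can be joined, the only new factor being the one at the junction.\<close>

lemma simple_chain_append:
  assumes "simple_chain A M Ns" "simple_chain A M Ns'" "Ns \<noteq> []" "Ns' \<noteq> []" "last Ns \<subseteq> hd Ns'"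
    "simple_module A (mod_quot (M \<restriction> (hd Ns')) (last Ns))"
  shows "simple_chain A M (Ns @ Ns')"
  unfolding simple_chain_def
proof (intro conjI allI impI)
  show "\<forall>N\<in>set (Ns @ Ns'). submodule N A M" using assms(1,2) by (auto simp: simple_chain_def)
  fix t assume t: "Suc t < length (Ns @ Ns')"
  consider "Suc t < length Ns" | "Suc t = length Ns" | "Suc t > length Ns" by linarith
  then have "(Ns @ Ns') ! t \<subseteq> (Ns @ Ns') ! Suc t \<and> simple_module A (filtration_factor M (Ns @ Ns') t)"
  proof cases
    case 1
    then show ?thesis using assms(1) by (auto simp: simple_chain_def filtration_factor_def nth_append)
  next
    case 2
    then have "(Ns @ Ns') ! t = last Ns" "(Ns @ Ns') ! Suc t = hd Ns'"
      using assms(3,4) by (auto simp: nth_append last_conv_nth hd_conv_nth simp flip: 2)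
    then show ?thesis using assms(5,6) by (simp add: filtration_factor_def)
  next
    case 3
    then have "Suc (t - length Ns) < length Ns'" "\<not> t < length Ns" "\<not> Suc t < length Ns"
      "Suc t - length Ns = Suc (t - length Ns)" using t by auto
    then show ?thesis
      using assms(2) by (auto simp: simple_chain_def filtration_factor_def nth_append)
  qed
  then show "(Ns @ Ns') ! t \<subseteq> (Ns @ Ns') ! Suc t" "simple_module A (filtration_factor M (Ns @ Ns') t)"
    by auto
qed

context fd_algebra_field
begin

text \<open>Factors are split off from the top: a submodule \<open>W\<close> that is maximal among
  those containing \<open>U\<close> and properly contained in \<open>V\<close> gives a simple
  factor, and its rank is smaller than that of \<open>V\<close>.\<close>

lemma simple_chain_exists:
  assumes "fg_module A M" "submodule U A M" "submodule V A M" "U \<subseteq> V"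
  shows "\<exists>Ns. simple_chain A M Ns \<and> Ns \<noteq> [] \<and> hd Ns = U \<and> last Ns = V"
proof -
  obtain l :: "'b set \<Rightarrow> nat" where l: "\<And>U V. \<lbrakk>ksubspace M U; ksubspace M V; U \<subset> V\<rbrakk> \<Longrightarrow> l U < l V"
    using fg_length[OF assms(1)] by metis
  have M: "left_module A M" by (rule fg_moduleD[OF assms(1)])
  show ?thesis using assms(3,4)
  proof (induction "l V" arbitrary: V rule: less_induct)
    case less
    show ?case
    proof (cases "U = V")
      case True
      then show ?thesis using assms(2) by (intro exI[of _ "[U]"]) (auto simp: simple_chain_def)
    next
      case False
      define Q where "Q W \<longleftrightarrow> submodule W A M \<and> U \<subseteq> W \<and> W \<subset> V" for W
      have Q: "Q U" "\<And>W. Q W \<Longrightarrow> submodule W A M"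
        unfolding Q_def using False assms(2) less.prems(2) by auto
      obtain W where "Q W" and WQ: "\<And>W'. Q W' \<Longrightarrow> W \<subseteq> W' \<Longrightarrow> W' = W"
        using fg_maximal[where Q = Q, OF assms(1) Q(2,1)] by blast
      then have W: "submodule W A M" "U \<subseteq> W" "W \<subset> V" by (auto simp: Q_def)
      have "l W < l V" using W less.prems(1) by (auto intro!: l submodule_ksubspace)
      then obtain Ns where Ns: "simple_chain A M Ns" "Ns \<noteq> []" "hd Ns = U" "last Ns = W"
        using less.hyps W(1,2) by blast
      have V: "left_module A (M \<restriction> V)" by (rule res_left_module[OF M less.prems(1)])
      have WV: "submodule W A (M \<restriction> V)" using W submodule_res_iff[OF M less.prems(1)] by auto
      note q = mod_quot_facts[OF V WV]
      have "simple_module A (mod_quot (M \<restriction> V) W)"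
      proof (rule simple_quotI[OF V q(1-3)], unfold q(4))
        show "W \<noteq> carrier (M \<restriction> V)" using W(3) by auto
        fix W' assume "submodule W' A (M \<restriction> V)" "W \<subseteq> W'" "W' \<noteq> carrier (M \<restriction> V)"
        then have "submodule W' A M" "W' \<subseteq> V" "W' \<noteq> V"
          using submodule_res_iff[OF M less.prems(1), of W'] by auto
        then show "W' = W" using W(2) WQ[of W'] \<open>W \<subseteq> W'\<close> by (auto simp: Q_def)
      qed
      then have "simple_chain A M (Ns @ [V])"
        using simple_chain_append[OF Ns(1), of "[V]"] Ns W(3) less.prems(1)
        by (auto simp: simple_chain_def)
      then show ?thesis using Ns by (intro exI[of _ "Ns @ [V]"]) auto
    qed
  qed
qed

text \<open>\<open>comp_factors_in\<close> constrains every composition series, so it suffices to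
  exhibit one in which \<open>S\<close> appears. If \<open>S\<close> is the quotient of
  \<open>U\<close> with kernel \<open>V\<close>, chains below \<open>V\<close> and above
  \<open>U\<close> join to such a series.\<close>

lemma comp_factors_in_subquot:
  assumes "fg_module A M" "comp_factors_in A M \<S>" "simple_module A S" "subquot A M S"
    "\<And>T. T \<in> \<S> \<Longrightarrow> left_module A T"
  shows "\<exists>T\<in>\<S>. mod_iso A S T"
proof -
  have M: "left_module A M" by (rule fg_moduleD[OF assms(1)])
  note S = simple_moduleD[OF assms(3)]
  obtain U p where U: "submodule U A M" "p \<in> mod_hom A (M \<restriction> U) S" "p ` U = carrier S"
    using assms(4) by (auto simp: subquot_def)
  have lU: "left_module A (M \<restriction> U)" by (rule res_left_module[OF M U(1)])
  define V where "V = a_kernel (M \<restriction> U) S p"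
  have V: "submodule V A (M \<restriction> U)" unfolding V_def by (rule submodule_kernel[OF lU S(1) U(2)])
  then have V': "submodule V A M" "V \<subseteq> U" using submodule_res_iff[OF M U(1)] by auto
  note q = mod_quot_facts[OF lU V]
  have iso: "mod_iso A (mod_quot (M \<restriction> U) V) S"
    by (rule mod_quot_cong_iso[OF lU S(1) U(2)]) (auto simp: U(3) V_def)
  have simp: "simple_module A (mod_quot (M \<restriction> U) V)"
    by (rule simple_iso[OF assms(3) q(1) mod_iso_sym[OF q(1) S(1) iso]])
  obtain Ns where Ns: "simple_chain A M Ns" "Ns \<noteq> []" "hd Ns = {\<zero>\<^bsub>M\<^esub>}" "last Ns = V"
    using simple_chain_exists[OF assms(1) submodule_zero[OF M] V'(1)] submoduleD(2)[OF V'(1)] by auto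
  obtain Ns' where Ns': "simple_chain A M Ns'" "Ns' \<noteq> []" "hd Ns' = U" "last Ns' = carrier M"
    using simple_chain_exists[OF assms(1) U(1) submodule_carrier[OF M] submoduleD(1)[OF U(1)]] by auto
  have "simple_chain A M (Ns @ Ns')"
    using simple_chain_append[OF Ns(1) Ns'(1) Ns(2) Ns'(2)] Ns Ns' V' simp by simp
  then have "composition_series A M (Ns @ Ns')"
    using Ns Ns' by (simp add: composition_series_eq)
  \<comment> \<open>\<open>t\<close> is the last index of the lower chain, so the factor at
    \<open>t\<close> is the one between \<open>V\<close> and \<open>U\<close>.\<close>
  moreover obtain t where t: "length Ns = Suc t" using Ns(2) by (cases "length Ns") auto
  ultimately obtain T where T: "T \<in> \<S>" "mod_iso A (filtration_factor M (Ns @ Ns') t) T"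
    using assms(2) Ns'(2) unfolding comp_factors_in_def
    by (metis add.commute length_append length_greater_0_conv less_add_same_cancel2)
  have "filtration_factor M (Ns @ Ns') t = mod_quot (M \<restriction> U) V"
    using t Ns Ns' by (auto simp: filtration_factor_def nth_append last_conv_nth hd_conv_nth)
  then have "mod_iso A S T"
    using T mod_iso_trans[OF S(1) mod_iso_sym[OF q(1) S(1) iso]] by simp
  then show ?thesis using T(1) by blast
qed

end

lemma comp_factors_inI:
  assumes "left_module A M"
    "\<And>U V. \<lbrakk>submodule U A M; submodule V A (M \<restriction> U); simple_module A (mod_quot (M \<restriction> U) V)\<rbrakk>
      \<Longrightarrow> \<exists>S\<in>\<S>. mod_iso A (mod_quot (M \<restriction> U) V) S"
  shows "comp_factors_in A M \<S>"
  unfolding comp_factors_in_def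
proof (intro allI impI)
  fix Ns t assume *: "composition_series A M Ns" "Suc t < length Ns"
  then have "submodule (Ns ! Suc t) A M" "submodule (Ns ! t) A M" "Ns ! t \<subseteq> Ns ! Suc t"
    "simple_module A (filtration_factor M Ns t)"
    by (auto simp: composition_series_eq simple_chain_def)
  then show "\<exists>S\<in>\<S>. mod_iso A (filtration_factor M Ns t) S"
    unfolding filtration_factor_def using submodule_res_iff[OF assms(1)] by (intro assms(2)) auto
qed

lemma filtered_by_factor:
  assumes "left_module A M" "mod_filtration A M Ns" "Suc t < length Ns"
    "mod_iso A (filtration_factor M Ns t) E" "left_module A E"
  shows "submodule (Ns ! t) A M" "submodule (Ns ! Suc t) A M" "Ns ! t \<subseteq> Ns ! Suc t"
    "\<exists>p\<in>mod_hom A (M \<restriction> (Ns ! Suc t)) E. p ` (Ns ! Suc t) = carrier E \<and>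
      a_kernel (M \<restriction> (Ns ! Suc t)) E p = Ns ! t"
proof -
  show *: "submodule (Ns ! t) A M" "submodule (Ns ! Suc t) A M" "Ns ! t \<subseteq> Ns ! Suc t"
    using assms(2,3) by (auto simp: mod_filtration_def)
  have "left_module A (M \<restriction> (Ns ! Suc t))" "submodule (Ns ! t) A (M \<restriction> (Ns ! Suc t))"
    using res_left_module[OF assms(1) *(2)] submodule_res_iff[OF assms(1) *(2)] * by auto
  from mod_iso_quot_hom[OF this assms(4)[unfolded filtration_factor_def] assms(5)]
  show "\<exists>p\<in>mod_hom A (M \<restriction> (Ns ! Suc t)) E. p ` (Ns ! Suc t) = carrier E \<and>
      a_kernel (M \<restriction> (Ns ! Suc t)) E p = Ns ! t" by simp
qed

text \<open>Climbing the filtration, \<open>subquot_ext\<close> places a simple subquotient either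
  in the earlier term or in the current factor; the bottom term is zero and has none.\<close>

lemma filtered_by_subquot:
  assumes "left_module A M" "filtered_by A M \<X>" "\<And>E. E \<in> \<X> \<Longrightarrow> left_module A E"
    "simple_module A S" "subquot A M S"
  shows "\<exists>E\<in>\<X>. subquot A E S"
proof -
  obtain Ns where Ns: "mod_filtration A M Ns"
    and fac: "\<And>t. Suc t < length Ns \<Longrightarrow> \<exists>E\<in>\<X>. mod_iso A (filtration_factor M Ns t) E"
    using assms(2) by (auto simp: filtered_by_def)
  have sub: "t < length Ns \<Longrightarrow> submodule (Ns ! t) A M" for t using Ns by (auto simp: mod_filtration_def)
  have "t < length Ns \<Longrightarrow> subquot A (M \<restriction> (Ns ! t)) S \<Longrightarrow> \<exists>E\<in>\<X>. subquot A E S" for t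
  proof (induction t)
    case 0
    have "Ns ! 0 = {\<zero>\<^bsub>M\<^esub>}" using Ns by (auto simp: mod_filtration_def hd_conv_nth)
    then obtain U p where U: "submodule U A (M \<restriction> {\<zero>\<^bsub>M\<^esub>})"
      "p \<in> mod_hom A (M \<restriction> {\<zero>\<^bsub>M\<^esub>} \<restriction> U) S"
      "p ` U = carrier S" using 0 unfolding subquot_def by auto
    have l0: "left_module A (M \<restriction> {\<zero>\<^bsub>M\<^esub>})"
      by (rule res_left_module[OF assms(1) submodule_zero[OF assms(1)]])
    have "U = {\<zero>\<^bsub>M\<^esub>}" using submoduleD(1,2)[OF U(1)] by auto
    then have "p ` U = {\<zero>\<^bsub>S\<^esub>}"
      using mod_hom_zero[OF res_left_module[OF l0 U(1)] simple_moduleD(1)[OF assms(4)] U(2)] by simp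
    then show ?case using U(3) simple_moduleD(2)[OF assms(4)] by simp
  next
    case (Suc t)
    obtain E where E: "E \<in> \<X>" "mod_iso A (filtration_factor M Ns t) E" using fac Suc.prems(1) by blast
    note f = filtered_by_factor[OF assms(1) Ns Suc.prems(1) E(2) assms(3)[OF E(1)]]
    obtain p where p: "p \<in> mod_hom A (M \<restriction> (Ns ! Suc t)) E" "a_kernel (M \<restriction> (Ns ! Suc t)) E p = Ns ! t"
      using f(4) by auto
    have "subquot A (M \<restriction> (Ns ! Suc t) \<restriction> a_kernel (M \<restriction> (Ns ! Suc t)) E p) S \<or> subquot A E S"
      by (rule subquot_ext[OF res_left_module[OF assms(1) f(2)] assms(3)[OF E(1)] p(1) assms(4) Suc.prems(2)])
    then show ?case using E(1) Suc p(2) by auto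
  qed
  moreover have "Ns ! (length Ns - 1) = carrier M" "length Ns - 1 < length Ns"
    using Ns by (auto simp: mod_filtration_def last_conv_nth)
  ultimately show ?thesis using assms(5) by (metis module.surjective module.update_convs(1) partial_object.update_convs(1) module.cases)
qed

section \<open>Schur's lemma\<close>

context fd_algebra_field
begin

text \<open>As for the polynomials of \<^theory>\<open>HOL-Algebra.Polynomials\<close>, the leading coefficient comes first.\<close>

fun pev :: "('a, 'm) module \<Rightarrow> ('m \<Rightarrow> 'm) \<Rightarrow> 'k list \<Rightarrow> 'm \<Rightarrow> 'm" where
  "pev M e [] x = \<zero>\<^bsub>M\<^esub>"
| "pev M e (a # p) x = pev M e p x \<oplus>\<^bsub>M\<^esub> scal A a \<odot>\<^bsub>M\<^esub> (e ^^ length p) x"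

lemma funpow_hom_closed:
  assumes "e \<in> mod_hom A M M" "x \<in> carrier M"
  shows "(e ^^ k) x \<in> carrier M"
  using assms by (induction k) (auto dest: mod_homD(1))

lemma pev_closed:
  assumes "left_module A M" "e \<in> mod_hom A M M" "set p \<subseteq> carrier K" "x \<in> carrier M"
  shows "pev M e p x \<in> carrier M"
proof -
  interpret N: left_module A M by fact
  show ?thesis using assms(3) by (induction p) (auto simp: funpow_hom_closed[OF assms(2,4)])
qed

text \<open>Horner's rule in this encoding: since the constant coefficient comes last, appending one
  multiplies the polynomial by the variable and adds the constant.\<close>

lemma pev_snoc:
  assumes "left_module A M" "e \<in> mod_hom A M M" "set p \<subseteq> carrier K" "b \<in> carrier K" "x \<in> carrier M"
  shows "pev M e (p @ [b]) x = e (pev M e p x) \<oplus>\<^bsub>M\<^esub> scal A b \<odot>\<^bsub>M\<^esub> x"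
proof -
  interpret N: left_module A M by fact
  note e = mod_homD[OF assms(2)] and ex = funpow_hom_closed[OF assms(2,5)]
  show ?thesis using assms(3)
  proof (induction p)
    case Nil
    then show ?case using assms mod_hom_zero[OF assms(1,1,2)] by simp
  next
    case (Cons a p)
    then have "pev M e p x \<in> carrier M" using pev_closed[OF assms(1,2) _ assms(5)] by auto
    then show ?case using Cons assms e ex by (simp add: N.M.a_ac)
  qed
qed

lemma kspan_pev:
  assumes "left_module A M" "e \<in> mod_hom A M M" "x \<in> carrier M"
    and "w \<in> kspan M (map (\<lambda>m. (e ^^ m) x) (rev [0..<k]))"
  shows "\<exists>p. length p = k \<and> set p \<subseteq> carrier K \<and> w = pev M e p x"
  using assms(4)
proof (induction k arbitrary: w)
  case 0
  then show ?case by simp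
next
  case (Suc k)
  then obtain v c where v: "v \<in> kspan M (map (\<lambda>m. (e ^^ m) x) (rev [0..<k]))" "c \<in> carrier K"
    "w = v \<oplus>\<^bsub>M\<^esub> scal A c \<odot>\<^bsub>M\<^esub> (e ^^ k) x" by auto
  then obtain p where "length p = k" "set p \<subseteq> carrier K" "v = pev M e p x" using Suc.IH by blast
  then show ?case using v by (intro exI[of _ "c # p"]) auto
qed

text \<open>The spans of the powers of \<open>e\<close> applied to \<open>x\<close> cannot grow
  forever because the rank is bounded, so some power depends on the earlier ones.\<close>

lemma pev_annihilator:
  assumes "fg_module A M" "e \<in> mod_hom A M M" "x \<in> carrier M"
  shows "\<exists>p. p \<noteq> [] \<and> hd p \<noteq> \<zero>\<^bsub>K\<^esub> \<and> set p \<subseteq> carrier K \<and> pev M e p x = \<zero>\<^bsub>M\<^esub>"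
proof -
  have M: "left_module A M" by (rule fg_moduleD[OF assms(1)])
  interpret N: left_module A M by fact
  note ex = funpow_hom_closed[OF assms(2,3)]
  obtain l :: "'b set \<Rightarrow> nat" where l: "\<And>U V. \<lbrakk>ksubspace M U; ksubspace M V; U \<subset> V\<rbrakk> \<Longrightarrow> l U < l V"
    "bdd_above (range l)" using fg_length[OF assms(1)] by metis
  obtain n where n: "\<And>U. l U \<le> n" using l(2) by (auto simp: bdd_above_def)
  \<comment> \<open>Highest power at the head, so that a new power is consed onto the list, as the
    recursions of \<open>kspan\<close> and \<open>pev\<close> expect.\<close>
  let ?b = "\<lambda>k. map (\<lambda>m. (e ^^ m) x) (rev [0..<k])"
  have b: "set (?b k) \<subseteq> carrier M" for k using ex by auto
  have bS: "?b (Suc k) = (e ^^ k) x # ?b k" for k by simp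
  have "\<exists>k. (e ^^ k) x \<in> kspan M (?b k)"
  proof (rule ccontr)
    assume no: "\<nexists>k. (e ^^ k) x \<in> kspan M (?b k)"
    have "kspan M (?b k) \<subset> kspan M (?b (Suc k))" for k
    proof -
      have "(e ^^ k) x \<in> kspan M (?b (Suc k))" "kspan M (?b k) \<subseteq> kspan M (?b (Suc k))"
        using kspan_hd[OF M, of "(e ^^ k) x" "?b k"] kspan_mono_Cons[OF M, of "(e ^^ k) x" "?b k"]
          b[of "Suc k"] unfolding bS by auto
      then show ?thesis using no by blast
    qed
    then have lt: "l (kspan M (?b k)) < l (kspan M (?b (Suc k)))" for k
      by (intro l(1) kspan_ksubspace[OF M b])
    have "k \<le> l (kspan M (?b k))" for k
    proof (induction k)
      case (Suc k)
      then show ?case using lt[of k] by linarith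
    qed simp
    from this[of "Suc n"] n show False by (metis not_less_eq_eq order_trans)
  qed
  then obtain k p where p: "length p = k" "set p \<subseteq> carrier K" "(e ^^ k) x = pev M e p x"
    using kspan_pev[OF M assms(2,3)] by blast
  \<comment> \<open>Subtracting the power itself gives the leading coefficient -1, so the relation
    has a nonzero head.\<close>
  have "pev M e (\<ominus>\<^bsub>K\<^esub> \<one>\<^bsub>K\<^esub> # p) x = \<zero>\<^bsub>M\<^esub>"
    using p(1) ex[of k] by (simp add: p(3)[symmetric] scal_mod[OF M _ R.one_closed R.one_closed] N.M.r_neg)
  moreover have "\<ominus>\<^bsub>K\<^esub> \<one>\<^bsub>K\<^esub> \<noteq> \<zero>\<^bsub>K\<^esub>"
    by (metis R.add.inv_eq_1_iff R.one_closed one_not_zero)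
  ultimately show ?thesis using p(2) by (intro exI[of _ "\<ominus>\<^bsub>K\<^esub> \<one>\<^bsub>K\<^esub> # p"]) auto
qed

text \<open>Division by X - c with remainder the value at \<open>c\<close>, carried out on values at
  \<open>x\<close> instead of in the polynomial ring. The clause on \<open>hd q\<close> records that
  the leading coefficient survives, so that the division can be repeated.\<close>

lemma pev_divide:
  assumes "left_module A M" "e \<in> mod_hom A M M" "set p \<subseteq> carrier K" "c \<in> carrier K" "x \<in> carrier M" "p \<noteq> []"
  shows "\<exists>q. set q \<subseteq> carrier K \<and> length p = Suc (length q) \<and> (q \<noteq> [] \<longrightarrow> hd q = hd p) \<and>
    pev M e p x = (e (pev M e q x) \<ominus>\<^bsub>M\<^esub> scal A c \<odot>\<^bsub>M\<^esub> pev M e q x) \<oplus>\<^bsub>M\<^esub> scal A (R.eval p c) \<odot>\<^bsub>M\<^esub> x"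
  using assms(3,6)
proof (induction p rule: rev_induct)
  case (snoc b p)
  interpret N: left_module A M by fact
  note e = mod_homD[OF assms(2)]
  have b: "b \<in> carrier K" and pK: "set p \<subseteq> carrier K" using snoc.prems by auto
  have ev: "R.eval p c \<in> carrier K" using R.eval_in_carrier[OF pK assms(4)] .
  have evs: "set r \<subseteq> carrier K \<Longrightarrow> R.eval (r @ [b]) c = R.eval r c \<otimes>\<^bsub>K\<^esub> c \<oplus>\<^bsub>K\<^esub> b" for r
    using b assms(4) by (induction r) (auto simp: R.l_distr R.r_distr R.m_lcomm R.a_assoc R.m_comm R.eval_in_carrier)
  show ?case
  proof (cases "p = []")
    case True
    then show ?thesis
      using assms b mod_hom_zero[OF assms(1,1,2)]
      by (intro exI[of _ "[]"]) (simp add: N.smult_zero_r a_minus_def N.M.r_neg)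
  next
    case False
    then obtain q where q: "set q \<subseteq> carrier K" "length p = Suc (length q)" "q \<noteq> [] \<longrightarrow> hd q = hd p"
      "pev M e p x = (e (pev M e q x) \<ominus>\<^bsub>M\<^esub> scal A c \<odot>\<^bsub>M\<^esub> pev M e q x) \<oplus>\<^bsub>M\<^esub> scal A (R.eval p c) \<odot>\<^bsub>M\<^esub> x"
      using snoc.IH pK by blast
    \<comment> \<open>If p = (X - c) q + p(c), then X p + b = (X - c) (X q + p(c)) + (p(c) c + b):
      the new quotient is \<open>q\<close> with the old remainder appended.\<close>
    define y z where "y = pev M e q x" and "z = pev M e (q @ [R.eval p c]) x"
    have y: "y \<in> carrier M" unfolding y_def by (rule pev_closed[OF assms(1,2) q(1) assms(5)])
    have z: "z = e y \<oplus>\<^bsub>M\<^esub> scal A (R.eval p c) \<odot>\<^bsub>M\<^esub> x"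
      unfolding z_def y_def by (rule pev_snoc[OF assms(1,2) q(1) ev assms(5)])
    have zM: "z \<in> carrier M" using z y e ev assms(5) by simp
    have pz: "pev M e p x = z \<oplus>\<^bsub>M\<^esub> \<ominus>\<^bsub>M\<^esub> (scal A c \<odot>\<^bsub>M\<^esub> y)"
      unfolding q(4)[folded y_def] z using y e ev assms(4,5) by (simp add: a_minus_def N.M.a_ac)
    have "pev M e (p @ [b]) x = e z \<oplus>\<^bsub>M\<^esub> \<ominus>\<^bsub>M\<^esub> (scal A c \<odot>\<^bsub>M\<^esub> e y) \<oplus>\<^bsub>M\<^esub> scal A b \<odot>\<^bsub>M\<^esub> x"
      using y zM e assms(4) unfolding pev_snoc[OF assms(1,2) pK b assms(5)] pz
      by (simp add: mod_hom_minus[OF assms(1,1,2)])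
    also have "\<dots> = (e z \<ominus>\<^bsub>M\<^esub> scal A c \<odot>\<^bsub>M\<^esub> z) \<oplus>\<^bsub>M\<^esub> scal A (R.eval (p @ [b]) c) \<odot>\<^bsub>M\<^esub> x"
    proof -
      have 1: "scal A c \<odot>\<^bsub>M\<^esub> z = scal A c \<odot>\<^bsub>M\<^esub> e y \<oplus>\<^bsub>M\<^esub> scal A (R.eval p c \<otimes>\<^bsub>K\<^esub> c) \<odot>\<^bsub>M\<^esub> x"
        unfolding z using y e ev assms(4,5)
        by (simp add: N.smult_r_distr R.m_comm[of _ c] scal_mod(2)[OF assms(1)])
      have 2: "scal A (R.eval (p @ [b]) c) \<odot>\<^bsub>M\<^esub> x
          = scal A (R.eval p c \<otimes>\<^bsub>K\<^esub> c) \<odot>\<^bsub>M\<^esub> x \<oplus>\<^bsub>M\<^esub> scal A b \<odot>\<^bsub>M\<^esub> x"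
        unfolding evs[OF pK] using ev assms(4,5) b by (simp add: scal_mod(1)[OF assms(1)])
      show ?thesis
        unfolding 1 2 using y zM e ev assms(4,5) b
        by (simp add: a_minus_def N.M.minus_add N.M.a_assoc N.M.r_neg1)
    qed
    finally show ?thesis
      using q(1-3) ev False pK assms(4)
      by (intro exI[of _ "q @ [R.eval p c]"], cases q; cases p) (auto simp: z_def)
  qed
qed simp

end

locale fd_algebra_ac = fd_algebra K A + algebraically_closed K
  for K :: "'k ring" (structure) and A :: "('k, 'a) module" (structure)

sublocale fd_algebra_ac \<subseteq> fd_algebra_field ..

context fd_algebra_ac
begin

text \<open>Splitting off a root \<open>c\<close> of \<open>p\<close> produces y = q(e) x with (e -
  c) y = 0. Either \<open>y\<close> is an eigenvector, or it vanishes and \<open>q\<close> is a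
  shorter relation; a constant relation would force x = 0.\<close>

lemma eigenvector_aux:
  assumes "left_module A M" "e \<in> mod_hom A M M" "x \<in> carrier M" "x \<noteq> \<zero>\<^bsub>M\<^esub>"
    and "p \<noteq> []" "hd p \<noteq> \<zero>\<^bsub>K\<^esub>" "set p \<subseteq> carrier K" "pev M e p x = \<zero>\<^bsub>M\<^esub>"
  shows "\<exists>c\<in>carrier K. \<exists>y\<in>carrier M. y \<noteq> \<zero>\<^bsub>M\<^esub> \<and> e y = scal A c \<odot>\<^bsub>M\<^esub> y"
  using assms(5-8)
proof (induction "length p" arbitrary: p rule: less_induct)
  case less
  interpret N: left_module A M by fact
  note e = mod_homD[OF assms(2)]
  show ?case
  proof (cases "length p = 1")
    case True
    then obtain a where p: "p = [a]" by (cases p) auto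
    then have a: "a \<in> Units K" using less.prems field_Units by auto
    then have "x = scal A (inv\<^bsub>K\<^esub> a \<otimes>\<^bsub>K\<^esub> a) \<odot>\<^bsub>M\<^esub> x" using assms(3)
      by (simp add: scal_simps)
    also have "\<dots> = scal A (inv\<^bsub>K\<^esub> a) \<odot>\<^bsub>M\<^esub> (scal A a \<odot>\<^bsub>M\<^esub> x)"
      using a assms(3) R.Units_inv_closed by (intro scal_mod(2)[OF assms(1)]) auto
    also have "scal A a \<odot>\<^bsub>M\<^esub> x = \<zero>\<^bsub>M\<^esub>" using less.prems(4) p R.Units_closed[OF a] assms(3) by simp
    also have "scal A (inv\<^bsub>K\<^esub> a) \<odot>\<^bsub>M\<^esub> \<zero>\<^bsub>M\<^esub> = \<zero>\<^bsub>M\<^esub>"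
      using a R.Units_inv_closed by (simp add: N.smult_zero_r)
    finally show ?thesis using assms(4) by simp
  next
    case False
    have "p \<in> carrier (poly_ring K)"
      using less.prems by (simp add: univ_poly_carrier[symmetric] polynomial_def)
    then have "size (R.roots p) = degree p" using roots_over_carrier by (simp add: R.splitted_def)
    then have "R.roots p \<noteq> {#}" using False less.prems(1) by (cases p) auto
    then obtain c where "c \<in># R.roots p" by blast
    then have c: "c \<in> carrier K" "R.eval p c = \<zero>\<^bsub>K\<^esub>"
      using roots_mem_iff_is_root[OF \<open>p \<in> carrier (poly_ring K)\<close>] by (auto simp: R.is_root_def)
    obtain q where q: "set q \<subseteq> carrier K" "length p = Suc (length q)" "q \<noteq> [] \<longrightarrow> hd q = hd p"
      "pev M e p x = (e (pev M e q x) \<ominus>\<^bsub>M\<^esub> scal A c \<odot>\<^bsub>M\<^esub> pev M e q x) \<oplus>\<^bsub>M\<^esub> scal A (R.eval p c) \<odot>\<^bsub>M\<^esub> x"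
      using pev_divide[OF assms(1,2) less.prems(3) c(1) assms(3) less.prems(1)] by blast
    have "q \<noteq> []" using q(2) False by auto
    define y where "y = pev M e q x"
    have y: "y \<in> carrier M" unfolding y_def by (rule pev_closed[OF assms(1,2) q(1) assms(3)])
    show ?thesis
    proof (cases "y = \<zero>\<^bsub>M\<^esub>")
      case True
      then show ?thesis using less.hyps[of q] q(1-3) \<open>q \<noteq> []\<close> less.prems by (simp add: y_def)
    next
      case False
      have "e y \<ominus>\<^bsub>M\<^esub> scal A c \<odot>\<^bsub>M\<^esub> y = \<zero>\<^bsub>M\<^esub>"
        using q(4)[folded y_def] less.prems(4) c y e assms(3)
        by (simp add: scal_mod(5)[OF assms(1) _ c(1) c(1)])
      then have "e y = scal A c \<odot>\<^bsub>M\<^esub> y" using y e c by (simp add: N.diff_eq_zero_iff)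
      then show ?thesis using False y c(1) by blast
    qed
  qed
qed

text \<open>One eigenvector exists, and its eigenspace is a submodule because scalars act centrally;
  simplicity makes it everything.\<close>

lemma schur:
  assumes "simple_module A S" "e \<in> mod_hom A S S"
  shows "\<exists>c\<in>carrier K. \<forall>x\<in>carrier S. e x = scal A c \<odot>\<^bsub>S\<^esub> x"
proof -
  note S = simple_moduleD[OF assms(1)]
  interpret N: left_module A S by (rule S(1))
  note e = mod_homD[OF assms(2)]
  obtain x where x: "x \<in> carrier S" "x \<noteq> \<zero>\<^bsub>S\<^esub>" using assms(1) by (rule simple_nonzeroE)
  obtain p where p: "p \<noteq> []" "hd p \<noteq> \<zero>\<^bsub>K\<^esub>" "set p \<subseteq> carrier K"
    "pev S e p x = \<zero>\<^bsub>S\<^esub>"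
    using pev_annihilator[OF simple_fg[OF assms(1)] assms(2) x(1)] by blast
  obtain c y where c: "c \<in> carrier K" "y \<in> carrier S" "y \<noteq> \<zero>\<^bsub>S\<^esub>"
    "e y = scal A c \<odot>\<^bsub>S\<^esub> y"
    using eigenvector_aux[OF S(1) assms(2) x p] by blast
  let ?U = "{x \<in> carrier S. e x = scal A c \<odot>\<^bsub>S\<^esub> x}"
  have "submodule ?U A S"
    by (rule N.submodule_intro)
      (use c(1) e mod_hom_zero[OF S(1) S(1) assms(2)] in
        \<open>auto simp: N.smult_zero_r N.smult_r_distr scal_commute[OF S(1)]\<close>)
  then have "?U = carrier S" using S(3) c by blast
  then show ?thesis using c(1) by blast
qed

end

section \<open>Standard and costandard modules\<close>

lemma (in left_module) add_diff_cancel: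
  "x \<in> carrier M \<Longrightarrow> y \<in> carrier M \<Longrightarrow> x \<oplus>\<^bsub>M\<^esub> (y \<ominus>\<^bsub>M\<^esub> x) = y"
  by (metis M.a_comm M.minus_closed M.r_neg1 M.add.inv_closed M.add.inv_inv a_minus_def)

locale qh_algebra = fd_algebra_ac K A for K :: "'k ring" (structure) and A :: "('k, 'a) module" (structure) +
  fixes n :: nat and L P I \<Delta> Nabla :: "nat \<Rightarrow> 'a umod"
  assumes simple_reps: "simple_representatives A n L"
    and P_cover: "\<And>l. l \<in> {1..n} \<Longrightarrow> projective_cover A (P l) (L l)"
    and I_hull: "\<And>l. l \<in> {1..n} \<Longrightarrow> injective_hull A (I l) (L l)"
    and Delta_std: "\<And>l. l \<in> {1..n} \<Longrightarrow> standard_module A L l (P l) (\<Delta> l)"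
    and Nabla_costd: "\<And>l. l \<in> {1..n} \<Longrightarrow> costandard_module A L l (I l) (Nabla l)"
    and qh: "quasi_hereditary A n L P \<Delta>"
begin

lemma L_simple: "l \<in> {1..n} \<Longrightarrow> simple_module A (L l)"
  using simple_reps by (simp add: simple_representatives_def)

lemma L_inj: "l \<in> {1..n} \<Longrightarrow> m \<in> {1..n} \<Longrightarrow> mod_iso A (L l) (L m) \<Longrightarrow> l = m"
  using simple_reps unfolding simple_representatives_def by blast

lemma fg:
  assumes "l \<in> {1..n}"
  shows "fg_module A (L l)" "fg_module A (P l)" "fg_module A (I l)" "fg_module A (\<Delta> l)" "fg_module A (Nabla l)"
  using simple_fg[OF L_simple[OF assms]] P_cover[OF assms] I_hull[OF assms] Delta_std[OF assms] Nabla_costd[OF assms]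
  by (auto simp: projective_cover_def projective_module_def injective_hull_def injective_module_def
      standard_module_def costandard_module_def)

lemmas lm = fg[THEN fg_moduleD]

text \<open>\<open>simple_representatives\<close> speaks of modules of the universe type. A simple
  module of another type, such as a quotient, is replaced by an isomorphic copy there.\<close>

lemma simple_classify:
  assumes "simple_module A S"
  shows "\<exists>l\<in>{1..n}. mod_iso A S (L l)"
proof -
  obtain T :: "'a umod" where T: "fg_module A T" "mod_iso A S T"
    using fg_module_in_universe[OF simple_fg[OF assms]] by blast
  then have "simple_module A T" using simple_iso[OF assms] fg_moduleD by blast
  then obtain l where "l \<in> {1..n}" "mod_iso A T (L l)" using simple_reps by (auto simp: simple_representatives_def)
  then show ?thesis using mod_iso_trans[OF simple_moduleD(1)[OF assms] T(2)] by blast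
qed

subsection \<open>Modules with bounded composition factors\<close>

text \<open>Phrased by subquotients so that it passes to submodules, images and extensions at once;
  \<open>comp_factors_in_iff_bd\<close> ties it back to the conditions in the definitions of
  standard and costandard modules.\<close>

definition bd :: "('a, 'm) module \<Rightarrow> nat \<Rightarrow> bool" where
  "bd M m \<longleftrightarrow> (\<forall>l\<in>{1..n}. subquot A M (L l) \<longrightarrow> l \<le> m)"

lemma bdD: "bd M m \<Longrightarrow> l \<in> {1..n} \<Longrightarrow> subquot A M (L l) \<Longrightarrow> l \<le> m"
  by (auto simp: bd_def)

lemma bd_mono: "bd M m \<Longrightarrow> m \<le> m' \<Longrightarrow> bd M m'"
  by (auto simp: bd_def intro: order_trans)

lemma bd_res: "left_module A M \<Longrightarrow> submodule N A M \<Longrightarrow> bd M m \<Longrightarrow> bd (M \<restriction> N) m"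
  using subquot_res unfolding bd_def by blast

lemma bd_image:
  "\<lbrakk>left_module A M; left_module A N; f \<in> mod_hom A M N; bd M m\<rbrakk> \<Longrightarrow> bd (N \<restriction> (f ` carrier M)) m"
  using subquot_image unfolding bd_def by blast

lemma bd_iso: "\<lbrakk>left_module A M; left_module A N; mod_iso A M N; bd N m\<rbrakk> \<Longrightarrow> bd M m"
  using subquot_iso unfolding bd_def by blast

lemma bd_ext:
  "\<lbrakk>left_module A M; left_module A Q; q \<in> mod_hom A M Q; bd (M \<restriction> a_kernel M Q q) m; bd Q m\<rbrakk> \<Longrightarrow> bd M m"
  using subquot_ext[OF _ _ _ L_simple] unfolding bd_def by blast

lemma bd_L: "l \<in> {1..n} \<Longrightarrow> bd (L l) l"
  using subquot_simple[OF L_simple L_simple] L_inj unfolding bd_def by blast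

lemma subquot_L: "l \<in> {1..n} \<Longrightarrow> subquot A (L l) (L l)"
  using submodule_carrier[OF lm(1)] mod_hom_id[OF lm(1)]
  by (intro subquotI[of "carrier (L l)" A _ "\<lambda>x\<in>carrier (L l). x"]) auto

lemma comp_factors_in_iff_bd:
  assumes "fg_module A M" "m \<le> n"
  shows "comp_factors_in A M (L ` {1..m}) \<longleftrightarrow> bd M m"
proof
  assume *: "comp_factors_in A M (L ` {1..m})"
  show "bd M m" unfolding bd_def
  proof (intro ballI impI)
    fix l assume l: "l \<in> {1..n}" "subquot A M (L l)"
    have "\<exists>T\<in>L ` {1..m}. mod_iso A (L l) T"
      by (rule comp_factors_in_subquot[OF assms(1) * L_simple[OF l(1)] l(2)]) (use assms(2) lm(1) in auto)
    then show "l \<le> m" using L_inj[OF l(1)] assms(2) by force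
  qed
next
  assume *: "bd M m"
  have M: "left_module A M" by (rule fg_moduleD[OF assms(1)])
  show "comp_factors_in A M (L ` {1..m})"
  proof (rule comp_factors_inI[OF M])
    fix U V assume UV: "submodule U A M" "submodule V A (M \<restriction> U)" "simple_module A (mod_quot (M \<restriction> U) V)"
    note U = res_left_module[OF M UV(1)]
    note q = mod_quot_facts[OF U UV(2)]
    obtain l where l: "l \<in> {1..n}" "mod_iso A (mod_quot (M \<restriction> U) V) (L l)"
      using simple_classify[OF UV(3)] by blast
    have "subquot A M (mod_quot (M \<restriction> U) V)" using q(2,3) by (intro subquotI[OF UV(1) q(2)]) auto
    then have "subquot A M (L l)" by (rule subquot_target_iso[OF M _ l(2)])
    then have "l \<in> {1..m}" using bdD[OF * l(1)] l(1) by auto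
    then show "\<exists>S\<in>L ` {1..m}. mod_iso A (mod_quot (M \<restriction> U) V) S" using l(2) by blast
  qed
qed

subsection \<open>Lifting and extension\<close>

text \<open>\<open>projective_module\<close> tests modules of the universe type. Here
  \<open>M\<close> and \<open>N\<close> may be quotients or products, so the lifting problem is
  moved to isomorphic copies and the answer is moved back; \<open>inj_extend\<close> does the same
  for injectivity.\<close>

lemma proj_lift:
  assumes "l \<in> {1..n}" "fg_module A M" "fg_module A N" "g \<in> mod_hom A M N" "g ` carrier M = carrier N"
    "h \<in> mod_hom A (P l) N"
  shows "\<exists>h'\<in>mod_hom A (P l) M. \<forall>x\<in>carrier (P l). g (h' x) = h x"
proof -
  note lM = fg_moduleD[OF assms(2)] and lN = fg_moduleD[OF assms(3)] and lP = lm(2)[OF assms(1)]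
  obtain M' :: "'a umod" where M': "fg_module A M'" "mod_iso A M M'"
    using fg_module_in_universe[OF assms(2)] by blast
  obtain N' :: "'a umod" where N': "fg_module A N'" "mod_iso A N N'"
    using fg_module_in_universe[OF assms(3)] by blast
  note lM' = fg_moduleD[OF M'(1)] and lN' = fg_moduleD[OF N'(1)]
  obtain u where u: "u \<in> mod_hom A M' M" "u ` carrier M' = carrier M"
    using mod_iso_sym[OF lM lM' M'(2)] by (auto simp: mod_iso_iff_surj_inj)
  obtain v where v: "v \<in> mod_hom A N N'" "inj_on v (carrier N)" "v ` carrier N = carrier N'"
    using N'(2) by (auto simp: mod_iso_iff_surj_inj)
  let ?g = "compose (carrier M') v (compose (carrier M') g u)"
  have g: "?g \<in> mod_hom A M' N'"
    by (rule mod_hom_comp[OF mod_hom_comp[OF u(1) assms(4) lM'] v(1) lM'])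
  have "?g ` carrier M' = v ` g ` u ` carrier M'" by (auto simp: compose_def image_image)
  then have gs: "?g ` carrier M' = carrier N'" by (simp add: u(2) assms(5) v(3))
  obtain h' where h': "h' \<in> mod_hom A (P l) M'" "compose (carrier (P l)) ?g h' = compose (carrier (P l)) v h"
    using P_cover[OF assms(1)] M'(1) N'(1) g gs mod_hom_comp[OF assms(6) v(1) lP]
    unfolding projective_cover_def projective_module_def by metis
  have "g (u (h' x)) = h x" if x: "x \<in> carrier (P l)" for x
  proof -
    have "v (g (u (h' x))) = v (h x)"
      using fun_cong[OF h'(2), of x] x mod_homD(1)[OF h'(1) x] by (simp add: compose_def)
    then show ?thesis
      using inj_onD[OF v(2)] mod_homD(1)[OF assms(6) x] mod_homD(1)[OF assms(4)]
        mod_homD(1)[OF u(1)] mod_homD(1)[OF h'(1) x] by blast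
  qed
  then show ?thesis using mod_hom_comp[OF h'(1) u(1) lP]
    by (intro bexI[of _ "compose (carrier (P l)) u h'"]) (auto simp: compose_def)
qed

lemma inj_extend:
  assumes "l \<in> {1..n}" "fg_module A M" "fg_module A N" "g \<in> mod_hom A M N" "inj_on g (carrier M)"
    "h \<in> mod_hom A M (I l)"
  shows "\<exists>h'\<in>mod_hom A N (I l). \<forall>x\<in>carrier M. h' (g x) = h x"
proof -
  note lM = fg_moduleD[OF assms(2)] and lN = fg_moduleD[OF assms(3)] and lI = lm(3)[OF assms(1)]
  obtain M' :: "'a umod" where M': "fg_module A M'" "mod_iso A M M'"
    using fg_module_in_universe[OF assms(2)] by blast
  obtain N' :: "'a umod" where N': "fg_module A N'" "mod_iso A N N'"
    using fg_module_in_universe[OF assms(3)] by blast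
  note lM' = fg_moduleD[OF M'(1)] and lN' = fg_moduleD[OF N'(1)]
  obtain u where u: "u \<in> mod_hom A M' M" "inj_on u (carrier M')" "u ` carrier M' = carrier M"
    using mod_iso_sym[OF lM lM' M'(2)] by (auto simp: mod_iso_iff_surj_inj)
  obtain v where v: "v \<in> mod_hom A N N'" "inj_on v (carrier N)" "v ` carrier N = carrier N'"
    using N'(2) by (auto simp: mod_iso_iff_surj_inj)
  let ?g = "compose (carrier M') v (compose (carrier M') g u)"
  have g: "?g \<in> mod_hom A M' N'"
    by (rule mod_hom_comp[OF mod_hom_comp[OF u(1) assms(4) lM'] v(1) lM'])
  have gi: "inj_on ?g (carrier M')"
  proof (rule inj_onI)
    fix x y assume xy: "x \<in> carrier M'" "y \<in> carrier M'" "?g x = ?g y"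
    have "u x \<in> carrier M" "u y \<in> carrier M" using xy mod_homD(1)[OF u(1)] by auto
    then show "x = y"
      using xy inj_onD[OF v(2)] inj_onD[OF assms(5)] inj_onD[OF u(2)] mod_homD(1)[OF assms(4)]
      by (simp add: compose_def)
  qed
  obtain h' where h': "h' \<in> mod_hom A N' (I l)" "compose (carrier M') h' ?g = compose (carrier M') h u"
    using I_hull[OF assms(1)] M'(1) N'(1) g gi mod_hom_comp[OF u(1) assms(6) lM']
    unfolding injective_hull_def injective_module_def by metis
  have "h' (v (g x)) = h x" if x: "x \<in> carrier M" for x
  proof -
    obtain y where y: "y \<in> carrier M'" "x = u y" using x u(3) by blast
    then show ?thesis using fun_cong[OF h'(2), of y] by (simp add: compose_def)
  qed
  then show ?thesis using mod_hom_comp[OF v(1) h'(1) lN] mod_homD(1)[OF assms(4)]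
    by (intro bexI[of _ "compose (carrier N) h' v"]) (auto simp: compose_def)
qed

section \<open>Projective presentations of standard modules\<close>

lemma std_kernel_unique: "std_kernel A L l M N \<Longrightarrow> std_kernel A L l M N' \<Longrightarrow> N = N'"
  unfolding std_kernel_def by blast

text \<open>The definition of standard module and the quasi-hereditary condition each assert the
  existence of a kernel. Both are least submodules of the same kind, hence equal, so the filtration
  from one is available for the presentation from the other.\<close>

lemma Delta_cover_ex:
  assumes l: "l \<in> {1..n}"
  shows "\<exists>\<rho>. \<rho> \<in> mod_hom A (P l) (\<Delta> l) \<and> \<rho> ` carrier (P l) = carrier (\<Delta> l) \<and>
    std_kernel A L l (P l) (a_kernel (P l) (\<Delta> l) \<rho>) \<and>
    filtered_by A (P l \<restriction> a_kernel (P l) (\<Delta> l) \<rho>) (\<Delta> ` {l<..n})"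
proof -
  obtain N where N: "std_kernel A L l (P l) N" "mod_iso A (mod_quot (P l) N) (\<Delta> l)"
    using Delta_std[OF l] by (auto simp: standard_module_def)
  obtain N' where N': "std_kernel A L l (P l) N'" "filtered_by A (P l \<restriction> N') (\<Delta> ` {l<..n})"
    using qh l unfolding quasi_hereditary_def by blast
  have "N' = N" using std_kernel_unique N(1) N'(1) by blast
  then show ?thesis
    using mod_iso_quot_hom[OF lm(2)[OF l] _ N(2) lm(4)[OF l]] N N' unfolding std_kernel_def by auto
qed

definition rho :: "nat \<Rightarrow> (nat \<Rightarrow> 'a) \<Rightarrow> nat \<Rightarrow> 'a" where
  "rho l = (SOME \<rho>. \<rho> \<in> mod_hom A (P l) (\<Delta> l) \<and> \<rho> ` carrier (P l) = carrier (\<Delta> l) \<and>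
    std_kernel A L l (P l) (a_kernel (P l) (\<Delta> l) \<rho>) \<and>
    filtered_by A (P l \<restriction> a_kernel (P l) (\<Delta> l) \<rho>) (\<Delta> ` {l<..n}))"

lemma rho:
  assumes "l \<in> {1..n}"
  shows "rho l \<in> mod_hom A (P l) (\<Delta> l)" "rho l ` carrier (P l) = carrier (\<Delta> l)"
    "std_kernel A L l (P l) (a_kernel (P l) (\<Delta> l) (rho l))"
    "filtered_by A (P l \<restriction> a_kernel (P l) (\<Delta> l) (rho l)) (\<Delta> ` {l<..n})"
  using someI_ex[OF Delta_cover_ex[OF assms]] unfolding rho_def by auto

text \<open>The image of \<open>g\<close> is a quotient of \<open>P l\<close> bounded by
  \<open>l\<close>, and the kernel of \<open>rho l\<close> is the least submodule with such a
  quotient.\<close>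

lemma rho_universal:
  assumes l: "l \<in> {1..n}" and M: "left_module A M" and g: "g \<in> mod_hom A (P l) M" and "bd M l"
    and "x \<in> carrier (P l)" "rho l x = \<zero>\<^bsub>\<Delta> l\<^esub>"
  shows "g x = \<zero>\<^bsub>M\<^esub>"
proof -
  note lP = lm(2)[OF l]
  let ?N = "a_kernel (P l) M g"
  have N: "submodule ?N A (P l)" by (rule submodule_kernel[OF lP M g])
  note q = mod_quot_facts[OF lP N]
  have im: "submodule (g ` carrier (P l)) A M"
    by (rule submodule_image[OF lP M g submodule_carrier[OF lP]])
  have "mod_iso A (mod_quot (P l) ?N) (M \<restriction> (g ` carrier (P l)))"
    by (rule mod_quot_cong_iso[OF lP res_left_module[OF M im] mod_hom_corestrict[OF g]])
      (auto simp: a_kernel_eq)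
  then have "bd (mod_quot (P l) ?N) l"
    using bd_iso[OF q(1) res_left_module[OF M im]] bd_res[OF M im assms(4)] by blast
  moreover have "fg_module A (mod_quot (P l) ?N)"
    by (rule fg_module_surj_image[OF fg(2)[OF l] q(1-3)])
  ultimately have "comp_factors_in A (mod_quot (P l) ?N) (L ` {1..l})"
    using comp_factors_in_iff_bd l by auto
  then have "a_kernel (P l) (\<Delta> l) (rho l) \<subseteq> ?N" using rho(3)[OF l] N unfolding std_kernel_def by blast
  then show ?thesis using assms(5,6) by (auto simp: a_kernel_eq)
qed

lemma bd_Delta:
  assumes l: "l \<in> {1..n}"
  shows "bd (\<Delta> l) l"
proof -
  let ?N = "a_kernel (P l) (\<Delta> l) (rho l)"
  note lP = lm(2)[OF l]
  have N: "submodule ?N A (P l)" by (rule submodule_kernel[OF lP lm(4)[OF l] rho(1)[OF l]])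
  note q = mod_quot_facts[OF lP N]
  have fq: "fg_module A (mod_quot (P l) ?N)"
    by (rule fg_module_surj_image[OF fg(2)[OF l] q(1-3)])
  have iso: "mod_iso A (mod_quot (P l) ?N) (\<Delta> l)"
    by (rule mod_quot_cong_iso[OF lP lm(4)[OF l] rho(1,2)[OF l] refl])
  have "bd (mod_quot (P l) ?N) l"
    using rho(3)[OF l] comp_factors_in_iff_bd[OF fq] l unfolding std_kernel_def by auto
  then show ?thesis
    using bd_iso[OF lm(4)[OF l] q(1) mod_iso_sym[OF q(1) lm(4)[OF l] iso]] by blast
qed

section \<open>Embeddings of costandard modules into injective hulls\<close>

lemma Nabla_hull_ex:
  assumes l: "l \<in> {1..n}"
  shows "\<exists>\<iota>. \<iota> \<in> mod_hom A (Nabla l) (I l) \<and> inj_on \<iota> (carrier (Nabla l)) \<and> bd (Nabla l) l \<and>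
    (\<forall>N. submodule N A (I l) \<and> bd (I l \<restriction> N) l \<longrightarrow> N \<subseteq> \<iota> ` carrier (Nabla l))"
proof -
  note lI = lm(3)[OF l]
  obtain N where N: "submodule N A (I l)" "comp_factors_in A (I l \<restriction> N) (L ` {1..l})"
    "\<And>N'. submodule N' A (I l) \<and> comp_factors_in A (I l \<restriction> N') (L ` {1..l}) \<Longrightarrow> N' \<subseteq> N"
    "mod_iso A (I l \<restriction> N) (Nabla l)"
    using Nabla_costd[OF l] unfolding costandard_module_def by auto
  note lN = res_left_module[OF lI N(1)]
  have iff: "comp_factors_in A (I l \<restriction> N') (L ` {1..l}) \<longleftrightarrow> bd (I l \<restriction> N') l"
    if "submodule N' A (I l)" for N'
    using comp_factors_in_iff_bd[OF fg_module_res[OF fg(3)[OF l] that]] l by auto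
  have iso: "mod_iso A (Nabla l) (I l \<restriction> N)" by (rule mod_iso_sym[OF lN lm(5)[OF l] N(4)])
  have "bd (Nabla l) l" using bd_iso[OF lm(5)[OF l] lN iso] N(1,2) iff by blast
  moreover obtain \<iota> where \<iota>: "\<iota> \<in> mod_hom A (Nabla l) (I l \<restriction> N)" "inj_on \<iota> (carrier (Nabla l))"
    "\<iota> ` carrier (Nabla l) = N"
    using iso by (auto simp: mod_iso_iff_surj_inj)
  moreover have "\<iota> \<in> mod_hom A (Nabla l) (I l)"
    by (rule mod_hom_expand[OF \<iota>(1) submoduleD(1)[OF N(1)]])
  moreover have "N' \<subseteq> \<iota> ` carrier (Nabla l)" if "submodule N' A (I l)" "bd (I l \<restriction> N') l" for N'
    using N(3)[of N'] iff that \<iota>(3) by simp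
  ultimately show ?thesis using \<iota>(2) by (intro exI[of _ \<iota>]) simp
qed

definition iota :: "nat \<Rightarrow> (nat \<Rightarrow> 'a) \<Rightarrow> nat \<Rightarrow> 'a" where
  "iota l = (SOME \<iota>. \<iota> \<in> mod_hom A (Nabla l) (I l) \<and> inj_on \<iota> (carrier (Nabla l)) \<and> bd (Nabla l) l \<and>
    (\<forall>N. submodule N A (I l) \<and> bd (I l \<restriction> N) l \<longrightarrow> N \<subseteq> \<iota> ` carrier (Nabla l)))"

lemma iota:
  assumes "l \<in> {1..n}"
  shows "iota l \<in> mod_hom A (Nabla l) (I l)" "inj_on (iota l) (carrier (Nabla l))" "bd (Nabla l) l"
    "\<lbrakk>submodule N A (I l); bd (I l \<restriction> N) l\<rbrakk> \<Longrightarrow> N \<subseteq> iota l ` carrier (Nabla l)"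
  using someI_ex[OF Nabla_hull_ex[OF assms], folded iota_def] by simp_all

text \<open>Dual to \<open>rho_universal\<close>: the image of \<open>g\<close> is bounded by
  \<open>l\<close>, and \<open>iota l\<close> maps onto the largest submodule with this
  property.\<close>

lemma iota_universal:
  assumes l: "l \<in> {1..n}" and "left_module A M" "g \<in> mod_hom A M (I l)" "bd M l"
  shows "g ` carrier M \<subseteq> iota l ` carrier (Nabla l)"
  by (rule iota(4)[OF l submodule_image[OF assms(2) lm(3)[OF l] assms(3) submodule_carrier[OF assms(2)]]
      bd_image[OF assms(2) lm(3)[OF l] assms(3,4)]])

section \<open>Tops of standard modules and socles of costandard modules\<close>

definition rr :: "nat \<Rightarrow> (nat \<Rightarrow> 'a) \<Rightarrow> nat \<Rightarrow> 'a" where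
  "rr l = (SOME r. r \<in> mod_hom A (\<Delta> l) (L l) \<and> r ` carrier (\<Delta> l) = carrier (L l) \<and>
    filtered_by A (\<Delta> l \<restriction> a_kernel (\<Delta> l) (L l) r) (L ` {1..<l}))"

text \<open>That this kernel deserves its name, containing every proper submodule of
  \<open>\<Delta> l\<close>, is the content of \<open>Delta_rad\<close>.\<close>

abbreviation rad :: "nat \<Rightarrow> (nat \<Rightarrow> 'a) set" where
  "rad l \<equiv> a_kernel (\<Delta> l) (L l) (rr l)"

lemma rr:
  assumes "l \<in> {1..n}"
  shows "rr l \<in> mod_hom A (\<Delta> l) (L l)" "rr l ` carrier (\<Delta> l) = carrier (L l)"
    "filtered_by A (\<Delta> l \<restriction> rad l) (L ` {1..<l})"
proof -
  have "\<exists>r. r \<in> mod_hom A (\<Delta> l) (L l) \<and> r ` carrier (\<Delta> l) = carrier (L l) \<and>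
    filtered_by A (\<Delta> l \<restriction> a_kernel (\<Delta> l) (L l) r) (L ` {1..<l})"
    using qh assms unfolding quasi_hereditary_def by blast
  from someI_ex[OF this]
  show "rr l \<in> mod_hom A (\<Delta> l) (L l)" "rr l ` carrier (\<Delta> l) = carrier (L l)"
    "filtered_by A (\<Delta> l \<restriction> rad l) (L ` {1..<l})" unfolding rr_def by auto
qed

lemma rad_submodule: "l \<in> {1..n} \<Longrightarrow> submodule (rad l) A (\<Delta> l)"
  by (rule submodule_kernel[OF lm(4) lm(1) rr(1)])

text \<open>The multiplicity-one part of quasi-heredity: the radical is filtered by simple modules
  of smaller index, and every simple subquotient must occur in one of the filtration
  factors.\<close>

lemma bd_rad:
  assumes l: "l \<in> {1..n}"
  shows "bd (\<Delta> l \<restriction> rad l) (l - 1)"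
  unfolding bd_def
proof (intro ballI impI)
  fix m assume m: "m \<in> {1..n}" "subquot A (\<Delta> l \<restriction> rad l) (L m)"
  have "\<exists>E\<in>L ` {1..<l}. subquot A E (L m)"
    by (rule filtered_by_subquot[OF res_left_module[OF lm(4)[OF l] rad_submodule[OF l]] rr(3)[OF l] _ L_simple[OF m(1)] m(2)])
      (use l lm(1) in auto)
  then show "m \<le> l - 1" using bdD[OF bd_L m(1)] l by force
qed

text \<open>Two maps onto \<open>L l\<close> compete, chosen independently: the covering map
  \<open>p\<close> and the composite of \<open>rho l\<close> with \<open>rr l\<close>. Superfluity
  of the kernel of \<open>p\<close> forces their kernels to agree, so the composite also detects
  which submodules are everything.\<close>

lemma P_rad:
  assumes l: "l \<in> {1..n}" and U: "submodule U A (P l)" and "x \<in> U" "rr l (rho l x) \<noteq> \<zero>\<^bsub>L l\<^esub>"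
  shows "U = carrier (P l)"
proof -
  note lP = lm(2)[OF l] and S = simple_moduleD[OF L_simple[OF l]]
  obtain p where p: "p \<in> mod_hom A (P l) (L l)" "p ` carrier (P l) = carrier (L l)"
    "\<And>U. submodule U A (P l) \<Longrightarrow> U <+>\<^bsub>P l\<^esub> a_kernel (P l) (L l) p = carrier (P l) \<Longrightarrow> U = carrier (P l)"
    using P_cover[OF l] unfolding projective_cover_def by blast
  interpret N: left_module A "P l" by (rule lP)
  let ?N = "a_kernel (P l) (L l) p"
  have N: "submodule ?N A (P l)" by (rule submodule_kernel[OF lP S(1) p(1)])
  \<comment> \<open>Superfluity of \<open>?N\<close>: a submodule not inside it maps onto the simple
    module \<open>L l\<close>, so together with \<open>?N\<close> it fills
    \<open>P l\<close>.\<close>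
  have maxl: "U = carrier (P l)" if U: "submodule U A (P l)" "x \<in> U" "p x \<noteq> \<zero>\<^bsub>L l\<^esub>" for U x
  proof (rule p(3)[OF U(1)])
    have pU: "p ` U = carrier (L l)"
      using S(3)[OF submodule_image[OF lP S(1) p(1) U(1)]] U(2,3) by blast
    note UN = sum_submodule[OF lP U(1) N]
    have "y \<in> U <+>\<^bsub>P l\<^esub> ?N" if y: "y \<in> carrier (P l)" for y
    proof -
      obtain u where u: "u \<in> U" "p y = p u" using pU mod_homD(1)[OF p(1) y] by (metis imageE)
      have uP: "u \<in> carrier (P l)" using submodule_memD[OF U(1) u(1)] .
      have "y \<ominus>\<^bsub>P l\<^esub> u \<in> ?N" using mod_hom_eq_iff_diff[OF lP S(1) p(1) y uP] u(2) by simp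
      then have "u \<oplus>\<^bsub>P l\<^esub> (y \<ominus>\<^bsub>P l\<^esub> u) \<in> U <+>\<^bsub>P l\<^esub> ?N"
        using submoduleD(3)[OF UN(1)] UN(2,3) u(1) by blast
      then show ?thesis using y uP by (simp add: N.add_diff_cancel)
    qed
    then show "U <+>\<^bsub>P l\<^esub> ?N = carrier (P l)" using submoduleD(1)[OF UN(1)] by blast
  qed
  note rh = mod_hom_comp[OF rho(1)[OF l] rr(1)[OF l] lP]
  let ?N' = "a_kernel (P l) (L l) (compose (carrier (P l)) (rr l) (rho l))"
  have N': "submodule ?N' A (P l)" by (rule submodule_kernel[OF lP S(1) rh])
  have xP: "x \<in> carrier (P l)" using submodule_memD[OF U assms(3)] .
  have "x \<notin> ?N'" using xP assms(4) by (simp add: a_kernel_eq compose_def)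
  then have "?N' \<noteq> carrier (P l)" using xP by blast
  then have N'N: "?N' \<subseteq> ?N" using maxl[OF N'] submoduleD(1)[OF N'] by (auto simp: a_kernel_eq)
  \<comment> \<open>Otherwise \<open>?N\<close> contains \<open>x\<close>, so the composite maps it
    onto \<open>L l\<close>; as it also contains the kernel \<open>?N'\<close>, it would be all of
    \<open>P l\<close>, against surjectivity of \<open>p\<close>.\<close>
  have "p x \<noteq> \<zero>\<^bsub>L l\<^esub>"
  proof
    assume "p x = \<zero>\<^bsub>L l\<^esub>"
    then have xN: "x \<in> ?N" using xP by (simp add: a_kernel_eq)
    let ?rh = "compose (carrier (P l)) (rr l) (rho l)"
    have rN: "?rh ` ?N = carrier (L l)"
      using S(3)[OF submodule_image[OF lP S(1) rh N]] xN assms(4) xP by (force simp: compose_def)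
    have "y \<in> ?N" if y: "y \<in> carrier (P l)" for y
    proof -
      have "?rh y \<in> ?rh ` ?N" unfolding rN by (rule mod_homD(1)[OF rh y])
      then obtain u where u: "?rh y = ?rh u" "u \<in> ?N" by (rule imageE)
      have uP: "u \<in> carrier (P l)" using submodule_memD[OF N u(2)] .
      have "y \<ominus>\<^bsub>P l\<^esub> u \<in> ?N" using mod_hom_eq_iff_diff[OF lP S(1) rh y uP] u(1) N'N by blast
      then have "u \<oplus>\<^bsub>P l\<^esub> (y \<ominus>\<^bsub>P l\<^esub> u) \<in> ?N" using submoduleD(3)[OF N] u(2) by blast
      then show ?thesis using y uP by (simp add: N.add_diff_cancel)
    qed
    then have "p ` carrier (P l) \<subseteq> {\<zero>\<^bsub>L l\<^esub>}" by (auto simp: a_kernel_eq)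
    then show False using p(2) S(2) submoduleD(2)[OF submodule_carrier[OF S(1)]] by auto
  qed
  then show ?thesis using maxl[OF U assms(3)] by blast
qed

lemma Delta_rad:
  assumes l: "l \<in> {1..n}" and U: "submodule U A (\<Delta> l)" and "x \<in> U" "rr l x \<noteq> \<zero>\<^bsub>L l\<^esub>"
  shows "U = carrier (\<Delta> l)"
proof -
  obtain y where y: "y \<in> carrier (P l)" "x = rho l y"
    using rho(2)[OF l] submodule_memD[OF U assms(3)] by blast
  have "{y \<in> carrier (P l). rho l y \<in> U} = carrier (P l)"
    by (rule P_rad[OF l submodule_vimage[OF lm(2)[OF l] lm(4)[OF l] rho(1)[OF l] U], of y])
      (use y assms in auto)
  then have "carrier (\<Delta> l) \<subseteq> U" unfolding rho(2)[OF l, symmetric] by blast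
  then show ?thesis using submoduleD(1)[OF U] by blast
qed

text \<open>The embedding of \<open>L l\<close> into its hull lands in \<open>Nabla l\<close>
  because \<open>L l\<close> is bounded by \<open>l\<close>. Essentiality makes every nonzero
  submodule of \<open>Nabla l\<close> meet its image, and simplicity turns meeting into
  containing.\<close>

lemma socle_ex:
  assumes l: "l \<in> {1..n}"
  shows "\<exists>s. s \<in> mod_hom A (L l) (Nabla l) \<and> inj_on s (carrier (L l)) \<and>
    (\<forall>U. submodule U A (Nabla l) \<and> U \<noteq> {\<zero>\<^bsub>Nabla l\<^esub>} \<longrightarrow> s ` carrier (L l) \<subseteq> U)"
proof -
  note lI = lm(3)[OF l] and lN = lm(5)[OF l] and S = simple_moduleD[OF L_simple[OF l]]
  obtain q where q: "q \<in> mod_hom A (L l) (I l)" "inj_on q (carrier (L l))"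
    "\<And>U. submodule U A (I l) \<Longrightarrow> U \<inter> q ` carrier (L l) = {\<zero>\<^bsub>I l\<^esub>} \<Longrightarrow> U = {\<zero>\<^bsub>I l\<^esub>}"
    using I_hull[OF l] unfolding injective_hull_def by blast
  obtain s where s: "s \<in> mod_hom A (L l) (Nabla l)" "\<forall>x\<in>carrier (L l). iota l (s x) = q x"
    using hom_lift_inj[OF S(1) lN lI iota(1,2)[OF l] q(1) iota_universal[OF l S(1) q(1) bd_L[OF l]]] by blast
  have inj: "inj_on s (carrier (L l))"
    using q(2) s(2) unfolding inj_on_def by metis
  have "s ` carrier (L l) \<subseteq> U" if U: "submodule U A (Nabla l)" "U \<noteq> {\<zero>\<^bsub>Nabla l\<^esub>}" for U
  proof -
    obtain u where u: "u \<in> U" "u \<noteq> \<zero>\<^bsub>Nabla l\<^esub>" using submoduleD(2)[OF U(1)] U(2) by blast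
    have uN: "u \<in> carrier (Nabla l)" "\<zero>\<^bsub>Nabla l\<^esub> \<in> carrier (Nabla l)"
      using submodule_memD[OF U(1)] u(1) submoduleD(2)[OF U(1)] by auto
    have z: "iota l \<zero>\<^bsub>Nabla l\<^esub> = \<zero>\<^bsub>I l\<^esub>" by (rule mod_hom_zero[OF lN lI iota(1)[OF l]])
    have iU: "submodule (iota l ` U) A (I l)" by (rule submodule_image[OF lN lI iota(1)[OF l] U(1)])
    have "iota l u \<noteq> \<zero>\<^bsub>I l\<^esub>" using inj_onD[OF iota(2)[OF l] _ uN] u(2) z by auto
    then have "iota l ` U \<noteq> {\<zero>\<^bsub>I l\<^esub>}" using u(1) by blast
    then have "iota l ` U \<inter> q ` carrier (L l) \<noteq> {\<zero>\<^bsub>I l\<^esub>}" using q(3)[OF iU] by blast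
    moreover have "\<zero>\<^bsub>I l\<^esub> \<in> iota l ` U \<inter> q ` carrier (L l)"
      using submoduleD(2)[OF iU] submoduleD(2)[OF submodule_image[OF S(1) lI q(1) submodule_carrier[OF S(1)]]] by blast
    ultimately obtain w where "w \<in> iota l ` U" "w \<in> q ` carrier (L l)" "w \<noteq> \<zero>\<^bsub>I l\<^esub>" by blast
    then obtain x v where x: "x \<in> carrier (L l)" "q x \<noteq> \<zero>\<^bsub>I l\<^esub>" "v \<in> U" "q x = iota l v"
      by (metis imageE)
    let ?V = "{x \<in> carrier (L l). s x \<in> U}"
    have "s x = v"
      using inj_onD[OF iota(2)[OF l]] s(2) x mod_homD(1)[OF s(1) x(1)] submodule_memD[OF U(1) x(3)] by metis
    then have "x \<in> ?V" "x \<noteq> \<zero>\<^bsub>L l\<^esub>" using x mod_hom_zero[OF S(1) lI q(1)] by auto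
    then have "?V = carrier (L l)" using S(3)[OF submodule_vimage[OF S(1) lN s(1) U(1)]] by blast
    then show ?thesis by blast
  qed
  then show ?thesis using s(1) inj by blast
qed

definition sg :: "nat \<Rightarrow> (nat \<Rightarrow> 'a) \<Rightarrow> nat \<Rightarrow> 'a" where
  "sg l = (SOME s. s \<in> mod_hom A (L l) (Nabla l) \<and> inj_on s (carrier (L l)) \<and>
    (\<forall>U. submodule U A (Nabla l) \<and> U \<noteq> {\<zero>\<^bsub>Nabla l\<^esub>} \<longrightarrow> s ` carrier (L l) \<subseteq> U))"

lemma sg:
  assumes "l \<in> {1..n}"
  shows "sg l \<in> mod_hom A (L l) (Nabla l)" "inj_on (sg l) (carrier (L l))"
    "\<lbrakk>submodule U A (Nabla l); U \<noteq> {\<zero>\<^bsub>Nabla l\<^esub>}\<rbrakk> \<Longrightarrow> sg l ` carrier (L l) \<subseteq> U"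
  using someI_ex[OF socle_ex[OF assms], folded sg_def] by simp_all

lemma sg_zero_iff:
  "l \<in> {1..n} \<Longrightarrow> x \<in> carrier (L l) \<Longrightarrow> sg l x = \<zero>\<^bsub>Nabla l\<^esub> \<longleftrightarrow> x = \<zero>\<^bsub>L l\<^esub>"
  using mod_hom_zero[OF lm(1) lm(5) sg(1), of l] inj_onD[OF sg(2), of l x "\<zero>\<^bsub>L l\<^esub>"]
    submoduleD(2)[OF submodule_carrier[OF lm(1), of l]] by auto

subsection \<open>Homomorphisms from standard and into costandard modules\<close>

text \<open>A lift exists on \<open>P l\<close>; since its target is bounded by \<open>l\<close>,
  \<open>rho_universal\<close> lets it descend to \<open>\<Delta> l\<close>.\<close>

lemma Delta_lift:
  assumes l: "l \<in> {1..n}" and M: "fg_module A M" "bd M l" and N: "left_module A N"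
    and g: "g \<in> mod_hom A M N" "g ` carrier M = carrier N" and h: "h \<in> mod_hom A (\<Delta> l) N"
  shows "\<exists>h'\<in>mod_hom A (\<Delta> l) M. \<forall>x\<in>carrier (\<Delta> l). g (h' x) = h x"
proof -
  note lM = fg_moduleD[OF M(1)] and lP = lm(2)[OF l] and lD = lm(4)[OF l]
  note r = rho(1,2)[OF l]
  obtain k where k: "k \<in> mod_hom A (P l) M" "\<forall>x\<in>carrier (P l). g (k x) = h (rho l x)"
    using proj_lift[OF l M(1) fg_module_surj_image[OF M(1) N g] g mod_hom_comp[OF r(1) h lP]]
    by (auto simp: compose_def)
  obtain h' where h': "h' \<in> mod_hom A (\<Delta> l) M" "\<forall>x\<in>carrier (P l). h' (rho l x) = k x"
    using hom_factor[OF lP lD lM r k(1) rho_universal[OF l lM k(1) M(2)]] by blast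
  have "g (h' x) = h x" if "x \<in> carrier (\<Delta> l)" for x
    using that k(2) h'(2) unfolding r(2)[symmetric] by auto
  then show ?thesis using h'(1) by blast
qed

text \<open>An extension into \<open>I l\<close> exists by injectivity, and boundedness of
  \<open>N\<close> forces it into the image of \<open>iota l\<close>.\<close>

lemma Nabla_extend:
  assumes l: "l \<in> {1..n}" and M: "fg_module A M" and N: "fg_module A N" "bd N l"
    and g: "g \<in> mod_hom A M N" "inj_on g (carrier M)" and h: "h \<in> mod_hom A M (Nabla l)"
  shows "\<exists>h'\<in>mod_hom A N (Nabla l). \<forall>x\<in>carrier M. h' (g x) = h x"
proof -
  note lM = fg_moduleD[OF M] and lN = fg_moduleD[OF N(1)] and lI = lm(3)[OF l] and lNab = lm(5)[OF l]
  obtain k where k: "k \<in> mod_hom A N (I l)" "\<forall>x\<in>carrier M. k (g x) = iota l (h x)"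
    using inj_extend[OF l M N(1) g mod_hom_comp[OF h iota(1)[OF l] lM]] by (auto simp: compose_def)
  obtain h' where h': "h' \<in> mod_hom A N (Nabla l)" "\<forall>x\<in>carrier N. iota l (h' x) = k x"
    using hom_lift_inj[OF lN lNab lI iota(1,2)[OF l] k(1) iota_universal[OF l lN k(1) N(2)]] by blast
  have "h' (g x) = h x" if x: "x \<in> carrier M" for x
  proof (rule inj_onD[OF iota(2)[OF l]])
    show "iota l (h' (g x)) = iota l (h x)" using k(2) h'(2) mod_homD(1)[OF g(1) x] x by simp
  qed (use mod_homD(1)[OF h'(1)] mod_homD(1)[OF g(1)] mod_homD(1)[OF h] x in auto)
  then show ?thesis using h'(1) by blast
qed

lemma Delta_kernel:
  assumes l: "l \<in> {1..n}" and M: "left_module A M" and f: "f \<in> mod_hom A (\<Delta> l) M"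
    and x: "x \<in> carrier (\<Delta> l)" "f x \<noteq> \<zero>\<^bsub>M\<^esub>" and y: "y \<in> carrier (\<Delta> l)"
      "f y = \<zero>\<^bsub>M\<^esub>"
  shows "rr l y = \<zero>\<^bsub>L l\<^esub>"
proof (rule ccontr)
  assume "rr l y \<noteq> \<zero>\<^bsub>L l\<^esub>"
  then have "a_kernel (\<Delta> l) M f = carrier (\<Delta> l)"
    using Delta_rad[OF l submodule_kernel[OF lm(4)[OF l] M f], of y] y by (auto simp: a_kernel_eq)
  then show False using x by (auto simp: a_kernel_eq)
qed

text \<open>The kernel of a nonzero map lies in the radical, so the projection of
  \<open>\<Delta> l\<close> to its top factors through the image of \<open>f\<close>.\<close>

lemma Delta_hom_subquot:
  assumes l: "l \<in> {1..n}" and M: "left_module A M" and f: "f \<in> mod_hom A (\<Delta> l) M"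
    and x: "x \<in> carrier (\<Delta> l)" "f x \<noteq> \<zero>\<^bsub>M\<^esub>"
  shows "subquot A M (L l)"
proof -
  note lD = lm(4)[OF l]
  let ?W = "f ` carrier (\<Delta> l)"
  have W: "submodule ?W A M" by (rule submodule_image[OF lD M f submodule_carrier[OF lD]])
  obtain g where g: "g \<in> mod_hom A (M \<restriction> ?W) (L l)" "\<forall>x\<in>carrier (\<Delta> l). g (f x) = rr l x"
    using hom_factor[OF lD res_left_module[OF M W] lm(1)[OF l] mod_hom_corestrict[OF f] _ rr(1)[OF l]]
      Delta_kernel[OF l M f x] by auto
  have "g ` ?W = carrier (L l)"
    unfolding rr(2)[OF l, symmetric] image_image using g(2) by (intro image_cong) auto
  then show ?thesis using subquotI[OF W g(1)] by blast
qed

text \<open>A nonzero image in \<open>Nabla l\<close> contains the socle, a copy of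
  \<open>L l\<close>.\<close>

lemma Nabla_hom_subquot:
  assumes l: "l \<in> {1..n}" and M: "left_module A M" and f: "f \<in> mod_hom A M (Nabla l)"
    and x: "x \<in> carrier M" "f x \<noteq> \<zero>\<^bsub>Nabla l\<^esub>"
  shows "subquot A M (L l)"
proof -
  note lN = lm(5)[OF l]
  let ?W = "f ` carrier M"
  have W: "submodule ?W A (Nabla l)" by (rule submodule_image[OF M lN f submodule_carrier[OF M]])
  have "?W \<noteq> {\<zero>\<^bsub>Nabla l\<^esub>}" using x by blast
  then have "sg l \<in> mod_hom A (L l) (Nabla l \<restriction> ?W)"
    by (intro mod_hom_corestrict[OF sg(1)[OF l]] sg(3)[OF l W])
  then have "subquot A (Nabla l \<restriction> ?W) (L l)"
    by (rule subquot_inj[OF lm(1)[OF l] res_left_module[OF lN W] _ sg(2)[OF l] subquot_L[OF l]])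
  then show ?thesis by (rule subquot_image[OF M lN f])
qed

lemma Delta_hom_zero:
  assumes "l \<in> {1..n}" "left_module A M" "f \<in> mod_hom A (\<Delta> l) M" "bd M m" "m < l" "x \<in> carrier (\<Delta> l)"
  shows "f x = \<zero>\<^bsub>M\<^esub>"
  using Delta_hom_subquot[OF assms(1-3,6)] bdD[OF assms(4,1)] assms(5) by linarith

lemma Nabla_hom_zero:
  assumes "l \<in> {1..n}" "left_module A M" "f \<in> mod_hom A M (Nabla l)" "bd M m" "m < l" "x \<in> carrier M"
  shows "f x = \<zero>\<^bsub>Nabla l\<^esub>"
  using Nabla_hom_subquot[OF assms(1-3,6)] bdD[OF assms(4,1)] assms(5) by linarith

lemma Delta_Nabla_rad:
  assumes l: "l \<in> {1..n}" and g: "g \<in> mod_hom A (\<Delta> l) (Nabla l)" and x: "x \<in> carrier (\<Delta> l)"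
    "rr l x = \<zero>\<^bsub>L l\<^esub>"
  shows "g x = \<zero>\<^bsub>Nabla l\<^esub>"
proof -
  have R: "submodule (rad l) A (\<Delta> l)" by (rule rad_submodule[OF l])
  have "x \<in> rad l" using x by (simp add: a_kernel_eq)
  then show ?thesis
    using Nabla_hom_zero[OF l res_left_module[OF lm(4)[OF l] R] mod_hom_res[OF g R lm(4)[OF l]] bd_rad[OF l], of x] l
    by auto
qed

text \<open>The map kills the radical, hence factors through \<open>L l\<close>, and its image lies
  in the socle. What remains is an endomorphism of \<open>L l\<close>, a scalar by Schur's
  lemma.\<close>

lemma hom_Delta_Nabla:
  assumes l: "l \<in> {1..n}" and g: "g \<in> mod_hom A (\<Delta> l) (Nabla l)"
  shows "\<exists>c\<in>carrier K. \<forall>x\<in>carrier (\<Delta> l). g x = scal A c \<odot>\<^bsub>Nabla l\<^esub> sg l (rr l x)"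
proof -
  note lL = lm(1)[OF l] and lD = lm(4)[OF l] and lN = lm(5)[OF l] and S = simple_moduleD[OF L_simple[OF l]]
  obtain g' where g': "g' \<in> mod_hom A (L l) (Nabla l)" "\<forall>x\<in>carrier (\<Delta> l). g' (rr l x) = g x"
    using hom_factor[OF lD lL lN rr(1,2)[OF l] g Delta_Nabla_rad[OF l g]] by blast
  have L0: "submodule (carrier (L l)) A (L l)" by (rule submodule_carrier[OF lL])
  let ?W = "g' ` carrier (L l)"
  have W: "submodule ?W A (Nabla l)" by (rule submodule_image[OF lL lN g'(1) L0])
  have sgL: "submodule (sg l ` carrier (L l)) A (Nabla l)" by (rule submodule_image[OF lL lN sg(1)[OF l] L0])
  \<comment> \<open>\<open>?W\<close> is zero or contains the socle. In the second case some nonzero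
    element of \<open>L l\<close> is sent into the socle, so by simplicity all of them are.\<close>
  have "?W \<subseteq> sg l ` carrier (L l)"
  proof (cases "?W = {\<zero>\<^bsub>Nabla l\<^esub>}")
    case True
    then show ?thesis using submoduleD(2)[OF sgL] by simp
  next
    case False
    obtain y where y: "y \<in> carrier (L l)" "y \<noteq> \<zero>\<^bsub>L l\<^esub>" using L_simple[OF l] by (rule simple_nonzeroE)
    then have "sg l y \<in> ?W" "sg l y \<noteq> \<zero>\<^bsub>Nabla l\<^esub>" using sg(3)[OF l W False] sg_zero_iff[OF l] by auto
    then obtain z where z: "z \<in> carrier (L l)" "sg l y = g' z" "g' z \<noteq> \<zero>\<^bsub>Nabla l\<^esub>" by force
    let ?V = "{z \<in> carrier (L l). g' z \<in> sg l ` carrier (L l)}"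
    have "g' z \<in> sg l ` carrier (L l)" using y(1) by (simp flip: z(2))
    then have "z \<in> ?V" using z(1) by simp
    moreover have "z \<noteq> \<zero>\<^bsub>L l\<^esub>" using z mod_hom_zero[OF lL lN g'(1)] by auto
    ultimately have "?V = carrier (L l)" using S(3)[OF submodule_vimage[OF lL lN g'(1) sgL]] by blast
    then show ?thesis by blast
  qed
  then obtain e where e: "e \<in> mod_hom A (L l) (L l)" "\<forall>x\<in>carrier (L l). sg l (e x) = g' x"
    using hom_lift_inj[OF lL lL lN sg(1,2)[OF l] g'(1)] by blast
  obtain c where c: "c \<in> carrier K" "\<forall>x\<in>carrier (L l). e x = scal A c \<odot>\<^bsub>L l\<^esub> x"
    using schur[OF L_simple[OF l] e(1)] by blast
  have "g x = scal A c \<odot>\<^bsub>Nabla l\<^esub> sg l (rr l x)" if x: "x \<in> carrier (\<Delta> l)" for x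
  proof -
    have rx: "rr l x \<in> carrier (L l)" by (rule mod_homD(1)[OF rr(1)[OF l] x])
    have "g x = sg l (scal A c \<odot>\<^bsub>L l\<^esub> rr l x)" using g'(2) e(2) c(2) x rx by auto
    then show ?thesis using mod_homD(3)[OF sg(1)[OF l] scal_closed[OF c(1)] rx] by simp
  qed
  then show ?thesis using c(1) by blast
qed

subsection \<open>The cokernel of a costandard module in its injective hull\<close>

definition Ck :: "nat \<Rightarrow> ('a, (nat \<Rightarrow> 'a) set) module" where
  "Ck j = mod_quot (I j) (iota j ` carrier (Nabla j))"

definition pk :: "nat \<Rightarrow> (nat \<Rightarrow> 'a) \<Rightarrow> (nat \<Rightarrow> 'a) set" where
  "pk j = (\<lambda>x\<in>carrier (I j). iota j ` carrier (Nabla j) +>\<^bsub>I j\<^esub> x)"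

lemma Ck:
  assumes "j \<in> {1..n}"
  shows "left_module A (Ck j)" "pk j \<in> mod_hom A (I j) (Ck j)" "pk j ` carrier (I j) = carrier (Ck j)"
    "a_kernel (I j) (Ck j) (pk j) = iota j ` carrier (Nabla j)" "fg_module A (Ck j)"
proof -
  have "submodule (iota j ` carrier (Nabla j)) A (I j)"
    by (rule submodule_image[OF lm(5)[OF assms] lm(3)[OF assms] iota(1)[OF assms] submodule_carrier[OF lm(5)[OF assms]]])
  note * = mod_quot_facts[OF lm(3)[OF assms] this, folded Ck_def pk_def]
  show "left_module A (Ck j)" "pk j \<in> mod_hom A (I j) (Ck j)" "pk j ` carrier (I j) = carrier (Ck j)"
    "a_kernel (I j) (Ck j) (pk j) = iota j ` carrier (Nabla j)" by (rule *)+
  show "fg_module A (Ck j)" by (rule fg_module_surj_image[OF fg(3)[OF assms] *(1-3)])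
qed

lemma pk_zero_iff: "j \<in> {1..n} \<Longrightarrow> x \<in> carrier (I j) \<Longrightarrow> pk j x = \<zero>\<^bsub>Ck j\<^esub> \<longleftrightarrow> x \<in> iota j ` carrier (Nabla j)"
  using Ck(4)[of j] by (auto simp: a_kernel_eq set_eq_iff)

text \<open>The preimage of \<open>W\<close> in \<open>I j\<close> is an extension of
  \<open>W\<close> by the image of \<open>Nabla j\<close>, and both ends are bounded by
  \<open>m\<close>, the latter because \<open>j\<close> is at most \<open>m\<close>.\<close>

lemma Ck_preimage:
  assumes j: "j \<in> {1..n}" and W: "submodule W A (Ck j)" "bd (Ck j \<restriction> W) m" and "j \<le> m"
  defines "V \<equiv> {y \<in> carrier (I j). pk j y \<in> W}"
  shows "submodule V A (I j)" "bd (I j \<restriction> V) m" "restrict (pk j) V \<in> mod_hom A (I j \<restriction> V) (Ck j \<restriction> W)"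
    "restrict (pk j) V ` V = W"
proof -
  note lI = lm(3)[OF j] and C = Ck[OF j]
  show V: "submodule V A (I j)" unfolding V_def by (rule submodule_vimage[OF lI C(1,2) W(1)])
  show p: "restrict (pk j) V \<in> mod_hom A (I j \<restriction> V) (Ck j \<restriction> W)"
    by (rule mod_hom_corestrict[OF mod_hom_res[OF C(2) V lI]]) (auto simp: V_def)
  show "restrict (pk j) V ` V = W"
    using submoduleD(1)[OF W(1)] unfolding V_def C(3)[symmetric] by auto
  have "a_kernel (I j \<restriction> V) (Ck j \<restriction> W) (restrict (pk j) V) = iota j ` carrier (Nabla j)"
  proof -
    have "x \<in> V" if "x \<in> carrier (I j)" "pk j x = \<zero>\<^bsub>Ck j\<^esub>" for x
      using that submoduleD(2)[OF W(1)] by (simp add: V_def)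
    moreover have "x \<in> carrier (I j)" if "x \<in> V" for x using that by (simp add: V_def)
    ultimately have "x \<in> V \<and> restrict (pk j) V x = \<zero>\<^bsub>Ck j\<^esub> \<longleftrightarrow> x \<in> carrier (I j) \<and> pk j x = \<zero>\<^bsub>Ck j\<^esub>" for x
      by (metis restrict_apply')
    then show ?thesis unfolding C(4)[symmetric] by (simp add: a_kernel_eq)
  qed
  moreover have "bd (I j \<restriction> (iota j ` carrier (Nabla j))) m"
    using bd_image[OF lm(5)[OF j] lI iota(1,3)[OF j]] \<open>j \<le> m\<close> bd_mono by blast
  ultimately show "bd (I j \<restriction> V) m"
    using bd_ext[OF res_left_module[OF lI V] res_left_module[OF C(1) W(1)] p] W(2) by simp
qed

text \<open>The preimage in \<open>I j\<close> of the image of \<open>k\<close> is still bounded by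
  \<open>j\<close>, so it lies in the image of \<open>Nabla j\<close>, the largest such submodule.
  In homological terms this yields Ext^1(M, Nabla j) = 0.\<close>

lemma hom_Ck_zero:
  assumes j: "j \<in> {1..n}" and M: "left_module A M" "bd M j" and k: "k \<in> mod_hom A M (Ck j)" and x: "x \<in> carrier M"
  shows "k x = \<zero>\<^bsub>Ck j\<^esub>"
proof -
  note C = Ck[OF j]
  have W: "submodule (k ` carrier M) A (Ck j)"
    by (rule submodule_image[OF M(1) C(1) k submodule_carrier[OF M(1)]])
  note V = Ck_preimage[OF j W bd_image[OF M(1) C(1) k M(2)] order_refl]
  obtain y where y: "y \<in> carrier (I j)" "pk j y = k x"
    using mod_homD(1)[OF k x] C(3) by (metis imageE)
  have "y \<in> iota j ` carrier (Nabla j)" using iota(4)[OF j V(1,2)] y x by auto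
  then show ?thesis using pk_zero_iff[OF j y(1)] y(2) by simp
qed

text \<open>In homological terms, Ext^1(\<Delta> t, Nabla j) = 0. For \<open>t\<close> at most
  \<open>j\<close> the map is zero; for larger \<open>t\<close> the preimage of its image is bounded
  by \<open>t\<close>, and among modules so bounded \<open>\<Delta> t\<close> is projective.\<close>

lemma Delta_lift_Ck:
  assumes j: "j \<in> {1..n}" and t: "t \<in> {1..n}" and k: "k \<in> mod_hom A (\<Delta> t) (Ck j)"
  shows "\<exists>k'\<in>mod_hom A (\<Delta> t) (I j). \<forall>x\<in>carrier (\<Delta> t). pk j (k' x) = k x"
proof (cases "t \<le> j")
  case True
  note lI = lm(3)[OF j] and lD = lm(4)[OF t] and C = Ck[OF j]
  have "k x = \<zero>\<^bsub>Ck j\<^esub>" if "x \<in> carrier (\<Delta> t)" for x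
    by (rule hom_Ck_zero[OF j lD bd_mono[OF bd_Delta[OF t] True] k that])
  then show ?thesis using zero_hom_in[OF lD lI] mod_hom_zero[OF lI C(1,2)]
    by (intro bexI[of _ "zero_hom (\<Delta> t) (I j)"]) (auto simp: zero_hom_def)
next
  case False
  note lI = lm(3)[OF j] and lD = lm(4)[OF t] and C = Ck[OF j]
  have W: "submodule (k ` carrier (\<Delta> t)) A (Ck j)"
    by (rule submodule_image[OF lD C(1) k submodule_carrier[OF lD]])
  let ?V = "{y \<in> carrier (I j). pk j y \<in> k ` carrier (\<Delta> t)}"
  have V: "submodule ?V A (I j)" "bd (I j \<restriction> ?V) t"
    "restrict (pk j) ?V \<in> mod_hom A (I j \<restriction> ?V) (Ck j \<restriction> (k ` carrier (\<Delta> t)))"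
    "restrict (pk j) ?V ` ?V = k ` carrier (\<Delta> t)"
    using Ck_preimage[OF j W bd_image[OF lD C(1) k bd_Delta[OF t]]] False by auto
  obtain k' where k': "k' \<in> mod_hom A (\<Delta> t) (I j \<restriction> ?V)"
    "\<forall>x\<in>carrier (\<Delta> t). restrict (pk j) ?V (k' x) = k x"
    using Delta_lift[OF t fg_module_res[OF fg(3)[OF j] V(1)] V(2) res_left_module[OF C(1) W] V(3) _
        mod_hom_corestrict[OF k order_refl]] V(4) by auto
  have "pk j (k' x) = k x" if "x \<in> carrier (\<Delta> t)" for x
  proof -
    have "k' x \<in> ?V" using mod_homD(1)[OF k'(1) that] by simp
    then have "restrict (pk j) ?V (k' x) = pk j (k' x)" by (rule restrict_apply')
    then show ?thesis using bspec[OF k'(2) that] by (rule trans[OF sym])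
  qed
  then show ?thesis using mod_hom_expand[OF k'(1) submoduleD(1)[OF V(1)]] by blast
qed

text \<open>The same vanishing for modules filtered by standard modules, by climbing the filtration:
  the lift found so far is extended by injectivity of \<open>I j\<close> and corrected by a map that
  factors through the next standard module.\<close>

lemma filtered_lift_Ck:
  assumes j: "j \<in> {1..n}" and M: "fg_module A M" and filt: "filtered_by A M (\<Delta> ` T)" "T \<subseteq> {1..n}"
    and g: "g \<in> mod_hom A M (Ck j)"
  shows "\<exists>g'\<in>mod_hom A M (I j). \<forall>x\<in>carrier M. pk j (g' x) = g x"
proof -
  note lM = fg_moduleD[OF M] and lI = lm(3)[OF j] and C = Ck[OF j]
  interpret Cm: left_module A "Ck j" by (rule C(1))
  obtain Ns where Ns: "mod_filtration A M Ns"
    and fac: "\<And>t. Suc t < length Ns \<Longrightarrow> \<exists>E\<in>\<Delta> ` T. mod_iso A (filtration_factor M Ns t) E"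
    using filt(1) by (auto simp: filtered_by_def)
  have sub: "t < length Ns \<Longrightarrow> submodule (Ns ! t) A M" for t using Ns by (auto simp: mod_filtration_def)
  have step: "t < length Ns \<Longrightarrow> \<exists>g'\<in>mod_hom A (M \<restriction> (Ns ! t)) (I j). \<forall>x\<in>Ns ! t. pk j (g' x) = g x" for t
  proof (induction t)
    case 0
    have N0: "Ns ! 0 = {\<zero>\<^bsub>M\<^esub>}" using Ns by (auto simp: mod_filtration_def hd_conv_nth)
    have "zero_hom (M \<restriction> (Ns ! 0)) (I j) \<in> mod_hom A (M \<restriction> (Ns ! 0)) (I j)"
      by (rule zero_hom_in[OF res_left_module[OF lM sub[OF 0]] lI])
    then show ?case
      using mod_hom_zero[OF lM C(1) g] mod_hom_zero[OF lI C(1,2)] N0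
      by (intro bexI[of _ "zero_hom (M \<restriction> (Ns ! 0)) (I j)"]) (auto simp: zero_hom_def)
  next
    case (Suc t)
    let ?N = "Ns ! t" and ?N' = "Ns ! Suc t"
    obtain s where s: "s \<in> {1..n}" "mod_iso A (filtration_factor M Ns t) (\<Delta> s)"
      using fac Suc.prems filt(2) by blast
    note lD = lm(4)[OF s(1)]
    note f = filtered_by_factor[OF lM Ns Suc.prems s(2) lD]
    obtain d where d: "d \<in> mod_hom A (M \<restriction> ?N') (\<Delta> s)" "d ` ?N' = carrier (\<Delta> s)"
      "a_kernel (M \<restriction> ?N') (\<Delta> s) d = ?N" using f(4) by blast
    note lN' = res_left_module[OF lM f(2)] and lN = res_left_module[OF lM f(1)]
    obtain g0 where g0: "g0 \<in> mod_hom A (M \<restriction> ?N) (I j)" "\<forall>x\<in>?N. pk j (g0 x) = g x"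
      using Suc by auto
    have incl: "(\<lambda>x\<in>?N. x) \<in> mod_hom A (M \<restriction> ?N) (M \<restriction> ?N')"
      by (rule mod_hom_corestrict[OF mod_hom_incl[OF f(1) lM]]) (use f(3) in auto)
    obtain g1 where g1: "g1 \<in> mod_hom A (M \<restriction> ?N') (I j)" "\<forall>x\<in>?N. g1 x = g0 x"
      using inj_extend[OF j fg_module_res[OF M f(1)] fg_module_res[OF M f(2)] incl _ g0(1)]
      by (auto simp: inj_on_def)
    have pg1: "compose ?N' (pk j) g1 \<in> mod_hom A (M \<restriction> ?N') (Ck j)"
      using mod_hom_comp[OF g1(1) C(2) lN'] by simp
    have gN': "restrict g ?N' \<in> mod_hom A (M \<restriction> ?N') (Ck j)" by (rule mod_hom_res[OF g f(2) lM])
    have cl: "g1 x \<in> carrier (I j)" "pk j (g1 x) \<in> carrier (Ck j)" "g x \<in> carrier (Ck j)"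
      "d x \<in> carrier (\<Delta> s)" if "x \<in> ?N'" for x
      using that mod_homD(1)[OF g1(1)] mod_homD(1)[OF C(2)] mod_homD(1)[OF g] mod_homD(1)[OF d(1)]
        submodule_memD[OF f(2)] by auto
    \<comment> \<open>On \<open>?N\<close> the extended map \<open>g1\<close> already lifts
      \<open>g\<close>, so the defect vanishes there and descends to \<open>\<Delta> s\<close>,
      where \<open>Delta_lift_Ck\<close> lifts it.\<close>
    let ?\<delta> = "\<lambda>x\<in>?N'. g x \<ominus>\<^bsub>Ck j\<^esub> pk j (g1 x)"
    have \<delta>: "?\<delta> \<in> mod_hom A (M \<restriction> ?N') (Ck j)"
      using mod_hom_diff[OF gN' pg1 lN' C(1)] by (simp add: compose_def cong: restrict_cong)
    have "\<exists>h\<in>mod_hom A (\<Delta> s) (Ck j). \<forall>x\<in>carrier (M \<restriction> ?N'). h (d x) = ?\<delta> x"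
    proof (rule hom_factor[OF lN' lD C(1) d(1) _ \<delta>])
      fix x assume x: "x \<in> carrier (M \<restriction> ?N')" "d x = \<zero>\<^bsub>\<Delta> s\<^esub>"
      then have "x \<in> ?N" unfolding d(3)[symmetric] by (simp add: a_kernel_eq)
      then show "?\<delta> x = \<zero>\<^bsub>Ck j\<^esub>" using x(1) g1(2) g0(2) cl by (simp add: Cm.diff_eq_zero_iff)
    qed (use d(2) in simp)
    then obtain h where h: "h \<in> mod_hom A (\<Delta> s) (Ck j)"
      "\<forall>x\<in>?N'. h (d x) = g x \<ominus>\<^bsub>Ck j\<^esub> pk j (g1 x)" by auto
    obtain h' where h': "h' \<in> mod_hom A (\<Delta> s) (I j)" "\<forall>x\<in>carrier (\<Delta> s). pk j (h' x) = h x"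
      using Delta_lift_Ck[OF j s(1) h(1)] by blast
    have hd: "compose ?N' h' d \<in> mod_hom A (M \<restriction> ?N') (I j)" using mod_hom_comp[OF d(1) h'(1) lN'] by simp
    have "(\<lambda>x\<in>?N'. g1 x \<oplus>\<^bsub>I j\<^esub> h' (d x)) \<in> mod_hom A (M \<restriction> ?N') (I j)"
      using mod_hom_add[OF g1(1) hd lN' lI] by (simp add: compose_def cong: restrict_cong)
    moreover have "pk j (g1 x \<oplus>\<^bsub>I j\<^esub> h' (d x)) = g x" if x: "x \<in> ?N'" for x
      using cl[OF x] h' h(2) x mod_homD(1)[OF h'(1)] mod_homD(2)[OF C(2)] by (simp add: Cm.add_diff_cancel)
    ultimately show ?case
      by (intro bexI[of _ "\<lambda>x\<in>?N'. g1 x \<oplus>\<^bsub>I j\<^esub> h' (d x)"]) auto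
  qed
  have "Ns ! (length Ns - 1) = carrier M" "length Ns - 1 < length Ns"
    using Ns by (auto simp: mod_filtration_def last_conv_nth)
  then show ?thesis using step[of "length Ns - 1"] by simp
qed

text \<open>This is Ext^1(L s, Ck j) = 0, with \<open>R\<close> the radical of \<open>P s\<close>.
  The kernel of \<open>rho s\<close> is filtered by standard modules, so there \<open>g\<close>
  lifts to \<open>I j\<close>, and the lift extends over \<open>P s\<close>. What is left lives on
  the radical of \<open>\<Delta> s\<close>, which has no nonzero map to \<open>Ck j\<close>.\<close>

lemma radical_extend_Ck:
  assumes j: "j \<in> {1..n}" and s: "s \<in> {1..n}" "s \<le> j"
  defines "R \<equiv> {x \<in> carrier (P s). rr s (rho s x) = \<zero>\<^bsub>L s\<^esub>}"
  assumes g: "g \<in> mod_hom A (P s \<restriction> R) (Ck j)"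
  shows "\<exists>G\<in>mod_hom A (P s) (Ck j). \<forall>x\<in>R. G x = g x"
proof -
  note lI = lm(3)[OF j] and lP = lm(2)[OF s(1)] and lD = lm(4)[OF s(1)] and lL = lm(1)[OF s(1)] and C = Ck[OF j]
  note rho = rho[OF s(1)] and rr = rr[OF s(1)]
  interpret Cm: left_module A "Ck j" by (rule C(1))
  let ?N = "a_kernel (P s) (\<Delta> s) (rho s)"
  have N: "submodule ?N A (P s)" by (rule submodule_kernel[OF lP lD rho(1)])
  have R_eq: "R = {x \<in> carrier (P s). rho s x \<in> rad s}"
    using mod_homD(1)[OF rho(1)] by (auto simp: R_def a_kernel_eq)
  have R: "submodule R A (P s)"
    unfolding R_eq by (rule submodule_vimage[OF lP lD rho(1) rad_submodule[OF s(1)]])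
  note lR = res_left_module[OF lP R]
  have NR: "?N \<subseteq> R" using mod_hom_zero[OF lD lL rr(1)] by (auto simp: R_def a_kernel_eq)
  have NR': "submodule ?N A (P s \<restriction> R)" using N NR submodule_res_iff[OF lP R] by simp
  have gN: "restrict g ?N \<in> mod_hom A (P s \<restriction> ?N) (Ck j)"
    using mod_hom_res[OF g NR' lR] by simp
  obtain g0 where g0: "g0 \<in> mod_hom A (P s \<restriction> ?N) (I j)" "\<forall>x\<in>?N. pk j (g0 x) = g x"
    using filtered_lift_Ck[OF j fg_module_res[OF fg(2)[OF s(1)] N] rho(4) _ gN] by fastforce
  obtain g1 where g1: "g1 \<in> mod_hom A (P s) (I j)" "\<forall>x\<in>?N. g1 x = g0 x"
    using inj_extend[OF j fg_module_res[OF fg(2)[OF s(1)] N] fg(2)[OF s(1)] mod_hom_incl[OF N lP] _ g0(1)]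
    by (auto simp: inj_on_def)
  let ?G = "compose (carrier (P s)) (pk j) g1"
  have G: "?G \<in> mod_hom A (P s) (Ck j)" by (rule mod_hom_comp[OF g1(1) C(2) lP])
  have GR: "restrict ?G R \<in> mod_hom A (P s \<restriction> R) (Ck j)" by (rule mod_hom_res[OF G R lP])
  let ?\<delta> = "\<lambda>x\<in>R. g x \<ominus>\<^bsub>Ck j\<^esub> ?G x"
  have \<delta>: "?\<delta> \<in> mod_hom A (P s \<restriction> R) (Ck j)"
    using mod_hom_diff[OF g GR lR C(1)] by (simp cong: restrict_cong)
  have rR: "restrict (rho s) R \<in> mod_hom A (P s \<restriction> R) (\<Delta> s \<restriction> rad s)"
    by (rule mod_hom_corestrict[OF mod_hom_res[OF rho(1) R lP]]) (auto simp: R_eq)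
  have RP: "x \<in> carrier (P s)" if "x \<in> R" for x using that by (simp add: R_def)
  have cl: "g x \<in> carrier (Ck j)" "?G x \<in> carrier (Ck j)" if "x \<in> R" for x
    using mod_homD(1)[OF g] mod_homD(1)[OF G] that RP by auto
  have lrad: "left_module A (\<Delta> s \<restriction> rad s)" by (rule res_left_module[OF lD rad_submodule[OF s(1)]])
  have "\<exists>h\<in>mod_hom A (\<Delta> s \<restriction> rad s) (Ck j). \<forall>x\<in>carrier (P s \<restriction> R). h (restrict (rho s) R x) = ?\<delta> x"
  proof (rule hom_factor[OF lR lrad C(1) rR _ \<delta>])
    show "restrict (rho s) R ` carrier (P s \<restriction> R) = carrier (\<Delta> s \<restriction> rad s)"
      using rho(2) submoduleD(1)[OF rad_submodule[OF s(1)]] by (auto simp: R_eq)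
    fix x assume x: "x \<in> carrier (P s \<restriction> R)" "restrict (rho s) R x = \<zero>\<^bsub>\<Delta> s \<restriction> rad s\<^esub>"
    then have "x \<in> ?N" "x \<in> R" using RP by (auto simp: a_kernel_eq)
    then show "?\<delta> x = \<zero>\<^bsub>Ck j\<^esub>"
      using g1(2) g0(2) cl RP by (simp add: Cm.diff_eq_zero_iff compose_def)
  qed
  then obtain h where h: "h \<in> mod_hom A (\<Delta> s \<restriction> rad s) (Ck j)"
    "\<And>x. x \<in> R \<Longrightarrow> h (rho s x) = ?\<delta> x" by auto
  have bd: "bd (\<Delta> s \<restriction> rad s) j" using bd_mono[OF bd_rad[OF s(1)]] s(2) by simp
  \<comment> \<open>The defect of \<open>?G\<close> descends to the radical of
    \<open>\<Delta> s\<close>, bounded by \<open>j\<close>, and is zero by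
    \<open>hom_Ck_zero\<close>; hence \<open>?G\<close> agrees with \<open>g\<close> on all of
    \<open>R\<close>.\<close>
  have "?G x = g x" if x: "x \<in> R" for x
  proof -
    have "rho s x \<in> rad s" using x by (simp add: R_eq)
    then have "h (rho s x) = \<zero>\<^bsub>Ck j\<^esub>" using hom_Ck_zero[OF j lrad bd h(1)] by simp
    then have "g x \<ominus>\<^bsub>Ck j\<^esub> ?G x = \<zero>\<^bsub>Ck j\<^esub>" using h(2)[OF x] x by simp
    then show ?thesis using cl[OF x] by (simp add: Cm.diff_eq_zero_iff)
  qed
  then show ?thesis using G by blast
qed

text \<open>This is \<open>Ext\<^sup>1(M, Ck j) = Ext\<^sup>2(M, Nabla j) = 0\<close> for the modules \<open>M\<close> all of whose composition
  factors are \<open>L l\<close> with \<open>l \<le> j\<close>; here \<open>M = T / U\<close>.\<close>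

lemma extend_Ck:
  assumes j: "j \<in> {1..n}" and T: "fg_module A T" and U: "submodule U A T" and g: "g \<in> mod_hom A (T \<restriction> U) (Ck j)"
    and factors: "\<And>V l p. \<lbrakk>submodule V A T; U \<subseteq> V; l \<in> {1..n}; p \<in> mod_hom A (T \<restriction> V) (L l);
      p ` V = carrier (L l); \<And>x. x \<in> U \<Longrightarrow> p x = \<zero>\<^bsub>L l\<^esub>\<rbrakk> \<Longrightarrow> l \<le> j"
  shows "\<exists>g'\<in>mod_hom A T (Ck j). \<forall>x\<in>U. g' x = g x"
proof -
  note lT = fg_moduleD[OF T] and C = Ck[OF j]
  interpret Cm: left_module A "Ck j" by (rule C(1))
  interpret Tm: left_module A T by (rule lT)
  \<comment> \<open>The submodules above \<open>U\<close> over which \<open>g\<close> extends. A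
    maximal one is shown to be everything by enlarging it through a simple factor.\<close>
  define Q where "Q U' \<longleftrightarrow> submodule U' A T \<and> U \<subseteq> U' \<and>
    (\<exists>g'\<in>mod_hom A (T \<restriction> U') (Ck j). \<forall>x\<in>U. g' x = g x)" for U'
  have "Q U" unfolding Q_def using U g by blast
  then obtain W where W: "Q W" "\<And>V. Q V \<Longrightarrow> W \<subseteq> V \<Longrightarrow> V = W"
    using fg_maximal[OF T, of Q] by (metis Q_def)
  then obtain g' where g': "g' \<in> mod_hom A (T \<restriction> W) (Ck j)" "\<forall>x\<in>U. g' x = g x"
    unfolding Q_def by blast
  have Wsub: "submodule W A T" "U \<subseteq> W" using W(1) unfolding Q_def by auto
  show ?thesis
  proof (cases "W = carrier T")
    case True
    then show ?thesis using g' by auto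
  next
    case False
    have "submodule (carrier T) A T \<and> W \<subset> carrier T"
      using False submoduleD(1)[OF Wsub(1)] submodule_carrier[OF lT] by auto
    \<comment> \<open>A minimal submodule properly above \<open>W\<close>: the quotient of
      \<open>V\<close> by \<open>W\<close> is simple, hence some \<open>L l\<close>, and
      \<open>factors\<close> bounds \<open>l\<close> by \<open>j\<close>.\<close>
    then obtain V where Vsub: "submodule V A T" "W \<subset> V"
      and V: "\<And>V'. submodule V' A T \<Longrightarrow> W \<subset> V' \<Longrightarrow> V' \<subseteq> V \<Longrightarrow> V' = V"
      using fg_minimal[OF T, of "\<lambda>V. submodule V A T \<and> W \<subset> V"] by (metis (no_types, lifting))
    note lV = res_left_module[OF lT Vsub(1)] and lW = res_left_module[OF lT Wsub(1)]
    have WV: "submodule W A (T \<restriction> V)" using Wsub(1) Vsub submodule_res_iff[OF lT Vsub(1)] by blast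
    note q = mod_quot_facts[OF lV WV]
    have "simple_module A (mod_quot (T \<restriction> V) W)"
    proof (rule simple_quotI[OF lV q(1-3)], unfold q(4))
      show "W \<noteq> carrier (T \<restriction> V)" using Vsub(2) by auto
      fix V' assume V': "submodule V' A (T \<restriction> V)" "W \<subseteq> V'" "V' \<noteq> carrier (T \<restriction> V)"
      then have "submodule V' A T" "V' \<subseteq> V" using submodule_res_iff[OF lT Vsub(1)] by auto
      then show "V' = W" using V[of V'] V'(2,3) by auto
    qed
    then obtain l where l: "l \<in> {1..n}" "mod_iso A (mod_quot (T \<restriction> V) W) (L l)" using simple_classify by blast
    note lL = lm(1)[OF l(1)] and lP = lm(2)[OF l(1)] and lD = lm(4)[OF l(1)]
    obtain p where p: "p \<in> mod_hom A (T \<restriction> V) (L l)" "p ` V = carrier (L l)" "a_kernel (T \<restriction> V) (L l) p = W"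
      using mod_iso_quot_hom[OF lV WV l(2) lL] by auto
    interpret Lm: left_module A "L l" by (rule lL)
    have pW: "p x = \<zero>\<^bsub>L l\<^esub> \<longleftrightarrow> x \<in> W" if "x \<in> V" for x
      using that unfolding p(3)[symmetric] by (simp add: a_kernel_eq)
    have lj: "l \<le> j"
      by (rule factors[OF Vsub(1) _ l(1) p(1,2)]) (use Wsub(2) Vsub(2) pW in auto)
    let ?q = "compose (carrier (P l)) (rr l) (rho l)"
    have rq: "?q \<in> mod_hom A (P l) (L l)" by (rule mod_hom_comp[OF rho(1)[OF l(1)] rr(1)[OF l(1)] lP])
    \<comment> \<open>\<open>P l\<close> maps to \<open>V\<close> over the simple factor, and the
      preimage of \<open>W\<close> under this map is exactly the radical \<open>R\<close>, to which
      \<open>radical_extend_Ck\<close> applies.\<close>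
    obtain w where w: "w \<in> mod_hom A (P l) (T \<restriction> V)" "\<forall>x\<in>carrier (P l). p (w x) = ?q x"
      using proj_lift[OF l(1) fg_module_res[OF T Vsub(1)] fg(1)[OF l(1)] p(1) _ rq] p(2) by auto
    have wV: "w x \<in> V" if "x \<in> carrier (P l)" for x using mod_homD(1)[OF w(1) that] by simp
    define R where "R = {x \<in> carrier (P l). rr l (rho l x) = \<zero>\<^bsub>L l\<^esub>}"
    have R: "submodule R A (P l)"
      using submodule_kernel[OF lP lL rq] unfolding R_def by (simp add: a_kernel_eq compose_def cong: conj_cong)
    have wR: "w x \<in> W \<longleftrightarrow> x \<in> R" if "x \<in> carrier (P l)" for x
      using pW[OF wV[OF that]] w(2) that by (simp add: R_def compose_def)
    have wR': "restrict w R \<in> mod_hom A (P l \<restriction> R) (T \<restriction> W)"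
    proof -
      have "restrict w R \<in> mod_hom A (P l \<restriction> R) (T \<restriction> V \<restriction> W)"
        by (rule mod_hom_corestrict[OF mod_hom_res[OF w(1) R lP]]) (use wR in \<open>auto simp: R_def\<close>)
      then show ?thesis by simp
    qed
    have "compose R g' (restrict w R) \<in> mod_hom A (P l \<restriction> R) (Ck j)"
      using mod_hom_comp[OF wR' g'(1) res_left_module[OF lP R]] by simp
    then obtain G where G: "G \<in> mod_hom A (P l) (Ck j)" "\<forall>x\<in>R. G x = g' (w x)"
      using radical_extend_Ck[OF j l(1) lj, folded R_def, of "compose R g' (restrict w R)"]
      by (auto simp: compose_def cong: restrict_cong)
    \<comment> \<open>\<open>V\<close> is the sum of \<open>W\<close> and the image of
      \<open>w\<close>, presented here as a quotient of a direct sum. The sum of \<open>g'\<close>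
      and \<open>G\<close> descends to \<open>V\<close> because a pair in the kernel has its second
      entry in \<open>R\<close>, where \<open>G\<close> agrees with \<open>g'\<close> after
      \<open>w\<close>.\<close>
    let ?Q = "mod_prod (T \<restriction> W) (P l)"
    have lQ: "left_module A ?Q" by (rule mod_prod_left_module[OF lW lP])
    have WT: "x \<in> carrier T" if "x \<in> W" for x using submodule_memD[OF Wsub(1) that] .
    have wT: "w x \<in> carrier T" if "x \<in> carrier (P l)" for x
      using submodule_memD[OF Vsub(1) wV[OF that]] .
    let ?s = "\<lambda>z. fst z \<oplus>\<^bsub>T\<^esub> w (snd z)" and ?f = "\<lambda>z. g' (fst z) \<oplus>\<^bsub>Ck j\<^esub> G (snd z)"
    have s: "restrict ?s (carrier ?Q) \<in> mod_hom A ?Q (T \<restriction> V)"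
      by (rule mod_homI[OF _ _ _ lQ])
        (use Vsub(2) submoduleD(3)[OF Vsub(1)] wV WT wT mod_homD(2,3)[OF w(1)] in
          \<open>auto simp: mod_prod_simps Tm.M.a_ac Tm.smult_r_distr\<close>)
    have ss: "restrict ?s (carrier ?Q) ` carrier ?Q = carrier (T \<restriction> V)"
    proof
      show "restrict ?s (carrier ?Q) ` carrier ?Q \<subseteq> carrier (T \<restriction> V)" using mod_homD(1)[OF s] by blast
      show "carrier (T \<restriction> V) \<subseteq> restrict ?s (carrier ?Q) ` carrier ?Q"
      proof
        fix v assume v: "v \<in> carrier (T \<restriction> V)"
        have "carrier (L l) = ?q ` carrier (P l)"
          unfolding rr(2)[OF l(1), symmetric] rho(2)[OF l(1), symmetric] by (auto simp: compose_def)
        then obtain x where x: "x \<in> carrier (P l)" "p v = p (w x)"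
          using mod_homD(1)[OF p(1) v] w(2) by auto
        have wxV: "w x \<in> carrier (T \<restriction> V)" using wV[OF x(1)] by simp
        have vT: "v \<in> carrier T" using submodule_memD[OF Vsub(1)] v by simp
        have "v \<ominus>\<^bsub>T \<restriction> V\<^esub> w x \<in> W" using mod_hom_eq_iff_diff[OF lV lL p(1) v wxV] x(2) p(3) by simp
        moreover have "w x \<oplus>\<^bsub>T\<^esub> (v \<ominus>\<^bsub>T \<restriction> V\<^esub> w x) = v"
          using left_module.add_diff_cancel[OF lV wxV v] by simp
        ultimately show "v \<in> restrict ?s (carrier ?Q) ` carrier ?Q"
          using x(1) WT wT by (intro image_eqI[of _ _ "(v \<ominus>\<^bsub>T \<restriction> V\<^esub> w x, x)"]) (auto simp: mod_prod_simps Tm.M.a_comm)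
      qed
    qed
    have f: "restrict ?f (carrier ?Q) \<in> mod_hom A ?Q (Ck j)"
      by (rule mod_homI[OF _ _ _ lQ])
        (use mod_homD(1-3)[OF g'(1)] mod_homD(1-3)[OF G(1)] in
          \<open>auto simp: mod_prod_simps Cm.M.a_ac Cm.smult_r_distr\<close>)
    have "\<exists>h\<in>mod_hom A (T \<restriction> V) (Ck j). \<forall>z\<in>carrier ?Q. h (restrict ?s (carrier ?Q) z) = restrict ?f (carrier ?Q) z"
    proof (rule hom_factor[OF lQ lV C(1) s ss f])
      fix z assume z: "z \<in> carrier ?Q" "restrict ?s (carrier ?Q) z = \<zero>\<^bsub>T \<restriction> V\<^esub>"
      obtain u x where ux: "z = (u, x)" "u \<in> W" "x \<in> carrier (P l)" using z(1) by (auto simp: mod_prod_simps)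
      have sum0: "u \<oplus>\<^bsub>T\<^esub> w x = \<zero>\<^bsub>T\<^esub>" using z ux by simp
      have uV: "u \<in> V" using ux(2) Vsub(2) by auto
      have "p (u \<oplus>\<^bsub>T\<^esub> w x) = p u \<oplus>\<^bsub>L l\<^esub> p (w x)"
        using mod_homD(2)[OF p(1), of u "w x"] uV wV[OF ux(3)] by simp
      moreover have "p u = \<zero>\<^bsub>L l\<^esub>" using pW[OF uV] ux(2) by simp
      moreover have "p (w x) \<in> carrier (L l)" using mod_homD(1)[OF p(1)] wV[OF ux(3)] by simp
      moreover have "p \<zero>\<^bsub>T\<^esub> = \<zero>\<^bsub>L l\<^esub>" using mod_hom_zero[OF lV lL p(1)] by simp
      ultimately have "p (w x) = \<zero>\<^bsub>L l\<^esub>" using sum0 by simp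
      then have xR: "x \<in> R" and wW: "w x \<in> W" using pW[OF wV[OF ux(3)]] wR[OF ux(3)] by auto
      have "g' u \<oplus>\<^bsub>Ck j\<^esub> G x = g' (u \<oplus>\<^bsub>T\<^esub> w x)"
        using G(2) xR mod_homD(2)[OF g'(1), of u "w x"] ux(2) wW by simp
      also have "\<dots> = \<zero>\<^bsub>Ck j\<^esub>" using mod_hom_zero[OF lW C(1) g'(1)] sum0 by simp
      finally show "restrict ?f (carrier ?Q) z = \<zero>\<^bsub>Ck j\<^esub>" using z(1) ux(1) by simp
    qed
    then obtain h where h: "h \<in> mod_hom A (T \<restriction> V) (Ck j)"
      "\<And>u x. u \<in> W \<Longrightarrow> x \<in> carrier (P l) \<Longrightarrow> h (u \<oplus>\<^bsub>T\<^esub> w x) = g' u \<oplus>\<^bsub>Ck j\<^esub> G x"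
      by (auto simp: mod_prod_simps)
    have "h u = g' u" if u: "u \<in> W" for u
    proof -
      have z: "\<zero>\<^bsub>P l\<^esub> \<in> carrier (P l)" using submoduleD(2)[OF submodule_carrier[OF lP]] .
      have "w \<zero>\<^bsub>P l\<^esub> = \<zero>\<^bsub>T\<^esub>" "G \<zero>\<^bsub>P l\<^esub> = \<zero>\<^bsub>Ck j\<^esub>"
        using mod_hom_zero[OF lP lV w(1)] mod_hom_zero[OF lP C(1) G(1)] by auto
      then show ?thesis using h(2)[OF u z] WT[OF u] mod_homD(1)[OF g'(1), of u] u by simp
    qed
    then have "\<forall>x\<in>U. h x = g x" using g'(2) Wsub(2) by auto
    then have "Q V" unfolding Q_def using h(1) Vsub Wsub(2) by blast
    then show ?thesis using W(2) Vsub(2) by blast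
  qed
qed

end

section \<open>Extensions\<close>

text \<open>Like \<open>extensions\<close>, but with a middle term of any carrier type, since Baer
  sums, multiples and pullbacks live on products and cosets.\<close>

definition is_ext :: "('a, 'r) ring_scheme \<Rightarrow> ('a, 'm) module \<Rightarrow> ('a, 'l) module \<Rightarrow>
    ('a, 'm, 'l, 'x) extension \<Rightarrow> bool" where
  "is_ext A M N \<xi> \<longleftrightarrow> (case \<xi> of (E, \<beta>, \<gamma>) \<Rightarrow> fg_module A E \<and>
     \<beta> \<in> mod_hom A N E \<and> \<gamma> \<in> mod_hom A E M \<and>
     inj_on \<beta> (carrier N) \<and> \<gamma> ` carrier E = carrier M \<and> \<beta> ` carrier N = a_kernel E M \<gamma>)"

lemma extensions_iff: "\<xi> \<in> extensions A M N \<longleftrightarrow> is_ext A M N \<xi>"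
  by (auto simp: extensions_def is_ext_def)

lemma is_extD:
  assumes "is_ext A M N (E, \<beta>, \<gamma>)"
  shows "fg_module A E" "left_module A E" "\<beta> \<in> mod_hom A N E" "\<gamma> \<in> mod_hom A E M" "inj_on \<beta> (carrier N)"
    "\<gamma> ` carrier E = carrier M" "\<beta> ` carrier N = a_kernel E M \<gamma>"
    "\<lbrakk>x \<in> carrier E; \<gamma> x = \<zero>\<^bsub>M\<^esub>\<rbrakk> \<Longrightarrow> x \<in> \<beta> ` carrier N"
    "y \<in> carrier N \<Longrightarrow> \<gamma> (\<beta> y) = \<zero>\<^bsub>M\<^esub>"
proof -
  show *: "fg_module A E" "left_module A E" "\<beta> \<in> mod_hom A N E" "\<gamma> \<in> mod_hom A E M" "inj_on \<beta> (carrier N)"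
    "\<gamma> ` carrier E = carrier M" "\<beta> ` carrier N = a_kernel E M \<gamma>"
    using assms by (auto simp: is_ext_def intro: fg_moduleD)
  show "\<lbrakk>x \<in> carrier E; \<gamma> x = \<zero>\<^bsub>M\<^esub>\<rbrakk> \<Longrightarrow> x \<in> \<beta> ` carrier N"
    unfolding *(7) by (simp add: a_kernel_eq)
  have "y \<in> carrier N \<Longrightarrow> \<beta> y \<in> a_kernel E M \<gamma>" unfolding *(7)[symmetric] by (rule imageI)
  then show "y \<in> carrier N \<Longrightarrow> \<gamma> (\<beta> y) = \<zero>\<^bsub>M\<^esub>" by (simp add: a_kernel_eq)
qed

lemma ext_equivalentI:
  assumes "\<theta> \<in> mod_hom A E E'" "bij_betw \<theta> (carrier E) (carrier E')"
    "\<beta>' \<in> mod_hom A N E'" "\<gamma> \<in> mod_hom A E M"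
    "\<And>y. y \<in> carrier N \<Longrightarrow> \<theta> (\<beta> y) = \<beta>' y"
      "\<And>x. x \<in> carrier E \<Longrightarrow> \<gamma>' (\<theta> x) = \<gamma> x"
  shows "ext_equivalent A N (E, \<beta>, \<gamma>) (E', \<beta>', \<gamma>')"
proof -
  have "compose (carrier N) \<theta> \<beta> = \<beta>'"
    by (rule extensionalityI[OF compose_extensional mod_homD(4)[OF assms(3)]]) (simp add: compose_eq assms(5))
  moreover have "compose (carrier E) \<gamma>' \<theta> = \<gamma>"
    by (rule extensionalityI[OF compose_extensional mod_homD(4)[OF assms(4)]]) (simp add: compose_eq assms(6))
  ultimately show ?thesis using assms(1,2) by auto
qed

lemma ext_equivalentE:
  assumes "ext_equivalent A N (E, \<beta>, \<gamma>) (E', \<beta>', \<gamma>')"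
  obtains \<theta> where "\<theta> \<in> mod_hom A E E'" "bij_betw \<theta> (carrier E) (carrier E')"
    "\<And>y. y \<in> carrier N \<Longrightarrow> \<theta> (\<beta> y) = \<beta>' y"
      "\<And>x. x \<in> carrier E \<Longrightarrow> \<gamma>' (\<theta> x) = \<gamma> x"
proof -
  obtain \<theta> where \<theta>: "\<theta> \<in> mod_hom A E E'" "bij_betw \<theta> (carrier E) (carrier E')"
    "compose (carrier N) \<theta> \<beta> = \<beta>'" "compose (carrier E) \<gamma>' \<theta> = \<gamma>" using assms by auto
  show thesis
    by (rule that[OF \<theta>(1,2)]) (use \<theta>(3,4) in \<open>auto simp: compose_def\<close>)
qed

lemma ext_equivalent_refl:
  assumes "is_ext A M N \<xi>"
  shows "ext_equivalent A N \<xi> \<xi>"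
proof -
  obtain E \<beta> \<gamma> where [simp]: "\<xi> = (E, \<beta>, \<gamma>)" by (cases \<xi>)
  note e = is_extD[OF assms[simplified]]
  have "bij_betw (\<lambda>x\<in>carrier E. x) (carrier E) (carrier E)" by (auto simp: bij_betw_def inj_on_def)
  then show ?thesis unfolding \<open>\<xi> = _\<close>
    by (rule ext_equivalentI[OF mod_hom_id[OF e(2)] _ e(3,4)]) (use mod_homD(1)[OF e(3)] in auto)
qed

lemma ext_equivalent_sym:
  assumes "is_ext A M N \<xi>" "is_ext A M N \<xi>'" "ext_equivalent A N \<xi> \<xi>'"
  shows "ext_equivalent A N \<xi>' \<xi>"
proof -
  obtain E \<beta> \<gamma> where x: "\<xi> = (E, \<beta>, \<gamma>)" by (cases \<xi>)
  obtain E' \<beta>' \<gamma>' where x': "\<xi>' = (E', \<beta>', \<gamma>')" by (cases \<xi>')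
  note e = is_extD[OF assms(1)[unfolded x]] and e' = is_extD[OF assms(2)[unfolded x']]
  obtain \<theta> where \<theta>: "\<theta> \<in> mod_hom A E E'" "bij_betw \<theta> (carrier E) (carrier E')"
    "\<And>y. y \<in> carrier N \<Longrightarrow> \<theta> (\<beta> y) = \<beta>' y"
      "\<And>x. x \<in> carrier E \<Longrightarrow> \<gamma>' (\<theta> x) = \<gamma> x"
    using assms(3) unfolding x x' by (rule ext_equivalentE) blast
  have inj: "inj_on \<theta> (carrier E)" and surj: "\<theta> ` carrier E = carrier E'"
    using \<theta>(2) by (auto simp: bij_betw_def)
  have "\<exists>g\<in>mod_hom A E' E. \<forall>x\<in>carrier E'. \<theta> (g x) = (\<lambda>x\<in>carrier E'. x) x"
    by (rule hom_lift_inj[OF e'(2) e(2) e'(2) \<theta>(1) inj mod_hom_id[OF e'(2)]]) (simp add: surj)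
  then obtain g where g: "g \<in> mod_hom A E' E" "\<And>x. x \<in> carrier E' \<Longrightarrow> \<theta> (g x) = x" by auto
  have g\<theta>: "g (\<theta> x) = x" if "x \<in> carrier E" for x
    using that inj_onD[OF inj] g mod_homD(1)[OF \<theta>(1)] mod_homD(1)[OF g(1)] by metis
  have "bij_betw g (carrier E') (carrier E)"
    by (rule bij_betw_byWitness[where f' = \<theta>]) (use g g\<theta> mod_homD(1)[OF \<theta>(1)] mod_homD(1)[OF g(1)] in auto)
  then show ?thesis unfolding x x'
  proof (rule ext_equivalentI[OF g(1) _ e(3) e'(4)])
    show "g (\<beta>' y) = \<beta> y" if "y \<in> carrier N" for y
      using g\<theta>[OF mod_homD(1)[OF e(3) that]] \<theta>(3)[OF that] by simp
    show "\<gamma> (g x) = \<gamma>' x" if "x \<in> carrier E'" for x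
      using \<theta>(4)[OF mod_homD(1)[OF g(1) that]] g(2)[OF that] by simp
  qed
qed

lemma ext_equivalent_trans:
  assumes "is_ext A M N \<xi>" "is_ext A M N \<xi>'" "is_ext A M N \<xi>''"
    "ext_equivalent A N \<xi> \<xi>'" "ext_equivalent A N \<xi>' \<xi>''"
  shows "ext_equivalent A N \<xi> \<xi>''"
proof -
  obtain E \<beta> \<gamma> where x: "\<xi> = (E, \<beta>, \<gamma>)" by (cases \<xi>)
  obtain E' \<beta>' \<gamma>' where x': "\<xi>' = (E', \<beta>', \<gamma>')" by (cases \<xi>')
  obtain E'' \<beta>'' \<gamma>'' where x'': "\<xi>'' = (E'', \<beta>'', \<gamma>'')" by (cases \<xi>'')
  note e = is_extD[OF assms(1)[unfolded x]] and e' = is_extD[OF assms(2)[unfolded x']]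
    and e'' = is_extD[OF assms(3)[unfolded x'']]
  obtain \<theta> where \<theta>: "\<theta> \<in> mod_hom A E E'" "bij_betw \<theta> (carrier E) (carrier E')"
    "\<And>y. y \<in> carrier N \<Longrightarrow> \<theta> (\<beta> y) = \<beta>' y"
      "\<And>x. x \<in> carrier E \<Longrightarrow> \<gamma>' (\<theta> x) = \<gamma> x"
    using assms(4) unfolding x x' by (rule ext_equivalentE) blast
  obtain \<theta>' where \<theta>': "\<theta>' \<in> mod_hom A E' E''" "bij_betw \<theta>' (carrier E') (carrier E'')"
    "\<And>y. y \<in> carrier N \<Longrightarrow> \<theta>' (\<beta>' y) = \<beta>'' y"
      "\<And>x. x \<in> carrier E' \<Longrightarrow> \<gamma>'' (\<theta>' x) = \<gamma>' x"
    using assms(5) unfolding x' x'' by (rule ext_equivalentE) blast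
  show ?thesis unfolding x x''
    by (rule ext_equivalentI[OF mod_hom_comp[OF \<theta>(1) \<theta>'(1) e(2)] bij_betw_compose[OF \<theta>(2) \<theta>'(2)] e''(3) e(4)])
      (use \<theta> \<theta>' mod_homD(1)[OF e(3)] mod_homD(1)[OF \<theta>(1)] in \<open>auto simp: compose_eq\<close>)
qed

lemma equiv_ext_rel: "equiv (extensions A M N) (ext_rel A M N)"
proof (rule equivI)
  show "ext_rel A M N \<subseteq> extensions A M N \<times> extensions A M N" by (auto simp: ext_rel_def)
  show "refl_on (extensions A M N) (ext_rel A M N)"
    by (auto simp: refl_on_def ext_rel_def extensions_iff intro!: ext_equivalent_refl)
  show "sym (ext_rel A M N)"
    by (auto simp: sym_def ext_rel_def extensions_iff simp del: ext_equivalent.simps intro: ext_equivalent_sym)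
  show "trans (ext_rel A M N)"
    by (auto simp: trans_def ext_rel_def extensions_iff simp del: ext_equivalent.simps intro: ext_equivalent_trans)
qed

text \<open>The sums and multiples in \<open>Ext1_space\<close> collect representatives of the
  universe type, while the constructions behind them have other carriers. Transporting the structure
  along a bijection shows that these collections are inhabited.\<close>

lemma ext_copy:
  fixes A :: "('a, 'r) ring_scheme" and M N :: "'a umod"
  assumes "is_ext A M N \<xi>" "left_module A N"
  shows "\<exists>\<zeta>\<in>extensions A M N. ext_equivalent A N \<xi> \<zeta>"
proof -
  obtain E \<beta> \<gamma> where x: "\<xi> = (E, \<beta>, \<gamma>)" by (cases \<xi>)
  note e = is_extD[OF assms(1)[unfolded x]]
  obtain E' :: "'a umod" where E': "fg_module A E'" "mod_iso A E E'"
    using fg_module_in_universe[OF e(1)] by blast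
  note lE' = fg_moduleD[OF E'(1)]
  obtain \<theta> where \<theta>: "\<theta> \<in> mod_hom A E E'" "bij_betw \<theta> (carrier E) (carrier E')"
    using E'(2) by (auto simp: mod_iso_def)
  have inj: "inj_on \<theta> (carrier E)" and surj: "\<theta> ` carrier E = carrier E'"
    using \<theta>(2) by (auto simp: bij_betw_def)
  have "\<exists>g\<in>mod_hom A E' E. \<forall>x\<in>carrier E'. \<theta> (g x) = (\<lambda>x\<in>carrier E'. x) x"
    by (rule hom_lift_inj[OF lE' e(2) lE' \<theta>(1) inj mod_hom_id[OF lE']]) (simp add: surj)
  then obtain g where g: "g \<in> mod_hom A E' E" "\<And>x. x \<in> carrier E' \<Longrightarrow> \<theta> (g x) = x" by auto
  have g\<theta>: "g (\<theta> x) = x" if "x \<in> carrier E" for x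
    using that inj_onD[OF inj] g mod_homD(1)[OF \<theta>(1)] mod_homD(1)[OF g(1)] by metis
  have gs: "g ` carrier E' = carrier E"
    using g\<theta> mod_homD(1)[OF \<theta>(1)] mod_homD(1)[OF g(1)] by (auto intro: image_eqI[OF sym])
  let ?\<beta> = "compose (carrier N) \<theta> \<beta>" and ?\<gamma> = "compose (carrier E') \<gamma> g"
  have \<beta>: "?\<beta> \<in> mod_hom A N E'" by (rule mod_hom_comp[OF e(3) \<theta>(1) assms(2)])
  have \<gamma>: "?\<gamma> \<in> mod_hom A E' M" by (rule mod_hom_comp[OF g(1) e(4) lE'])
  have "inj_on ?\<beta> (carrier N)"
    using e(5) inj mod_homD(1)[OF e(3)] by (auto simp: inj_on_def compose_def)
  moreover have "?\<gamma> ` carrier E' = carrier M"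
    unfolding e(6)[symmetric] gs[symmetric] by (auto simp: compose_def image_image)
  moreover have "?\<beta> ` carrier N = a_kernel E' M ?\<gamma>"
  proof
    show "?\<beta> ` carrier N \<subseteq> a_kernel E' M ?\<gamma>"
      using mod_homD(1)[OF \<beta>] g\<theta> mod_homD(1)[OF e(3)] e(9) mod_homD(1)[OF \<theta>(1)]
      by (auto simp: a_kernel_eq compose_def)
    show "a_kernel E' M ?\<gamma> \<subseteq> ?\<beta> ` carrier N"
    proof
      fix x assume "x \<in> a_kernel E' M ?\<gamma>"
      then have x: "x \<in> carrier E'" "\<gamma> (g x) = \<zero>\<^bsub>M\<^esub>" by (auto simp: a_kernel_eq compose_def)
      then obtain y where "y \<in> carrier N" "g x = \<beta> y" using e(8) mod_homD(1)[OF g(1)] by blast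
      then show "x \<in> ?\<beta> ` carrier N" using g(2)[OF x(1)] by (intro image_eqI[of _ _ y]) (auto simp: compose_def)
    qed
  qed
  ultimately have ext: "is_ext A M N (E', ?\<beta>, ?\<gamma>)" using E'(1) \<beta> \<gamma> by (simp add: is_ext_def)
  have "ext_equivalent A N (E, \<beta>, \<gamma>) (E', ?\<beta>, ?\<gamma>)"
    by (rule ext_equivalentI[OF \<theta> \<beta> e(4)])
      (use g\<theta> mod_homD(1)[OF \<theta>(1)] in \<open>auto simp: compose_def\<close>)
  then show ?thesis using ext by (auto simp: x extensions_iff simp del: ext_equivalent.simps)
qed

lemma split_is_ext:
  assumes "fg_module A M" "fg_module A N"
  shows "is_ext A M N (split_ext M N)"
proof -
  note M = fg_moduleD[OF assms(1)] and N = fg_moduleD[OF assms(2)]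
  interpret M: left_module A M by (rule M)
  interpret N: left_module A N by (rule N)
  have "(\<lambda>y\<in>carrier N. (y, \<zero>\<^bsub>M\<^esub>)) \<in> mod_hom A N (mod_prod N M)"
    by (rule mod_homI[OF _ _ _ N]) (auto simp: mod_prod_simps M.smult_zero_r)
  moreover have "(\<lambda>p\<in>carrier (mod_prod N M). snd p) \<in> mod_hom A (mod_prod N M) M"
    by (rule mod_homI[OF _ _ _ mod_prod_left_module[OF N M]]) (auto simp: mod_prod_simps)
  moreover have "(\<lambda>p\<in>carrier (mod_prod N M). snd p) ` carrier (mod_prod N M) = carrier M"
    by (auto simp: mod_prod_simps intro!: image_eqI[of _ _ "(\<zero>\<^bsub>N\<^esub>, _)"])
  ultimately show ?thesis
    using fg_module_prod[OF assms(2,1)]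
    by (auto simp: is_ext_def split_ext_def inj_on_def a_kernel_eq mod_prod_simps)
qed

text \<open>The comparison map sends \<open>x\<close> to (r x, \<gamma> x); a preimage of (y, m) is
  any lift \<open>x\<close> of \<open>m\<close>, corrected by \<beta> (y - r x).\<close>

lemma retraction_split:
  assumes "is_ext A M N (E, \<beta>, \<gamma>)" "fg_module A M" "fg_module A N"
    and r: "r \<in> mod_hom A E N" "\<And>y. y \<in> carrier N \<Longrightarrow> r (\<beta> y) = y"
  shows "ext_equivalent A N (split_ext M N) (E, \<beta>, \<gamma>)"
proof -
  note e = is_extD[OF assms(1)] and M = fg_moduleD[OF assms(2)] and N = fg_moduleD[OF assms(3)]
  note NM = mod_prod_left_module[OF N M]
  interpret E: left_module A E by (rule e(2))
  interpret N: left_module A N by (rule N)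
  interpret M: left_module A M by (rule M)
  let ?\<theta> = "\<lambda>x\<in>carrier E. (r x, \<gamma> x)"
  have \<theta>: "?\<theta> \<in> mod_hom A E (mod_prod N M)"
    by (rule mod_homI[OF _ _ _ e(2)]) (use mod_homD[OF r(1)] mod_homD[OF e(4)] in \<open>auto simp: mod_prod_simps\<close>)
  have inj: "inj_on ?\<theta> (carrier E)"
  proof (rule mod_hom_inj_onI[OF e(2) NM \<theta>])
    fix x assume x: "x \<in> carrier E" "?\<theta> x = \<zero>\<^bsub>mod_prod N M\<^esub>"
    then obtain y where y: "y \<in> carrier N" "x = \<beta> y" using e(8) by (auto simp: mod_prod_simps)
    then have "y = \<zero>\<^bsub>N\<^esub>" using x r(2) by (simp add: mod_prod_simps)
    then show "x = \<zero>\<^bsub>E\<^esub>" using y(2) mod_hom_zero[OF N e(2,3)] by simp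
  qed
  have "carrier (mod_prod N M) \<subseteq> ?\<theta> ` carrier E"
  proof
    fix z assume "z \<in> carrier (mod_prod N M)"
    then obtain y m where z: "z = (y, m)" "y \<in> carrier N" "m \<in> carrier M" by (auto simp: mod_prod_simps)
    obtain x where x: "x \<in> carrier E" "\<gamma> x = m" using z(3) unfolding e(6)[symmetric] by blast
    have rx: "r x \<in> carrier N" by (rule mod_homD(1)[OF r(1) x(1)])
    then have "\<beta> (y \<ominus>\<^bsub>N\<^esub> r x) \<in> carrier E" using mod_homD(1)[OF e(3)] z(2) by simp
    moreover have "r (x \<oplus>\<^bsub>E\<^esub> \<beta> (y \<ominus>\<^bsub>N\<^esub> r x)) = y"
      using calculation x(1) rx z(2) mod_homD(2)[OF r(1)] r(2) by (simp add: N.add_diff_cancel)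
    moreover have "\<gamma> (x \<oplus>\<^bsub>E\<^esub> \<beta> (y \<ominus>\<^bsub>N\<^esub> r x)) = m"
      using calculation(1) x rx z(2,3) mod_homD(2)[OF e(4)] e(9) by simp
    ultimately show "z \<in> ?\<theta> ` carrier E" using x(1) z(1)
      by (intro image_eqI[of _ _ "x \<oplus>\<^bsub>E\<^esub> \<beta> (y \<ominus>\<^bsub>N\<^esub> r x)"]) auto
  qed
  then have "bij_betw ?\<theta> (carrier E) (carrier (mod_prod N M))"
    using inj mod_homD(1)[OF \<theta>] unfolding bij_betw_def by blast
  moreover note split = split_is_ext[OF assms(2,3)]
  ultimately have "ext_equivalent A N (E, \<beta>, \<gamma>) (split_ext M N)"
    unfolding split_ext_def
  proof (intro ext_equivalentI[OF \<theta> _ _ e(4)])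
    show "(\<lambda>y\<in>carrier N. (y, \<zero>\<^bsub>M\<^esub>)) \<in> mod_hom A N (mod_prod N M)"
      using split by (simp add: split_ext_def is_ext_def)
    show "?\<theta> (\<beta> y) = (\<lambda>y\<in>carrier N. (y, \<zero>\<^bsub>M\<^esub>)) y" if "y \<in> carrier N" for y
      using that mod_homD(1)[OF e(3) that] r(2)[OF that] e(9)[OF that] by simp
    show "(\<lambda>p\<in>carrier (mod_prod N M). snd p) (?\<theta> x) = \<gamma> x" if "x \<in> carrier E" for x
      using that mod_homD(1)[OF e(4) that] mod_homD(1)[OF r(1) that] by (simp add: mod_prod_simps)
  qed
  then show ?thesis by (rule ext_equivalent_sym[OF assms(1) split])
qed

text \<open>Describes the Baer sum by the projection \<pi> from the pullback: its last two
  properties say that \<pi> respects the maps to \<open>M\<close> and adds the two copies of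
  \<open>N\<close>. Later arguments use this description in place of cosets.\<close>

lemma baer_sum_is_ext:
  fixes E :: "('a, 'x) module" and E' :: "('a, 'y) module" and N :: "('a, 'l) module"
  assumes A: "fd_algebra_field K A" and M: "left_module A M" and N: "left_module A N"
    and ext: "is_ext A M N (E, \<beta>, \<gamma>)" "is_ext A M N (E', \<beta>', \<gamma>')"
  obtains Q \<beta>'' \<gamma>'' \<pi> where "baer_sum N (E, \<beta>, \<gamma>) (E', \<beta>', \<gamma>') = (Q, \<beta>'', \<gamma>'')"
    "is_ext A M N (Q, \<beta>'', \<gamma>'')"
    "\<pi> \<in> mod_hom A ((mod_prod E E')\<lparr>carrier := {(x, x') \<in> carrier E \<times> carrier E'. \<gamma> x = \<gamma>' x'}\<rparr>) Q"
    "\<And>x x'. \<lbrakk>x \<in> carrier E; x' \<in> carrier E'; \<gamma> x = \<gamma>' x'\<rbrakk> \<Longrightarrow> \<gamma>'' (\<pi> (x, x')) = \<gamma> x"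
    "\<And>y y'. \<lbrakk>y \<in> carrier N; y' \<in> carrier N\<rbrakk> \<Longrightarrow> \<pi> (\<beta> y, \<beta>' y') = \<beta>'' (y \<oplus>\<^bsub>N\<^esub> y')"
proof -
  interpret fd_algebra_field K A by fact
  note e = is_extD[OF ext(1)] and e' = is_extD[OF ext(2)]
  interpret E: left_module A E by (rule e(2))
  interpret E': left_module A E' by (rule e'(2))
  interpret M: left_module A M by (rule M)
  interpret N: left_module A N by (rule N)
  define Yc where "Yc = {(x, x') \<in> carrier E \<times> carrier E'. \<gamma> x = \<gamma>' x'}"
  define Y where "Y = (mod_prod E E')\<lparr>carrier := Yc\<rparr>"
  define D where "D = {(\<beta> y, \<ominus>\<^bsub>E'\<^esub> \<beta>' y) | y. y \<in> carrier N}"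
  define Q where "Q = mod_quot Y D"
  note EE' = mod_prod_left_module[OF e(2) e'(2)]
  interpret EE': left_module A "mod_prod E E'" by (rule EE')
  have Ys: "submodule Yc A (mod_prod E E')"
    by (rule EE'.submodule_intro)
      (use mod_homD[OF e(4)] mod_homD[OF e'(4)] mod_hom_zero[OF e(2) M e(4)] mod_hom_zero[OF e'(2) M e'(4)]
        in \<open>auto simp: mod_prod_simps Yc_def\<close>)
  have Y: "left_module A Y" unfolding Y_def by (rule res_left_module[OF EE' Ys])
  interpret Y: left_module A Y by (rule Y)
  have fgY: "fg_module A Y" unfolding Y_def by (rule fg_module_res[OF fg_module_prod[OF e(1) e'(1)] Ys])
  have Y_simps: "carrier Y = Yc" "\<zero>\<^bsub>Y\<^esub> = (\<zero>\<^bsub>E\<^esub>, \<zero>\<^bsub>E'\<^esub>)"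
    "\<And>p q. p \<oplus>\<^bsub>Y\<^esub> q = (fst p \<oplus>\<^bsub>E\<^esub> fst q, snd p \<oplus>\<^bsub>E'\<^esub> snd q)"
    "\<And>a p. a \<odot>\<^bsub>Y\<^esub> p = (a \<odot>\<^bsub>E\<^esub> fst p, a \<odot>\<^bsub>E'\<^esub> snd p)"
    by (auto simp: Y_def mod_prod_simps)
  have bc: "\<beta> y \<in> carrier E" "\<beta>' y \<in> carrier E'" "\<gamma> (\<beta> y) = \<zero>\<^bsub>M\<^esub>"
    "\<gamma>' (\<beta>' y) = \<zero>\<^bsub>M\<^esub>"
    if "y \<in> carrier N" for y
    using that mod_homD(1)[OF e(3)] mod_homD(1)[OF e'(3)] e(9) e'(9) by auto
  \<comment> \<open>Negation is moved inside \<beta>', so that the antidiagonal \<open>D\<close> is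
    the image of a homomorphism and thereby a submodule.\<close>
  let ?\<delta> = "\<lambda>y. (\<beta> y, \<beta>' (\<ominus>\<^bsub>N\<^esub> y))"
  have D_eq: "D = ?\<delta> ` carrier N"
    unfolding D_def using mod_hom_minus[OF N e'(2,3)] by auto
  have \<delta>: "restrict ?\<delta> (carrier N) \<in> mod_hom A N Y"
  proof (rule mod_homI[OF _ _ _ N])
    show "?\<delta> (a \<odot>\<^bsub>N\<^esub> x) = a \<odot>\<^bsub>Y\<^esub> ?\<delta> x" if "a \<in> carrier A"
      "x \<in> carrier N" for a x
      using that mod_homD(3)[OF e(3)] mod_homD(3)[OF e'(3)] by (simp add: Y_simps flip: N.smult_minus_right)
  qed (use bc mod_homD(2)[OF e(3)] mod_homD(2)[OF e'(3)] in \<open>auto simp: Y_simps Yc_def N.M.minus_add\<close>)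
  have Ds: "submodule D A Y"
    using submodule_image[OF N Y \<delta> submodule_carrier[OF N]] by (simp add: D_eq)
  note q = mod_quot_facts[OF Y Ds, folded Q_def]
  define \<pi> where "\<pi> = (\<lambda>p\<in>carrier Y. D +>\<^bsub>Y\<^esub> p)"
  note q = q[folded \<pi>_def]
  have fgQ: "fg_module A Q" by (rule fg_module_surj_image[OF fgY q(1-3)])
  interpret Q: left_module A Q by (rule q(1))
  let ?\<beta> = "\<lambda>y\<in>carrier N. D +>\<^bsub>Y\<^esub> (\<beta> y, \<zero>\<^bsub>E'\<^esub>)"
    and ?\<gamma> = "\<lambda>C\<in>carrier Q. the_elem ((\<lambda>p. \<gamma> (fst p)) ` C)"
  have baer: "baer_sum N (E, \<beta>, \<gamma>) (E', \<beta>', \<gamma>') = (Q, ?\<beta>, ?\<gamma>)"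
    by (simp add: Let_def Q_def D_def Y_def Yc_def)
  have b0: "(\<beta> y, \<zero>\<^bsub>E'\<^esub>) \<in> carrier Y" if "y \<in> carrier N" for y
    using bc[OF that] mod_hom_zero[OF e'(2) M e'(4)] by (simp add: Y_simps Yc_def)
  have \<beta>_eq: "?\<beta> y = \<pi> (\<beta> y, \<zero>\<^bsub>E'\<^esub>)" if "y \<in> carrier N" for y
    using b0[OF that] that by (simp add: \<pi>_def)
  have b0h: "(\<lambda>y\<in>carrier N. (\<beta> y, \<zero>\<^bsub>E'\<^esub>)) \<in> mod_hom A N Y"
    by (rule mod_homI[OF _ _ _ N]) (use b0 mod_homD[OF e(3)] in \<open>auto simp: Y_simps E'.smult_zero_r\<close>)
  have \<beta>h: "?\<beta> \<in> mod_hom A N Q"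
    using mod_hom_comp[OF b0h q(2) N] b0 by (simp add: compose_def \<pi>_def cong: restrict_cong)
  have \<gamma>fst: "(\<lambda>p\<in>carrier Y. \<gamma> (fst p)) \<in> mod_hom A Y M"
    by (rule mod_homI[OF _ _ _ Y]) (use mod_homD[OF e(4)] mod_homD(1)[OF e'(4)] in \<open>auto simp: Y_simps Yc_def\<close>)
  note ker\<pi> = q(5)
  have "\<exists>g\<in>mod_hom A Q M. \<forall>p\<in>carrier Y. g (\<pi> p) = (\<lambda>p\<in>carrier Y. \<gamma> (fst p)) p"
    by (rule hom_factor[OF Y q(1) M q(2,3) \<gamma>fst]) (use ker\<pi> bc in \<open>auto simp: D_eq\<close>)
  then obtain g where g: "g \<in> mod_hom A Q M" "\<And>p. p \<in> carrier Y \<Longrightarrow> g (\<pi> p) = \<gamma> (fst p)" by auto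
  \<comment> \<open>The definition extracts with \<open>the_elem\<close> the common value of
    \<gamma> on the first components of a coset. This value is unique since \<gamma> kills the first
    components of \<open>D\<close>, so the extracted map is the induced one.\<close>
  have "?\<gamma> = g"
  proof (rule extensionalityI[OF _ mod_homD(4)[OF g(1)]])
    fix C assume C: "C \<in> carrier Q"
    then obtain p where p: "p \<in> carrier Y" "C = \<pi> p" using q(3) by blast
    have C_eq: "C = D +>\<^bsub>Y\<^esub> p" using p by (simp add: \<pi>_def)
    have "\<gamma> (fst c) = g C" if c: "c \<in> C" for c
    proof -
      obtain d where d: "d \<in> D" "c = d \<oplus>\<^bsub>Y\<^esub> p" using c unfolding C_eq by (auto simp: a_r_coset_def')
      obtain y where y: "y \<in> carrier N" "d = ?\<delta> y" using d(1) unfolding D_eq by blast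
      have "fst p \<in> carrier E" using p(1) by (auto simp: Y_simps Yc_def)
      then show ?thesis using g(2)[OF p(1)] p(2) d(2) y bc mod_homD(1,2)[OF e(4)] by (simp add: Y_simps)
    qed
    moreover have "p \<in> C"
    proof -
      have "\<zero>\<^bsub>Y\<^esub> \<in> D" by (rule submoduleD(2)[OF Ds])
      moreover have "p = \<zero>\<^bsub>Y\<^esub> \<oplus>\<^bsub>Y\<^esub> p" using p(1) by simp
      ultimately show ?thesis unfolding C_eq a_r_coset_def' by blast
    qed
    ultimately have "(\<lambda>p. \<gamma> (fst p)) ` C = {g C}" by auto
    then show "?\<gamma> C = g C" using C by simp
  qed auto
  then have \<gamma>h: "?\<gamma> \<in> mod_hom A Q M" and \<gamma>\<pi>: "\<And>p. p \<in> carrier Y \<Longrightarrow> ?\<gamma> (\<pi> p) = \<gamma> (fst p)" using g by simp_all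
  have YI: "(x, x') \<in> carrier Y" if "x \<in> carrier E" "x' \<in> carrier E'" "\<gamma> x = \<gamma>' x'" for x x'
    using that by (simp add: Y_simps Yc_def)
  have \<pi>\<beta>: "\<pi> (\<beta> y, \<beta>' y') = ?\<beta> (y \<oplus>\<^bsub>N\<^esub> y')" if y: "y \<in> carrier N"
    "y' \<in> carrier N" for y y'
  proof -
    have yy: "y \<oplus>\<^bsub>N\<^esub> y' \<in> carrier N" using y by simp
    have c1: "(\<beta> y, \<beta>' y') \<in> carrier Y" using bc y by (auto intro!: YI)
    \<comment> \<open>Modulo \<open>D\<close> the second component is moved into the first: (\<beta>
      y, \<beta>' y') is (\<beta> (y + y'), 0) plus the element (- \<beta> y', \<beta>' y') of
      \<open>D\<close>.\<close>
    have dd: "?\<delta> (\<ominus>\<^bsub>N\<^esub> y') \<in> D" unfolding D_eq using y by blast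
    have ddY: "?\<delta> (\<ominus>\<^bsub>N\<^esub> y') \<in> carrier Y" using submoduleD(1)[OF Ds] dd by blast
    have "\<beta> y \<in> carrier E" "\<beta> y' \<in> carrier E" "\<beta>' y' \<in> carrier E'"
      "\<beta> (\<ominus>\<^bsub>N\<^esub> y') = \<ominus>\<^bsub>E\<^esub> \<beta> y'"
      using bc y mod_hom_minus[OF N e(2,3)] by auto
    then have "?\<delta> (\<ominus>\<^bsub>N\<^esub> y') \<oplus>\<^bsub>Y\<^esub> (\<beta> (y \<oplus>\<^bsub>N\<^esub> y'), \<zero>\<^bsub>E'\<^esub>) = (\<beta> y, \<beta>' y')"
      using y mod_homD(2)[OF e(3)] by (simp add: Y_simps E.M.a_comm[of _ "\<beta> y'"] E.M.r_neg1)
    then have "\<pi> (\<beta> y, \<beta>' y') = \<pi> (?\<delta> (\<ominus>\<^bsub>N\<^esub> y')) \<oplus>\<^bsub>Q\<^esub> \<pi> (\<beta> (y \<oplus>\<^bsub>N\<^esub> y'), \<zero>\<^bsub>E'\<^esub>)"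
      using mod_homD(2)[OF q(2) ddY b0[OF yy]] by simp
    also have "\<dots> = \<pi> (\<beta> (y \<oplus>\<^bsub>N\<^esub> y'), \<zero>\<^bsub>E'\<^esub>)"
      using ker\<pi>[OF ddY] dd mod_homD(1)[OF q(2) b0[OF yy]] by simp
    finally show ?thesis using \<beta>_eq[OF yy] by simp
  qed
  have inj: "inj_on ?\<beta> (carrier N)"
  proof (rule mod_hom_inj_onI[OF N q(1) \<beta>h])
    fix y assume y: "y \<in> carrier N" "?\<beta> y = \<zero>\<^bsub>Q\<^esub>"
    then have "(\<beta> y, \<zero>\<^bsub>E'\<^esub>) \<in> D" using \<beta>_eq[OF y(1)] ker\<pi>[OF b0[OF y(1)]] by simp
    then obtain z where z: "z \<in> carrier N" "\<beta> y = \<beta> z"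
      "\<beta>' (\<ominus>\<^bsub>N\<^esub> z) = \<zero>\<^bsub>E'\<^esub>" unfolding D_eq by auto
    have "\<beta>' (\<ominus>\<^bsub>N\<^esub> z) = \<beta>' \<zero>\<^bsub>N\<^esub>" using z(3) mod_hom_zero[OF N e'(2,3)] by simp
    then have "\<ominus>\<^bsub>N\<^esub> z = \<zero>\<^bsub>N\<^esub>" using inj_onD[OF e'(5)] z(1) by auto
    then have "z = \<zero>\<^bsub>N\<^esub>" using z(1) by (metis N.M.r_neg N.M.r_zero)
    then show "y = \<zero>\<^bsub>N\<^esub>" using inj_onD[OF e(5) z(2) y(1) z(1)] by simp
  qed
  have surj: "?\<gamma> ` carrier Q = carrier M"
  proof
    show "?\<gamma> ` carrier Q \<subseteq> carrier M" using mod_homD(1)[OF \<gamma>h] by blast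
    show "carrier M \<subseteq> ?\<gamma> ` carrier Q"
    proof
      fix m assume m: "m \<in> carrier M"
      obtain x where x: "x \<in> carrier E" "\<gamma> x = m" using m unfolding e(6)[symmetric] by blast
      obtain x' where x': "x' \<in> carrier E'" "\<gamma>' x' = m" using m unfolding e'(6)[symmetric] by blast
      have xx: "(x, x') \<in> carrier Y" using x x' by (auto intro!: YI)
      show "m \<in> ?\<gamma> ` carrier Q"
        using \<gamma>\<pi>[OF xx] x(2) mod_homD(1)[OF q(2) xx] by (intro image_eqI[of _ _ "\<pi> (x, x')"]) auto
    qed
  qed
  have "?\<beta> ` carrier N = a_kernel Q M ?\<gamma>"
  proof
    have "?\<gamma> (?\<beta> y) = \<zero>\<^bsub>M\<^esub>" if "y \<in> carrier N" for y
      using \<gamma>\<pi>[OF b0[OF that]] \<beta>_eq[OF that] bc(3)[OF that] by simp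
    then show "?\<beta> ` carrier N \<subseteq> a_kernel Q M ?\<gamma>"
      using mod_homD(1)[OF \<beta>h] unfolding a_kernel_eq by blast
    show "a_kernel Q M ?\<gamma> \<subseteq> ?\<beta> ` carrier N"
    proof
      fix C assume "C \<in> a_kernel Q M ?\<gamma>"
      then have C: "C \<in> carrier Q" "?\<gamma> C = \<zero>\<^bsub>M\<^esub>" unfolding a_kernel_eq by blast+
      then obtain p where p: "p \<in> carrier Y" "C = \<pi> p" using q(3) by blast
      then obtain x x' where x: "p = (x, x')" "x \<in> carrier E" "x' \<in> carrier E'" "\<gamma> x = \<gamma>' x'"
        by (auto simp: Y_simps Yc_def)
      have "\<gamma> x = \<zero>\<^bsub>M\<^esub>" using C(2) p(2) \<gamma>\<pi>[OF p(1)] x(1) by simp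
      then obtain y y' where "y \<in> carrier N" "x = \<beta> y" "y' \<in> carrier N" "x' = \<beta>' y'"
        using e(8)[OF x(2)] e'(8)[OF x(3)] x(4) by auto
      then show "C \<in> ?\<beta> ` carrier N" using \<pi>\<beta>[of y y'] p(2) x(1) N.M.a_closed by blast
    qed
  qed
  then have "is_ext A M N (Q, ?\<beta>, ?\<gamma>)"
    unfolding is_ext_def using fgQ \<beta>h \<gamma>h inj surj by simp
  then show thesis
    by (rule that[OF baer _ q(2)[unfolded Y_def Yc_def]]) (use \<gamma>\<pi> YI \<pi>\<beta> in auto)
qed

text \<open>The extension of the image of \<open>g\<close> by \<open>N\<close>, pulled back along
  \<open>v\<close>. It serves twice: for scalar multiples, with \<open>v\<close> a multiple of the
  identity, and for building an extension from a map into the cokernel \<open>Ck j\<close>.\<close>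

lemma pullback_is_ext:
  assumes A: "fd_algebra_field K A"
    and E: "fg_module A E" and M: "fg_module A M" and N: "left_module A N" and C: "left_module A C"
    and \<beta>: "\<beta> \<in> mod_hom A N E" "inj_on \<beta> (carrier N)" "\<beta> ` carrier N = a_kernel E C g"
    and g: "g \<in> mod_hom A E C" and v: "v \<in> mod_hom A M C" "v ` carrier M \<subseteq> g ` carrier E"
  defines "Y \<equiv> (mod_prod E M)\<lparr>carrier := {(x, z) \<in> carrier E \<times> carrier M. g x = v z}\<rparr>"
  shows "is_ext A M N (Y, \<lambda>y\<in>carrier N. (\<beta> y, \<zero>\<^bsub>M\<^esub>), \<lambda>p\<in>carrier Y. snd p)"
proof -
  interpret fd_algebra_field K A by fact
  note lE = fg_moduleD[OF E] and lM = fg_moduleD[OF M]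
  interpret E: left_module A E by (rule lE)
  interpret M: left_module A M by (rule lM)
  define Yc where "Yc = {(x, z) \<in> carrier E \<times> carrier M. g x = v z}"
  note EM = mod_prod_left_module[OF lE lM]
  interpret EM: left_module A "mod_prod E M" by (rule EM)
  have v0: "v \<zero>\<^bsub>M\<^esub> = \<zero>\<^bsub>C\<^esub>" by (rule mod_hom_zero[OF lM C v(1)])
  have Y_eq: "Y = mod_prod E M \<restriction> Yc" by (simp add: Y_def Yc_def)
  have Ys: "submodule Yc A (mod_prod E M)"
    by (rule EM.submodule_intro)
      (use mod_homD[OF g] mod_homD[OF v(1)] v0 mod_hom_zero[OF lE C g] in \<open>auto simp: mod_prod_simps Yc_def\<close>)
  have lY: "left_module A Y" unfolding Y_eq by (rule res_left_module[OF EM Ys])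
  have fgY: "fg_module A Y" unfolding Y_eq by (rule fg_module_res[OF fg_module_prod[OF E M] Ys])
  have Y_simps: "carrier Y = Yc" "\<zero>\<^bsub>Y\<^esub> = (\<zero>\<^bsub>E\<^esub>, \<zero>\<^bsub>M\<^esub>)"
    "\<And>p q. p \<oplus>\<^bsub>Y\<^esub> q = (fst p \<oplus>\<^bsub>E\<^esub> fst q, snd p \<oplus>\<^bsub>M\<^esub> snd q)"
    "\<And>a p. a \<odot>\<^bsub>Y\<^esub> p = (a \<odot>\<^bsub>E\<^esub> fst p, a \<odot>\<^bsub>M\<^esub> snd p)"
    by (auto simp: Y_eq mod_prod_simps)
  have \<beta>_ker: "x \<in> \<beta> ` carrier N \<longleftrightarrow> x \<in> carrier E \<and> g x = \<zero>\<^bsub>C\<^esub>" for x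
    unfolding \<beta>(3) by (simp add: a_kernel_eq)
  have bY: "(\<beta> y, \<zero>\<^bsub>M\<^esub>) \<in> Yc" if "y \<in> carrier N" for y
    using \<beta>_ker[of "\<beta> y"] that v0 by (simp add: Yc_def)
  let ?\<beta> = "\<lambda>y\<in>carrier N. (\<beta> y, \<zero>\<^bsub>M\<^esub>)" and ?\<gamma> = "\<lambda>p\<in>carrier Y. snd p"
  have "?\<beta> \<in> mod_hom A N Y"
    by (rule mod_homI[OF _ _ _ N]) (use bY mod_homD[OF \<beta>(1)] in \<open>auto simp: Y_simps M.smult_zero_r\<close>)
  moreover have "?\<gamma> \<in> mod_hom A Y M"
    by (rule mod_homI[OF _ _ _ lY]) (auto simp: Y_simps Yc_def)
  moreover have "inj_on ?\<beta> (carrier N)" using \<beta>(2) by (auto simp: inj_on_def)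
  moreover have "?\<gamma> ` carrier Y = carrier M"
  proof
    show "carrier M \<subseteq> ?\<gamma> ` carrier Y"
    proof
      fix z assume z: "z \<in> carrier M"
      then have "v z \<in> g ` carrier E" using v(2) by blast
      then obtain x where "x \<in> carrier E" "g x = v z" by (metis imageE)
      then have "(x, z) \<in> carrier Y" using z by (simp add: Y_simps Yc_def)
      then show "z \<in> ?\<gamma> ` carrier Y" by (intro image_eqI[of _ _ "(x, z)"]) auto
    qed
  qed (auto simp: Y_simps Yc_def)
  moreover have "?\<beta> ` carrier N = a_kernel Y M ?\<gamma>"
  proof
    show "?\<beta> ` carrier N \<subseteq> a_kernel Y M ?\<gamma>" using bY by (auto simp: a_kernel_eq Y_simps)
    show "a_kernel Y M ?\<gamma> \<subseteq> ?\<beta> ` carrier N"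
    proof
      fix p assume "p \<in> a_kernel Y M ?\<gamma>"
      then obtain x where p: "p = (x, \<zero>\<^bsub>M\<^esub>)" "x \<in> carrier E" "g x = \<zero>\<^bsub>C\<^esub>"
        using v0 by (auto simp: a_kernel_eq Y_simps Yc_def)
      then show "p \<in> ?\<beta> ` carrier N" using \<beta>_ker[of x] by auto
    qed
  qed
  ultimately show ?thesis using fgY by (simp add: is_ext_def)
qed

lemma ext_scale_is_ext:
  assumes A: "fd_algebra_field K A" and M: "fg_module A M" and N: "left_module A N"
    and ext: "is_ext A M N (E, \<beta>, \<gamma>)" and c: "c \<in> carrier K"
  shows "is_ext A M N (ext_scale A M N c (E, \<beta>, \<gamma>))"
proof -
  interpret fd_algebra_field K A by fact
  note e = is_extD[OF ext] and lM = fg_moduleD[OF M]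
  interpret M: left_module A M by (rule lM)
  let ?v = "\<lambda>z\<in>carrier M. scal A c \<odot>\<^bsub>M\<^esub> z"
  have "?v ` carrier M \<subseteq> \<gamma> ` carrier E" unfolding e(6) using c by auto
  from pullback_is_ext[OF A e(1) M N lM e(3,5,7,4) scal_hom[OF lM c] this]
  show ?thesis
    by (simp add: Let_def scal_def[symmetric] cong: conj_cong)
qed

section \<open>The pairing\<close>

locale hom_ext_pairing = qh_algebra K A n L P I \<Delta> Nabla
  for K :: "'k ring" (structure) and A :: "('k, 'a) module" (structure) and n L P I \<Delta> Nabla +
  fixes \<alpha> :: "nat \<Rightarrow> (nat \<Rightarrow> 'a) \<Rightarrow> nat \<Rightarrow> 'a" and i j :: nat
  assumes alpha_hom: "\<And>l. l \<in> {1..n} \<Longrightarrow> \<alpha> l \<in> mod_hom A (\<Delta> l) (Nabla l)"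
    and alpha_nonzero_hom: "\<And>l. l \<in> {1..n} \<Longrightarrow> \<alpha> l \<noteq> zero_hom (\<Delta> l) (Nabla l)"
    and i: "i \<in> {1..n}" and j: "j \<in> {1..n}" and ji: "j < i"
begin

lemma scal_eq_imp:
  assumes "left_module A M" "x \<in> carrier M" "x \<noteq> \<zero>\<^bsub>M\<^esub>" "c \<in> carrier K" "d \<in> carrier K"
    "scal A c \<odot>\<^bsub>M\<^esub> x = scal A d \<odot>\<^bsub>M\<^esub> x"
  shows "c = d"
proof (rule ccontr)
  interpret N: left_module A M by fact
  assume "c \<noteq> d"
  let ?b = "c \<oplus>\<^bsub>K\<^esub> \<ominus>\<^bsub>K\<^esub> d"
  have "?b \<noteq> \<zero>\<^bsub>K\<^esub>" using \<open>c \<noteq> d\<close> assms(4,5)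
    by (metis R.minus_equality R.minus_minus R.a_inv_closed)
  then have b: "?b \<in> Units K" using assms(4,5) field_Units by auto
  have "scal A ?b \<odot>\<^bsub>M\<^esub> x = \<zero>\<^bsub>M\<^esub>"
    using assms by (simp add: scal_mod(1)[OF assms(1)] scal_mod(3)[OF assms(1) _ assms(5,5)] N.M.r_neg)
  then have "scal A (inv\<^bsub>K\<^esub> ?b) \<odot>\<^bsub>M\<^esub> (scal A ?b \<odot>\<^bsub>M\<^esub> x) = \<zero>\<^bsub>M\<^esub>"
    using R.Units_inv_closed[OF b] by (simp add: N.smult_zero_r)
  moreover have "scal A (inv\<^bsub>K\<^esub> ?b) \<odot>\<^bsub>M\<^esub> (scal A ?b \<odot>\<^bsub>M\<^esub> x) = scal A (inv\<^bsub>K\<^esub> ?b \<otimes>\<^bsub>K\<^esub> ?b) \<odot>\<^bsub>M\<^esub> x"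
    by (rule scal_mod(2)[OF assms(1,2) R.Units_inv_closed[OF b] R.Units_closed[OF b], symmetric])
  ultimately show False using R.Units_l_inv[OF b] assms(2,3) by (simp add: scal_simps)
qed

section \<open>Kernels and images of the maps \<open>\<alpha> l\<close>\<close>

lemma alpha_nonzero: "l \<in> {1..n} \<Longrightarrow> \<exists>x\<in>carrier (\<Delta> l). \<alpha> l x \<noteq> \<zero>\<^bsub>Nabla l\<^esub>"
  using mod_hom_eqI[OF alpha_hom zero_hom_in[OF lm(4,5)], of l] alpha_nonzero_hom[of l]
  by (auto simp: zero_hom_def)

text \<open>The composite of \<open>rr l\<close> and \<open>sg l\<close> spans the maps from
  \<open>\<Delta> l\<close> to \<open>Nabla l\<close>; the scalar is a unit because
  \<open>\<alpha> l\<close> is nonzero. \<open>alpha_span\<close> and \<open>alpha_image\<close>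
  rest on this normal form.\<close>

lemma alpha_form:
  assumes l: "l \<in> {1..n}"
  shows "\<exists>d\<in>Units K. \<forall>x\<in>carrier (\<Delta> l). \<alpha> l x = scal A d \<odot>\<^bsub>Nabla l\<^esub> sg l (rr l x)"
proof -
  interpret N: left_module A "Nabla l" by (rule lm(5)[OF l])
  obtain d where d: "d \<in> carrier K" "\<forall>x\<in>carrier (\<Delta> l). \<alpha> l x = scal A d \<odot>\<^bsub>Nabla l\<^esub> sg l (rr l x)"
    using hom_Delta_Nabla[OF l alpha_hom[OF l]] by blast
  obtain x where "x \<in> carrier (\<Delta> l)" "\<alpha> l x \<noteq> \<zero>\<^bsub>Nabla l\<^esub>" using alpha_nonzero[OF l] by blast
  then have "d \<noteq> \<zero>\<^bsub>K\<^esub>"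
    using d mod_homD(1)[OF rr(1)[OF l]] mod_homD(1)[OF sg(1)[OF l]] by (auto simp: scal_simps N.smult_zero_l)
  then show ?thesis using d field_Units by auto
qed

lemma alpha_span:
  assumes l: "l \<in> {1..n}" and g: "g \<in> mod_hom A (\<Delta> l) (Nabla l)"
  shows "\<exists>c\<in>carrier K. \<forall>x\<in>carrier (\<Delta> l). g x = scal A c \<odot>\<^bsub>Nabla l\<^esub> \<alpha> l x"
proof -
  note lN = lm(5)[OF l]
  obtain d where d: "d \<in> Units K" "\<forall>x\<in>carrier (\<Delta> l). \<alpha> l x = scal A d \<odot>\<^bsub>Nabla l\<^esub> sg l (rr l x)"
    using alpha_form[OF l] by blast
  obtain c where c: "c \<in> carrier K" "\<forall>x\<in>carrier (\<Delta> l). g x = scal A c \<odot>\<^bsub>Nabla l\<^esub> sg l (rr l x)"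
    using hom_Delta_Nabla[OF l g] by blast
  have dK: "d \<in> carrier K" "inv\<^bsub>K\<^esub> d \<in> carrier K"
    "inv\<^bsub>K\<^esub> d \<otimes>\<^bsub>K\<^esub> d = \<one>\<^bsub>K\<^esub>" using d(1) by auto
  have cd: "(c \<otimes>\<^bsub>K\<^esub> inv\<^bsub>K\<^esub> d) \<otimes>\<^bsub>K\<^esub> d = c" using dK c(1) by (simp add: R.m_assoc)
  have "g x = scal A (c \<otimes>\<^bsub>K\<^esub> inv\<^bsub>K\<^esub> d) \<odot>\<^bsub>Nabla l\<^esub> \<alpha> l x" if x: "x \<in> carrier (\<Delta> l)" for x
  proof -
    have "sg l (rr l x) \<in> carrier (Nabla l)"
      using x mod_homD(1)[OF rr(1)[OF l]] mod_homD(1)[OF sg(1)[OF l]] by blast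
    then show ?thesis
      using scal_mod(2)[OF lN _ _ dK(1), of "sg l (rr l x)" "c \<otimes>\<^bsub>K\<^esub> inv\<^bsub>K\<^esub> d"] cd c dK d(2) x by simp
  qed
  then show ?thesis using c(1) dK(2) by blast
qed

lemma alpha_rad:
  assumes l: "l \<in> {1..n}" and x: "x \<in> carrier (\<Delta> l)"
  shows "\<alpha> l x = \<zero>\<^bsub>Nabla l\<^esub> \<longleftrightarrow> rr l x = \<zero>\<^bsub>L l\<^esub>"
  using Delta_kernel[OF l lm(5)[OF l] alpha_hom[OF l]] Delta_Nabla_rad[OF l alpha_hom[OF l]] alpha_nonzero[OF l] x
  by blast

lemma alpha_image:
  assumes l: "l \<in> {1..n}"
  shows "\<alpha> l ` carrier (\<Delta> l) = sg l ` carrier (L l)"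
proof -
  have 0: "submodule (carrier (L l)) A (L l)" by (rule submodule_carrier[OF lm(1)[OF l]])
  have W: "submodule (\<alpha> l ` carrier (\<Delta> l)) A (Nabla l)"
    by (rule submodule_image[OF lm(4,5)[OF l] alpha_hom[OF l] submodule_carrier[OF lm(4)[OF l]]])
  have "sg l ` carrier (L l) \<subseteq> \<alpha> l ` carrier (\<Delta> l)"
    using alpha_nonzero[OF l] by (intro sg(3)[OF l W]) blast
  moreover have sgs: "submodule (sg l ` carrier (L l)) A (Nabla l)"
    by (rule submodule_image[OF lm(1,5)[OF l] sg(1)[OF l] 0])
  obtain d where d: "d \<in> Units K" "\<forall>x\<in>carrier (\<Delta> l). \<alpha> l x = scal A d \<odot>\<^bsub>Nabla l\<^esub> sg l (rr l x)"
    using alpha_form[OF l] by blast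
  have "\<alpha> l ` carrier (\<Delta> l) \<subseteq> sg l ` carrier (L l)"
    using d submoduleD(4)[OF sgs] mod_homD(1)[OF rr(1)[OF l]] by auto
  ultimately show ?thesis by blast
qed

section \<open>Lifts and values\<close>

abbreviation "is_extn \<equiv> is_ext A (Nabla i) (Nabla j)"

abbreviation "val \<equiv> pairing_value K A (\<Delta> i) (\<Delta> j) (\<alpha> i) (\<alpha> j)"

lemma bd_ext_module:
  assumes "is_extn (E, \<beta>, \<gamma>)"
  shows "bd E i"
proof -
  note e = is_extD[OF assms]
  have "bd (E \<restriction> a_kernel E (Nabla i) \<gamma>) i"
    using bd_mono[OF bd_image[OF lm(5)[OF j] e(2,3) iota(3)[OF j]], of i] ji unfolding e(7)[symmetric] by simp
  then show ?thesis by (rule bd_ext[OF e(2) lm(5)[OF i] e(4) _ iota(3)[OF i]])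
qed

lemma is_lift_iff:
  "is_lift A (\<Delta> i) (\<alpha> i) (E, \<beta>, \<gamma>) \<phi> \<longleftrightarrow>
    \<phi> \<in> mod_hom A (\<Delta> i) E \<and> (\<forall>x\<in>carrier (\<Delta> i). \<gamma> (\<phi> x) = \<alpha> i x)"
proof -
  have "compose (carrier (\<Delta> i)) \<gamma> \<phi> = \<alpha> i \<longleftrightarrow> (\<forall>x\<in>carrier (\<Delta> i). \<gamma> (\<phi> x) = \<alpha> i x)"
    using extensionalityI[OF compose_extensional mod_homD(4)[OF alpha_hom[OF i]], of \<gamma> \<phi>]
    by (metis compose_eq)
  then show ?thesis by (simp add: is_lift_def)
qed

lemma is_value_iff:
  "is_value K A (\<Delta> j) \<phi> (\<alpha> j) f (E, \<beta>, \<gamma>) s \<longleftrightarrow> s \<in> carrier K \<and>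
    (\<forall>x\<in>carrier (\<Delta> j). \<phi> (f x) = scal A s \<odot>\<^bsub>E\<^esub> \<beta> (\<alpha> j x))"
  by (auto simp: is_value_def hom_scale_def compose_def scal_def restrict_def fun_eq_iff)

lemma lift_ex:
  assumes "is_extn (E, \<beta>, \<gamma>)"
  shows "\<exists>\<phi>. is_lift A (\<Delta> i) (\<alpha> i) (E, \<beta>, \<gamma>) \<phi>"
proof -
  note e = is_extD[OF assms]
  show ?thesis
    using Delta_lift[OF i e(1) bd_ext_module[OF assms] lm(5)[OF i] e(4,6) alpha_hom[OF i]]
    unfolding is_lift_iff by blast
qed

text \<open>Two lifts differ by a map from \<open>\<Delta> i\<close> into the image of
  \<open>Nabla j\<close>; it is zero because the top \<open>L i\<close> cannot occur in a module
  bounded by \<open>j\<close>.\<close>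

lemma lift_unique:
  assumes "is_extn (E, \<beta>, \<gamma>)" "is_lift A (\<Delta> i) (\<alpha> i) (E, \<beta>, \<gamma>) \<phi>"
    "is_lift A (\<Delta> i) (\<alpha> i) (E, \<beta>, \<gamma>) \<psi>"
  shows "\<phi> = \<psi>"
proof -
  note e = is_extD[OF assms(1)] and lD = lm(4)[OF i] and lNi = lm(5)[OF i] and lNj = lm(5)[OF j]
  interpret E: left_module A E by (rule e(2))
  interpret Ni: left_module A "Nabla i" by (rule lNi)
  have \<phi>: "\<phi> \<in> mod_hom A (\<Delta> i) E" "\<And>x. x \<in> carrier (\<Delta> i) \<Longrightarrow> \<gamma> (\<phi> x) = \<alpha> i x"
    and \<psi>: "\<psi> \<in> mod_hom A (\<Delta> i) E" "\<And>x. x \<in> carrier (\<Delta> i) \<Longrightarrow> \<gamma> (\<psi> x) = \<alpha> i x"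
    using assms(2,3) unfolding is_lift_iff by blast+
  let ?d = "\<lambda>x\<in>carrier (\<Delta> i). \<phi> x \<ominus>\<^bsub>E\<^esub> \<psi> x"
  have d: "?d \<in> mod_hom A (\<Delta> i) E" by (rule mod_hom_diff[OF \<phi>(1) \<psi>(1) lD e(2)])
  have "?d ` carrier (\<Delta> i) \<subseteq> \<beta> ` carrier (Nabla j)"
  proof -
    have "\<phi> x \<ominus>\<^bsub>E\<^esub> \<psi> x \<in> \<beta> ` carrier (Nabla j)" if "x \<in> carrier (\<Delta> i)" for x
      using mod_hom_eq_iff_diff[OF e(2) lNi e(4), of "\<phi> x"
        "\<psi> x"] \<phi> \<psi> that mod_homD(1)[OF \<phi>(1)] mod_homD(1)[OF \<psi>(1)]
      unfolding e(7) by simp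
    then show ?thesis by auto
  qed
  then obtain g where g: "g \<in> mod_hom A (\<Delta> i) (Nabla j)" "\<forall>x\<in>carrier (\<Delta> i). \<beta> (g x) = ?d x"
    using hom_lift_inj[OF lD lNj e(2,3,5) d] by blast
  show ?thesis
  proof (rule mod_hom_eqI[OF \<phi>(1) \<psi>(1)])
    fix x assume x: "x \<in> carrier (\<Delta> i)"
    have "g x = \<zero>\<^bsub>Nabla j\<^esub>" by (rule Delta_hom_zero[OF i lNj g(1) iota(3)[OF j] ji x])
    then have "\<phi> x \<ominus>\<^bsub>E\<^esub> \<psi> x = \<zero>\<^bsub>E\<^esub>" using g(2) x mod_hom_zero[OF lNj e(2,3)] by force
    then show "\<phi> x = \<psi> x"
      using E.diff_eq_zero_iff mod_homD(1)[OF \<phi>(1) x] mod_homD(1)[OF \<psi>(1) x] by blast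
  qed
qed

lemma value_ex:
  assumes "is_extn (E, \<beta>, \<gamma>)" "is_lift A (\<Delta> i) (\<alpha> i) (E, \<beta>, \<gamma>) \<phi>"
    "f \<in> mod_hom A (\<Delta> j) (\<Delta> i)"
  shows "\<exists>s. is_value K A (\<Delta> j) \<phi> (\<alpha> j) f (E, \<beta>, \<gamma>) s"
proof -
  note e = is_extD[OF assms(1)] and lDi = lm(4)[OF i] and lDj = lm(4)[OF j] and lNi = lm(5)[OF i] and lNj = lm(5)[OF j]
  have \<phi>: "\<phi> \<in> mod_hom A (\<Delta> i) E" "\<And>x. x \<in> carrier (\<Delta> i) \<Longrightarrow> \<gamma> (\<phi> x) = \<alpha> i x"
    using assms(2) unfolding is_lift_iff by blast+
  note f = mod_homD(1)[OF assms(3)]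
  have af: "compose (carrier (\<Delta> j)) (\<alpha> i) f \<in> mod_hom A (\<Delta> j) (Nabla i)"
    by (rule mod_hom_comp[OF assms(3) alpha_hom[OF i] lDj])
  have "\<phi> (f x) \<in> \<beta> ` carrier (Nabla j)" if x: "x \<in> carrier (\<Delta> j)" for x
  proof (rule e(8))
    show "\<phi> (f x) \<in> carrier E" using mod_homD(1)[OF \<phi>(1)] f x by blast
    show "\<gamma> (\<phi> (f x)) = \<zero>\<^bsub>Nabla i\<^esub>"
      using Nabla_hom_zero[OF i lDj af bd_Delta[OF j] ji x] \<phi>(2)[OF f[OF x]] x by (simp add: compose_eq)
  qed
  then have "compose (carrier (\<Delta> j)) \<phi> f ` carrier (\<Delta> j) \<subseteq> \<beta> ` carrier (Nabla j)"
    by (auto simp: compose_eq)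
  then obtain g where g: "g \<in> mod_hom A (\<Delta> j) (Nabla j)"
    "\<forall>x\<in>carrier (\<Delta> j). \<beta> (g x) = compose (carrier (\<Delta> j)) \<phi> f x"
    using hom_lift_inj[OF lDj lNj e(2,3,5) mod_hom_comp[OF assms(3) \<phi>(1) lDj]] by blast
  obtain c where c: "c \<in> carrier K" "\<forall>x\<in>carrier (\<Delta> j). g x = scal A c \<odot>\<^bsub>Nabla j\<^esub> \<alpha> j x"
    using alpha_span[OF j g(1)] by blast
  have "\<phi> (f x) = scal A c \<odot>\<^bsub>E\<^esub> \<beta> (\<alpha> j x)" if "x \<in> carrier (\<Delta> j)" for x
    using that g(2) c mod_homD(3)[OF e(3) scal_closed[OF c(1)] mod_homD(1)[OF alpha_hom[OF j] that]]
    by (simp add: compose_eq)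
  then show ?thesis using c(1) unfolding is_value_iff by blast
qed

lemma value_unique:
  assumes "is_extn (E, \<beta>, \<gamma>)" "is_value K A (\<Delta> j) \<phi> (\<alpha> j) f (E, \<beta>, \<gamma>) s"
    "is_value K A (\<Delta> j) \<phi> (\<alpha> j) f (E, \<beta>, \<gamma>) t"
  shows "s = t"
proof -
  note e = is_extD[OF assms(1)] and lNj = lm(5)[OF j]
  interpret Nj: left_module A "Nabla j" by (rule lNj)
  obtain x where x: "x \<in> carrier (\<Delta> j)" "\<alpha> j x \<noteq> \<zero>\<^bsub>Nabla j\<^esub>" using alpha_nonzero[OF j] by blast
  have ax: "\<alpha> j x \<in> carrier (Nabla j)" by (rule mod_homD(1)[OF alpha_hom[OF j] x(1)])
  have bx: "\<beta> (\<alpha> j x) \<in> carrier E" by (rule mod_homD(1)[OF e(3) ax])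
  have "\<beta> (\<alpha> j x) \<noteq> \<zero>\<^bsub>E\<^esub>"
    using inj_onD[OF e(5), of "\<alpha> j x" "\<zero>\<^bsub>Nabla j\<^esub>"] mod_hom_zero[OF lNj e(2,3)] ax x(2) by auto
  then show ?thesis
    using scal_eq_imp[OF e(2) bx, of s t] assms(2,3) x(1) unfolding is_value_iff by simp
qed

lemma val_eqI:
  assumes "is_extn (E, \<beta>, \<gamma>)" "is_lift A (\<Delta> i) (\<alpha> i) (E, \<beta>, \<gamma>) \<phi>"
    "is_value K A (\<Delta> j) \<phi> (\<alpha> j) f (E, \<beta>, \<gamma>) s"
  shows "val f (E, \<beta>, \<gamma>) = s"
proof -
  have 1: "(THE \<phi>. is_lift A (\<Delta> i) (\<alpha> i) (E, \<beta>, \<gamma>) \<phi>) = \<phi>"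
    by (rule the_equality, rule assms(2), rule lift_unique[OF assms(1) _ assms(2)])
  show ?thesis unfolding pairing_value_def 1
    by (rule the_equality, rule assms(3), rule value_unique[OF assms(1) _ assms(3)])
qed

text \<open>The lift \<phi> depends on the extension alone and serves every \<open>f\<close>;
  additivity and homogeneity in \<open>f\<close> come from this.\<close>

lemma valE:
  assumes "is_extn (E, \<beta>, \<gamma>)"
  obtains \<phi> where "\<phi> \<in> mod_hom A (\<Delta> i) E"
    "\<And>x. x \<in> carrier (\<Delta> i) \<Longrightarrow> \<gamma> (\<phi> x) = \<alpha> i x"
    "\<And>f. f \<in> mod_hom A (\<Delta> j) (\<Delta> i) \<Longrightarrow> val f (E, \<beta>, \<gamma>) \<in> carrier K"
    "\<And>f x. f \<in> mod_hom A (\<Delta> j) (\<Delta> i) \<Longrightarrow> x \<in> carrier (\<Delta> j) \<Longrightarrow>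
       \<phi> (f x) = scal A (val f (E, \<beta>, \<gamma>)) \<odot>\<^bsub>E\<^esub> \<beta> (\<alpha> j x)"
proof -
  obtain \<phi> where \<phi>: "is_lift A (\<Delta> i) (\<alpha> i) (E, \<beta>, \<gamma>) \<phi>" using lift_ex[OF assms] by blast
  have v: "is_value K A (\<Delta> j) \<phi> (\<alpha> j) f (E, \<beta>, \<gamma>) (val f (E, \<beta>, \<gamma>))" if "f \<in> mod_hom A (\<Delta> j) (\<Delta> i)" for f
    using value_ex[OF assms \<phi> that] val_eqI[OF assms \<phi>] by blast
  show thesis using that[of \<phi>] \<phi> v unfolding is_lift_iff is_value_iff by blast
qed

lemma valI:
  assumes "is_extn (E, \<beta>, \<gamma>)" "\<phi> \<in> mod_hom A (\<Delta> i) E"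
    "\<And>x. x \<in> carrier (\<Delta> i) \<Longrightarrow> \<gamma> (\<phi> x) = \<alpha> i x"
    "s \<in> carrier K" "\<And>x. x \<in> carrier (\<Delta> j) \<Longrightarrow> \<phi> (f x) = scal A s \<odot>\<^bsub>E\<^esub> \<beta> (\<alpha> j x)"
  shows "val f (E, \<beta>, \<gamma>) = s"
  by (rule val_eqI[OF assms(1)]) (use assms(2-5) in \<open>auto simp: is_lift_iff is_value_iff\<close>)

section \<open>Values under equivalence, sums and multiples\<close>

lemma val_equivalent:
  assumes "is_extn \<xi>" "is_extn \<zeta>" "ext_equivalent A (Nabla j) \<xi> \<zeta>" "f \<in> mod_hom A (\<Delta> j) (\<Delta> i)"
  shows "val f \<zeta> = val f \<xi>"
proof -
  obtain E \<beta> \<gamma> where x: "\<xi> = (E, \<beta>, \<gamma>)" by (cases \<xi>)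
  obtain E' \<beta>' \<gamma>' where x': "\<zeta> = (E', \<beta>', \<gamma>')" by (cases \<zeta>)
  note e = is_extD[OF assms(1)[unfolded x]] and e' = is_extD[OF assms(2)[unfolded x']]
  obtain \<theta> where \<theta>: "\<theta> \<in> mod_hom A E E'"
    "\<And>y. y \<in> carrier (Nabla j) \<Longrightarrow> \<theta> (\<beta> y) = \<beta>' y"
      "\<And>x. x \<in> carrier E \<Longrightarrow> \<gamma>' (\<theta> x) = \<gamma> x"
    using assms(3) unfolding x x' by (rule ext_equivalentE) blast
  obtain \<phi> where \<phi>: "\<phi> \<in> mod_hom A (\<Delta> i) E"
    "\<And>x. x \<in> carrier (\<Delta> i) \<Longrightarrow> \<gamma> (\<phi> x) = \<alpha> i x"
    "val f (E, \<beta>, \<gamma>) \<in> carrier K"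
    "\<And>x. x \<in> carrier (\<Delta> j) \<Longrightarrow> \<phi> (f x) = scal A (val f (E, \<beta>, \<gamma>)) \<odot>\<^bsub>E\<^esub> \<beta> (\<alpha> j x)"
    using valE[OF assms(1)[unfolded x]] assms(4) by metis
  show ?thesis unfolding x x'
  proof (rule valI[OF assms(2)[unfolded x'] mod_hom_comp[OF \<phi>(1) \<theta>(1) lm(4)[OF i]] _ \<phi>(3)])
    show "\<gamma>' (compose (carrier (\<Delta> i)) \<theta> \<phi> x) = \<alpha> i x" if "x \<in> carrier (\<Delta> i)" for x
      using \<theta>(3)[OF mod_homD(1)[OF \<phi>(1) that]] \<phi>(2)[OF that] that by (simp add: compose_eq)
    fix x assume x: "x \<in> carrier (\<Delta> j)"
    have a: "\<alpha> j x \<in> carrier (Nabla j)" by (rule mod_homD(1)[OF alpha_hom[OF j] x])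
    show "compose (carrier (\<Delta> i)) \<theta> \<phi> (f x) = scal A (val f (E, \<beta>, \<gamma>)) \<odot>\<^bsub>E'\<^esub> \<beta>' (\<alpha> j x)"
      using mod_homD(1)[OF assms(4) x] \<phi>(4)[OF x] \<theta>(2)[OF a]
        mod_homD(3)[OF \<theta>(1) scal_closed[OF \<phi>(3)] mod_homD(1)[OF e(3) a]] by (simp add: compose_eq)
  qed
qed

text \<open>The two lifts together map to the pullback, and composing with \<pi> gives a lift of
  \<open>\<alpha> i\<close> to the Baer sum. On the image of \<open>f\<close> they are multiples of
  \<beta> and \<beta>' after \<open>\<alpha> j\<close>, and \<pi> adds these.\<close>

lemma val_baer:
  assumes "is_extn \<xi>" "is_extn \<xi>'" and f: "f \<in> mod_hom A (\<Delta> j) (\<Delta> i)"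
  shows "is_extn (baer_sum (Nabla j) \<xi> \<xi>')" "val f (baer_sum (Nabla j) \<xi> \<xi>') = val f \<xi> \<oplus>\<^bsub>K\<^esub> val f \<xi>'"
proof -
  note lNi = lm(5)[OF i] and lNj = lm(5)[OF j] and lDi = lm(4)[OF i]
  obtain E \<beta> \<gamma> where x: "\<xi> = (E, \<beta>, \<gamma>)" by (cases \<xi>)
  obtain E' \<beta>' \<gamma>' where x': "\<xi>' = (E', \<beta>', \<gamma>')" by (cases \<xi>')
  note e = is_extD[OF assms(1)[unfolded x]] and e' = is_extD[OF assms(2)[unfolded x']]
  obtain Q \<beta>'' \<gamma>'' \<pi> where Q: "baer_sum (Nabla j) (E, \<beta>, \<gamma>) (E', \<beta>', \<gamma>') = (Q, \<beta>'', \<gamma>'')" "is_extn (Q, \<beta>'', \<gamma>'')"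
    and \<pi>: "\<pi> \<in> mod_hom A ((mod_prod E E')\<lparr>carrier := {(x, x') \<in> carrier E \<times> carrier E'. \<gamma> x = \<gamma>' x'}\<rparr>) Q"
    and \<pi>1: "\<And>x x'. \<lbrakk>x \<in> carrier E; x' \<in> carrier E'; \<gamma> x = \<gamma>' x'\<rbrakk> \<Longrightarrow> \<gamma>'' (\<pi> (x, x')) = \<gamma> x"
    and \<pi>2: "\<And>y y'. \<lbrakk>y \<in> carrier (Nabla j); y' \<in> carrier (Nabla j)\<rbrakk> \<Longrightarrow> \<pi> (\<beta> y, \<beta>' y') = \<beta>'' (y \<oplus>\<^bsub>Nabla j\<^esub> y')"
    by (rule baer_sum_is_ext[OF fd_algebra_field_axioms lNi lNj assms(1)[unfolded x] assms(2)[unfolded x']])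
      (rule that)
  let ?Y = "(mod_prod E E')\<lparr>carrier := {(x, x') \<in> carrier E \<times> carrier E'. \<gamma> x = \<gamma>' x'}\<rparr>"
  show "is_extn (baer_sum (Nabla j) \<xi> \<xi>')" using Q unfolding x x' by simp
  note e'' = is_extD[OF Q(2)]
  obtain \<phi> where \<phi>: "\<phi> \<in> mod_hom A (\<Delta> i) E"
    "\<And>x. x \<in> carrier (\<Delta> i) \<Longrightarrow> \<gamma> (\<phi> x) = \<alpha> i x"
    "val f (E, \<beta>, \<gamma>) \<in> carrier K"
    "\<And>x. x \<in> carrier (\<Delta> j) \<Longrightarrow> \<phi> (f x) = scal A (val f (E, \<beta>, \<gamma>)) \<odot>\<^bsub>E\<^esub> \<beta> (\<alpha> j x)"
    using valE[OF assms(1)[unfolded x]] f by metis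
  obtain \<phi>' where \<phi>': "\<phi>' \<in> mod_hom A (\<Delta> i) E'"
    "\<And>x. x \<in> carrier (\<Delta> i) \<Longrightarrow> \<gamma>' (\<phi>' x) = \<alpha> i x"
    "val f (E', \<beta>', \<gamma>') \<in> carrier K"
    "\<And>x. x \<in> carrier (\<Delta> j) \<Longrightarrow> \<phi>' (f x) = scal A (val f (E', \<beta>', \<gamma>')) \<odot>\<^bsub>E'\<^esub> \<beta>' (\<alpha> j x)"
    using valE[OF assms(2)[unfolded x']] f by metis
  let ?p = "\<lambda>x\<in>carrier (\<Delta> i). (\<phi> x, \<phi>' x)"
  have p: "?p \<in> mod_hom A (\<Delta> i) ?Y"
    by (rule mod_homI[OF _ _ _ lDi])
      (use mod_homD[OF \<phi>(1)] mod_homD[OF \<phi>'(1)] \<phi>(2) \<phi>'(2) in \<open>auto simp: mod_prod_simps\<close>)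
  have "val f (Q, \<beta>'', \<gamma>'') = val f (E, \<beta>, \<gamma>) \<oplus>\<^bsub>K\<^esub> val f (E', \<beta>', \<gamma>')"
  proof (rule valI[OF Q(2) mod_hom_comp[OF p \<pi> lDi]])
    show "\<gamma>'' (compose (carrier (\<Delta> i)) \<pi> ?p x) = \<alpha> i x" if "x \<in> carrier (\<Delta> i)" for x
      using \<pi>1 \<phi>(2) \<phi>'(2) mod_homD(1)[OF \<phi>(1)] mod_homD(1)[OF \<phi>'(1)] that by (simp add: compose_eq)
    show "val f (E, \<beta>, \<gamma>) \<oplus>\<^bsub>K\<^esub> val f (E', \<beta>', \<gamma>') \<in> carrier K"
      using \<phi>(3) \<phi>'(3) by simp
    fix x assume x: "x \<in> carrier (\<Delta> j)"
    let ?s = "val f (E, \<beta>, \<gamma>)" and ?s' = "val f (E', \<beta>', \<gamma>')"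
    interpret Nj: left_module A "Nabla j" by (rule lNj)
    have a: "\<alpha> j x \<in> carrier (Nabla j)" by (rule mod_homD(1)[OF alpha_hom[OF j] x])
    have as: "scal A ?s \<odot>\<^bsub>Nabla j\<^esub> \<alpha> j x \<in> carrier (Nabla j)"
      "scal A ?s' \<odot>\<^bsub>Nabla j\<^esub> \<alpha> j x \<in> carrier (Nabla j)"
      using a \<phi>(3) \<phi>'(3) by auto
    have "compose (carrier (\<Delta> i)) \<pi> ?p (f x) = \<pi> (\<phi> (f x), \<phi>' (f x))"
      using mod_homD(1)[OF f x] by (simp add: compose_eq)
    also have "\<dots> = \<pi> (\<beta> (scal A ?s \<odot>\<^bsub>Nabla j\<^esub> \<alpha> j x), \<beta>' (scal A ?s' \<odot>\<^bsub>Nabla j\<^esub> \<alpha> j x))"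
      using \<phi>(3,4) \<phi>'(3,4) x a mod_homD(3)[OF e(3)] mod_homD(3)[OF e'(3)] by simp
    also have "\<dots> = \<beta>'' (scal A (?s \<oplus>\<^bsub>K\<^esub> ?s') \<odot>\<^bsub>Nabla j\<^esub> \<alpha> j x)"
      using \<pi>2[OF as] scal_mod(1)[OF lNj a \<phi>(3) \<phi>'(3)] by simp
    also have "\<dots> = scal A (?s \<oplus>\<^bsub>K\<^esub> ?s') \<odot>\<^bsub>Q\<^esub> \<beta>'' (\<alpha> j x)"
      using mod_homD(3)[OF e''(3) _ a] \<phi>(3) \<phi>'(3) by simp
    finally show "compose (carrier (\<Delta> i)) \<pi> ?p (f x) = scal A (?s \<oplus>\<^bsub>K\<^esub> ?s') \<odot>\<^bsub>Q\<^esub> \<beta>'' (\<alpha> j x)" .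
  qed
  then show "val f (baer_sum (Nabla j) \<xi> \<xi>') = val f \<xi> \<oplus>\<^bsub>K\<^esub> val f \<xi>'" unfolding x x' Q(1) .
qed

text \<open>The lift into the pullback along multiplication by \<open>c\<close> has the components
  \<open>c\<close> times \<phi> and \<open>\<alpha> i\<close>; the first one carries the
  value.\<close>

lemma val_scale:
  assumes "is_extn \<xi>" and c: "c \<in> carrier K" and f: "f \<in> mod_hom A (\<Delta> j) (\<Delta> i)"
  shows "is_extn (ext_scale A (Nabla i) (Nabla j) c \<xi>)"
    "val f (ext_scale A (Nabla i) (Nabla j) c \<xi>) = c \<otimes>\<^bsub>K\<^esub> val f \<xi>"
proof -
  note lNi = lm(5)[OF i] and lNj = lm(5)[OF j] and lDi = lm(4)[OF i]
  interpret Ni: left_module A "Nabla i" by (rule lNi)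
  interpret Nj: left_module A "Nabla j" by (rule lNj)
  obtain E \<beta> \<gamma> where x: "\<xi> = (E, \<beta>, \<gamma>)" by (cases \<xi>)
  note e = is_extD[OF assms(1)[unfolded x]]
  interpret E: left_module A E by (rule e(2))
  show ext: "is_extn (ext_scale A (Nabla i) (Nabla j) c \<xi>)"
    unfolding x by (rule ext_scale_is_ext[OF fd_algebra_field_axioms fg(5)[OF i] lNj assms(1)[unfolded x] c])
  obtain \<phi> where \<phi>: "\<phi> \<in> mod_hom A (\<Delta> i) E"
    "\<And>x. x \<in> carrier (\<Delta> i) \<Longrightarrow> \<gamma> (\<phi> x) = \<alpha> i x"
    "val f (E, \<beta>, \<gamma>) \<in> carrier K"
    "\<And>x. x \<in> carrier (\<Delta> j) \<Longrightarrow> \<phi> (f x) = scal A (val f (E, \<beta>, \<gamma>)) \<odot>\<^bsub>E\<^esub> \<beta> (\<alpha> j x)"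
    using valE[OF assms(1)[unfolded x]] f by metis
  define Y where "Y = (mod_prod E (Nabla i))\<lparr>carrier :=
    {(x, z) \<in> carrier E \<times> carrier (Nabla i). \<gamma> x = (c \<odot>\<^bsub>A\<^esub> \<one>\<^bsub>A\<^esub>) \<odot>\<^bsub>Nabla i\<^esub> z}\<rparr>"
  let ?\<beta> = "\<lambda>y\<in>carrier (Nabla j). (\<beta> y, \<zero>\<^bsub>Nabla i\<^esub>)" and ?\<gamma> = "\<lambda>p\<in>carrier Y. snd p"
  have sc: "ext_scale A (Nabla i) (Nabla j) c \<xi> = (Y, ?\<beta>, ?\<gamma>)" unfolding x by (simp add: Let_def Y_def)
  let ?p = "\<lambda>x\<in>carrier (\<Delta> i). (scal A c \<odot>\<^bsub>E\<^esub> \<phi> x, \<alpha> i x)"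
  have pY: "(scal A c \<odot>\<^bsub>E\<^esub> \<phi> x, \<alpha> i x) \<in> carrier Y" if "x \<in> carrier (\<Delta> i)" for x
    using that \<phi>(2) c mod_homD(1)[OF \<phi>(1)] mod_homD(1)[OF alpha_hom[OF i]] mod_homD(3)[OF e(4)]
    by (simp add: Y_def scal_def[symmetric])
  have p: "?p \<in> mod_hom A (\<Delta> i) Y"
    by (rule mod_homI[OF _ _ _ lDi])
      (use pY mod_homD[OF \<phi>(1)] mod_homD[OF alpha_hom[OF i]] c in
        \<open>auto simp: mod_prod_simps Y_def E.smult_r_distr scal_commute[OF e(2)]\<close>)
  have "val f (Y, ?\<beta>, ?\<gamma>) = c \<otimes>\<^bsub>K\<^esub> val f (E, \<beta>, \<gamma>)"
  proof (rule valI[OF ext[unfolded sc] p])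
    show "?\<gamma> (?p x) = \<alpha> i x" if "x \<in> carrier (\<Delta> i)" for x
      using that pY[OF that] by simp
    show "c \<otimes>\<^bsub>K\<^esub> val f (E, \<beta>, \<gamma>) \<in> carrier K" using c \<phi>(3) by simp
    fix x assume x: "x \<in> carrier (\<Delta> j)"
    have a: "\<alpha> j x \<in> carrier (Nabla j)" by (rule mod_homD(1)[OF alpha_hom[OF j] x])
    have ba: "\<beta> (\<alpha> j x) \<in> carrier E" by (rule mod_homD(1)[OF e(3) a])
    have fx: "f x \<in> carrier (\<Delta> i)" by (rule mod_homD(1)[OF f x])
    \<comment> \<open>The embedding of \<open>Nabla j\<close> has second component zero, so the
      second component \<open>\<alpha> i\<close> of the lift has to vanish on the image of
      \<open>f\<close>.\<close>
    have "\<alpha> i (f x) = \<gamma> (\<phi> (f x))" using \<phi>(2)[OF fx] by simp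
    also have "\<dots> = \<zero>\<^bsub>Nabla i\<^esub>"
      using \<phi>(4)[OF x] mod_homD(3)[OF e(4) scal_closed[OF \<phi>(3)] ba] e(9)[OF a] \<phi>(3) by (simp add: Ni.smult_zero_r)
    finally have af: "\<alpha> i (f x) = \<zero>\<^bsub>Nabla i\<^esub>" .
    show "?p (f x) = scal A (c \<otimes>\<^bsub>K\<^esub> val f (E, \<beta>, \<gamma>)) \<odot>\<^bsub>Y\<^esub> ?\<beta> (\<alpha> j x)"
      using fx af \<phi>(4)[OF x] a scal_mod(2)[OF e(2) ba c \<phi>(3)] c \<phi>(3)
      by (simp add: Y_def mod_prod_simps Ni.smult_zero_r)
  qed
  then show "val f (ext_scale A (Nabla i) (Nabla j) c \<xi>) = c \<otimes>\<^bsub>K\<^esub> val f \<xi>" unfolding sc unfolding x .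
qed

lemma val_add_hom:
  assumes "is_extn \<xi>" and f: "f \<in> mod_hom A (\<Delta> j) (\<Delta> i)" and g: "g \<in> mod_hom A (\<Delta> j) (\<Delta> i)"
  shows "val (\<lambda>x\<in>carrier (\<Delta> j). f x \<oplus>\<^bsub>\<Delta> i\<^esub> g x) \<xi> = val f \<xi> \<oplus>\<^bsub>K\<^esub> val g \<xi>"
proof -
  obtain E \<beta> \<gamma> where x: "\<xi> = (E, \<beta>, \<gamma>)" by (cases \<xi>)
  note e = is_extD[OF assms(1)[unfolded x]]
  obtain \<phi> where \<phi>: "\<phi> \<in> mod_hom A (\<Delta> i) E"
    "\<And>x. x \<in> carrier (\<Delta> i) \<Longrightarrow> \<gamma> (\<phi> x) = \<alpha> i x"
    "\<And>f. f \<in> mod_hom A (\<Delta> j) (\<Delta> i) \<Longrightarrow> val f (E, \<beta>, \<gamma>) \<in> carrier K"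
    "\<And>f x. f \<in> mod_hom A (\<Delta> j) (\<Delta> i) \<Longrightarrow> x \<in> carrier (\<Delta> j) \<Longrightarrow>
       \<phi> (f x) = scal A (val f (E, \<beta>, \<gamma>)) \<odot>\<^bsub>E\<^esub> \<beta> (\<alpha> j x)"
    using valE[OF assms(1)[unfolded x]] by metis
  show ?thesis unfolding x
  proof (rule valI[OF assms(1)[unfolded x] \<phi>(1,2)])
    fix x assume x: "x \<in> carrier (\<Delta> j)"
    have ba: "\<beta> (\<alpha> j x) \<in> carrier E" using mod_homD(1)[OF e(3)] mod_homD(1)[OF alpha_hom[OF j] x] by blast
    show "\<phi> ((\<lambda>x\<in>carrier (\<Delta> j). f x \<oplus>\<^bsub>\<Delta> i\<^esub> g x) x)
        = scal A (val f (E, \<beta>, \<gamma>) \<oplus>\<^bsub>K\<^esub> val g (E, \<beta>, \<gamma>)) \<odot>\<^bsub>E\<^esub> \<beta> (\<alpha> j x)"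
      using x \<phi>(4)[OF f x] \<phi>(4)[OF g x] mod_homD(2)[OF \<phi>(1) mod_homD(1)[OF f x] mod_homD(1)[OF g x]]
        scal_mod(1)[OF e(2) ba \<phi>(3)[OF f] \<phi>(3)[OF g]] by simp
  qed (use \<phi>(3) f g in auto)
qed

lemma val_scale_hom:
  assumes "is_extn \<xi>" and f: "f \<in> mod_hom A (\<Delta> j) (\<Delta> i)" and c: "c \<in> carrier K"
  shows "val (hom_scale A (\<Delta> j) (\<Delta> i) c f) \<xi> = c \<otimes>\<^bsub>K\<^esub> val f \<xi>"
proof -
  obtain E \<beta> \<gamma> where x: "\<xi> = (E, \<beta>, \<gamma>)" by (cases \<xi>)
  note e = is_extD[OF assms(1)[unfolded x]]
  obtain \<phi> where \<phi>: "\<phi> \<in> mod_hom A (\<Delta> i) E"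
    "\<And>x. x \<in> carrier (\<Delta> i) \<Longrightarrow> \<gamma> (\<phi> x) = \<alpha> i x"
    "val f (E, \<beta>, \<gamma>) \<in> carrier K"
    "\<And>x. x \<in> carrier (\<Delta> j) \<Longrightarrow> \<phi> (f x) = scal A (val f (E, \<beta>, \<gamma>)) \<odot>\<^bsub>E\<^esub> \<beta> (\<alpha> j x)"
    using valE[OF assms(1)[unfolded x]] f by metis
  show ?thesis unfolding x
  proof (rule valI[OF assms(1)[unfolded x] \<phi>(1,2)])
    fix x assume x: "x \<in> carrier (\<Delta> j)"
    have ba: "\<beta> (\<alpha> j x) \<in> carrier E" using mod_homD(1)[OF e(3)] mod_homD(1)[OF alpha_hom[OF j] x] by blast
    show "\<phi> (hom_scale A (\<Delta> j) (\<Delta> i) c f x)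
        = scal A (c \<otimes>\<^bsub>K\<^esub> val f (E, \<beta>, \<gamma>)) \<odot>\<^bsub>E\<^esub> \<beta> (\<alpha> j x)"
      using x \<phi>(4)[OF x] mod_homD(3)[OF \<phi>(1) scal_closed[OF c] mod_homD(1)[OF f x]]
        scal_mod(2)[OF e(2) ba c \<phi>(3)] by (simp add: hom_scale_def scal_def[symmetric])
  qed (use \<phi>(3) c in auto)
qed

lemma val_closed:
  assumes "is_extn \<xi>" "f \<in> mod_hom A (\<Delta> j) (\<Delta> i)"
  shows "val f \<xi> \<in> carrier K"
  using assms valE[of "fst \<xi>" "fst (snd \<xi>)" "snd (snd \<xi>)"] by (metis prod.collapse)


section \<open>The pairing on classes of extensions\<close>

lemma is_extn_split: "is_extn (split_ext (Nabla i) (Nabla j))"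
  by (rule split_is_ext[OF fg(5)[OF i] fg(5)[OF j]])

lemma pairing_eqI:
  assumes "w \<noteq> {}" "\<And>\<xi>. \<xi> \<in> w \<Longrightarrow> val f \<xi> = s"
  shows "pairing K A (\<Delta> i) (\<Delta> j) (\<alpha> i) (\<alpha> j) f w = s"
proof -
  have "val f ` w = {s}" using assms by auto
  then show ?thesis by (simp add: pairing_def)
qed

text \<open>Collects what is used about a class: it is nonempty and closed under equivalence, its
  members are mutually equivalent, and the pairing can be computed at any of them.\<close>

lemma Ext1_class:
  assumes "w \<in> carrier (Ext1_space A (Nabla i) (Nabla j))"
  shows "w \<noteq> {}" "\<xi> \<in> w \<Longrightarrow> is_extn \<xi>"
    "\<lbrakk>\<xi> \<in> w; is_extn \<zeta>; ext_equivalent A (Nabla j) \<xi> \<zeta>\<rbrakk> \<Longrightarrow> \<zeta> \<in> w"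
    "\<lbrakk>\<xi> \<in> w; \<zeta> \<in> w\<rbrakk> \<Longrightarrow> ext_equivalent A (Nabla j) \<xi> \<zeta>"
    "\<lbrakk>\<xi> \<in> w; f \<in> mod_hom A (\<Delta> j) (\<Delta> i)\<rbrakk> \<Longrightarrow> pairing K A (\<Delta> i) (\<Delta> j) (\<alpha> i) (\<alpha> j) f w = val f \<xi>"
proof -
  let ?X = "Defs.extensions A (Nabla i) (Nabla j)" and ?r = "ext_rel A (Nabla i) (Nabla j)"
  have w: "w \<in> ?X // ?r" using assms by (simp add: Ext1_space_def)
  show "w \<noteq> {}" by (rule in_quotient_imp_non_empty[OF equiv_ext_rel w])
  have sub: "w \<subseteq> ?X" by (rule in_quotient_imp_subset[OF equiv_ext_rel w])
  then show e: "\<xi> \<in> w \<Longrightarrow> is_extn \<xi>" for \<xi> by (auto simp: extensions_iff)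
  show "\<lbrakk>\<xi> \<in> w; is_extn \<zeta>; ext_equivalent A (Nabla j) \<xi> \<zeta>\<rbrakk> \<Longrightarrow> \<zeta> \<in> w"
    using in_quotient_imp_closed[OF equiv_ext_rel w, of \<xi> \<zeta>] e by (simp add: ext_rel_def extensions_iff)
  show eq: "\<lbrakk>\<xi> \<in> w; \<zeta> \<in> w\<rbrakk> \<Longrightarrow> ext_equivalent A (Nabla j) \<xi> \<zeta>" for \<xi> \<zeta>
    using in_quotient_imp_in_rel[OF equiv_ext_rel w, of \<xi> \<zeta>] by (simp add: ext_rel_def)
  show "\<lbrakk>\<xi> \<in> w; f \<in> mod_hom A (\<Delta> j) (\<Delta> i)\<rbrakk> \<Longrightarrow> pairing K A (\<Delta> i) (\<Delta> j) (\<alpha> i) (\<alpha> j) f w = val f \<xi>"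
    by (rule pairing_eqI) (auto intro!: val_equivalent e eq simp del: ext_equivalent.simps)
qed

lemma bilinear:
  "bilinear_form K (Hom_space A (\<Delta> j) (\<Delta> i)) (Ext1_space A (Nabla i) (Nabla j))
     (pairing K A (\<Delta> i) (\<Delta> j) (\<alpha> i) (\<alpha> j))"
proof -
  let ?W = "Ext1_space A (Nabla i) (Nabla j)" and ?p = "pairing K A (\<Delta> i) (\<Delta> j) (\<alpha> i) (\<alpha> j)"
  note lD = lm(4)[OF j] lm(4)[OF i]
  have Hom_simps: "carrier (Hom_space A (\<Delta> j) (\<Delta> i)) = mod_hom A (\<Delta> j) (\<Delta> i)"
    "f \<oplus>\<^bsub>Hom_space A (\<Delta> j) (\<Delta> i)\<^esub> g = (\<lambda>x\<in>carrier (\<Delta> j). f x \<oplus>\<^bsub>\<Delta> i\<^esub> g x)"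
    "s \<odot>\<^bsub>Hom_space A (\<Delta> j) (\<Delta> i)\<^esub> f = hom_scale A (\<Delta> j) (\<Delta> i) s f" for f g s
    by (simp_all add: Hom_space_def)
  have sch: "hom_scale A (\<Delta> j) (\<Delta> i) s f \<in> mod_hom A (\<Delta> j) (\<Delta> i)"
    if "s \<in> carrier K" "f \<in> mod_hom A (\<Delta> j) (\<Delta> i)" for s f
  proof -
    have "compose (carrier (\<Delta> j)) (\<lambda>x\<in>carrier (\<Delta> i). scal A s \<odot>\<^bsub>\<Delta> i\<^esub> x) f = hom_scale A (\<Delta> j) (\<Delta> i) s f"
      using mod_homD(1)[OF that(2)] by (auto simp: compose_def hom_scale_def scal_def)
    then show ?thesis using mod_hom_comp[OF that(2) scal_hom[OF lD(2) that(1)] lD(1)] by simp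
  qed
  have addh: "(\<lambda>x\<in>carrier (\<Delta> j). f x \<oplus>\<^bsub>\<Delta> i\<^esub> g x) \<in> mod_hom A (\<Delta> j) (\<Delta> i)"
    if "f \<in> mod_hom A (\<Delta> j) (\<Delta> i)" "g \<in> mod_hom A (\<Delta> j) (\<Delta> i)" for f g
    by (rule mod_hom_add[OF that lD])
  have add_W: "?p f (w \<oplus>\<^bsub>?W\<^esub> w') = ?p f w \<oplus>\<^bsub>K\<^esub> ?p f w'"
    if f: "f \<in> mod_hom A (\<Delta> j) (\<Delta> i)" and w: "w \<in> carrier ?W" "w' \<in> carrier ?W" for f w w'
  proof -
    note c = Ext1_class[OF w(1)] and c' = Ext1_class[OF w(2)]
    have sum: "w \<oplus>\<^bsub>?W\<^esub> w' = {\<zeta> \<in> Defs.extensions A (Nabla i) (Nabla j).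
       \<exists>\<xi>\<in>w. \<exists>\<xi>'\<in>w'. ext_equivalent A (Nabla j) (baer_sum (Nabla j) \<xi> \<xi>') \<zeta>}" by (simp add: Ext1_space_def)
    obtain \<xi> \<xi>' where "\<xi> \<in> w" "\<xi>' \<in> w'" using c(1) c'(1) by blast
    \<comment> \<open>\<open>pairing\<close> applies \<open>the_elem\<close> to the set of values on
      the sum, so besides constancy of the values an actual member is required;
      \<open>ext_copy\<close> supplies one.\<close>
    then have "w \<oplus>\<^bsub>?W\<^esub> w' \<noteq> {}"
      unfolding sum using ext_copy[OF val_baer(1)[OF c(2) c'(2) f] lm(5)[OF j]] by blast
    then show ?thesis
    proof (rule pairing_eqI)
      fix \<zeta> assume "\<zeta> \<in> w \<oplus>\<^bsub>?W\<^esub> w'"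
      then obtain \<xi> \<xi>' where z: "is_extn \<zeta>" "\<xi> \<in> w" "\<xi>' \<in> w'"
        "ext_equivalent A (Nabla j) (baer_sum (Nabla j) \<xi> \<xi>') \<zeta>"
        unfolding sum by (auto simp: extensions_iff simp del: ext_equivalent.simps baer_sum.simps)
      show "val f \<zeta> = ?p f w \<oplus>\<^bsub>K\<^esub> ?p f w'"
        using val_equivalent[OF val_baer(1)[OF c(2)[OF z(2)] c'(2)[OF z(3)] f] z(1,4) f]
          val_baer(2)[OF c(2)[OF z(2)] c'(2)[OF z(3)] f] c(5)[OF z(2) f] c'(5)[OF z(3) f] by simp
    qed
  qed
  have scale_W: "?p f (s \<odot>\<^bsub>?W\<^esub> w) = s \<otimes>\<^bsub>K\<^esub> ?p f w"
    if s: "s \<in> carrier K" and f: "f \<in> mod_hom A (\<Delta> j) (\<Delta> i)" and w: "w \<in> carrier ?W" for f s w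
  proof -
    note c = Ext1_class[OF w]
    have smul: "s \<odot>\<^bsub>?W\<^esub> w = {\<zeta> \<in> Defs.extensions A (Nabla i) (Nabla j).
       \<exists>\<xi>\<in>w. ext_equivalent A (Nabla j) (ext_scale A (Nabla i) (Nabla j) s \<xi>) \<zeta>}" by (simp add: Ext1_space_def)
    obtain \<xi> where "\<xi> \<in> w" using c(1) by blast
    then have "s \<odot>\<^bsub>?W\<^esub> w \<noteq> {}"
      unfolding smul using ext_copy[OF val_scale(1)[OF c(2) s f] lm(5)[OF j]] by blast
    then show ?thesis
    proof (rule pairing_eqI)
      fix \<zeta> assume "\<zeta> \<in> s \<odot>\<^bsub>?W\<^esub> w"
      then obtain \<xi> where z: "is_extn \<zeta>" "\<xi> \<in> w"
        "ext_equivalent A (Nabla j) (ext_scale A (Nabla i) (Nabla j) s \<xi>) \<zeta>"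
        unfolding smul by (auto simp: extensions_iff simp del: ext_equivalent.simps ext_scale.simps)
      show "val f \<zeta> = s \<otimes>\<^bsub>K\<^esub> ?p f w"
        using val_equivalent[OF val_scale(1)[OF c(2)[OF z(2)] s f] z(1,3) f]
          val_scale(2)[OF c(2)[OF z(2)] s f] c(5)[OF z(2) f] by simp
    qed
  qed
  have ex: "\<exists>\<xi>. \<xi> \<in> w" if "w \<in> carrier ?W" for w using Ext1_class(1)[OF that] by blast
  have closed: "?p f w \<in> carrier K" if "f \<in> mod_hom A (\<Delta> j) (\<Delta> i)" "w \<in> carrier ?W" for f w
  proof -
    note w = that(2)
    obtain \<xi> where \<xi>: "\<xi> \<in> w" using ex[OF w] by blast
    note c = Ext1_class(2,5)[OF that(2) \<xi>]
    show ?thesis using val_closed[OF c(1) that(1)] c(2)[OF that(1)] by simp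
  qed
  have add_H: "?p (\<lambda>x\<in>carrier (\<Delta> j). f x \<oplus>\<^bsub>\<Delta> i\<^esub> g x) w = ?p f w \<oplus>\<^bsub>K\<^esub> ?p g w"
    if "f \<in> mod_hom A (\<Delta> j) (\<Delta> i)" "g \<in> mod_hom A (\<Delta> j) (\<Delta> i)" "w \<in> carrier ?W" for f g w
  proof -
    note w = that(3)
    obtain \<xi> where \<xi>: "\<xi> \<in> w" using ex[OF w] by blast
    note c = Ext1_class(2,5)[OF that(3) \<xi>]
    show ?thesis using val_add_hom[OF c(1) that(1,2)] c(2) that(1,2) addh[OF that(1,2)] by simp
  qed
  have scale_H: "?p (hom_scale A (\<Delta> j) (\<Delta> i) s f) w = s \<otimes>\<^bsub>K\<^esub> ?p f w"
    if "s \<in> carrier K" "f \<in> mod_hom A (\<Delta> j) (\<Delta> i)" "w \<in> carrier ?W" for f s w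
  proof -
    note w = that(3)
    obtain \<xi> where \<xi>: "\<xi> \<in> w" using ex[OF w] by blast
    note c = Ext1_class(2,5)[OF that(3) \<xi>]
    show ?thesis using val_scale_hom[OF c(1) that(2,1)] c(2) that(2) sch[OF that(1,2)] by simp
  qed
  show ?thesis
    unfolding bilinear_form_def Hom_simps
    by (intro conjI ballI) (simp_all only: closed add_H scale_H add_W scale_W)
qed

subsection \<open>Adjacent indices\<close>

text \<open>The quotient of \<open>Nabla i\<close> by its socle is bounded by i - 1, the counterpart
  of \<open>bd_rad\<close>. If \<open>L i\<close> occurred above the socle, relative projectivity
  would give a map from \<open>\<Delta> i\<close> to \<open>Nabla i\<close> covering that factor;
  but by \<open>hom_Delta_Nabla\<close> such maps land in the socle, where \<open>p\<close> is
  zero.\<close>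

lemma bd_below_socle:
  assumes V: "submodule V A (Nabla i)" and l: "l \<in> {1..n}" and p: "p \<in> mod_hom A (Nabla i \<restriction> V) (L l)"
    "p ` V = carrier (L l)"
    and sub: "sg i ` carrier (L i) \<subseteq> V" and ker: "\<And>x. x \<in> sg i ` carrier (L i) \<Longrightarrow> p x = \<zero>\<^bsub>L l\<^esub>"
  shows "l \<le> i - 1"
proof -
  note lN = lm(5)[OF i] and lV = res_left_module[OF lm(5)[OF i] V]
  have "l \<le> i" using bdD[OF iota(3)[OF i] l subquotI[OF V p]] .
  moreover have "l \<noteq> i"
  proof
    assume [simp]: "l = i"
    obtain f where f: "f \<in> mod_hom A (\<Delta> i) (Nabla i \<restriction> V)" "\<forall>x\<in>carrier (\<Delta> i). p (f x) = rr i x"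
      using Delta_lift[OF i fg_module_res[OF fg(5)[OF i] V] bd_res[OF lN V iota(3)[OF i]] lm(1)[OF i], of p "rr i"]
        p rr(1)[OF i] by auto
    have f': "f \<in> mod_hom A (\<Delta> i) (Nabla i)" by (rule mod_hom_expand[OF f(1) submoduleD(1)[OF V]])
    obtain c where c: "c \<in> carrier K" "\<forall>x\<in>carrier (\<Delta> i). f x = scal A c \<odot>\<^bsub>Nabla i\<^esub> sg i (rr i x)"
      using hom_Delta_Nabla[OF i f'] by blast
    have S: "submodule (sg i ` carrier (L i)) A (Nabla i)"
      by (rule submodule_image[OF lm(1)[OF i] lN sg(1)[OF i] submodule_carrier[OF lm(1)[OF i]]])
    have "rr i x = \<zero>\<^bsub>L i\<^esub>" if x: "x \<in> carrier (\<Delta> i)" for x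
    proof -
      have "f x \<in> sg i ` carrier (L i)"
        using c x submoduleD(4)[OF S scal_closed[OF c(1)]] mod_homD(1)[OF rr(1)[OF i] x] by simp
      then have "p (f x) = \<zero>\<^bsub>L i\<^esub>" using ker by simp
      then show ?thesis using f(2) x by simp
    qed
    then have "carrier (L i) \<subseteq> {\<zero>\<^bsub>L i\<^esub>}" unfolding rr(2)[OF i, symmetric] by blast
    then show False using simple_nonzeroE[OF L_simple[OF i]] by blast
  qed
  ultimately show ?thesis by simp
qed

text \<open>The relation between \<open>i\<close> and \<open>j\<close> is used twice: the radical of
  \<open>\<Delta> i\<close> and the quotient of \<open>Nabla i\<close> by its socle are both bounded
  by i - 1 = j, and among modules so bounded \<open>\<Delta> j\<close> is projective and
  \<open>Nabla j\<close> is injective.\<close>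

lemma split_if_orthogonal:
  assumes ij: "j = i - 1" and ext: "is_extn (E, \<beta>, \<gamma>)"
    and zero: "\<And>f. f \<in> mod_hom A (\<Delta> j) (\<Delta> i) \<Longrightarrow> val f (E, \<beta>, \<gamma>) = \<zero>\<^bsub>K\<^esub>"
  shows "ext_equivalent A (Nabla j) (split_ext (Nabla i) (Nabla j)) (E, \<beta>, \<gamma>)"
proof -
  note e = is_extD[OF ext]
  note lDi = lm(4)[OF i] and lDj = lm(4)[OF j] and lNi = lm(5)[OF i] and lNj = lm(5)[OF j] and lLj = lm(1)[OF j]
  interpret E: left_module A E by (rule e(2))
  obtain \<phi> where \<phi>: "\<phi> \<in> mod_hom A (\<Delta> i) E"
    "\<And>x. x \<in> carrier (\<Delta> i) \<Longrightarrow> \<gamma> (\<phi> x) = \<alpha> i x"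
    "\<And>f. f \<in> mod_hom A (\<Delta> j) (\<Delta> i) \<Longrightarrow> val f (E, \<beta>, \<gamma>) \<in> carrier K"
    "\<And>f x. f \<in> mod_hom A (\<Delta> j) (\<Delta> i) \<Longrightarrow> x \<in> carrier (\<Delta> j) \<Longrightarrow>
       \<phi> (f x) = scal A (val f (E, \<beta>, \<gamma>)) \<odot>\<^bsub>E\<^esub> \<beta> (\<alpha> j x)"
    using ext by (rule valE) (rule that)
  have \<phi>0: "\<phi> (f x) = \<zero>\<^bsub>E\<^esub>" if "f \<in> mod_hom A (\<Delta> j) (\<Delta> i)"
    "x \<in> carrier (\<Delta> j)" for f x
    using \<phi>(4)[OF that] zero[OF that(1)] mod_homD(1)[OF e(3) mod_homD(1)[OF alpha_hom[OF j] that(2)]]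
    by (simp add: scal_simps E.smult_zero_l)
  have R: "submodule (rad i) A (\<Delta> i)" by (rule rad_submodule[OF i])
  note lR = res_left_module[OF lDi R]
  have radD: "x \<in> carrier (\<Delta> i)" "\<alpha> i x = \<zero>\<^bsub>Nabla i\<^esub>" if "x \<in> rad i" for x
    using that alpha_rad[OF i] by (auto simp: a_kernel_eq)
  have bdR: "bd (\<Delta> i \<restriction> rad i) j" using bd_rad[OF i] ij by simp
  have \<phi>R: "restrict \<phi> (rad i) \<in> mod_hom A (\<Delta> i \<restriction> rad i) E" by (rule mod_hom_res[OF \<phi>(1) R lDi])
  have "restrict \<phi> (rad i) ` carrier (\<Delta> i \<restriction> rad i) \<subseteq> \<beta> ` carrier (Nabla j)"
    using radD \<phi>(2) mod_homD(1)[OF \<phi>(1)] by (auto intro!: e(8))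
  then obtain \<psi> where \<psi>: "\<psi> \<in> mod_hom A (\<Delta> i \<restriction> rad i) (Nabla j)"
    "\<And>x. x \<in> rad i \<Longrightarrow> \<beta> (\<psi> x) = \<phi> x"
    using hom_lift_inj[OF lR lNj e(2,3,5) \<phi>R] by auto
  have \<psi>0: "\<psi> d = \<zero>\<^bsub>Nabla j\<^esub>" if d: "d \<in> rad i" for d
  proof (rule ccontr)
    assume nz: "\<psi> d \<noteq> \<zero>\<^bsub>Nabla j\<^esub>"
    have W: "submodule (\<psi> ` rad i) A (Nabla j)"
      using submodule_image[OF lR lNj \<psi>(1) submodule_carrier[OF lR]] by simp
    have sgW: "sg j ` carrier (L j) \<subseteq> \<psi> ` rad i" using nz d by (intro sg(3)[OF j W]) blast
    \<comment> \<open>The part of the radical that \<psi> sends into the socle of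
      \<open>Nabla j\<close>. It has \<open>L j\<close> as a quotient, so \<open>\<Delta> j\<close>
      maps into it over its top. By hypothesis \<phi> kills the image of this map, although \<psi>
      does not: a contradiction.\<close>
    define U where "U = {x \<in> rad i. \<psi> x \<in> sg j ` carrier (L j)}"
    have S: "submodule (sg j ` carrier (L j)) A (Nabla j)"
      by (rule submodule_image[OF lLj lNj sg(1)[OF j] submodule_carrier[OF lLj]])
    have U': "submodule U A (\<Delta> i \<restriction> rad i)"
      using submodule_vimage[OF lR lNj \<psi>(1) S] by (simp add: U_def)
    then have U: "submodule U A (\<Delta> i)" using submodule_res_iff[OF lDi R] by blast
    note lU = res_left_module[OF lDi U]
    have \<psi>U: "restrict \<psi> U \<in> mod_hom A (\<Delta> i \<restriction> U) (Nabla j)" using mod_hom_res[OF \<psi>(1) U' lR] by simp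
    have "restrict \<psi> U ` carrier (\<Delta> i \<restriction> U) \<subseteq> sg j ` carrier (L j)" by (auto simp: U_def)
    then obtain g where g: "g \<in> mod_hom A (\<Delta> i \<restriction> U) (L j)"
      "\<And>x. x \<in> U \<Longrightarrow> sg j (g x) = \<psi> x"
      using hom_lift_inj[OF lU lLj lNj sg(1,2)[OF j] \<psi>U] by auto
    have gU: "g x \<in> carrier (L j)" if "x \<in> U" for x using mod_homD(1)[OF g(1)] that by simp
    have "carrier (L j) \<subseteq> g ` U"
    proof
      fix y assume y: "y \<in> carrier (L j)"
      then obtain x where x: "x \<in> rad i" "sg j y = \<psi> x" using sgW by blast
      have "\<psi> x \<in> sg j ` carrier (L j)" unfolding x(2)[symmetric] using y by (rule imageI)
      then have xU: "x \<in> U" using x(1) by (simp add: U_def)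
      then have "y = g x" using inj_onD[OF sg(2)[OF j] _ y gU[OF xU]] g(2)[OF xU] x(2) by simp
      then show "y \<in> g ` U" using xU by blast
    qed
    then have gs: "g ` carrier (\<Delta> i \<restriction> U) = carrier (L j)" using gU by auto
    have "bd (\<Delta> i \<restriction> U) j" using bd_res[OF lR U' bdR] by simp
    then obtain f where f: "f \<in> mod_hom A (\<Delta> j) (\<Delta> i \<restriction> U)"
      "\<forall>x\<in>carrier (\<Delta> j). g (f x) = rr j x"
      using Delta_lift[OF j fg_module_res[OF fg(4)[OF i] U] _ lLj g(1) gs rr(1)[OF j]] by blast
    have f': "f \<in> mod_hom A (\<Delta> j) (\<Delta> i)" by (rule mod_hom_expand[OF f(1) submoduleD(1)[OF U]])
    have "rr j x = \<zero>\<^bsub>L j\<^esub>" if x: "x \<in> carrier (\<Delta> j)" for x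
    proof -
      have fU: "f x \<in> U" using mod_homD(1)[OF f(1) x] by simp
      then have fR: "f x \<in> rad i" by (simp add: U_def)
      have "\<beta> (\<psi> (f x)) = \<beta> \<zero>\<^bsub>Nabla j\<^esub>"
        using \<phi>0[OF f' x] \<psi>(2)[OF fR] mod_hom_zero[OF lNj e(2,3)] by simp
      then have "\<psi> (f x) = \<zero>\<^bsub>Nabla j\<^esub>"
        using inj_onD[OF e(5)] mod_homD(1)[OF \<psi>(1)] fR submoduleD(2)[OF submodule_carrier[OF lNj]] by simp
      then show ?thesis using g(2)[OF fU] f(2) x gU[OF fU] sg_zero_iff[OF j] by simp
    qed
    then have "carrier (L j) \<subseteq> {\<zero>\<^bsub>L j\<^esub>}" unfolding rr(2)[OF j, symmetric] by blast
    then show False using simple_nonzeroE[OF L_simple[OF j]] by blast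
  qed
  have \<phi>rad: "\<phi> d = \<zero>\<^bsub>E\<^esub>" if "d \<in> rad i" for d
    using \<psi>(2)[OF that] \<psi>0[OF that] mod_hom_zero[OF lNj e(2,3)] by simp
  \<comment> \<open>Since \<phi> kills the radical, which is the kernel of
    \<open>\<alpha> i\<close>, the image \<open>T\<close> meets the copy of \<open>Nabla j\<close>
    in zero only.\<close>
  define T where "T = \<phi> ` carrier (\<Delta> i)"
  have T: "submodule T A E" unfolding T_def by (rule submodule_image[OF lDi e(2) \<phi>(1) submodule_carrier[OF lDi]])
  define C where "C = mod_quot E T"
  define \<pi> where "\<pi> = (\<lambda>x\<in>carrier E. T +>\<^bsub>E\<^esub> x)"
  note q = mod_quot_facts[OF e(2) T, folded C_def \<pi>_def]
  note ker\<pi> = q(5)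
  have fgC: "fg_module A C" by (rule fg_module_surj_image[OF e(1) q(1-3)])
  let ?\<pi>\<beta> = "compose (carrier (Nabla j)) \<pi> \<beta>"
  have \<pi>\<beta>: "?\<pi>\<beta> \<in> mod_hom A (Nabla j) C" by (rule mod_hom_comp[OF e(3) q(2) lNj])
  have \<pi>\<beta>_inj: "inj_on ?\<pi>\<beta> (carrier (Nabla j))"
  proof (rule mod_hom_inj_onI[OF lNj q(1) \<pi>\<beta>])
    fix y assume y: "y \<in> carrier (Nabla j)" "?\<pi>\<beta> y = \<zero>\<^bsub>C\<^esub>"
    then have "\<beta> y \<in> T" using ker\<pi>[OF mod_homD(1)[OF e(3) y(1)]] by (simp add: compose_eq)
    then obtain d where d: "d \<in> carrier (\<Delta> i)" "\<beta> y = \<phi> d" by (auto simp: T_def)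
    then have "\<alpha> i d = \<zero>\<^bsub>Nabla i\<^esub>" using \<phi>(2)[OF d(1)] e(9)[OF y(1)] by simp
    then have "d \<in> rad i" using alpha_rad[OF i d(1)] d(1) by (simp add: a_kernel_eq)
    then have "\<beta> y = \<beta> \<zero>\<^bsub>Nabla j\<^esub>" using d(2) \<phi>rad mod_hom_zero[OF lNj e(2,3)] by simp
    then show "y = \<zero>\<^bsub>Nabla j\<^esub>"
      using inj_onD[OF e(5)] y(1) submoduleD(2)[OF submodule_carrier[OF lNj]] by blast
  qed
  define S where "S = sg i ` carrier (L i)"
  have S: "submodule S A (Nabla i)"
    unfolding S_def by (rule submodule_image[OF lm(1)[OF i] lNi sg(1)[OF i] submodule_carrier[OF lm(1)[OF i]]])
  have \<alpha>S: "\<alpha> i ` carrier (\<Delta> i) = S" unfolding S_def by (rule alpha_image[OF i])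
  \<comment> \<open>The quotient of \<open>E\<close> by \<open>T\<close> is an extension of
    \<open>D\<close> by \<open>Nabla j\<close>; since \<open>D\<close> is bounded by
    \<open>j\<close>, so is the quotient, as relative injectivity of \<open>Nabla j\<close>
    requires.\<close>
  define D where "D = mod_quot (Nabla i) S"
  define \<delta> where "\<delta> = (\<lambda>x\<in>carrier (Nabla i). S +>\<^bsub>Nabla i\<^esub> x)"
  note qD = mod_quot_facts[OF lNi S, folded D_def \<delta>_def]
  note ker\<delta> = qD(5)
  have bdD': "bd D j" unfolding bd_def
  proof (intro ballI impI)
    fix l assume l: "l \<in> {1..n}" "subquot A D (L l)"
    then obtain U p where U: "submodule U A D" "p \<in> mod_hom A (D \<restriction> U) (L l)" "p ` U = carrier (L l)"
      by (auto simp: subquot_def)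
    let ?V = "{x \<in> carrier (Nabla i). \<delta> x \<in> U}"
    have V: "submodule ?V A (Nabla i)" by (rule submodule_vimage[OF lNi qD(1,2) U(1)])
    have \<delta>V: "restrict \<delta> ?V \<in> mod_hom A (Nabla i \<restriction> ?V) (D \<restriction> U)"
      by (rule mod_hom_corestrict[OF mod_hom_res[OF qD(2) V lNi]]) auto
    have im: "\<delta> ` ?V = U" using submoduleD(1)[OF U(1)] unfolding qD(3)[symmetric] by auto
    have pV: "compose ?V p (restrict \<delta> ?V) \<in> mod_hom A (Nabla i \<restriction> ?V) (L l)"
      using mod_hom_comp[OF \<delta>V U(2) res_left_module[OF lNi V]] by simp
    have pim: "compose ?V p (restrict \<delta> ?V) ` ?V = carrier (L l)"
      unfolding U(3)[symmetric] by (subst im[symmetric]) (auto simp: compose_def image_image)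
    have SV: "S \<subseteq> ?V"
    proof
      fix x assume x: "x \<in> S"
      then have xN: "x \<in> carrier (Nabla i)" using submodule_memD[OF S] by blast
      then have "\<delta> x = \<zero>\<^bsub>D\<^esub>" using ker\<delta> x by blast
      then show "x \<in> ?V" using xN submoduleD(2)[OF U(1)] by simp
    qed
    have pz: "p \<zero>\<^bsub>D\<^esub> = \<zero>\<^bsub>L l\<^esub>"
      using mod_hom_zero[OF res_left_module[OF qD(1) U(1)] lm(1)[OF l(1)] U(2)] by simp
    have "l \<le> i - 1"
    proof (rule bd_below_socle[OF V l(1) pV pim SV[unfolded S_def]])
      fix x assume "x \<in> sg i ` carrier (L i)"
      then have x: "x \<in> S" by (simp add: S_def)
      then have "\<delta> x = \<zero>\<^bsub>D\<^esub>" using ker\<delta> submodule_memD[OF S] by blast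
      then show "compose ?V p (restrict \<delta> ?V) x = \<zero>\<^bsub>L l\<^esub>" using x SV pz by (auto simp: compose_eq)
    qed
    then show "l \<le> j" using ij by simp
  qed
  let ?\<delta>\<gamma> = "compose (carrier E) \<delta> \<gamma>"
  have \<delta>\<gamma>: "?\<delta>\<gamma> \<in> mod_hom A E D" by (rule mod_hom_comp[OF e(4) qD(2) e(2)])
  have "\<exists>h\<in>mod_hom A C D. \<forall>x\<in>carrier E. h (\<pi> x) = ?\<delta>\<gamma> x"
  proof (rule hom_factor[OF e(2) q(1) qD(1) q(2,3) \<delta>\<gamma>])
    fix x assume x: "x \<in> carrier E" "\<pi> x = \<zero>\<^bsub>C\<^esub>"
    then obtain d where d: "d \<in> carrier (\<Delta> i)" "x = \<phi> d" using ker\<pi> by (auto simp: T_def)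
    have "\<gamma> x \<in> S" using \<phi>(2)[OF d(1)] d \<alpha>S by auto
    then show "?\<delta>\<gamma> x = \<zero>\<^bsub>D\<^esub>" using x(1) ker\<delta> mod_homD(1)[OF e(4)] by (simp add: compose_eq)
  qed
  then obtain h where h: "h \<in> mod_hom A C D" "\<And>x. x \<in> carrier E \<Longrightarrow> h (\<pi> x) = \<delta> (\<gamma> x)"
    by (auto simp: compose_eq)
  have "a_kernel C D h \<subseteq> ?\<pi>\<beta> ` carrier (Nabla j)"
  proof
    fix c assume "c \<in> a_kernel C D h"
    then have c: "c \<in> carrier C" "h c = \<zero>\<^bsub>D\<^esub>" by (auto simp: a_kernel_eq)
    obtain x where x: "x \<in> carrier E" "c = \<pi> x" using c(1) unfolding q(3)[symmetric] by blast
    have gx: "\<gamma> x \<in> carrier (Nabla i)" by (rule mod_homD(1)[OF e(4) x(1)])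
    have "\<gamma> x \<in> S" using h(2)[OF x(1)] c(2) x(2) ker\<delta>[OF gx] by simp
    then obtain d where d: "d \<in> carrier (\<Delta> i)" "\<gamma> x = \<alpha> i d" unfolding \<alpha>S[symmetric] by blast
    have pd: "\<phi> d \<in> carrier E" "\<phi> d \<in> T" using mod_homD(1)[OF \<phi>(1) d(1)] d(1) by (auto simp: T_def)
    have "x \<ominus>\<^bsub>E\<^esub> \<phi> d \<in> \<beta> ` carrier (Nabla j)"
      unfolding e(7) using mod_hom_eq_iff_diff[OF e(2) lNi e(4) x(1) pd(1)] \<phi>(2)[OF d(1)] d(2) by simp
    then obtain y where y: "y \<in> carrier (Nabla j)" "x \<ominus>\<^bsub>E\<^esub> \<phi> d = \<beta> y" by blast
    have bE: "\<beta> y \<in> carrier E" by (rule mod_homD(1)[OF e(3) y(1)])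
    interpret C: left_module A C by (rule q(1))
    have "x = \<phi> d \<oplus>\<^bsub>E\<^esub> \<beta> y" using E.add_diff_cancel[OF pd(1) x(1)] y(2) by simp
    then have "c = \<pi> (\<phi> d) \<oplus>\<^bsub>C\<^esub> \<pi> (\<beta> y)" using x(2) mod_homD(2)[OF q(2) pd(1) bE] by simp
    also have "\<dots> = \<pi> (\<beta> y)" using ker\<pi>[OF pd(1)] pd(2) mod_homD(1)[OF q(2) bE] by simp
    finally show "c \<in> ?\<pi>\<beta> ` carrier (Nabla j)" using y(1) by (intro image_eqI[of _ _ y]) (auto simp: compose_eq)
  qed
  moreover have "?\<pi>\<beta> ` carrier (Nabla j) \<subseteq> a_kernel C D h"
  proof -
    have "\<delta> (\<gamma> (\<beta> y)) = \<zero>\<^bsub>D\<^esub>" if "y \<in> carrier (Nabla j)" for y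
      using e(9)[OF that] mod_hom_zero[OF lNi qD(1,2)] by simp
    then show ?thesis
      using h(2) mod_homD(1)[OF e(3)] mod_homD(1)[OF q(2)] by (auto simp: a_kernel_eq compose_eq)
  qed
  ultimately have "a_kernel C D h = ?\<pi>\<beta> ` carrier (Nabla j)" by blast
  then have "bd (C \<restriction> a_kernel C D h) j" using bd_image[OF lNj q(1) \<pi>\<beta> iota(3)[OF j]] by simp
  then have "bd C j" by (rule bd_ext[OF q(1) qD(1) h(1) _ bdD'])
  \<comment> \<open>The identity of \<open>Nabla j\<close> extends over the quotient; composed with
    the projection \<pi> this gives a retraction of \<beta>.\<close>
  then obtain r where r: "r \<in> mod_hom A C (Nabla j)"
    "\<forall>x\<in>carrier (Nabla j). r (?\<pi>\<beta> x) = (\<lambda>x\<in>carrier (Nabla j). x) x"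
    using Nabla_extend[OF j fg(5)[OF j] fgC _ \<pi>\<beta> \<pi>\<beta>_inj mod_hom_id[OF lNj]] by blast
  show ?thesis
    by (rule retraction_split[OF ext fg(5)[OF i] fg(5)[OF j] mod_hom_comp[OF q(2) r(1) e(2)]])
      (use r(2) mod_homD(1)[OF e(3)] in \<open>auto simp: compose_eq\<close>)
qed

text \<open>The extension is read off from the lift it must have. Inside the product of
  \<open>I j\<close> and \<open>Nabla i\<close>, a lift with value 1 at \<open>f\<close> is a pair
  (H, \<alpha> i) such that \<open>H\<close> after \<open>f\<close> is \<open>iota j\<close> after
  \<open>\<alpha> j\<close>; the pullback is arranged to contain the image of this pair.\<close>

lemma extension_detecting:
  assumes ij: "j = i - 1" and f: "f \<in> mod_hom A (\<Delta> j) (\<Delta> i)" and nz: "x0 \<in> carrier (\<Delta> j)"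
    "f x0 \<noteq> \<zero>\<^bsub>\<Delta> i\<^esub>"
  shows "\<exists>\<xi>\<in>Defs.extensions A (Nabla i) (Nabla j). val f \<xi> \<noteq> \<zero>\<^bsub>K\<^esub>"
proof -
  note lDi = lm(4)[OF i] and lDj = lm(4)[OF j] and lNi = lm(5)[OF i] and lNj = lm(5)[OF j] and lLi = lm(1)[OF i] and lI = lm(3)[OF j]
  note C = Ck[OF j]
  interpret Ni: left_module A "Nabla i" by (rule lNi)
  have R: "submodule (rad i) A (\<Delta> i)" by (rule rad_submodule[OF i])
  note lR = res_left_module[OF lDi R]
  have bdR: "bd (\<Delta> i \<restriction> rad i) j" using bd_rad[OF i] ij by simp
  \<comment> \<open>Otherwise \<open>f\<close> would give \<open>\<Delta> j\<close> the simple
    quotient \<open>L i\<close>, whose index exceeds \<open>j\<close>.\<close>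
  have fR: "f x \<in> rad i" if x: "x \<in> carrier (\<Delta> j)" for x
  proof (rule ccontr)
    assume "f x \<notin> rad i"
    let ?g = "compose (carrier (\<Delta> j)) (rr i) f"
    have g: "?g \<in> mod_hom A (\<Delta> j) (L i)" by (rule mod_hom_comp[OF f rr(1)[OF i] lDj])
    have "?g x \<noteq> \<zero>\<^bsub>L i\<^esub>" using \<open>f x \<notin> rad i\<close> x mod_homD(1)[OF f x]
      by (simp add: a_kernel_eq compose_eq)
    then have "?g ` carrier (\<Delta> j) = carrier (L i)" by (rule simple_hom_surj[OF L_simple[OF i] lDj g x])
    then have "subquot A (\<Delta> j) (L i)"
      using g by (intro subquotI[OF submodule_carrier[OF lDj], of ?g]) auto
    then show False using bdD[OF bd_Delta[OF j] i] ji by simp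
  qed
  let ?W = "f ` carrier (\<Delta> j)"
  have W: "submodule ?W A (\<Delta> i)" by (rule submodule_image[OF lDj lDi f submodule_carrier[OF lDj]])
  note lW = res_left_module[OF lDi W]
  \<comment> \<open>The kernel of the nonzero map \<open>f\<close> lies in the radical of
    \<open>\<Delta> j\<close>, which is the kernel of \<open>\<alpha> j\<close>.\<close>
  have "\<exists>h\<in>mod_hom A (\<Delta> i \<restriction> ?W) (Nabla j). \<forall>x\<in>carrier (\<Delta> j). h (f x) = \<alpha> j x"
    by (rule hom_factor[OF lDj lW lNj mod_hom_corestrict[OF f order_refl] _ alpha_hom[OF j]])
      (use Delta_kernel[OF j lDi f nz] alpha_rad[OF j] in auto)
  then obtain h where h: "h \<in> mod_hom A (\<Delta> i \<restriction> ?W) (Nabla j)"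
    "\<And>x. x \<in> carrier (\<Delta> j) \<Longrightarrow> h (f x) = \<alpha> j x" by blast
  have WR: "?W \<subseteq> rad i" using fR by blast
  have incl: "(\<lambda>x\<in>?W. x) \<in> mod_hom A (\<Delta> i \<restriction> ?W) (\<Delta> i \<restriction> rad i)"
    by (rule mod_hom_corestrict[OF mod_hom_incl[OF W lDi]]) (use WR in auto)
  obtain h' where h': "h' \<in> mod_hom A (\<Delta> i \<restriction> rad i) (Nabla j)"
    "\<forall>x\<in>carrier (\<Delta> i \<restriction> ?W). h' ((\<lambda>x\<in>?W. x) x) = h x"
    using Nabla_extend[OF j fg_module_res[OF fg(4)[OF i] W] fg_module_res[OF fg(4)[OF i] R] bdR incl _ h(1)]
    by (auto simp: inj_on_def)
  have h'f: "h' (f x) = \<alpha> j x" if "x \<in> carrier (\<Delta> j)" for x using h'(2) h(2)[OF that] that by simp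
  have ih': "compose (rad i) (iota j) h' \<in> mod_hom A (\<Delta> i \<restriction> rad i) (I j)"
    using mod_hom_comp[OF h'(1) iota(1)[OF j] lR] by simp
  \<comment> \<open>On the radical the target can be \<open>Nabla j\<close>, because the radical is
    bounded by \<open>j\<close>. Beyond it \<open>\<Delta> i\<close> has the top \<open>L i\<close>,
    so the extension goes into the injective module \<open>I j\<close>.\<close>
  obtain H where H: "H \<in> mod_hom A (\<Delta> i) (I j)"
    "\<forall>x\<in>carrier (\<Delta> i \<restriction> rad i). H ((\<lambda>x\<in>rad i. x) x) = compose (rad i) (iota j) h' x"
    using inj_extend[OF j fg_module_res[OF fg(4)[OF i] R] fg(4)[OF i] mod_hom_incl[OF R lDi] _ ih']
    by (auto simp: inj_on_def)
  have HR: "H d = iota j (h' d)" if "d \<in> rad i" for d using H(2) that by (simp add: compose_eq)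
  define S where "S = sg i ` carrier (L i)"
  have S: "submodule S A (Nabla i)"
    unfolding S_def by (rule submodule_image[OF lLi lNi sg(1)[OF i] submodule_carrier[OF lLi]])
  have \<alpha>S: "\<alpha> i ` carrier (\<Delta> i) = S" unfolding S_def by (rule alpha_image[OF i])
  let ?pH = "compose (carrier (\<Delta> i)) (pk j) H"
  have pH: "?pH \<in> mod_hom A (\<Delta> i) (Ck j)" by (rule mod_hom_comp[OF H(1) C(2) lDi])
  \<comment> \<open>Modulo \<open>Nabla j\<close> the map \<open>H\<close> kills the radical, the
    kernel of \<open>\<alpha> i\<close>, so it induces a map on the image of
    \<open>\<alpha> i\<close>, the socle of \<open>Nabla i\<close>.\<close>
  have "\<exists>u\<in>mod_hom A (Nabla i \<restriction> S) (Ck j). \<forall>x\<in>carrier (\<Delta> i). u (\<alpha> i x) = ?pH x"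
  proof (rule hom_factor[OF lDi res_left_module[OF lNi S] C(1) mod_hom_corestrict[OF alpha_hom[OF i]] _ pH])
    fix x assume x: "x \<in> carrier (\<Delta> i)" "\<alpha> i x = \<zero>\<^bsub>Nabla i \<restriction> S\<^esub>"
    then have xR: "x \<in> rad i" using alpha_rad[OF i x(1)] by (simp add: a_kernel_eq)
    then have "H x \<in> iota j ` carrier (Nabla j)" using HR mod_homD(1)[OF h'(1)] by simp
    then show "?pH x = \<zero>\<^bsub>Ck j\<^esub>" using pk_zero_iff[OF j mod_homD(1)[OF H(1) x(1)]] x(1) by (simp add: compose_eq)
  qed (use \<alpha>S in auto)
  then obtain u where u: "u \<in> mod_hom A (Nabla i \<restriction> S) (Ck j)"
    "\<And>x. x \<in> carrier (\<Delta> i) \<Longrightarrow> u (\<alpha> i x) = pk j (H x)"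
    by (auto simp: compose_eq)
  have "\<exists>v\<in>mod_hom A (Nabla i) (Ck j). \<forall>x\<in>S. v x = u x"
  proof (rule extend_Ck[OF j fg(5)[OF i] S u(1)])
    fix V l p assume "submodule V A (Nabla i)" "S \<subseteq> V" "l \<in> {1..n}" "p \<in> mod_hom A (Nabla i \<restriction> V) (L l)"
      "p ` V = carrier (L l)" "\<And>x. x \<in> S \<Longrightarrow> p x = \<zero>\<^bsub>L l\<^esub>"
    then show "l \<le> j" using bd_below_socle[of V l p] ij by (simp add: S_def)
  qed
  then obtain v where v: "v \<in> mod_hom A (Nabla i) (Ck j)" "\<And>x. x \<in> S \<Longrightarrow> v x = u x" by blast
  have v\<alpha>: "v (\<alpha> i x) = pk j (H x)" if "x \<in> carrier (\<Delta> i)" for x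
    using v(2)[of "\<alpha> i x"] u(2)[OF that] \<alpha>S that by auto
  define Y where "Y = (mod_prod (I j) (Nabla i))\<lparr>carrier := {(x, y) \<in> carrier (I j) \<times> carrier (Nabla i). pk j x = v y}\<rparr>"
  let ?\<beta> = "\<lambda>y\<in>carrier (Nabla j). (iota j y, \<zero>\<^bsub>Nabla i\<^esub>)" and ?\<gamma> = "\<lambda>p\<in>carrier Y. snd p"
  have "v ` carrier (Nabla i) \<subseteq> pk j ` carrier (I j)" unfolding C(3) using mod_homD(1)[OF v(1)] by blast
  then have ext: "is_extn (Y, ?\<beta>, ?\<gamma>)"
    unfolding Y_def
    by (rule pullback_is_ext[OF fd_algebra_field_axioms fg(3)[OF j] fg(5)[OF i] lNj C(1) iota(1,2)[OF j] C(4)[symmetric] C(2) v(1)])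
  let ?\<phi> = "\<lambda>x\<in>carrier (\<Delta> i). (H x, \<alpha> i x)"
  have \<phi>Y: "(H x, \<alpha> i x) \<in> carrier Y" if "x \<in> carrier (\<Delta> i)" for x
    using v\<alpha>[OF that] mod_homD(1)[OF H(1) that] mod_homD(1)[OF alpha_hom[OF i] that] by (simp add: Y_def)
  have \<phi>: "?\<phi> \<in> mod_hom A (\<Delta> i) Y"
    by (rule mod_homI[OF _ _ _ lDi]) (use \<phi>Y mod_homD[OF H(1)] mod_homD[OF alpha_hom[OF i]] in \<open>auto simp: Y_def mod_prod_simps\<close>)
  \<comment> \<open>On the image of \<open>f\<close>, which lies in the radical, the lift takes the
    value (iota j (\<alpha> j x), 0), the copy of \<open>\<alpha> j x\<close> in
    \<open>Y\<close>.\<close>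
  have "val f (Y, ?\<beta>, ?\<gamma>) = \<one>\<^bsub>K\<^esub>"
  proof (rule valI[OF ext \<phi>])
    show "?\<gamma> (?\<phi> x) = \<alpha> i x" if "x \<in> carrier (\<Delta> i)" for x using that \<phi>Y[OF that] by simp
    fix x assume x: "x \<in> carrier (\<Delta> j)"
    have fx: "f x \<in> carrier (\<Delta> i)" by (rule mod_homD(1)[OF f x])
    have "\<alpha> i (f x) = \<zero>\<^bsub>Nabla i\<^esub>" using fR[OF x] alpha_rad[OF i fx] by (simp add: a_kernel_eq)
    moreover have "H (f x) = iota j (\<alpha> j x)" using HR[OF fR[OF x]] h'f[OF x] by simp
    moreover have "\<alpha> j x \<in> carrier (Nabla j)" by (rule mod_homD(1)[OF alpha_hom[OF j] x])
    moreover have "iota j (\<alpha> j x) \<in> carrier (I j)" using mod_homD(1)[OF iota(1)[OF j]] calculation(3) by blast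
    ultimately show "?\<phi> (f x) = scal A \<one>\<^bsub>K\<^esub> \<odot>\<^bsub>Y\<^esub> ?\<beta> (\<alpha> j x)"
      using fx by (simp add: Y_def mod_prod_simps scal_simps left_module.smult_one[OF lI])
  qed simp
  moreover obtain \<zeta> where "\<zeta> \<in> Defs.extensions A (Nabla i) (Nabla j)"
    "ext_equivalent A (Nabla j) (Y, ?\<beta>, ?\<gamma>) \<zeta>"
    using ext_copy[OF ext lNj] by blast
  ultimately show ?thesis
    using val_equivalent[OF ext _ _ f] one_not_zero by (metis extensions_iff)
qed

lemma nondegenerate:
  assumes ij: "j = i - 1"
  shows "nondegenerate_form K (Hom_space A (\<Delta> j) (\<Delta> i)) (Ext1_space A (Nabla i) (Nabla j))
     (pairing K A (\<Delta> i) (\<Delta> j) (\<alpha> i) (\<alpha> j))"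
  unfolding nondegenerate_form_def
proof (intro conjI ballI impI)
  let ?W = "Ext1_space A (Nabla i) (Nabla j)" and ?p = "pairing K A (\<Delta> i) (\<Delta> j) (\<alpha> i) (\<alpha> j)"
  fix f assume "f \<in> carrier (Hom_space A (\<Delta> j) (\<Delta> i))"
    and zero: "\<forall>w\<in>carrier ?W. ?p f w = \<zero>\<^bsub>K\<^esub>"
  then have f: "f \<in> mod_hom A (\<Delta> j) (\<Delta> i)" by (simp add: Hom_space_def)
  have "f = zero_hom (\<Delta> j) (\<Delta> i)"
  proof (rule ccontr)
    assume "f \<noteq> zero_hom (\<Delta> j) (\<Delta> i)"
    then obtain x where "x \<in> carrier (\<Delta> j)" "f x \<noteq> \<zero>\<^bsub>\<Delta> i\<^esub>"
      using mod_hom_eqI[OF f zero_hom_in[OF lm(4)[OF j] lm(4)[OF i]]] by (auto simp: zero_hom_def)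
    then obtain \<xi> where \<xi>: "\<xi> \<in> Defs.extensions A (Nabla i) (Nabla j)" "val f \<xi> \<noteq> \<zero>\<^bsub>K\<^esub>"
      using extension_detecting[OF ij f] by blast
    define w where "w = ext_rel A (Nabla i) (Nabla j) `` {\<xi>}"
    have "w \<in> carrier ?W" unfolding w_def using \<xi>(1) by (simp add: Ext1_space_def quotientI)
    moreover have "\<xi> \<in> w" unfolding w_def by (rule equiv_class_self[OF equiv_ext_rel \<xi>(1)])
    ultimately show False using Ext1_class(5)[of w \<xi> f] f \<xi>(2) zero by simp
  qed
  then show "f = \<zero>\<^bsub>Hom_space A (\<Delta> j) (\<Delta> i)\<^esub>" by (simp add: Hom_space_def)
next
  let ?W = "Ext1_space A (Nabla i) (Nabla j)" and ?p = "pairing K A (\<Delta> i) (\<Delta> j) (\<alpha> i) (\<alpha> j)"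
  fix w assume w: "w \<in> carrier ?W" and zero: "\<forall>f\<in>carrier (Hom_space A (\<Delta> j) (\<Delta> i)). ?p f w = \<zero>\<^bsub>K\<^esub>"
  note c = Ext1_class[OF w]
  obtain \<xi> where \<xi>: "\<xi> \<in> w" using c(1) by blast
  obtain E \<beta> \<gamma> where x: "\<xi> = (E, \<beta>, \<gamma>)" by (cases \<xi>)
  have "val f \<xi> = \<zero>\<^bsub>K\<^esub>" if "f \<in> mod_hom A (\<Delta> j) (\<Delta> i)" for f
    using zero c(5)[OF \<xi> that] that by (simp add: Hom_space_def)
  then have split: "ext_equivalent A (Nabla j) (split_ext (Nabla i) (Nabla j)) \<xi>"
    unfolding x by (intro split_if_orthogonal[OF ij c(2)[OF \<xi>, unfolded x]]) (simp add: x)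
  note ex = is_extn_split and e\<xi> = c(2)[OF \<xi>]
  \<comment> \<open>The zero of \<open>Ext1_space\<close> is the set of all extensions equivalent to
    the split one; since \<xi> is among them, it coincides with the class \<open>w\<close>.\<close>
  have "\<zeta> \<in> w \<longleftrightarrow> is_extn \<zeta> \<and> ext_equivalent A (Nabla j) (split_ext (Nabla i) (Nabla j)) \<zeta>" for \<zeta>
  proof
    assume z: "\<zeta> \<in> w"
    show "is_extn \<zeta> \<and> ext_equivalent A (Nabla j) (split_ext (Nabla i) (Nabla j)) \<zeta>"
      using ext_equivalent_trans[OF ex e\<xi> c(2)[OF z] split c(4)[OF \<xi> z]] c(2)[OF z] by blast
  next
    assume "is_extn \<zeta> \<and> ext_equivalent A (Nabla j) (split_ext (Nabla i) (Nabla j)) \<zeta>"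
    then have z: "is_extn \<zeta>" "ext_equivalent A (Nabla j) (split_ext (Nabla i) (Nabla j)) \<zeta>" by blast+
    show "\<zeta> \<in> w"
      by (rule c(3)[OF \<xi> z(1) ext_equivalent_trans[OF e\<xi> ex z(1) ext_equivalent_sym[OF ex e\<xi> split] z(2)]])
  qed
  then show "w = \<zero>\<^bsub>?W\<^esub>"
    by (auto simp: Ext1_space_def extensions_iff simp del: ext_equivalent.simps)
qed

lemma well_defined:
  "\<forall>\<xi>\<in>Defs.extensions A (Nabla i) (Nabla j). \<exists>!\<phi>. is_lift A (\<Delta> i) (\<alpha> i) \<xi> \<phi>"
  "\<forall>f\<in>mod_hom A (\<Delta> j) (\<Delta> i). \<forall>\<xi>\<in>Defs.extensions A (Nabla i) (Nabla j).
     \<forall>\<phi>. is_lift A (\<Delta> i) (\<alpha> i) \<xi> \<phi> \<longrightarrow> (\<exists>!s. is_value K A (\<Delta> j) \<phi> (\<alpha> j) f \<xi> s)"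
  "\<forall>f\<in>mod_hom A (\<Delta> j) (\<Delta> i). \<forall>(\<xi>, \<xi>')\<in>ext_rel A (Nabla i) (Nabla j). val f \<xi> = val f \<xi>'"
proof -
  show "\<forall>\<xi>\<in>Defs.extensions A (Nabla i) (Nabla j). \<exists>!\<phi>. is_lift A (\<Delta> i) (\<alpha> i) \<xi> \<phi>"
  proof
    fix \<xi> assume "\<xi> \<in> Defs.extensions A (Nabla i) (Nabla j)"
    then have e: "is_extn \<xi>" by (simp add: extensions_iff)
    obtain E \<beta> \<gamma> where "\<xi> = (E, \<beta>, \<gamma>)" by (cases \<xi>)
    then show "\<exists>!\<phi>. is_lift A (\<Delta> i) (\<alpha> i) \<xi> \<phi>" using lift_ex lift_unique e by blast
  qed
  show "\<forall>f\<in>mod_hom A (\<Delta> j) (\<Delta> i). \<forall>\<xi>\<in>Defs.extensions A (Nabla i) (Nabla j).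
     \<forall>\<phi>. is_lift A (\<Delta> i) (\<alpha> i) \<xi> \<phi> \<longrightarrow> (\<exists>!s. is_value K A (\<Delta> j) \<phi> (\<alpha> j) f \<xi> s)"
  proof (intro ballI allI impI)
    fix f \<xi> \<phi> assume *: "f \<in> mod_hom A (\<Delta> j) (\<Delta> i)" "\<xi> \<in> Defs.extensions A (Nabla i) (Nabla j)"
      "is_lift A (\<Delta> i) (\<alpha> i) \<xi> \<phi>"
    then have e: "is_extn \<xi>" by (simp add: extensions_iff)
    obtain E \<beta> \<gamma> where "\<xi> = (E, \<beta>, \<gamma>)" by (cases \<xi>)
    then show "\<exists>!s. is_value K A (\<Delta> j) \<phi> (\<alpha> j) f \<xi> s" using value_ex value_unique e * by blast
  qed
  show "\<forall>f\<in>mod_hom A (\<Delta> j) (\<Delta> i). \<forall>(\<xi>, \<xi>')\<in>ext_rel A (Nabla i) (Nabla j). val f \<xi> = val f \<xi>'"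
    by (auto simp: ext_rel_def extensions_iff simp del: ext_equivalent.simps intro!: val_equivalent[symmetric])
qed

end

theorem theorem1:
  fixes K :: "'k ring" and A :: "('k, 'a) module"
    and n i j :: nat
    and L P I \<Delta> Nabla :: "nat \<Rightarrow> 'a umod"
    and \<alpha> :: "nat \<Rightarrow> (nat \<Rightarrow> 'a) \<Rightarrow> (nat \<Rightarrow> 'a)"
  assumes "algebraically_closed K"
    and "fd_algebra K A"
    and "basic_algebra A"
    and "simple_representatives A n L"
    and "\<And>l. l \<in> {1..n} \<Longrightarrow> projective_cover A (P l) (L l)"
    and "\<And>l. l \<in> {1..n} \<Longrightarrow> injective_hull A (I l) (L l)"
    and "\<And>l. l \<in> {1..n} \<Longrightarrow> standard_module A L l (P l) (\<Delta> l)"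
    and "\<And>l. l \<in> {1..n} \<Longrightarrow> costandard_module A L l (I l) (Nabla l)"
    and "quasi_hereditary A n L P \<Delta>"
    and "\<And>l. l \<in> {1..n} \<Longrightarrow> \<alpha> l \<in> mod_hom A (\<Delta> l) (Nabla l) \<and> \<alpha> l \<noteq> zero_hom (\<Delta> l) (Nabla l)"
    and "i \<in> {1..n}" and "j \<in> {1..n}" and "j < i"
  shows
    "((\<forall>\<xi>\<in>extensions A (Nabla i) (Nabla j). \<exists>!\<phi>. is_lift A (\<Delta> i) (\<alpha> i) \<xi> \<phi>) \<and>
      (\<forall>f\<in>mod_hom A (\<Delta> j) (\<Delta> i). \<forall>\<xi>\<in>extensions A (Nabla i) (Nabla j).
         \<forall>\<phi>. is_lift A (\<Delta> i) (\<alpha> i) \<xi> \<phi> \<longrightarrow> (\<exists>!s. is_value K A (\<Delta> j) \<phi> (\<alpha> j) f \<xi> s)) \<and>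
      (\<forall>f\<in>mod_hom A (\<Delta> j) (\<Delta> i). \<forall>(\<xi>, \<xi>')\<in>ext_rel A (Nabla i) (Nabla j).
         pairing_value K A (\<Delta> i) (\<Delta> j) (\<alpha> i) (\<alpha> j) f \<xi> =
         pairing_value K A (\<Delta> i) (\<Delta> j) (\<alpha> i) (\<alpha> j) f \<xi>') \<and>
      bilinear_form K (Hom_space A (\<Delta> j) (\<Delta> i)) (Ext1_space A (Nabla i) (Nabla j))
        (pairing K A (\<Delta> i) (\<Delta> j) (\<alpha> i) (\<alpha> j))) \<and>
     (j = i - 1 \<longrightarrow>
      nondegenerate_form K (Hom_space A (\<Delta> j) (\<Delta> i)) (Ext1_space A (Nabla i) (Nabla j))
        (pairing K A (\<Delta> i) (\<Delta> j) (\<alpha> i) (\<alpha> j)))"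
proof -
  interpret hom_ext_pairing K A n L P I \<Delta> Nabla \<alpha> i j
    by (intro hom_ext_pairing.intro qh_algebra.intro fd_algebra_ac.intro
        qh_algebra_axioms.intro hom_ext_pairing_axioms.intro)
      (use assms in blast)+
  show ?thesis using well_defined bilinear nondegenerate by blast
qed

end
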